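(* Let $p$ be a prime, $k$ an algebraically closed field of characteristic $p$, and $0\le l\le m$ integers with $n:=m-l<p$. Let $B$ be a generalised ribbon block of $\mathcal C_{l,m}^k$, that is, a combinatorial block of $\mathcal C_{l,m}^k$ for which the common $p$-content of the skew-partitions in $B$ has no repeated entries (and $n<p$). Then, for every $\mu_1\setminus\lambda_1\in B$ and every $\mu_2\setminus\lambda_2\in\mathcal P_{l,m}$, the Specht modules $S_k^{\mu_1\setminus\lambda_1}$ and $S_k^{\mu_2\setminus\lambda_2}$ belong to the same $p$-block of $\mathcal C_{l,m}^k$ if and only if $\operatorname{core}_p(\mu_1)=\operatorname{core}_p(\mu_2)$ and $\operatorname{core}_p(\lambda_1)=\operatorname{core}_p(\lambda_2)$.
   Context: A partition is a weakly decreasing, eventually zero sequence $\nu=(\nu_1,\nu_2,\dots)$ of non-negative integers, with Young diagram $[\nu]=\{(r,c)\in\mathbb N^2: c\le\nu_r\}$. A skew-partition $\mu\setminus\lambda$ is a pair of partitions with $[\lambda]\subseteq[\mu]$; $\mathcal P_{l,m}$ denotes the set of skew-partitions $\mu\setminus\lambda$ with $|\lambda|=l$, $|\mu|=m$. The $p$-residue of a node $(r,c)$ is $c-r$ modulo $p$; the $p$-content of $\mu\setminus\lambda$ is the multiset of $p$-residues of the nodes in $[\mu]\setminus[\lambda]$. The $p$-core $\operatorname{core}_p(\nu)$ is the partition obtained from $\nu$ by repeatedly removing rim $p$-hooks until none remain. The centraliser algebra is $\mathcal C_{l,m}^k=\{a\in kS_m: ab=ba\text{ for all }b\in kS_l\}$.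 For $\mu\setminus\lambda\in\mathcal P_{l,m}$, the Specht module over $k$ is $S_k^{\mu\setminus\lambda}=k\otimes_{\mathbb Z}\operatorname{Hom}_{\mathbb ZS_l}(S^\lambda_{\mathbb Z},S^\mu_{\mathbb Z}\downarrow_{S_l})$, where $S^\nu_{\mathbb Z}$ is the integral Specht module; it is a $\mathcal C_{l,m}^k$-module via $(c\phi)(v)=c\,\phi(v)$ (it is the $p$-modular reduction of the corresponding simple module in characteristic $0$). The $p$-blocks of $\mathcal C_{l,m}^k$ are the ideals $e\,\mathcal C_{l,m}^k$ with $e$ a primitive central idempotent of $\mathcal C_{l,m}^k$; a Specht module belongs to the block $e\,\mathcal C_{l,m}^k$ if $e$ acts on it as the identity (each Specht module belongs to exactly one block). A combinatorial block is a non-empty set of the form $\{\mu\setminus\lambda\in\mathcal P_{l,m}:\operatorname{core}_p(\mu)=\gamma,\ \operatorname{core}_p(\lambda)=\delta\}$ for some $p$-cores $\gamma,\delta$. All skew-partitions in a combinatorial block have the same $p$-content. *)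

theory Defs
  imports
    "HOL-Combinatorics.Perm"
    "HOL-Combinatorics.Permutations"
    "HOL-Library.Multiset"
    "HOL-Library.Function_Algebras"
    "HOL-Library.Poly_Mapping"
    "HOL-Computational_Algebra.Group_Closure"
    "HOL-Computational_Algebra.Primes"
    "HOL-Computational_Algebra.Polynomial"
begin

section \<open>Partitions, residues and cores\<close>

text \<open>
  Sequences are indexed from \<open>0\<close>, so \<open>\<alpha> r\<close> is the part usually written with index
  \<open>r + 1\<close>; likewise rows and columns of Young diagrams are counted from \<open>0\<close>.  This shifts both
  coordinates of a node by one and leaves \<open>c - r\<close> unchanged.
\<close>

definition partition :: "(nat \<Rightarrow> nat) \<Rightarrow> bool" where
  "partition \<alpha> \<longleftrightarrow> antimono \<alpha> \<and> finite {r. \<alpha> r \<noteq> 0}"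

definition weight :: "(nat \<Rightarrow> nat) \<Rightarrow> nat" where
  "weight \<alpha> = (\<Sum>r | \<alpha> r \<noteq> 0. \<alpha> r)"

definition young :: "(nat \<Rightarrow> nat) \<Rightarrow> (nat \<times> nat) set" where
  "young \<alpha> = {(r, c). c < \<alpha> r}"

text \<open>The skew partition \<open>\<mu> \<setminus> \<nu>\<close> is the pair \<open>(\<mu>, \<nu>)\<close>.\<close>

type_synonym skew = "(nat \<Rightarrow> nat) \<times> (nat \<Rightarrow> nat)"

definition skew_partitions :: "nat \<Rightarrow> nat \<Rightarrow> skew set" where
  "skew_partitions l m =
    {(\<mu>, \<nu>). partition \<mu> \<and> partition \<nu> \<and> young \<nu> \<subseteq> young \<mu> \<and> weight \<nu> = l \<and> weight \<mu> = m}"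

definition residue :: "nat \<Rightarrow> nat \<times> nat \<Rightarrow> int" where
  "residue p = (\<lambda>(r, c). (int c - int r) mod int p)"

definition content :: "nat \<Rightarrow> skew \<Rightarrow> int multiset" where
  "content p = (\<lambda>(\<mu>, \<nu>). image_mset (residue p) (mset_set (young \<mu> - young \<nu>)))"

definition rim :: "(nat \<Rightarrow> nat) \<Rightarrow> (nat \<times> nat) set" where
  "rim \<alpha> = {(r, c) \<in> young \<alpha>. (Suc r, Suc c) \<notin> young \<alpha>}"

definition adjacent :: "nat \<times> nat \<Rightarrow> nat \<times> nat \<Rightarrow> bool" where
  "adjacent = (\<lambda>(r, c) (r', c').
    (r = r' \<and> (c' = Suc c \<or> c = Suc c')) \<or> (c = c' \<and> (r' = Suc r \<or> r = Suc r')))"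

definition connected_nodes :: "(nat \<times> nat) set \<Rightarrow> bool" where
  "connected_nodes R \<longleftrightarrow>
    (\<forall>x\<in>R. \<forall>y\<in>R. (x, y) \<in> {(u, v). u \<in> R \<and> v \<in> R \<and> adjacent u v}\<^sup>*)"

text \<open>A rim \<open>p\<close>-hook is a connected piece of the rim, with \<open>p\<close> nodes, whose removal leaves the
  diagram of a partition; \<open>remove_rim_hook p \<alpha> \<beta>\<close> says that \<open>\<beta>\<close> arises from \<open>\<alpha>\<close> by removing one.\<close>

definition remove_rim_hook :: "nat \<Rightarrow> (nat \<Rightarrow> nat) \<Rightarrow> (nat \<Rightarrow> nat) \<Rightarrow> bool" where
  "remove_rim_hook p \<alpha> \<beta> \<longleftrightarrow> partition \<alpha> \<and> partition \<beta> \<and>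
    (\<exists>R \<subseteq> rim \<alpha>. connected_nodes R \<and> card R = p \<and> young \<beta> = young \<alpha> - R)"

definition is_core :: "nat \<Rightarrow> (nat \<Rightarrow> nat) \<Rightarrow> bool" where
  "is_core p \<gamma> \<longleftrightarrow> partition \<gamma> \<and> (\<nexists>\<beta>. remove_rim_hook p \<gamma> \<beta>)"

definition core :: "nat \<Rightarrow> (nat \<Rightarrow> nat) \<Rightarrow> (nat \<Rightarrow> nat)" where
  "core p \<alpha> = (THE \<gamma>. (remove_rim_hook p)\<^sup>*\<^sup>* \<alpha> \<gamma> \<and> is_core p \<gamma>)"

definition combinatorial_block :: "nat \<Rightarrow> nat \<Rightarrow> nat \<Rightarrow> skew set \<Rightarrow> bool" where
  "combinatorial_block p l m B \<longleftrightarrow> B \<noteq> {} \<and>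
    (\<exists>\<gamma> \<delta>. is_core p \<gamma> \<and> is_core p \<delta> \<and>
      B = {(\<mu>, \<nu>) \<in> skew_partitions l m. core p \<mu> = \<gamma> \<and> core p \<nu> = \<delta>})"

definition generalised_ribbon_block :: "nat \<Rightarrow> nat \<Rightarrow> nat \<Rightarrow> skew set \<Rightarrow> bool" where
  "generalised_ribbon_block p l m B \<longleftrightarrow> combinatorial_block p l m B \<and> m - l < p \<and>
    (\<forall>s\<in>B. \<forall>i. count (content p s) i \<le> 1)"


section \<open>Group algebras of symmetric groups and their centraliser algebras\<close>

text \<open>
  With the group law of \<^typ>\<open>'a perm\<close> written additively, the convolution product of
  \<^typ>\<open>'g \<Rightarrow>\<^sub>0 'k\<close> is the product of a group algebra: \<^typ>\<open>nat perm \<Rightarrow>\<^sub>0 'k\<close> is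
  the group algebra over \<open>'k\<close> of the group of finitely supported permutations of \<^typ>\<open>nat\<close>.
\<close>

instantiation perm :: (type) group_add
begin

definition zero_perm :: "'a perm" where "zero_perm = 1"
definition plus_perm :: "'a perm \<Rightarrow> 'a perm \<Rightarrow> 'a perm" where "plus_perm \<sigma> \<tau> = \<sigma> * \<tau>"
definition uminus_perm :: "'a perm \<Rightarrow> 'a perm" where "uminus_perm \<sigma> = inverse \<sigma>"
definition minus_perm :: "'a perm \<Rightarrow> 'a perm \<Rightarrow> 'a perm" where "minus_perm \<sigma> \<tau> = \<sigma> * inverse \<tau>"

instance
  by standard (simp_all add: zero_perm_def plus_perm_def uminus_perm_def minus_perm_def mult.assoc)

end

definition sym :: "nat \<Rightarrow> nat perm set" where
  "sym n = {\<sigma>. affected \<sigma> \<subseteq> {1..n}}"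

definition group_algebra :: "nat \<Rightarrow> (nat perm \<Rightarrow>\<^sub>0 'k::ring_1) set" where
  "group_algebra n = {a. Poly_Mapping.keys a \<subseteq> sym n}"

definition centraliser_algebra :: "nat \<Rightarrow> nat \<Rightarrow> (nat perm \<Rightarrow>\<^sub>0 'k::ring_1) set" where
  "centraliser_algebra l m = {a \<in> group_algebra m. \<forall>b \<in> group_algebra l. a * b = b * a}"


section \<open>Blocks of a subring\<close>

definition central_idempotent :: "'r::ring_1 set \<Rightarrow> 'r \<Rightarrow> bool" where
  "central_idempotent C e \<longleftrightarrow> e \<in> C \<and> e * e = e \<and> (\<forall>c\<in>C. e * c = c * e)"

definition primitive_central_idempotent :: "'r::ring_1 set \<Rightarrow> 'r \<Rightarrow> bool" where
  "primitive_central_idempotent C e \<longleftrightarrow> central_idempotent C e \<and> e \<noteq> 0 \<and>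
    (\<forall>f g. central_idempotent C f \<and> central_idempotent C g \<and> f * g = 0 \<and> e = f + g
      \<longrightarrow> f = 0 \<or> g = 0)"

definition blocks :: "'r::ring_1 set \<Rightarrow> 'r set set" where
  "blocks C = {(\<lambda>c. e * c) ` C | e. primitive_central_idempotent C e}"


section \<open>Integral Specht modules\<close>

text \<open>A tableau of shape \<open>\<alpha>\<close> is a bijection from the diagram to \<open>{1..|\<alpha>|}\<close>, extended by \<open>0\<close>
  outside the diagram.  Elements of \<^const>\<open>sym\<close> fix \<open>0\<close>, so composing with them gives a tableau.\<close>

type_synonym tableau = "nat \<times> nat \<Rightarrow> nat"

definition tableaux :: "(nat \<Rightarrow> nat) \<Rightarrow> tableau set" where
  "tableaux \<alpha> = {t. bij_betw t (young \<alpha>) {1..weight \<alpha>} \<and> (\<forall>x. x \<notin> young \<alpha> \<longrightarrow> t x = 0)}"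

definition row :: "(nat \<Rightarrow> nat) \<Rightarrow> nat \<Rightarrow> (nat \<times> nat) set" where
  "row \<alpha> r = {x \<in> young \<alpha>. fst x = r}"

definition column :: "(nat \<Rightarrow> nat) \<Rightarrow> nat \<Rightarrow> (nat \<times> nat) set" where
  "column \<alpha> c = {x \<in> young \<alpha>. snd x = c}"

definition tabloid :: "(nat \<Rightarrow> nat) \<Rightarrow> tableau \<Rightarrow> tableau set" where
  "tabloid \<alpha> t = {s \<in> tableaux \<alpha>. \<forall>r. s ` row \<alpha> r = t ` row \<alpha> r}"

definition act_tabloid :: "nat perm \<Rightarrow> tableau set \<Rightarrow> tableau set" where
  "act_tabloid \<sigma> T = (\<lambda>t. apply \<sigma> \<circ> t) ` T"

definition column_stabiliser :: "(nat \<Rightarrow> nat) \<Rightarrow> tableau \<Rightarrow> nat perm set" where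
  "column_stabiliser \<alpha> t =
    {\<sigma> \<in> sym (weight \<alpha>). \<forall>c. apply \<sigma> ` t ` column \<alpha> c = t ` column \<alpha> c}"

definition polytabloid :: "(nat \<Rightarrow> nat) \<Rightarrow> tableau \<Rightarrow> tableau set \<Rightarrow>\<^sub>0 int" where
  "polytabloid \<alpha> t = (\<Sum>\<sigma>\<in>column_stabiliser \<alpha> t.
    frag_cmul (sign (apply \<sigma>)) (frag_of (act_tabloid \<sigma> (tabloid \<alpha> t))))"

definition specht_int :: "(nat \<Rightarrow> nat) \<Rightarrow> (tableau set \<Rightarrow>\<^sub>0 int) set" where
  "specht_int \<alpha> = group_closure (polytabloid \<alpha> ` tableaux \<alpha>)"

definition act_int ::
    "(nat perm \<Rightarrow>\<^sub>0 int) \<Rightarrow> (tableau set \<Rightarrow>\<^sub>0 int) \<Rightarrow> (tableau set \<Rightarrow>\<^sub>0 int)" where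
  "act_int a x = (\<Sum>\<sigma>\<in>Poly_Mapping.keys a.
    frag_cmul (Poly_Mapping.lookup a \<sigma>) (frag_extend (\<lambda>T. frag_of (act_tabloid \<sigma> T)) x))"


section \<open>Specht modules of centraliser algebras\<close>

type_synonym specht_map = "(tableau set \<Rightarrow>\<^sub>0 int) \<Rightarrow> (tableau set \<Rightarrow>\<^sub>0 int)"

text \<open>\<open>\<int>S\<^sub>l\<close>-linear maps from the Specht module of \<open>\<nu>\<close> to the restricted one of \<open>\<mu>\<close>, where
  \<open>l = |\<nu>|\<close>.  They are extended by \<open>0\<close>, so that pointwise addition on the whole type is addition of
  homomorphisms.\<close>

definition specht_hom :: "skew \<Rightarrow> specht_map set" where
  "specht_hom = (\<lambda>(\<mu>, \<nu>). {\<phi>.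
    (\<forall>v\<in>specht_int \<nu>. \<phi> v \<in> specht_int \<mu>) \<and> (\<forall>v. v \<notin> specht_int \<nu> \<longrightarrow> \<phi> v = 0) \<and>
    (\<forall>v\<in>specht_int \<nu>. \<forall>w\<in>specht_int \<nu>. \<phi> (v + w) = \<phi> v + \<phi> w) \<and>
    (\<forall>b\<in>group_algebra (weight \<nu>). \<forall>v\<in>specht_int \<nu>. \<phi> (act_int b v) = act_int b (\<phi> v))})"

text \<open>The tensor product over \<open>\<int>\<close> of the additive group of \<open>'a\<close> with a subgroup \<open>H\<close>: the free
  abelian group on \<open>UNIV \<times> H\<close> modulo the biadditivity relations (these imply \<open>\<int>\<close>-balancedness).
  Elements are cosets, and \<open>a \<otimes> x\<close> is the coset of \<^term>\<open>frag_of (a, x)\<close>.\<close>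

definition tensor_relations :: "'b::ab_group_add set \<Rightarrow> ('a::ab_group_add \<times> 'b \<Rightarrow>\<^sub>0 int) set" where
  "tensor_relations H = group_closure
    ({frag_of (a + b, x) - frag_of (a, x) - frag_of (b, x) | a b x. x \<in> H} \<union>
     {frag_of (a, x + y) - frag_of (a, x) - frag_of (a, y) | a x y. x \<in> H \<and> y \<in> H})"

definition tensor_class ::
    "'b::ab_group_add set \<Rightarrow> ('a::ab_group_add \<times> 'b \<Rightarrow>\<^sub>0 int) \<Rightarrow> ('a \<times> 'b \<Rightarrow>\<^sub>0 int) set" where
  "tensor_class H z = {z + u | u. u \<in> tensor_relations H}"

definition tensor_product :: "'b::ab_group_add set \<Rightarrow> ('a::ab_group_add \<times> 'b \<Rightarrow>\<^sub>0 int) set set" where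
  "tensor_product H = {tensor_class H z | z. Poly_Mapping.keys z \<subseteq> UNIV \<times> H}"

definition specht :: "skew \<Rightarrow> ('k::field \<times> specht_map \<Rightarrow>\<^sub>0 int) set set" where
  "specht s = tensor_product (specht_hom s)"

text \<open>
  Elements of the centraliser algebra over any ring of coefficients are constant on the
  \<open>S\<^sub>l\<close>-conjugacy classes of \<open>S\<^sub>m\<close>, so the sums of these classes form a \<open>\<int>\<close>-basis of the integral
  centraliser algebra and, reduced, a basis of the one over \<open>'k\<close>.  If \<open>c\<close> has coefficient
  \<open>c\<^sub>K\<close> on the class \<open>K\<close>, then \<open>c (a \<otimes> \<phi>) = (\<Sum>K. c\<^sub>K a \<otimes> s\<^sub>K \<phi>)\<close>, where \<open>s\<^sub>K\<close>
  is the sum of \<open>K\<close> and \<open>(s\<^sub>K \<phi>) v = s\<^sub>K (\<phi> v)\<close>.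
\<close>

definition conj_class :: "nat \<Rightarrow> nat perm \<Rightarrow> nat perm set" where
  "conj_class l \<pi> = {\<sigma> * \<pi> * inverse \<sigma> | \<sigma>. \<sigma> \<in> sym l}"

definition conj_classes :: "nat \<Rightarrow> nat \<Rightarrow> nat perm set set" where
  "conj_classes l m = conj_class l ` sym m"

definition class_sum :: "nat perm set \<Rightarrow> nat perm \<Rightarrow>\<^sub>0 int" where
  "class_sum K = (\<Sum>\<pi>\<in>K. Poly_Mapping.single \<pi> 1)"

definition class_coeff :: "(nat perm \<Rightarrow>\<^sub>0 'k::ring_1) \<Rightarrow> nat perm set \<Rightarrow> 'k" where
  "class_coeff c K = the_elem (Poly_Mapping.lookup c ` K)"

lemma lookup_single_times:
  fixes c :: "'g::group_add \<Rightarrow>\<^sub>0 'k::ring_1"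
  shows "Poly_Mapping.lookup (Poly_Mapping.single g 1 * c) (g + h) = Poly_Mapping.lookup c h"
    and "Poly_Mapping.lookup (c * Poly_Mapping.single g 1) (h + g) = Poly_Mapping.lookup c h"
proof -
  have upd: "Poly_Mapping.update a b f = f + Poly_Mapping.single a b" if "a \<notin> Poly_Mapping.keys f"
    for a :: 'g and b :: 'k and f
    using that by (intro poly_mapping_eqI) (auto simp: lookup_update lookup_add lookup_single when_def in_keys_iff)
  show "Poly_Mapping.lookup (Poly_Mapping.single g 1 * c) (g + h) = Poly_Mapping.lookup c h"
    by (induction c rule: update_induct)
      (auto simp: upd distrib_left lookup_add mult_single lookup_single when_def)
  show "Poly_Mapping.lookup (c * Poly_Mapping.single g 1) (h + g) = Poly_Mapping.lookup c h"
    by (induction c rule: update_induct)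
      (auto simp: upd distrib_right lookup_add mult_single lookup_single when_def)
qed

lemma class_coeff_eq:
  fixes c :: "nat perm \<Rightarrow>\<^sub>0 'k::ring_1"
  assumes c: "c \<in> centraliser_algebra l m"
  shows "class_coeff c (conj_class l \<pi>) = Poly_Mapping.lookup c \<pi>"
proof -
  have *: "Poly_Mapping.lookup c (\<sigma> * \<pi> * inverse \<sigma>) = Poly_Mapping.lookup c \<pi>" if "\<sigma> \<in> sym l" for \<sigma>
  proof -
    have "Poly_Mapping.single \<sigma> (1::'k) \<in> group_algebra l"
      using that by (auto simp: group_algebra_def)
    then have "c * Poly_Mapping.single \<sigma> 1 = Poly_Mapping.single \<sigma> 1 * c"
      using c by (simp add: centraliser_algebra_def)
    then have "Poly_Mapping.lookup c (\<sigma> + \<pi> - \<sigma>) = Poly_Mapping.lookup c \<pi>"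
      using lookup_single_times(1)[of \<sigma> c \<pi>] lookup_single_times(2)[of c \<sigma> "\<sigma> + \<pi> - \<sigma>"] by simp
    then show ?thesis
      by (simp add: plus_perm_def minus_perm_def)
  qed
  have "1 \<in> sym l" by (simp add: sym_def)
  then have "conj_class l \<pi> \<noteq> {}" by (auto simp: conj_class_def)
  moreover have "Poly_Mapping.lookup c \<pi>' = Poly_Mapping.lookup c \<pi>" if "\<pi>' \<in> conj_class l \<pi>" for \<pi>'
    using that * by (auto simp: conj_class_def)
  ultimately have "Poly_Mapping.lookup c ` conj_class l \<pi> = {Poly_Mapping.lookup c \<pi>}" by auto
  then show ?thesis by (simp add: class_coeff_def)
qed

definition act_pure ::
    "skew \<Rightarrow> (nat perm \<Rightarrow>\<^sub>0 'k::field) \<Rightarrow> 'k \<times> specht_map \<Rightarrow> ('k \<times> specht_map \<Rightarrow>\<^sub>0 int)" where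
  "act_pure = (\<lambda>(\<mu>, \<nu>) c (a, \<phi>). \<Sum>K\<in>conj_classes (weight \<nu>) (weight \<mu>).
    frag_of (class_coeff c K * a, \<lambda>v. act_int (class_sum K) (\<phi> v)))"

definition act_specht :: "skew \<Rightarrow> (nat perm \<Rightarrow>\<^sub>0 'k::field)
    \<Rightarrow> ('k \<times> specht_map \<Rightarrow>\<^sub>0 int) set \<Rightarrow> ('k \<times> specht_map \<Rightarrow>\<^sub>0 int) set" where
  "act_specht s c X = (\<Union>z\<in>X. tensor_class (specht_hom s) (frag_extend (act_pure s c) z))"

definition specht_in_block :: "nat \<Rightarrow> nat \<Rightarrow> skew \<Rightarrow> (nat perm \<Rightarrow>\<^sub>0 'k::field) set \<Rightarrow> bool" where
  "specht_in_block l m s b \<longleftrightarrow>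
    (\<exists>e. primitive_central_idempotent (centraliser_algebra l m) e \<and>
      b = (\<lambda>c. e * c) ` centraliser_algebra l m \<and>
      (\<forall>X\<in>specht s. act_specht s e X = X))"

end

theory Submission
 imports Defs "HOL-Number_Theory.Cong"
begin

text \<open>
  Jucys-Murphy elements act on weight vectors of the integral group algebra by contents of partitions.
  Modulo \<open>p\<close>, the product \<open>eB\<close> of the idempotents \<open>1 - (x ^ (p ^ N) - a) ^ (p - 1)\<close>, with \<open>x\<close> an
  elementary symmetric polynomial in them, is therefore a central idempotent which acts on a Specht
  module as \<open>1\<close> or \<open>0\<close> according to the residue contents of \<open>\<mu>\<close> and \<open>\<nu>\<close>, that is, to their cores.

  Its primitivity uses that the residues are distinct: weight spaces are then lines, so a central
  idempotent \<open>e\<close> multiplies the projection \<open>eW w * eB\<close> onto each residue word \<open>w\<close> by \<open>0\<close> or \<open>1\<close>.  Evaluating an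
  integral lift of \<open>e * eB\<close> on integral weight vectors shows that this value does not change when two
  neighbouring contents are exchanged, and a study of bead configurations shows that such exchanges,
  made in all partitions of the block, link all residue words.
\<close>

text \<open>Modulo \<open>p\<close> Jucys-Murphy elements need not be diagonalisable, which is why
  \<open>x\<close> is raised to the power \<open>p ^ N\<close> before it is compared with an
  integer, and weight vectors need not span. An idempotent of the double commutant is nevertheless 0
  once it kills all weight vectors; identities between projections are verified in this way. Over
  the integers the positive form \<open>ip\<close> takes the place of complete reducibility, and
  results obtained there are reduced, so that denominators never arise. That weight spaces are lines
  requires the centre of the group algebra of S_l to act on weight vectors through their residues
  alone; hence the integral description of this centre by symmetric polynomials. The obstacle in the
  combinatorial part is that sizes are fixed: an exchange needs a configuration of exactly the
  prescribed total height in which both orders are valid. Beads are therefore lowered as far as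
  possible, and the height saved is spent elsewhere. As fewer than \<open>p\<close> residues occur,
  the circle of runners is cut at a missing one and becomes a line.\<close>

unbundle permutation_syntax
no_notation "apply" (infixl "\<langle>$\<rangle>" 999)
notation "apply" (infixl "$" 999)
notation swap ("{|_,/ _|}")
abbreviation (input) iff_ascii (infixr "<->" 25) where "P <-> Q == P = (Q :: bool)"
abbreviation "lookup == Poly_Mapping.lookup"
abbreviation "single == Poly_Mapping.single"
abbreviation "keys == Poly_Mapping.keys"
lemmas diff_distrib = left_diff_distrib right_diff_distrib
abbreviation (input) "GA == group_algebra"
abbreviation (input) "CA == centraliser_algebra"

section \<open>Group algebras of symmetric groups and Jucys-Murphy elements\<close>

type_synonym 'r galg = "nat perm \<Rightarrow>\<^sub>0 'r"

text \<open>Arbitrary supports are allowed because the group on the points l+1, ..., m is needed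
  besides \<open>sym l\<close>.\<close>

definition sgrp :: "nat set => nat perm set" where
 "sgrp S = {sg. affected sg <= S}"

lemma sym_sgrp: "sym n = sgrp {1..n}" by (simp add: sym_def sgrp_def)

lemma sgrp_one [simp]: "1 : sgrp S" by (simp add: sgrp_def)

lemma sgrp_mult: "sg : sgrp S ==> tt : sgrp S ==> sg * tt : sgrp S" using affected_times[of sg tt] unfolding sgrp_def by blast

lemma sgrp_inverse [simp]: "inverse sg : sgrp S <-> sg : sgrp S" by (simp add: sgrp_def)

lemma sgrp_swap: "a : S ==> b : S ==> {|a,b|} : sgrp S" by (cases "a = b") (auto simp: sgrp_def affected_swap)

lemma sgrp_mono: "S <= S' ==> sg : sgrp S ==> sg : sgrp S'" by (auto simp: sgrp_def)

lemma sgrp_fix: "sg : sgrp S ==> x ~: S ==> sg $ x = x" by (auto simp: sgrp_def in_affected)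

lemma perm_apply_inverse [simp]: "sg $ (inverse sg $ x) = x" "inverse sg $ (sg $ x) = x"
 by (metis apply_sequence apply_one comp_def id_apply perm.right_inverse perm.left_inverse)+

lemma sgrp_image: "sg : sgrp S ==> S <= S' ==> ($) sg ` S' = S'"
proof -
 assume *: "sg : sgrp S" "S <= S'"
 have sub: "($) tt ` S' <= S'" if "tt : sgrp S" for tt
 proof
  fix y assume "y : ($) tt ` S'"
  then obtain x where x: "x : S'" "y = tt $ x" by auto
  show "y : S'"
  proof (cases "tt $ x = x")
   case False
   hence "x : affected tt" by (simp add: in_affected)
   hence "tt $ x : affected tt" by simp
   thus ?thesis using that * x unfolding sgrp_def by blast
  qed (use x in simp)
 qed
 have "S' <= ($) sg ` S'"
 proof
  fix y assume "y : S'"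
  hence "inverse sg $ y : S'" using sub[of "inverse sg"] * by auto
  thus "y : ($) sg ` S'" by (metis image_eqI perm_apply_inverse(1))
 qed
 with sub * show ?thesis by blast
qed

lemma finite_sgrp [simp]: "finite S ==> finite (sgrp S)"
proof -
 assume S: "finite S"
 have "inj_on ($) (sgrp S)" by (rule inj_onI) (metis perm_eqI)
 moreover have "($) ` sgrp S <= {f. f permutes S}" by (auto simp: permutes_def sgrp_def in_affected) (metis perm_apply_inverse)+
 ultimately show ?thesis using finite_permutations[OF S] by (metis finite_imageD finite_subset)
qed

lemma finite_sym [simp]: "finite (sym n)" by (simp add: sym_sgrp)

lemma perm_swap_conj: "sg * {|a,b|} = {|sg $ a,sg $ b|} * sg"
proof (rule perm_eqI)
 fix x
 have inj: "sg $ x = sg $ y <-> x = y" for y by (simp add: apply_inj)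
 show "(sg * {|a,b|}) $ x = ({|sg $ a,sg $ b|} * sg) $ x" by (cases "x = a"; cases "x = b") (auto simp: apply_times inj)
qed

lemma swap_times_swap [simp]: "{|a,b|} * {|a,b|} = (1 :: 'a perm)" by (metis inverse_swap perm.left_inverse)

lemma apply_swap_times: "({|a,b|} * sg) $ x = (if sg $ x = a then b else if sg $ x = b then a else sg $ x)" by (auto simp: apply_times)

lemma sgrp_induct [consumes 2, case_names one swap]:
 assumes S: "finite S" and sg: "sg : sgrp S"
  and one: "P 1"
  and step: "!!tt a b. tt : sgrp S ==> P tt ==> a : S ==> b : S ==> a ~= b ==> P ({|a,b|} * tt)"
 shows "P sg" using sg
proof (induction "card (affected sg)" arbitrary: sg rule: less_induct)
 case less
 show ?case
 proof (cases "sg = 1")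
  case False
  then obtain a where a: "a : affected sg" by (metis affected_empty_iff ex_in_conv)
  define b where "b = sg $ a"
  define tt where "tt = {|a,b|} * sg"
  have ab: "a ~= b" "b : affected sg" using a by (auto simp: b_def in_affected apply_inj)
  have "affected tt <= affected sg - {a}"
  proof
   fix x assume x: "x : affected tt"
   have "tt $ a = a" by (simp add: tt_def apply_times b_def)
   hence "x ~= a" using x by (auto simp: in_affected)
   moreover have "x : affected sg" using x affected_times[of "{|a,b|}" sg] ab a by (auto simp: tt_def affected_swap)
   ultimately show "x : affected sg - {a}" by blast
  qed
  hence "card (affected tt) < card (affected sg)"
   using a by (meson Diff_subset finite_affected psubset_card_mono psubsetI subset_Diff_insert order.trans insertI1 Diff_iff subsetD finite_Diff card_mono card_Diff1_less le_less_trans)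
  moreover have "tt : sgrp S" unfolding tt_def using less.prems a ab by (intro sgrp_mult sgrp_swap) (auto simp: sgrp_def)
  ultimately have "P tt" using less by blast
  have "P ({|a,b|} * tt)" using less.prems a ab `tt : sgrp S` `P tt` by (intro step) (auto simp: sgrp_def)
  thus ?thesis by (simp add: tt_def flip: mult.assoc)
 qed (simp add: one)
qed

lemma sgrp_interval_induct [consumes 1, case_names one swap]:
 assumes sg: "sg : sgrp {i..j}"
  and one: "P 1"
  and step: "!!tt r. P tt ==> i <= r ==> r < j ==> P ({|r,Suc r|} * tt)"
 shows "P sg"
proof -
 \<comment> \<open>Transpositions of any distance are built up by conjugation: the simple
   transposition of a+d+1 and a+d+2 moves the upper end one step up.\<close>
 have sw: "P ({|a,a + Suc d|} * tt)" if "P tt" "i <= a" "a + Suc d <= j" for tt a d using that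
 proof (induction d arbitrary: tt)
  case (Suc d)
  let ?s = "{|a + Suc d,Suc (a + Suc d)|}"
  have "P (?s * tt)" using Suc.prems by (intro step) auto
  hence "P ({|a,a + Suc d|} * (?s * tt))" using Suc by simp
  hence "P (?s * ({|a,a + Suc d|} * (?s * tt)))" using Suc.prems by (intro step) auto
  moreover have "?s * {|a,a + Suc d|} = {|a,a + Suc (Suc d)|} * ?s" by (subst perm_swap_conj) simp
  ultimately show ?case by (metis mult.assoc swap_times_swap mult_1)
 qed (use step in simp)
 have "finite {i..j}" by simp
 thus ?thesis using sg
 proof (induction sg rule: sgrp_induct)
  case (swap tt a b)
  show ?case
  proof (cases "a < b")
   case True
   then obtain d where "b = a + Suc d" by (metis less_iff_Suc_add add_Suc_right)
   thus ?thesis using sw swap by simp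
  next
   case False
   hence "b < a" using swap by simp
   then obtain d where "a = b + Suc d" by (metis less_iff_Suc_add add_Suc_right)
   thus ?thesis using sw[of tt b d] swap by (simp add: swap_sym)
  qed
 qed (rule one)
qed

abbreviation gs :: "nat perm => 'r::comm_ring_1 galg" where
 "gs sg == single sg 1"

lemma gs_mult: "gs sg * gs tt = gs (sg * tt)" by (simp add: mult_single plus_perm_def)

lemma gs_one [simp]: "gs 1 = 1" by (metis single_one zero_perm_def)

lemma gs_inverse [simp]: "gs (inverse sg) * gs sg = 1" "gs sg * gs (inverse sg) = 1" by (simp_all add: gs_mult)

lemma lookup_gs_mult: "lookup (gs sg * x) tt = lookup x (inverse sg * tt)" using lookup_single_times(1)[of sg x "inverse sg * tt"]
 by (simp add: plus_perm_def flip: mult.assoc)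

lemma lookup_mult_gs: "lookup (x * gs sg) tt = lookup x (tt * inverse sg)" using lookup_single_times(2)[of x sg "tt * inverse sg"]
 by (simp add: plus_perm_def mult.assoc)

definition tr :: "nat => nat => 'r::comm_ring_1 galg" where
 "tr a b = gs {|a,b|}"

lemma tr_sq [simp]: "tr a b * tr a b = 1" by (simp add: tr_def gs_mult)

lemma gs_tr: "gs sg * tr a b = tr (sg $ a) (sg $ b) * gs sg" by (simp add: tr_def gs_mult perm_swap_conj)

definition jm :: "nat => 'r::comm_ring_1 galg" where
 "jm j = (SUM b:{1..<j}. tr b j)"

lemma gs_jm:
 assumes "sg $ j = j" "($) sg ` {1..<j} = {1..<j}"
 shows "gs sg * jm j = jm j * gs sg"
proof -
 have "gs sg * jm j = (SUM b:{1..<j}. tr (sg $ b) j) * gs sg" by (simp add: jm_def sum_distrib_left sum_distrib_right gs_tr assms)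
 also have "(SUM b:{1..<j}. tr (sg $ b) j) = (SUM b:($) sg ` {1..<j}. tr b j :: 'a galg)"
  by (subst sum.reindex) (auto simp: inj_on_def apply_inj tr_def)
 finally show ?thesis unfolding assms(2) jm_def .
qed

lemma gs_jm_sgrp:
 assumes "sg : sgrp S" "S <= {1..<j}"
 shows "gs sg * jm j = jm j * gs sg" using assms by (intro gs_jm) (auto simp: sgrp_image intro!: sgrp_fix)

lemma gs_jm_sgrp_less:
 assumes "sg : sgrp S" "S Int {1..j} = {}"
 shows "gs sg * jm j = jm j * gs sg"
proof -
 have "sg $ b = b" if "b : {1..j}" for b using assms that by (intro sgrp_fix[of _ S]) auto
 hence "($) sg ` {1..<j} = {1..<j}" "j > 0 ==> sg $ j = j" by auto
 thus ?thesis by (cases "j = 0") (simp add: jm_def, auto intro!: gs_jm)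
qed

text \<open>For i < j every summand of \<open>jm i\<close> permutes points below j only, and such a
  permutation merely rearranges the summands of \<open>jm j\<close>.\<close>

lemma jm_commute: "jm i * jm j = jm j * (jm i :: 'r::comm_ring_1 galg)"
proof -
 have *: "jm i * jm j = jm j * (jm i :: 'r galg)" if "i < j" for i j
 proof -
  have "tr b i * jm j = jm j * (tr b i :: 'r galg)" if "b : {1..<i}" for b
   unfolding tr_def using `i < j` that by (intro gs_jm_sgrp[of _ "{b, i}"] sgrp_swap) auto
  thus ?thesis by (simp add: jm_def[of i] sum_distrib_left sum_distrib_right)
 qed
 show ?thesis using *[of i j] *[of j i] by (cases i j rule: linorder_cases) auto
qed

abbreviation sr :: "nat => 'r::comm_ring_1 galg" where
 "sr r == tr r (Suc r)"

lemma sr_jm: "1 <= r ==> j ~= r ==> j ~= Suc r ==> sr r * jm j = jm j * sr r" unfolding tr_def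
 using gs_jm_sgrp_less[of "{|r,Suc r|}" "{r, Suc r}" j] gs_jm_sgrp[of "{|r,Suc r|}" "{r, Suc r}" j]
  sgrp_swap[of r "{r, Suc r}" "Suc r"] by (cases "j < r") auto

text \<open>The relation of the degenerate affine Hecke algebra: conjugation by \<open>sr r\<close>
  turns \<open>jm r\<close> into \<open>jm (Suc r)\<close> without its last summand, and that
  summand is \<open>sr r\<close> itself.\<close>

lemma jm_Suc_sr: "1 <= r ==> jm (Suc r) * sr r = sr r * jm r + (1 :: 'r::comm_ring_1 galg)"
proof -
 assume r: "1 <= r"
 have "sr r * jm r = (SUM b:{1..<r}. tr b (Suc r)) * (sr r :: 'r galg)" unfolding jm_def sum_distrib_left sum_distrib_right
 proof (intro sum.cong refl)
  fix b assume "b : {1..<r}"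
  thus "sr r * tr b r = tr b (Suc r) * (sr r :: 'r galg)" using gs_tr[of "{|r,Suc r|}" b r] by (simp add: tr_def)
 qed
 moreover have "jm (Suc r) = (SUM b:{1..<r}. tr b (Suc r)) + (sr r :: 'r galg)" using r by (simp add: jm_def atLeastLessThanSuc add.commute)
 ultimately show ?thesis by (simp add: distrib_right)
qed

lemma sr_jm_Suc: "1 <= r ==> sr r * jm (Suc r) = jm r * sr r + (1 :: 'r::comm_ring_1 galg)"
proof -
 assume "1 <= r"
 hence "sr r * (jm (Suc r) * sr r) * sr r = sr r * (sr r * jm r + 1) * (sr r :: 'r galg)" by (simp add: jm_Suc_sr)
 thus ?thesis by (simp add: mult.assoc distrib_left distrib_right flip: mult.assoc[of "sr r" "sr r"])
qed

lemma jm_sr: "1 <= r ==> jm r * sr r = sr r * jm (Suc r) - (1 :: 'r::comm_ring_1 galg)" by (simp add: sr_jm_Suc)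

lemma comm_multI: "z * a = a * z ==> z * b = b * z ==> z * (a * b) = (a * b) * (z :: 'a::semigroup_mult)" by (metis mult.assoc)

lemma comm_addI: "z * a = a * z ==> z * b = b * z ==> z * (a + b) = (a + b) * (z :: 'a::semiring)" by (simp add: distrib_left distrib_right)

text \<open>The double commutant stands in for the Gelfand-Zetlin algebra generated by the Jucys-Murphy elements.\<close>

definition gz :: "nat => 'r::comm_ring_1 galg set" where
 "gz m = {h. ALL z. (ALL j:{1..m}. z * jm j = jm j * z) --> z * h = h * z}"

lemma gzD: "h : gz m ==> (!!j. j : {1..m} ==> z * jm j = jm j * z) ==> z * h = h * z" by (auto simp: gz_def)

lemma gz_jm: "j : {1..m} ==> jm j : gz m" by (auto simp: gz_def)

lemma gz_one [simp]: "1 : gz m" by (auto simp: gz_def)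

lemma gz_zero [simp]: "0 : gz m" by (auto simp: gz_def)

lemma gz_mult: "a : gz m ==> b : gz m ==> a * b : gz m" unfolding gz_def mem_Collect_eq by (blast intro: comm_multI)

lemma gz_add: "a : gz m ==> b : gz m ==> a + b : gz m" by (auto simp: gz_def distrib_left distrib_right)

lemma gz_diff: "a : gz m ==> b : gz m ==> a - b : gz m" by (auto simp: gz_def diff_distrib)

lemma gz_of_int [simp]: "of_int c : gz m" by (auto simp: gz_def mult_of_int_commute)

lemma gz_power: "a : gz m ==> a ^ n : gz m" by (induction n) (auto intro: gz_mult)

lemma gz_sum: "(!!i. i : I ==> f i : gz m) ==> sum f I : gz m" by (induction I rule: infinite_finite_induct) (auto intro: gz_add)

lemma gz_commute: "a : gz m ==> b : gz m ==> a * b = b * a" by (rule gzD[of b m a]) (auto intro!: gzD[of a m, symmetric] simp: jm_commute)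

section \<open>Elementary symmetric polynomials\<close>

fun esym :: "(nat => 'r::ring_1) => nat => nat => 'r" where
 "esym f j 0 = 1"
| "esym f 0 (Suc k) = 0"
| "esym f (Suc j) (Suc k) = esym f j (Suc k) + esym f j k * f (Suc j)"

lemma esym_gz: "j <= m ==> esym jm j k : gz m"
proof (induction "jm :: nat => 'a galg" j k rule: esym.induct)
 case (3 j k)
 thus ?case by (auto intro!: gz_add gz_mult gz_jm)
qed auto

text \<open>Only x = \<open>jm r\<close> and y = \<open>jm (Suc r)\<close> fail to commute with
  \<open>sr r\<close>. As soon as both are included, the polynomial involves them through x + y and
  x y alone, and these two do commute with it.\<close>

lemma sr_esym_jm:
 assumes "1 <= r" "r < j"
 shows "sr r * esym jm j k = esym jm j k * (sr r :: 'r::comm_ring_1 galg)"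
proof -
 have below: "sr r * esym jm i k = esym jm i k * (sr r :: 'r galg)" if "i < r" for i k using that
 proof (induction "jm :: nat => 'r galg" i k rule: esym.induct)
  case (3 i k)
  have "sr r * jm (Suc i) = jm (Suc i) * (sr r :: 'r galg)" using 3 assms by (intro sr_jm) auto
  with 3 show ?case by (auto intro!: comm_addI comm_multI)
 qed auto
 let ?s = "sr r :: 'r galg"
 let ?x = "jm r :: 'r galg" let ?y = "jm (Suc r) :: 'r galg"
 have c1: "?s * (?x + ?y) = (?x + ?y) * ?s" using jm_Suc_sr[OF assms(1), where ?'r = 'r] sr_jm_Suc[OF assms(1), where ?'r = 'r]
  by (simp add: distrib_left distrib_right)
 have c2: "?s * (?x * ?y) = (?x * ?y) * ?s"
 proof -
  have "?s * (?x * ?y) = (?y * ?s - 1) * ?y" by (simp add: jm_Suc_sr[OF assms(1)] flip: mult.assoc)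
  also have "... = ?y * (?x * ?s + 1) - ?y" by (simp add: sr_jm_Suc[OF assms(1)] left_diff_distrib mult.assoc)
  also have "... = ?x * ?y * ?s" by (simp add: distrib_left jm_commute[of "Suc r" r] flip: mult.assoc)
  finally show ?thesis .
 qed
 obtain q where q: "r = Suc q" using assms by (cases r) auto
 have at: "?s * esym jm (Suc r) k = esym jm (Suc r) k * ?s" for k
 proof -
  have b: "?s * esym jm q k = esym jm q k * ?s" for k using below[of q k] q by simp
  show ?thesis
  proof (cases k)
   case (Suc k')
   show ?thesis
   proof (cases k')
    case 0
    thus ?thesis using Suc q b[of 1] c1 by (simp add: distrib_left distrib_right)
   next
    case (Suc k'')
    have "esym jm (Suc r) k = esym jm q k + esym jm q k' * (?x + ?y) + esym jm q k'' * (?x * ?y)"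
     using Suc `k = Suc k'` q by (simp add: algebra_simps)
    thus ?thesis using b c1 c2 by (auto intro!: comm_addI comm_multI)
   qed
  qed simp
 qed
 have "?s * esym jm (Suc r + d) k = esym jm (Suc r + d) k * ?s" for d k
 proof (induction d arbitrary: k)
  case (Suc d)
  have "?s * jm (Suc (Suc r + d)) = jm (Suc (Suc r + d)) * ?s" using assms by (intro sr_jm) auto
  moreover have *: "Suc r + Suc d = Suc (Suc r + d)" by simp
  ultimately show ?case using Suc unfolding * by (cases k) (auto simp del: add_Suc add_Suc_right intro!: comm_addI comm_multI)
 qed (use at in simp)
 from this[of "j - Suc r" k] assms show ?thesis by simp
qed

text \<open>Simple transpositions generate the group, so \<open>sr_esym_jm\<close> gives the easy
  half of the theorem of Jucys on the centre.\<close>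

lemma gs_esym_jm:
 assumes "sg : sym j"
 shows "gs sg * esym jm j k = esym jm j k * gs sg" using assms unfolding sym_sgrp
proof (induction sg rule: sgrp_interval_induct)
 case (swap tt r)
 have "gs ({|r,Suc r|} * tt) = sr r * (gs tt :: 'a galg)" by (simp add: tr_def gs_mult)
 with swap show ?case by (metis (no_types) mult.assoc sr_esym_jm)
qed simp

section \<open>Eigenvalues of Jucys-Murphy elements\<close>

text \<open>A polynomial with integral roots, kept as its list of roots so that shifting the
  argument is shifting the list.\<close>

definition rprod :: "int list => 'r::ring_1 => 'r" where
 "rprod cs x = prod_list (map (%c. x - of_int c) cs)"

lemma rprod_simps [simp]: "rprod [] x = 1" "rprod (c # cs) x = (x - of_int c) * rprod cs x" by (simp_all add: rprod_def)

lemma rprod_append: "rprod (cs @ ds) x = rprod cs x * rprod ds x" by (simp add: rprod_def)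

text \<open>The intertwining element of the degenerate affine Hecke algebra. It carries eigenvectors
  of x to eigenvectors of y or to 0, and it is its own inverse up to the factor 1 - (x -
  y)^2.\<close>

lemma intertwiner:
 fixes s x y :: "'r::ring_1"
 assumes xy: "x * y = y * x" and ss: "s * s = 1" and ys: "y * s = s * x + 1" and xs: "x * s = s * y - 1"
 shows "y * (s * (x - y) + 1) = (s * (x - y) + 1) * x"
  and "(s * (x - y) + 1) * (s * (x - y) + 1) = 1 - (x - y) * (x - y)"
proof -
 have "y * (s * (x - y) + 1) = (y * s) * (x - y) + y" by (simp add: distrib_left mult.assoc)
 also have "... = s * (x * (x - y)) + x" by (simp add: ys distrib_right mult.assoc)
 also have "x * (x - y) = (x - y) * x" using xy by (simp add: diff_distrib)
 also have "s * ((x - y) * x) + x = (s * (x - y) + 1) * x" by (simp add: distrib_right mult.assoc)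
 finally show "y * (s * (x - y) + 1) = (s * (x - y) + 1) * x" .
 define d where "d = x - y"
 have *: "d * s = - (s * d) - 2" by (simp add: d_def diff_distrib ys xs)
 have "s * d * s = s * (d * s)" by (simp add: mult.assoc)
 also have "... = - (s * s * d) - s * 2" by (simp add: * right_diff_distrib mult.assoc)
 finally have **: "s * d * s = - d - (s + s)" by (simp add: ss mult_2_right)
 have "(s * d + 1) * (s * d + 1) = (s * d * s) * d + s * d + s * d + 1" by (simp add: distrib_left distrib_right mult.assoc)
 also have "... = 1 - d * d" by (simp add: ** left_diff_distrib distrib_right)
 finally show "(s * (x - y) + 1) * (s * (x - y) + 1) = 1 - (x - y) * (x - y)" by (simp add: d_def)
qed

lemma rprod_intertwine: "y * ph = ph * x ==> rprod cs y * ph = ph * rprod cs x"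
proof (induction cs)
 case (Cons c cs)
 have "(y - of_int c) * ph = ph * (x - of_int c)" using Cons.prems by (simp add: diff_distrib mult_of_int_commute)
 with Cons show ?case by (simp add: mult.assoc) (simp flip: mult.assoc)
qed simp

text \<open>Taylor expansion to first order. The quotient g is a polynomial in x and u; this is
  recorded as commuting with everything that commutes with both, which lets g move past other
  factors.\<close>

lemma rprod_shift:
 fixes x u :: "'r::ring_1"
 assumes xu: "x * u = u * x"
 shows "EX g. rprod cs (x - u) = rprod cs x + g * u & (ALL z. z * x = x * z --> z * u = u * z --> z * g = g * z)"
proof (induction cs)
 case Nil
 show ?case by (intro exI[of _ 0]) simp
next
 case (Cons c cs)
 then obtain g where g: "rprod cs (x - u) = rprod cs x + g * u"
  and gz: "!!z. z * x = x * z ==> z * u = u * z ==> z * g = g * z" by blast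
 have rz: "z * rprod cs x = rprod cs x * z" if "z * x = x * z" for z using rprod_intertwine[of x z x cs] that by simp
 have cx: "z * (x - of_int c) = (x - of_int c) * z" if "z * x = x * z" for z using that by (simp add: diff_distrib mult_of_int_commute)
 define g' where "g' = (x - of_int c) * g - rprod cs x - u * g"
 have "rprod (c # cs) (x - u) = (x - of_int c - u) * (rprod cs x + g * u)" by (simp add: g algebra_simps)
 also have "... = rprod (c # cs) x + g' * u" using rz[of u] xu by (simp add: g'_def algebra_simps)
 finally have 1: "rprod (c # cs) (x - u) = rprod (c # cs) x + g' * u" .
 have "z * g' = g' * z" if z: "z * x = x * z" "z * u = u * z" for z
 proof -
  have "z * ((x - of_int c) * g) = ((x - of_int c) * g) * z" "z * (u * g) = (u * g) * z" using z gz cx by (auto intro!: comm_multI)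
  with rz[of z] z show ?thesis by (simp add: g'_def diff_distrib)
 qed
 with 1 show ?case by blast
qed

lemma rprod_map_add: "rprod (map (%c. c + d) cs) y = rprod cs (y - of_int d)" by (induction cs) (auto simp: algebra_simps)

text \<open>Let f be the polynomial with roots cs. The intertwiner gives f(y) (1 - (x - y)^2) = 0,
  while f(x) = 0 makes f(y + 1) a multiple of x - y - 1 and f(y - 1) a multiple of x - y + 1. Hence
  f(y) f(y - 1) f(y + 1) vanishes. No division occurs, so the argument applies over the integers and
  modulo p alike.\<close>

lemma annihilator_step:
 fixes s x y :: "'r::ring_1"
 assumes xy: "x * y = y * x" and ss: "s * s = 1" and ys: "y * s = s * x + 1" and xs: "x * s = s * y - 1"
  and x: "rprod cs x = 0"
 shows "rprod (cs @ map (%c. c + 1) cs @ map (%c. c + -1) cs) y = 0"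
proof -
 let ?ph = "s * (x - y) + 1"
 have "rprod cs y * ?ph = 0" using rprod_intertwine[OF intertwiner(1)[OF xy ss ys xs], of cs] x by simp
 hence "rprod cs y * (?ph * ?ph) = 0" by (simp flip: mult.assoc)
 hence 0: "rprod cs y * (1 - (x - y) * (x - y)) = 0" using intertwiner(2)[OF xy ss ys xs] by simp
 define u where "u = x - y - 1" define u' where "u' = x - y + 1"
 have uu: "u * u' = - (1 - (x - y) * (x - y))" by (simp add: u_def u'_def algebra_simps)
 have c: "x * u = u * x" "x * u' = u' * x" "u * u' = u' * u" using xy by (auto simp: u_def u'_def algebra_simps)
 obtain g where g: "rprod cs (x - u) = g * u"
  and gz: "!!z. z * x = x * z ==> z * u = u * z ==> z * g = g * z" using rprod_shift[OF c(1), of cs] x by auto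
 obtain g' where g': "rprod cs (x - u') = g' * u'"
  and gz': "!!z. z * x = x * z ==> z * u' = u' * z ==> z * g' = g' * z" using rprod_shift[OF c(2), of cs] x by auto
 have r: "rprod (map (%c. c + 1) cs) y = rprod cs (x - u')" "rprod (map (%c. c + -1) cs) y = rprod cs (x - u)"
  using rprod_map_add[of 1 cs y] rprod_map_add[of "-1" cs y] by (simp_all add: u_def u'_def algebra_simps)
 have "u * g = g * u" using gz[of u] c by simp
 moreover have "u * g' = g' * u" "u' * g' = g' * u'" using gz'[of u] gz'[of u'] c by simp_all
 moreover have "u' * g = g * u'" using gz[of u'] c by simp
 ultimately have "g' * u' * (g * u) = u * u' * (g' * g)" using c(3) by (metis mult.assoc)
 hence "rprod (cs @ map (%c. c + 1) cs @ map (%c. c + -1) cs) y = rprod cs y * (u * u') * (g' * g)"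
  unfolding rprod_append r g g' by (simp add: mult.assoc)
 also have "rprod cs y * (u * u') = 0" using 0 by (simp only: uu mult_minus_right minus_zero)
 finally have "rprod (cs @ map (%c. c + 1) cs @ map (%c. c + -1) cs) y = 0 * (g' * g)" .
 also have "... = 0" by simp
 finally show ?thesis .
qed

lemma jm_annihilator: "1 <= j ==> EX cs. rprod cs (jm j :: 'r::comm_ring_1 galg) = 0"
proof (induction j rule: nat_induct_at_least)
 case base
 show ?case by (intro exI[of _ "[0]"]) (simp add: jm_def)
next
 case (Suc j)
 then obtain cs where cs: "rprod cs (jm j :: 'r galg) = 0" by blast
 show ?case using annihilator_step[OF jm_commute tr_sq jm_Suc_sr jm_sr cs, OF Suc.hyps Suc.hyps] by blast
qed

text \<open>Weights are integer sequences over every coefficient ring; in characteristic p several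
  sequences describe the same weight.\<close>

definition wtv :: "nat => (nat => int) => 'r::comm_ring_1 galg => bool" where
 "wtv m as v <-> (ALL j:{1..m}. jm j * v = of_int (as j) * v)"

lemma wtvD: "wtv m as v ==> 1 <= j ==> j <= m ==> jm j * v = of_int (as j) * v" by (simp add: wtv_def)

lemma of_int_comm: "of_int c * (a * x) = a * (of_int c * (x :: 'r::ring_1))" by (metis mult.assoc mult_of_int_commute)

lemma rprod_gz: "x : gz m ==> rprod cs x : gz m" by (induction cs) (auto intro: gz_mult gz_diff gz_of_int gz_one)

lemma rprod_eigen:
 "rprod cs x * v = 0 ==> v ~= 0 ==> EX ds c. rprod ds x * v ~= 0 & (x - of_int c) * (rprod ds x * v) = 0"
proof (induction cs)
 case (Cons c cs)
 show ?case
 proof (cases "rprod cs x * v = 0")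
  case False
  thus ?thesis using Cons.prems by (intro exI[of _ cs] exI[of _ c]) (simp add: mult.assoc)
 qed (use Cons in blast)
qed simp

text \<open>Each Jucys-Murphy element is killed by a product of integral linear factors. Multiplying
  by the last partial product that does not kill the vector leaves an eigenvector, and the next
  element is treated likewise; factors in \<open>gz m\<close> preserve the eigenvalues already
  reached.\<close>

lemma ex_weight:
 fixes u :: "'r::comm_ring_1 galg"
 assumes u: "u ~= 0"
 shows "EX h as. h : gz m & h * u ~= 0 & wtv m as (h * u)"
proof -
 have "EX h as. h : gz m & h * u ~= 0 & wtv k as (h * u)" if "k <= m" for k using that
 proof (induction k)
  case 0
  show ?case using u by (intro exI[of _ 1]) (simp add: wtv_def)
 next
  case (Suc k)
  then obtain h as where h: "h : gz m" "h * u ~= 0" "wtv k as (h * u)" by auto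
  let ?x = "jm (Suc k) :: 'r galg"
  obtain cs where "rprod cs ?x = 0" using jm_annihilator[of "Suc k"] by auto
  then obtain ds c where d: "rprod ds ?x * (h * u) ~= 0" "(?x - of_int c) * (rprod ds ?x * (h * u)) = 0"
   using rprod_eigen[of cs ?x "h * u"] h by auto
  have x: "?x : gz m" using Suc by (intro gz_jm) auto
  hence g: "rprod ds ?x : gz m" by (rule rprod_gz)
  have "jm j * (rprod ds ?x * (h * u)) = of_int ((as(Suc k := c)) j) * (rprod ds ?x * (h * u))"
   if "j : {1..Suc k}" for j
  proof (cases "j = Suc k")
   case True
   thus ?thesis using d(2) by (simp add: left_diff_distrib)
  next
   case False
   have "jm j * rprod ds ?x = rprod ds ?x * (jm j :: 'r galg)" using that Suc by (intro gz_commute[of _ m] g gz_jm) auto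
   moreover have "jm j * (h * u) = of_int (as j) * (h * u)" using h(3) that False by (auto simp: wtv_def)
   ultimately have "jm j * (rprod ds ?x * (h * u)) = rprod ds ?x * (of_int (as j) * (h * u))"
    by (simp only: mult.assoc[symmetric, of "jm j" "rprod ds ?x"] mult.assoc[of "rprod ds ?x"])
   thus ?thesis using False by (simp add: of_int_comm)
  qed
  hence "wtv (Suc k) (as(Suc k := c)) ((rprod ds ?x * h) * u)" by (simp add: wtv_def mult.assoc)
  moreover have "rprod ds ?x * h : gz m" using g h by (intro gz_mult)
  ultimately show ?case using d(1) by (metis mult.assoc)
 qed
 thus ?thesis by blast
qed

text \<open>By \<open>ex_weight\<close> a non-zero f has a multiple h * f that is a weight vector,
  and f fixes it. This replaces semisimplicity when identities between commuting idempotents are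
  tested.\<close>

lemma gz_idempotent_zero:
 fixes f :: "'r::comm_ring_1 galg"
 assumes "f : gz m" "f * f = f" and "!!as v :: 'r galg. wtv m as v ==> f * v = 0"
 shows "f = 0"
proof (rule ccontr)
 assume "f ~= 0"
 then obtain h as where h: "h : gz m" "h * f ~= 0" "wtv m as (h * f)" using ex_weight by blast
 have "f * (h * f) = h * f" using gz_commute[OF assms(1) h(1)] assms(2) by (metis mult.assoc)
 thus False using assms(3)[OF h(3)] h(2) by simp
qed

lemma esym_wtv:
 "wtv m as v ==> j <= m ==> esym jm j k * v = of_int (esym as j k) * v"
proof (induction as j k rule: esym.induct)
 case (3 as j k)
 have "jm (Suc j) * v = of_int (as (Suc j)) * v" using 3 by (simp add: wtv_def)
 moreover have "esym jm j (Suc k) * v = of_int (esym as j (Suc k)) * v" "esym jm j k * v = of_int (esym as j k) * v" using 3 by simp_all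
 moreover have "esym jm j k * (jm (Suc j)) * v = of_int (esym as j k * as (Suc j)) * v"
 proof -
  have "esym jm j k * jm (Suc j) * v = esym jm j k * (of_int (as (Suc j)) * v)" by (simp only: mult.assoc `jm (Suc j) * v = _`)
  also have "... = of_int (as (Suc j)) * (esym jm j k * v)" by (rule of_int_comm[symmetric])
  also have "... = of_int (as (Suc j)) * of_int (esym as j k) * v" using `esym jm j k * v = _` by (simp only: mult.assoc)
  finally show ?thesis by (simp only: of_int_mult[symmetric] mult.commute[of "esym as j k"])
 qed
 ultimately show ?case by (simp add: distrib_right)
qed simp_all

section \<open>Reduction of coefficients\<close>

lemma galg_induct [case_names zero single add]:
 fixes x :: "'a \<Rightarrow>\<^sub>0 'b::ab_group_add"
 assumes "P 0" "!!sg c. P (single sg c)" "!!x y. P x ==> P y ==> P (x + y)"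
 shows "P x"
proof (induction x rule: update_induct)
 case (update f a b)
 have "Poly_Mapping.update a b f = f + single a b"
  using update by (intro poly_mapping_eqI) (auto simp: lookup_update lookup_add lookup_single when_def in_keys_iff)
 thus ?case using update assms by simp
qed (rule assms)

definition red :: "('a \<Rightarrow>\<^sub>0 int) => ('a \<Rightarrow>\<^sub>0 'k::ring_1)" where
 "red x = Abs_poly_mapping (%sg. of_int (lookup x sg))"

lemma lookup_red [simp]: "lookup (red x :: _ \<Rightarrow>\<^sub>0 'k::ring_1) sg = of_int (lookup x sg)"
proof -
 have "{sg. (of_int (lookup x sg) :: 'k) ~= 0} <= keys x" by (auto simp: in_keys_iff)
 hence "finite {sg. (of_int (lookup x sg) :: 'k) ~= 0}" using finite_keys finite_subset by blast
 thus ?thesis by (simp add: red_def)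
qed

lemma red_zero [simp]: "red 0 = 0" by (rule poly_mapping_eqI) simp

lemma red_add: "red (x + y) = red x + red y" by (rule poly_mapping_eqI) (simp add: lookup_add)

lemma red_diff: "red (x - y) = red x - red y" by (rule poly_mapping_eqI) (simp add: lookup_minus)

lemma red_single [simp]: "red (single sg c) = single sg (of_int c)" by (rule poly_mapping_eqI) (simp add: lookup_single when_def)

lemma red_mult: "red (x * y) = red x * (red y :: 'k::comm_ring_1 galg)"
proof (induction x rule: galg_induct)
 case (single sg c)
 show ?case by (induction y rule: galg_induct) (auto simp: distrib_left red_add mult_single)
qed (auto simp: distrib_right red_add)

lemma red_one [simp]: "red 1 = (1 :: 'k::comm_ring_1 galg)" by (simp flip: single_one)

lemma red_power: "red (x ^ n) = (red x :: 'k::comm_ring_1 galg) ^ n" by (induction n) (auto simp: red_mult)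

lemma red_sum: "red (sum f A) = (SUM a:A. red (f a))" by (induction A rule: infinite_finite_induct) (auto simp: red_add)

lemma of_int_eq_single: "(of_int c :: 'r::comm_ring_1 galg) = single 0 (of_int c)" by simp

lemma red_of_int [simp]: "red (of_int c) = (of_int c :: 'k::comm_ring_1 galg)"
 by (simp only: of_int_eq_single red_single of_int_eq_id id_apply)

lemma red_tr [simp]: "red (tr a b) = (tr a b :: 'k::comm_ring_1 galg)" by (simp add: tr_def)

lemma red_jm [simp]: "red (jm j) = (jm j :: 'k::comm_ring_1 galg)" by (simp add: jm_def red_sum)

lemma red_esym [simp]: "red (esym jm j k) = (esym jm j k :: 'k::comm_ring_1 galg)"
proof (induction "jm :: nat => int galg" j k rule: esym.induct)
qed (auto simp: red_add red_mult)

lemma lookup_of_int_times: "lookup (of_int c * x) sg = of_int c * lookup (x :: 'r::comm_ring_1 galg) sg"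
proof (induction x rule: galg_induct)
 case (single sg d)
 thus ?case by (simp only: of_int_eq_single mult_single lookup_single) (simp add: when_def)
qed (auto simp: distrib_left lookup_add)

lemma red_eq_0_iff:
 assumes "CHAR('k::comm_ring_1) = p"
 shows "(red x :: 'k galg) = 0 <-> (EX y. x = of_int (int p) * y)"
proof
 assume 0: "(red x :: 'k galg) = 0"
 have dvd: "int p dvd lookup x sg" for sg using arg_cong[OF 0, of "%z. lookup z sg"] assms by (simp add: of_int_eq_0_iff_char_dvd)
 define y where "y = Abs_poly_mapping (%sg. lookup x sg div int p)"
 have "{sg. lookup x sg div int p ~= 0} <= keys x" by (auto simp: in_keys_iff)
 hence "finite {sg. lookup x sg div int p ~= 0}" using finite_keys finite_subset by blast
 hence "lookup y sg = lookup x sg div int p" for sg by (simp add: y_def)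
 hence "x = of_int (int p) * y" using dvd by (intro poly_mapping_eqI) (simp only: lookup_of_int_times, simp)
 thus "EX y. x = of_int (int p) * y" ..
next
 assume "EX y. x = of_int (int p) * y"
 then obtain y where "x = of_int (int p) * y" ..
 hence "lookup (red x :: 'k galg) sg = 0" for sg using of_nat_CHAR[where 'a = 'k] assms by (simp only: lookup_red lookup_of_int_times) simp
 thus "(red x :: 'k galg) = 0" by (intro poly_mapping_eqI) simp
qed

section \<open>Idempotents in characteristic p\<close>

lemma binomial_commuting:
 fixes x y :: "'r::ring_1"
 assumes xy: "x * y = y * x"
 shows "(x + y) ^ n = (SUM k<=n. of_nat (n choose k) * (x ^ k * y ^ (n - k)))"
proof (induction n)
 case (Suc n)
 let ?f = "%k. of_nat (n choose k) * (x ^ k * y ^ (n - k))"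
 let ?g = "%k. x ^ k * y ^ (Suc n - k)"
 have yx: "y * x ^ k = x ^ k * y" for k using power_commuting_commutes[OF xy] by simp
 have c: "z * (of_nat i * w) = of_nat i * (z * w)" for i and z w :: 'r by (metis mult.assoc mult_of_nat_commute)
 have "(x + y) ^ Suc n = x * sum ?f {..n} + y * sum ?f {..n}" by (simp add: Suc distrib_right)
 also have "x * sum ?f {..n} = (SUM k<=n. of_nat (n choose k) * ?g (Suc k))" by (simp add: sum_distrib_left c mult.assoc)
 also have "y * sum ?f {..n} = (SUM k<=n. of_nat (n choose k) * ?g k)" unfolding sum_distrib_left
 proof (intro sum.cong refl)
  fix k assume "k : {..n}"
  hence "y * (x ^ k * y ^ (n - k)) = ?g k" by (simp add: yx Suc_diff_le flip: mult.assoc)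
  thus "y * ?f k = of_nat (n choose k) * ?g k" by (simp only: c)
 qed
 also have "... = (SUM k<=Suc n. of_nat (n choose k) * ?g k)" by (simp add: binomial_eq_0)
 also have "... = ?g 0 + (SUM k<=n. of_nat (n choose Suc k) * ?g (Suc k))" by (subst sum.atMost_Suc_shift) simp
 also have "(SUM k<=n. of_nat (n choose k) * ?g (Suc k)) + ... =
   ?g 0 + (SUM k<=n. of_nat (Suc n choose Suc k) * ?g (Suc k))" by (simp add: sum.distrib distrib_right add_ac)
 also have "... = (SUM k<=Suc n. of_nat (Suc n choose k) * ?g k)" by (subst sum.atMost_Suc_shift) simp
 finally show ?case .
qed simp

lemma frobenius_add:
 fixes x y :: "'r::ring_1"
 assumes p: "prime p" and 0: "of_nat p = (0 :: 'r)" and xy: "x * y = y * x"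
 shows "(x + y) ^ p = x ^ p + y ^ p"
proof -
 have "of_nat (p choose k) = (0 :: 'r)" if "k : {..p} - {0, p}" for k
 proof -
  have "p dvd (p choose k)" using that p by (intro dvd_choose_prime) auto
  thus ?thesis using 0 by (auto elim!: dvdE)
 qed
 hence "(x + y) ^ p = (SUM k:{0, p}. of_nat (p choose k) * (x ^ k * y ^ (p - k)))"
  unfolding binomial_commuting[OF xy] by (intro sum.mono_neutral_right) auto
 thus ?thesis using prime_gt_0_nat[OF p] by simp
qed

lemma frobenius_power_add:
 fixes x y :: "'r::ring_1"
 assumes p: "prime p" and 0: "of_nat p = (0 :: 'r)" and xy: "x * y = y * x"
 shows "(x + y) ^ (p ^ N) = x ^ (p ^ N) + y ^ (p ^ N)"
proof (induction N)
 case (Suc N)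
 have c: "x ^ (p ^ N) * y ^ (p ^ N) = y ^ (p ^ N) * x ^ (p ^ N)"
  by (rule power_commuting_commutes[OF power_commuting_commutes[OF xy, symmetric], symmetric])
 show ?case by (simp only: power_Suc2 power_mult Suc frobenius_add[OF p 0 c])
qed simp

lemma int_fermat:
 assumes p: "prime p"
 shows "[c ^ p = c] (mod int p)"
proof -
 have add: "[(a + b) ^ p = a ^ p + b ^ p] (mod int p)" for a b :: int
 proof -
  let ?f = "%k. of_nat (p choose k) * a ^ k * b ^ (p - k)"
  have "int p dvd sum ?f ({..p} - {0, p})"
  proof (rule dvd_sum)
   fix k assume "k : {..p} - {0, p}"
   hence "p dvd (p choose k)" using p by (intro dvd_choose_prime) auto
   thus "int p dvd ?f k" by simp
  qed
  moreover have "(a + b) ^ p = sum ?f ({..p} - {0, p}) + sum ?f {0, p}" unfolding binomial_ring by (rule sum.subset_diff) auto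
  ultimately show ?thesis using prime_gt_0_nat[OF p] by (simp add: cong_iff_dvd_diff)
 qed
 have n: "[int n ^ p = int n] (mod int p)" for n
 proof (induction n)
  case 0
  show ?case using prime_gt_0_nat[OF p] by (simp add: zero_power)
 next
  case (Suc n)
  have "[(int n + 1) ^ p = int n ^ p + 1 ^ p] (mod int p)" by (rule add)
  also have "[int n ^ p + 1 ^ p = int n + 1] (mod int p)" using Suc by (intro cong_add) auto
  finally show ?case by (simp add: add.commute)
 qed
 have c: "[c = int (nat (c mod int p))] (mod int p)" using prime_gt_0_nat[OF p] by (simp add: cong_def)
 show ?thesis by (rule cong_trans[OF cong_pow[OF c] cong_trans[OF n cong_sym[OF c]]])
qed

lemma frobenius_of_int:
 assumes p: "prime p" and 0: "of_nat p = (0 :: 'r::ring_1)"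
 shows "(of_int c :: 'r) ^ p = of_int c"
proof -
 obtain k where "c ^ p = c + int p * k" using int_fermat[OF p, of c] by (metis cong_iff_lin cong_sym)
 hence "of_int (c ^ p) = (of_int c + of_nat p * of_int k :: 'r)" by simp
 thus ?thesis using 0 by simp
qed

lemma frobenius_power_of_int:
 assumes p: "prime p" and 0: "of_nat p = (0 :: 'r::ring_1)"
 shows "(of_int c :: 'r) ^ (p ^ N) = of_int c" by (induction N) (auto simp: power_mult frobenius_of_int[OF p 0])

lemma frobenius_diff_of_int:
 fixes x :: "'r::ring_1"
 assumes p: "prime p" and 0: "of_nat p = (0 :: 'r)"
 shows "(x - of_int c) ^ (p ^ N) = x ^ (p ^ N) - of_int c"
proof -
 have "(x + of_int (- c)) ^ (p ^ N) = x ^ (p ^ N) + of_int (- c) ^ (p ^ N)"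
  by (rule frobenius_power_add[OF p 0]) (simp add: mult_of_int_commute)
 thus ?thesis by (simp only: frobenius_power_of_int[OF p 0]) simp
qed

text \<open>Some power \<open>x ^ (p ^ N)\<close> of a root of a product of integral linear factors is fixed by Frobenius.\<close>

definition semis :: "nat => nat => 'r::ring_1 => bool" where
 "semis p N x <-> (x ^ (p ^ N)) ^ p = x ^ (p ^ N)"

lemma semis_mono: "N <= N' ==> semis p N x ==> semis p N' x"
proof (induction N' rule: dec_induct)
 case (step n)
 have "x ^ (p ^ Suc n) = (x ^ (p ^ n)) ^ p" by (simp add: mult.commute flip: power_mult)
 with step show ?case by (simp add: semis_def)
qed

text \<open>Modulo p the element x^p - x is divisible by every x - c. Its power of exponent
  \<open>length cs\<close> is thus a multiple of \<open>rprod cs x\<close> and vanishes, and the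
  Frobenius map turns nilpotency of x^p - x into the claim.\<close>

lemma semis_root_prod:
 fixes x :: "'r::ring_1"
 assumes p: "prime p" and 0: "of_nat p = (0 :: 'r)" and r: "rprod cs x = 0"
 shows "EX N. semis p N x"
proof -
 let ?w = "x ^ p - x"
 have xw: "x ^ p - x = ((x - of_int c) ^ (p - 1) - 1) * (x - of_int c)" for c
 proof -
  have "(x - of_int c) ^ p - (x - of_int c) = x ^ p - x" using frobenius_diff_of_int[OF p 0, of x c 1] by simp
  moreover have "(x - of_int c) ^ (p - 1) * (x - of_int c) = (x - of_int c) ^ p" using prime_gt_0_nat[OF p] by (metis power_minus_mult)
  ultimately show ?thesis by (simp add: left_diff_distrib)
 qed
 have wx: "?w * x = x * ?w" by (simp add: diff_distrib power_commutes)
 have "EX G. ?w ^ length cs = G * rprod cs x & G * x = x * G"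
 proof (induction cs)
  case (Cons c cs)
  then obtain G where G: "?w ^ length cs = G * rprod cs x" "G * x = x * G" by blast
  let ?g = "(x - of_int c) ^ (p - 1) - 1"
  have c: "z * (x - of_int c) = (x - of_int c) * z" if "z * x = x * z" for z using that by (simp add: diff_distrib mult_of_int_commute)
  have gx: "?g * x = x * ?g" using power_commuting_commutes[of "x - of_int c" x "p - 1"] by (simp add: diff_distrib mult_of_int_commute)
  have "?w ^ length (c # cs) = G * rprod cs x * (?g * (x - of_int c))" by (simp only: length_Cons power_Suc2 G(1)) (simp only: xw[of c])
  also have "... = (G * ?g) * rprod (c # cs) x"
  proof -
   have "rprod cs x * ?g = ?g * rprod cs x" using rprod_intertwine[of x ?g x cs] gx by simp
   moreover have "rprod cs x * (x - of_int c) = (x - of_int c) * rprod cs x" using rprod_intertwine[of x x x cs] c[of "rprod cs x"] by simp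
   ultimately have "rprod cs x * ?g * (x - of_int c) = ?g * ((x - of_int c) * rprod cs x)" by (metis mult.assoc)
   thus ?thesis by (simp only: rprod_simps mult.assoc)
  qed
  finally have 1: "?w ^ length (c # cs) = (G * ?g) * rprod (c # cs) x" .
  have "(G * ?g) * x = x * (G * ?g)" using G(2) gx by (metis mult.assoc)
  with 1 show ?case by blast
 qed (intro exI[of _ 1], simp)
 hence w: "?w ^ length cs = 0" using r by auto
 obtain N where N: "length cs <= p ^ N"
  using prime_gt_1_nat[OF p] by (metis less_exp less_or_eq_imp_le order.strict_trans2 power_mono zero_le Suc_1 Suc_leI)
 have "?w ^ (p ^ N) = 0" using w N by (metis le_add_diff_inverse mult_zero_left power_add)
 moreover have "?w ^ (p ^ N) = (x ^ p) ^ (p ^ N) - x ^ (p ^ N)"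
 proof -
  have c: "?w * x = x * ?w" by (rule wx)
  have "(?w + x) ^ (p ^ N) = ?w ^ (p ^ N) + x ^ (p ^ N)" by (rule frobenius_power_add[OF p 0 c])
  thus ?thesis by simp
 qed
 ultimately show ?thesis unfolding semis_def by (metis eq_iff_diff_eq_0 power_mult mult.commute)
qed

lemma power_mult_commuting: "a * b = b * a ==> (a * b) ^ n = a ^ n * (b ^ n :: 'a::monoid_mult)"
proof (induction n)
 case (Suc n)
 have "(a * b) ^ Suc n = (a * b) * (a ^ n * b ^ n)" using Suc by (simp only: power_Suc)
 also have "... = a * (b * a ^ n) * b ^ n" by (simp only: mult.assoc)
 also have "b * a ^ n = a ^ n * b" using Suc.prems by (simp add: power_commuting_commutes)
 finally show ?case by (simp add: mult.assoc)
qed simp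

lemma esym_commute: "(!!i. z * f i = f i * z) ==> z * esym f j k = esym f j k * z"
 by (induction f j k rule: esym.induct) (auto intro!: comm_addI comm_multI)

text \<open>On commuting elements the p^N-th power is additive and multiplicative, so it passes
  through \<open>esym\<close>; one N serves all symmetric polynomials.\<close>

lemma semis_esym:
 fixes f :: "nat => 'r::ring_1"
 assumes p: "prime p" and 0: "of_nat p = (0 :: 'r)"
  and s: "!!i. i : {1..j} ==> semis p N (f i)"
  and c: "!!i i'. f i * f i' = f i' * f i"
 shows "semis p N (esym f j k)"
proof -
 have cp: "f i ^ n * f i' ^ n = f i' ^ n * f i ^ n"
  for i i' n by (rule power_commuting_commutes[OF power_commuting_commutes[OF c, symmetric], symmetric])
 have fr: "esym f j k ^ (p ^ N) = esym (%i. f i ^ (p ^ N)) j k"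
  if c: "!!i i'. f i * f i' = f i' * f i" for f :: "nat => 'r" and j k N using c
 proof (induction f j k rule: esym.induct)
  case (2 f k)
  thus ?case using prime_gt_0_nat[OF p] by (simp add: power_0_left)
 next
  case (3 f j k)
  have cm: "f i * esym f j k = esym f j k * f i" for i j k by (rule esym_commute) (rule 3)
  have cc: "esym f j k * esym f j' k' = esym f j' k' * esym f j k" for j k j' k' by (rule esym_commute) (rule cm[symmetric])
  have "esym f (Suc j) (Suc k) ^ (p ^ N) = esym f j (Suc k) ^ (p ^ N) + (esym f j k * f (Suc j)) ^ (p ^ N)"
   unfolding esym.simps by (rule frobenius_power_add[OF p 0]) (intro comm_multI cc cm[symmetric])
  also have "(esym f j k * f (Suc j)) ^ (p ^ N) = esym f j k ^ (p ^ N) * f (Suc j) ^ (p ^ N)"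
   by (rule power_mult_commuting) (rule cm[symmetric])
  finally show ?case using 3 by simp
 qed simp
 have eq: "esym g j k = esym h j k" if "!!i. i : {1..j} ==> g i = h i" for g h :: "nat => 'r" and j k
  using that by (induction g j k rule: esym.induct) auto
 have "(esym f j k ^ (p ^ N)) ^ p = esym (%i. (f i ^ (p ^ N)) ^ p) j k" unfolding fr[OF c] using fr[of "%i. f i ^ (p ^ N)" j k 1] cp by simp
 also have "... = esym (%i. f i ^ (p ^ N)) j k" using s by (intro eq) (auto simp: semis_def)
 finally show ?thesis by (simp add: semis_def fr[OF c])
qed

text \<open>The projection onto the generalised eigenspace of x for the eigenvalue a modulo p: the
  power p^N removes the nilpotent part, and by Fermat 1 - (b - a)^(p - 1) is the indicator of b =
  a.\<close>

definition epsi :: "nat => nat => int => 'r::ring_1 => 'r" where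
 "epsi p N a x = 1 - (x ^ (p ^ N) - of_int a) ^ (p - 1)"

lemma epsi_idem:
 fixes x :: "'r::ring_1"
 assumes p: "prime p" and 0: "of_nat p = (0 :: 'r)" and s: "semis p N x"
 shows "epsi p N a x * epsi p N a x = epsi p N a x"
proof -
 define u where "u = x ^ (p ^ N) - of_int a"
 have up: "u ^ p = u" using frobenius_diff_of_int[OF p 0, of "x ^ (p ^ N)" a 1] s by (simp add: u_def semis_def)
 obtain q where q: "p = Suc (Suc q)" using prime_ge_2_nat[OF p] by (metis add_2_eq_Suc le_Suc_ex)
 have "u ^ (p - 1) * u ^ (p - 1) = u ^ (p - 1 + (p - 1))" by (simp add: power_add)
 also have "p - 1 + (p - 1) = q + p" using q by simp
 also have "u ^ (q + p) = u ^ q * u" by (simp add: power_add up)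
 also have "... = u ^ (p - 1)" using q by (simp add: power_commutes)
 finally have "u ^ (p - 1) * u ^ (p - 1) = u ^ (p - 1)" .
 thus ?thesis by (simp add: epsi_def u_def[symmetric] diff_distrib)
qed

lemma power_eigen:
 fixes x v :: "'r::ring_1"
 assumes "x * v = of_int b * v"
 shows "x ^ n * v = of_int (b ^ n) * v"
proof (induction n)
 case (Suc n)
 have "x ^ Suc n * v = x * (x ^ n * v)" by (simp add: mult.assoc)
 also have "... = of_int (b ^ n) * (x * v)" by (simp only: Suc of_int_comm)
 also have "... = of_int (b ^ Suc n) * v" by (simp only: assms) (simp flip: mult.assoc add: power_commutes)
 finally show ?case .
qed simp

definition epsi_val :: "nat => nat => int => int => int" where
 "epsi_val p N a b = 1 - (b ^ (p ^ N) - a) ^ (p - 1)"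

lemma epsi_eigen:
 fixes x v :: "'r::ring_1"
 assumes "x * v = of_int b * v"
 shows "epsi p N a x * v = of_int (epsi_val p N a b) * v"
proof -
 have "(x ^ (p ^ N) - of_int a) * v = of_int (b ^ (p ^ N) - a) * v" using power_eigen[OF assms, of "p ^ N"] by (simp add: left_diff_distrib)
 from power_eigen[OF this, of "p - 1"] show ?thesis by (simp add: epsi_def epsi_val_def left_diff_distrib)
qed

lemma epsi_val_cong:
 assumes p: "prime p"
 shows "[epsi_val p N a b = (if [b = a] (mod int p) then 1 else 0)] (mod int p)"
proof -
 have bN: "[b ^ (p ^ N) = b] (mod int p)" for N
 proof (induction N)
  case (Suc N)
  have "[(b ^ (p ^ N)) ^ p = b ^ p] (mod int p)" using Suc by (rule cong_pow)
  thus ?case using int_fermat[OF p, of b] by (simp add: power_mult[symmetric] mult.commute) (metis cong_trans)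
 qed simp
 define d where "d = b ^ (p ^ N) - a"
 have d: "[d = b - a] (mod int p)" unfolding d_def using bN by (intro cong_diff) auto
 have iff: "[b = a] (mod int p) <-> int p dvd d" using d by (metis cong_0_iff cong_diff_iff_cong_0 cong_sym cong_trans)
 show ?thesis
 proof (cases "int p dvd d")
  case True
  hence "int p dvd d ^ (p - 1)" using prime_gt_1_nat[OF p] by (intro dvd_trans[OF _ dvd_power]) auto
  hence "[1 - d ^ (p - 1) = 1 - 0] (mod int p)" by (intro cong_diff) (auto simp: cong_0_iff)
  with True iff show ?thesis by (simp add: epsi_val_def d_def)
 next
  case False
  have "[d * d ^ (p - 1) = d * 1] (mod int p)" using int_fermat[OF p, of d] prime_gt_0_nat[OF p] by (simp add: power_eq_if)
  hence "[d ^ (p - 1) = 1] (mod int p)" using cong_mult_lcancel[of d "int p" "d ^ (p - 1)" 1] prime_imp_coprime[of "int p" d] False p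
   by (simp only: mult_1_right coprime_commute prime_nat_int_transfer not_False_eq_True)
  hence "[1 - d ^ (p - 1) = 1 - 1] (mod int p)" by (intro cong_diff) auto
  with False iff show ?thesis by (simp add: epsi_val_def d_def)
 qed
qed

lemma of_int_cong:
 assumes "of_nat p = (0 :: 'r::ring_1)" "[a = b] (mod int p)"
 shows "(of_int a :: 'r) = of_int b"
proof -
 obtain c where "a = b + int p * c" using assms(2) by (metis cong_iff_lin cong_sym)
 thus ?thesis using assms(1) by simp
qed

lemma epsi_eigen_char:
 fixes x v :: "'r::ring_1"
 assumes p: "prime p" and 0: "of_nat p = (0 :: 'r)" and "x * v = of_int b * v"
 shows "epsi p N a x * v = (if [b = a] (mod int p) then v else 0)"
 using epsi_eigen[OF assms(3), of p N a] of_int_cong[OF 0 epsi_val_cong[OF p, of N a b]] by simp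

lemma epsi_gz: "x : gz m ==> epsi p N a x : gz m" unfolding epsi_def by (intro gz_diff gz_power gz_one gz_of_int)

lemma red_epsi: "red (epsi p N a x) = epsi p N a (red x :: 'k::comm_ring_1 galg)" by (simp add: epsi_def red_diff red_power)

section \<open>Content sequences\<close>

text \<open>A partition \<open>\<lambda>\<close> is encoded by the set of its beta numbers \<open>\<lambda> i - i - 1\<close> (\<open>i \<ge> 0\<close>);
 adding a node of content \<open>a\<close> moves the bead at \<open>a - 1\<close> to \<open>a\<close>.\<close>

definition mv :: "int set => int => int set" where
 "mv X a = insert a (X - {a - 1})"

fun valid :: "int set => int list => bool" where
 "valid X [] <-> True"
| "valid X (a # as) <-> a - 1 : X & a ~: X & valid (mv X a) as"

definition fin :: "int set => int list => int set" where
 "fin X as = foldl mv X as"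

lemma fin_simps [simp]: "fin X [] = X" "fin X (a # as) = fin (mv X a) as" "fin X (as @ bs) = fin (fin X as) bs" by (simp_all add: fin_def)

lemma valid_append [simp]: "valid X (as @ bs) <-> valid X as & valid (fin X as) bs" by (induction as arbitrary: X) auto

lemma mem_fin:
 "valid X as ==> (of_bool (x : fin X as) :: int) = of_bool (x : X) + int (count (mset as) x) - int (count (mset as) (x + 1))"
proof (induction as arbitrary: X)
 case (Cons a as)
 have "(of_bool (x : mv X a) :: int) = of_bool (x : X) + of_bool (x = a) - of_bool (x + 1 = a)" using Cons.prems by (auto simp: mv_def)
 with Cons show ?case by (auto simp: of_bool_def)
qed simp

lemma fin_mset:
 assumes "valid X as" "valid X bs" "mset as = mset bs"
 shows "fin X as = fin X bs"
proof -
 have "x : fin X as <-> x : fin X bs" for x using mem_fin[OF assms(1), of x] mem_fin[OF assms(2), of x] assms(3) by (metis of_bool_eq_iff)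
 thus ?thesis by blast
qed

lemma fin_far:
 "(!!z. z : set zs ==> z ~: {x, x + 1}) ==> x : fin X zs <-> x : X"
proof (induction zs arbitrary: X)
 case (Cons z zs)
 have "x : mv X z <-> x : X" using Cons.prems[of z] by (auto simp: mv_def)
 moreover have "x : fin (mv X z) zs <-> x : mv X z" using Cons by auto
 ultimately show ?case by simp
qed simp

inductive swp :: "int list => int list => bool" where
 "abs (c - d) >= 2 ==> swp (xs @ c # d # ys) (xs @ d # c # ys)"

abbreviation "swps == swp\<^sup>*\<^sup>*"

lemma swp_sym: "swp as bs ==> swp bs as" by (induction rule: swp.induct) (auto intro: swp.intros simp: abs_minus_commute)

lemma swps_sym: "swps as bs ==> swps bs as" by (induction rule: rtranclp_induct) (auto intro: converse_rtranclp_into_rtranclp swp_sym)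

lemma swp_append: "swp as bs ==> swp (us @ as @ ws) (us @ bs @ ws)"
proof (induction rule: swp.induct)
 case (1 c d xs ys)
 thus ?case using swp.intros[of c d "us @ xs" "ys @ ws"] by simp
qed

lemma swps_append: "swps as bs ==> swps (us @ as @ ws) (us @ bs @ ws)"
 by (induction rule: rtranclp_induct) (auto intro: rtranclp.rtrancl_into_rtrancl swp_append)

lemma swp_valid: "swp as bs ==> valid X as ==> valid X bs"
proof (induction rule: swp.induct)
 case (1 c d xs ys)
 have "c ~= d" "c ~= d - 1" "c - 1 ~= d" "d ~= c + 1" using 1 by auto
 moreover have "mv (mv (fin X xs) c) d = mv (mv (fin X xs) d) c" using calculation by (auto simp: mv_def)
 ultimately show ?case using 1 by (auto simp: mv_def)
qed

lemma swps_valid: "swps as bs ==> valid X as ==> valid X bs" by (induction rule: rtranclp_induct) (auto intro: swp_valid)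

lemma swp_mset: "swp as bs ==> mset bs = mset as" by (induction rule: swp.induct) auto

lemma swps_move_right: "(!!z. z : set zs ==> abs (z - x) >= 2) ==> swps (us @ [x] @ zs @ ws) (us @ zs @ [x] @ ws)"
proof (induction zs arbitrary: us)
 case (Cons z zs)
 have "swp (us @ x # z # (zs @ ws)) (us @ z # x # (zs @ ws))" using Cons.prems[of z] by (intro swp.intros) (auto simp: abs_minus_commute)
 moreover have "swps ((us @ [z]) @ [x] @ zs @ ws) ((us @ [z]) @ zs @ [x] @ ws)" using Cons.prems by (intro Cons.IH) auto
 ultimately show ?case by (simp add: converse_rtranclp_into_rtranclp)
qed simp

lemma swps_move_left: "(!!z. z : set zs ==> abs (z - x) >= 2) ==> swps (us @ zs @ [x] @ ws) (us @ [x] @ zs @ ws)"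
 by (rule swps_sym) (rule swps_move_right)

text \<open>For the base set this is the connectedness of the standard tableaux of one shape under
  admissible transpositions. Let d be the last letter of bs. Since the final configurations agree,
  none of d - 1, d, d + 1 can follow the last d in as, so this d moves to the end and induction
  applies.\<close>

lemma valid_connected:
 "valid X as ==> valid X bs ==> mset as = mset bs ==> swps as bs"
proof (induction bs arbitrary: as rule: rev_induct)
 case (snoc d bs)
 have "d : set as" using snoc.prems(3) by (metis in_set_conv_decomp mset_eq_setD)
 then obtain u t where as: "as = u @ d # t" and t: "d ~: set t" by (meson split_list_last)
 have fin: "fin X as = fin X (bs @ [d])" using snoc.prems by (intro fin_mset) auto
 hence d: "d : fin X as" "d - 1 ~: fin X as" using snoc.prems by (auto simp: mv_def)
 have far: "abs (z - d) >= 2" if "z : set t" for z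
 proof (rule ccontr)
  assume "~ abs (z - d) >= 2"
  hence "z = d - 1 | z = d | z = d + 1" by arith
  hence "z : {d - 1, d + 1}" using that t by auto
  hence "EX z:set t. z : {d - 1, d + 1}" using that by blast
  then obtain t1 z t2 where *: "t = t1 @ z # t2" "z : {d - 1, d + 1}" "ALL y:set t2. ~ y : {d - 1, d + 1}"
   using split_list_last_propE[of t "%z. z : {d - 1, d + 1}"] by metis
  let ?Y = "fin X (u @ d # t1)"
  have "d : fin (mv ?Y z) t2 <-> d : mv ?Y z" "d - 1 : fin (mv ?Y z) t2 <-> d - 1 : mv ?Y z" using * t by (intro fin_far; auto)+
  thus False using d *(2) by (auto simp: as *(1) mv_def)
 qed
 have s: "swps as (u @ t @ [d])" using swps_move_right[of t d u "[]"] far by (simp add: as)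
 hence v: "valid X (u @ t @ [d])" using snoc.prems swps_valid by blast
 have "swps (u @ t) bs" using snoc.prems v by (intro snoc.IH) (auto simp: as)
 hence "swps ([] @ (u @ t) @ [d]) ([] @ bs @ [d])" by (rule swps_append)
 with s show ?case by simp
qed simp

section \<open>Integral weight vectors\<close>

text \<open>The form for which the group elements are orthonormal. Jucys-Murphy elements are
  self-adjoint for it, and it is positive because the coefficients are integers.\<close>

definition ip :: "('a \<Rightarrow>\<^sub>0 int) => ('a \<Rightarrow>\<^sub>0 int) => int" where
 "ip x y = (SUM sg:keys x. lookup x sg * lookup y sg)"

lemma ip_superset:
 assumes "finite A" "keys x <= A"
 shows "ip x y = (SUM sg:A. lookup x sg * lookup y sg)"
 unfolding ip_def using assms by (intro sum.mono_neutral_left) (auto simp: in_keys_iff)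

lemma ip_commute: "ip x y = ip y x"
proof -
 let ?A = "keys x Un keys y"
 show ?thesis using ip_superset[of ?A x y] ip_superset[of ?A y x] by (simp add: mult.commute)
qed

lemma ip_add_right: "ip x (y + z) = ip x y + ip x z" by (simp add: ip_def lookup_add distrib_left sum.distrib)

lemma ip_zero [simp]: "ip 0 x = 0" "ip x 0 = 0" by (simp_all add: ip_def)

lemma ip_diff_right: "ip x (y - z) = ip x y - ip x z" by (simp add: ip_def lookup_minus right_diff_distrib sum_subtractf)

lemma ip_diff_left: "ip (x - y) z = ip x z - ip y z" by (metis ip_commute ip_diff_right)

lemma ip_sum_right: "ip x (sum f A) = (SUM a:A. ip x (f a))" by (induction A rule: infinite_finite_induct) (auto simp: ip_add_right)

lemma ip_sum_left: "ip (sum f A) x = (SUM a:A. ip (f a) x)" by (metis (no_types, lifting) ip_commute ip_sum_right sum.cong)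

lemma ip_self_eq_0 [simp]: "ip x x = 0 <-> x = 0"
proof
 assume "ip x x = 0"
 hence "ALL sg:keys x. lookup x sg * lookup x sg = 0" unfolding ip_def by (subst (asm) sum_nonneg_eq_0_iff) auto
 hence "lookup x sg = 0" for sg by (cases "sg : keys x") (auto simp: in_keys_iff)
 thus "x = 0" by (intro poly_mapping_eqI) simp
qed simp

lemma ip_of_int_right: "ip x (of_int c * y) = c * ip x (y :: int galg)"
 by (simp only: ip_def lookup_of_int_times) (simp add: sum_distrib_left mult_ac)

lemma ip_of_int_left: "ip (of_int c * x) y = c * ip (x :: int galg) y" by (metis ip_commute ip_of_int_right)

lemma ip_gs: "ip (gs sg * x) (gs sg * y) = ip x y"
proof -
 have "keys (gs sg * x) <= (*) sg ` keys x"
 proof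
  fix tt assume "tt : keys (gs sg * x)"
  hence "inverse sg * tt : keys x" by (simp add: in_keys_iff lookup_gs_mult)
  thus "tt : (*) sg ` keys x" by (intro image_eqI[of _ _ "inverse sg * tt"]) (auto simp flip: mult.assoc)
 qed
 moreover have "inj_on ((*) sg) (keys x)" by (rule inj_onI) (metis mult.assoc mult_1 perm.left_inverse)
 ultimately show ?thesis by (subst ip_superset[of "(*) sg ` keys x"])
   (auto simp: sum.reindex lookup_gs_mult ip_def simp flip: mult.assoc)
qed

lemma ip_tr: "ip (tr a b * x) y = ip x (tr a b * y)"
proof -
 have "ip (tr a b * x) y = ip (tr a b * (tr a b * x)) (tr a b * y)" unfolding tr_def by (simp only: ip_gs)
 thus ?thesis by (simp flip: mult.assoc)
qed

lemma ip_jm: "ip (jm j * x) y = ip x (jm j * y)" by (simp add: jm_def sum_distrib_right ip_sum_left ip_sum_right ip_tr)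

lemma of_int_mult_eq_0: "(of_int c :: int galg) * v = 0 <-> c = 0 | v = 0"
proof
 assume 0: "(of_int c :: int galg) * v = 0"
 have "c * lookup v sg = 0" for sg using arg_cong[OF 0, of "%x. lookup x sg"] by (simp only: lookup_of_int_times) simp
 thus "c = 0 | v = 0" by (auto intro: poly_mapping_eqI)
qed auto

lemma of_int_mult_cancel: "v ~= 0 ==> (of_int c :: int galg) * v = of_int d * v <-> c = d"
proof
 assume "v ~= 0" "(of_int c :: int galg) * v = of_int d * v"
 hence "(of_int (c - d) :: int galg) * v = 0" by (simp only: of_int_diff left_diff_distrib) simp
 thus "c = d" using `v ~= 0` of_int_mult_eq_0[of "c - d" v] by simp
qed simp

context
 fixes r :: nat and a b :: int and v :: "int galg"
 assumes r: "1 <= r" and va: "jm r * v = of_int a * v" and vb: "jm (Suc r) * v = of_int b * v"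
begin

lemma jm_r_sr: "jm r * (sr r * v) = of_int b * (sr r * v) - v"
proof -
 have "jm r * (sr r * v) = sr r * (jm (Suc r) * v) - v" by (simp add: jm_sr[OF r] left_diff_distrib flip: mult.assoc)
 thus ?thesis by (simp add: vb of_int_comm)
qed

lemma jm_Suc_r_sr: "jm (Suc r) * (sr r * v) = of_int a * (sr r * v) + v"
proof -
 have "jm (Suc r) * (sr r * v) = sr r * (jm r * v) + v" by (simp add: jm_Suc_sr[OF r] distrib_right flip: mult.assoc)
 thus ?thesis by (simp add: va of_int_comm)
qed

text \<open>Pair \<open>jm_r_sr\<close> with v and move \<open>jm r\<close> to the other side.
  Positivity of the right-hand side forces neighbouring contents to differ.\<close>

lemma weight_diff_ip: "(b - a) * ip (sr r * v) v = ip v v"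
proof -
 have "ip (jm r * (sr r * v)) v = a * ip (sr r * v) v" by (simp only: ip_jm va ip_of_int_right)
 thus ?thesis by (simp add: jm_r_sr ip_diff_left ip_of_int_left algebra_simps)
qed

lemma weight_neq: "v ~= 0 ==> a ~= b" using weight_diff_ip by auto

text \<open>For (b - a)^2 = 1 the identity \<open>weight_diff_ip\<close> makes the squared length of
  the difference of the two sides vanish.\<close>

lemma weight_adjacent:
 assumes "abs (b - a) = 1"
 shows "sr r * v = of_int (b - a) * v"
proof -
 let ?e = "b - a"
 have "?e = 1 | ?e = -1" using assms by arith
 hence ee: "?e * ?e = 1" by (metis mult_1 minus_mult_minus)
 have t: "ip (sr r * v) v = ?e * ip v v" using weight_diff_ip ee by (metis mult.assoc mult_1)
 have ss: "ip (sr r * v) (sr r * v) = ip v v" unfolding tr_def by (rule ip_gs)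
 have "ip (sr r * v - of_int ?e * v) (sr r * v - of_int ?e * v)
  = ip v v - ?e * ip (sr r * v) v - (?e * ip v (sr r * v) - ?e * (?e * ip v v))"
  by (simp only: ip_diff_left ip_diff_right ip_of_int_left ip_of_int_right ss right_diff_distrib)
 also have "... = ip v v - (?e * ?e) * ip v v - ((?e * ?e) * ip v v - (?e * ?e) * ip v v)"
  by (simp only: ip_commute[of v "sr r * v"] t mult.assoc)
 also have "... = 0" by (simp add: ee)
 finally show ?thesis by simp
qed

text \<open>Young's seminormal form without denominators: v' is b - a times the component of
  \<open>sr r * v\<close> of the exchanged weight. If v' were 0, comparing lengths in v = (b - a)
  \<open>sr r * v\<close> would give (b - a)^2 = 1.\<close>

lemma weight_swap:
 assumes "abs (b - a) >= 2" "v ~= 0"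
 defines "v' == of_int (b - a) * (sr r * v) - v"
 shows "v' ~= 0" "jm r * v' = of_int b * v'" "jm (Suc r) * v' = of_int a * v'"
  "j ~= r ==> j ~= Suc r ==> jm j * v = of_int c * v ==> jm j * v' = of_int c * v'"
proof -
 have com: "x * (of_int d * y) = of_int d * (x * y)" for x y :: "int galg" and d by (rule of_int_comm[symmetric])
 have dv: "of_int (b - a) * v = of_int b * v - of_int a * v" by (simp only: of_int_diff left_diff_distrib)
 have grp: "P - (Q - R) - R = P - Q" "P + (Q - R) - Q = P - R" for P Q R :: "int galg" by simp_all
 show "v' ~= 0"
 proof
  assume "v' = 0"
  hence v: "v = of_int (b - a) * (sr r * v)" by (simp add: v'_def)
  have "ip v v = (b - a) * ((b - a) * ip (sr r * v) (sr r * v))" by (subst (1 2) v) (simp only: ip_of_int_left ip_of_int_right)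
  also have "ip (sr r * v) (sr r * v) = ip v v" unfolding tr_def by (rule ip_gs)
  finally have "(b - a) * (b - a) * ip v v = 1 * ip v v" by simp
  hence "(b - a) * (b - a) = 1" using assms(2) by (simp only: mult_cancel_right) simp
  hence "b - a = 1 | b - a = -1" by (simp only: zmult_eq_1_iff) blast
  thus False using assms(1) by auto
 qed
 have "jm r * v' = of_int (b - a) * (of_int b * (sr r * v) - v) - of_int a * v"
  by (simp only: v'_def right_diff_distrib com[of "jm r"] jm_r_sr va)
 also have "... = of_int b * v'" by (simp only: v'_def right_diff_distrib com[of "of_int b"] dv) (rule grp(1))
 finally show "jm r * v' = of_int b * v'" .
 have "jm (Suc r) * v' = of_int (b - a) * (of_int a * (sr r * v) + v) - of_int b * v"
  by (simp only: v'_def right_diff_distrib com[of "jm (Suc r)"] jm_Suc_r_sr vb)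
 also have "... = of_int a * v'" by (simp only: v'_def right_diff_distrib distrib_left com[of "of_int a"] dv) (rule grp(2))
 finally show "jm (Suc r) * v' = of_int a * v'" .
 assume j: "j ~= r" "j ~= Suc r" "jm j * v = of_int c * v"
 have "jm j * (sr r * v) = sr r * (jm j * v)" using sr_jm[OF r j(1,2), where ?'a = int] by (simp flip: mult.assoc)
 hence "jm j * (sr r * v) = of_int c * (sr r * v)" by (simp only: j com)
 thus "jm j * v' = of_int c * v'" by (simp only: v'_def right_diff_distrib com[of "jm j"] j) (simp only: com[of "of_int c"])
qed

end

lemma sr_braid: "sr r * sr (Suc r) * sr r = sr (Suc r) * sr r * (sr (Suc r) :: 'r::comm_ring_1 galg)"
 unfolding tr_def gs_mult by (rule arg_cong[of _ _ gs]) (rule perm_eqI, simp only: apply_times comp_def mult.assoc, rename_tac a,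
   case_tac "a = r"; case_tac "a = Suc r"; case_tac "a = Suc (Suc r)"; simp)

text \<open>By \<open>weight_adjacent\<close> the two simple transpositions would act on v by
  opposite signs, against the braid relation.\<close>

lemma weight_no_braid:
 fixes v :: "int galg"
 assumes r: "1 <= r" and v: "v ~= 0" and x: "jm r * v = of_int x * v" "jm (Suc r) * v = of_int y * v"
  "jm (Suc (Suc r)) * v = of_int x * v" and xy: "abs (y - x) = 1"
 shows False
proof -
 have 1: "sr r * v = of_int (y - x) * v" by (rule weight_adjacent[OF r x(1,2) xy])
 have 2: "sr (Suc r) * v = of_int (x - y) * v" using xy by (intro weight_adjacent[OF _ x(2,3)]) auto
 have com: "a * (of_int d * b) = of_int d * (a * b)" for a b :: "int galg" and d by (rule of_int_comm[symmetric])
 have "sr r * (sr (Suc r) * (sr r * v)) = of_int (y - x) * (of_int (x - y) * (of_int (y - x) * v))"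
  by (simp only: 1 2 com[of "sr r"] com[of "sr (Suc r)"])
 moreover have "sr (Suc r) * (sr r * (sr (Suc r) * v)) = of_int (x - y) * (of_int (y - x) * (of_int (x - y) * v))"
  by (simp only: 1 2 com[of "sr r"] com[of "sr (Suc r)"])
 ultimately have "of_int ((y - x) * (x - y) * (y - x)) * v = of_int ((x - y) * (y - x) * (x - y)) * v"
 proof -
  assume a1: "sr r * (sr (Suc r) * (sr r * v)) = of_int (y - x) * (of_int (x - y) * (of_int (y - x) * v))"
   and a2: "sr (Suc r) * (sr r * (sr (Suc r) * v)) = of_int (x - y) * (of_int (y - x) * (of_int (x - y) * v))"
  have "sr r * (sr (Suc r) * (sr r * v)) = sr (Suc r) * (sr r * (sr (Suc r) * v))"
   using arg_cong[OF sr_braid[of r, where ?'r = int], of "%z. z * v"] by (simp only: mult.assoc)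
  thus ?thesis unfolding a1 a2 by (simp only: of_int_mult mult.assoc)
 qed
 hence "(y - x) * (x - y) * (y - x) = (x - y) * (y - x) * (x - y)" using v of_int_mult_cancel by blast
 thus False using xy by (auto simp: abs_if algebra_simps split: if_splits)
qed

definition wtl :: "int list => 'r::comm_ring_1 galg => bool" where
 "wtl as v <-> (ALL j<length as. jm (Suc j) * v = of_int (as ! j) * v)"

definition is_weight :: "int list => bool" where
 "is_weight as <-> (EX v :: int galg. v ~= 0 & wtl as v)"

lemma wtl_append: "wtl (as @ bs) v ==> wtl as v" by (force simp: wtl_def nth_append)

lemma wtl_swap:
 fixes v :: "int galg"
 assumes v: "v ~= 0" and w: "wtl (xs @ c # d # ys) v" and cd: "abs (d - c) >= 2"
 defines "v' == of_int (d - c) * (sr (Suc (length xs)) * v) - v"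
 shows "v' ~= 0" "wtl (xs @ d # c # ys) v'"
proof -
 let ?r = "Suc (length xs)"
 let ?as = "xs @ c # d # ys" let ?bs = "xs @ d # c # ys"
 have w': "jm (Suc j) * v = of_int (?as ! j) * v" if "j < length ?as" for j using w that unfolding wtl_def by blast
 have va: "jm ?r * v = of_int c * v" and vb: "jm (Suc ?r) * v = of_int d * v"
  using w'[of "length xs"] w'[of "Suc (length xs)"] by (simp_all add: nth_append)
 note sw = weight_swap[OF _ va vb cd v, folded v'_def]
 show "v' ~= 0" using sw by simp
 show "wtl ?bs v'" unfolding wtl_def
 proof (intro allI impI)
  fix j assume j: "j < length ?bs"
  consider "j = length xs" | "j = Suc (length xs)" | "j ~= length xs" "j ~= Suc (length xs)" by blast
  thus "jm (Suc j) * v' = of_int (?bs ! j) * v'"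
  proof cases
   case 3
   hence "?bs ! j = ?as ! j" by (auto simp: nth_append nth_Cons split: nat.splits)
   thus ?thesis using sw(4)[of "Suc j" "?as ! j"] w'[of j] j 3 by simp
  qed (use sw in \<open>simp_all add: nth_append\<close>)
 qed
qed

lemma is_weight_swp: "swp as bs ==> is_weight as ==> is_weight bs"
proof (induction rule: swp.induct)
 case (1 c d xs ys)
 then obtain v :: "int galg" where v: "v ~= 0" "wtl (xs @ c # d # ys) v" by (auto simp: is_weight_def)
 have "abs (d - c) >= 2" using 1 by arith
 from wtl_swap[OF v this] show ?case unfolding is_weight_def by blast
qed

lemma is_weight_swps: "swps as bs ==> is_weight as ==> is_weight bs" by (induction rule: rtranclp_induct) (auto intro: is_weight_swp)

lemma is_weight_no_repeat: "~ is_weight (xs @ x # x # ys)"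
proof
 assume "is_weight (xs @ x # x # ys)"
 then obtain v :: "int galg" where v: "v ~= 0" "wtl (xs @ x # x # ys) v" by (auto simp: is_weight_def)
 have "jm (Suc (length xs)) * v = of_int x * v" "jm (Suc (Suc (length xs))) * v = of_int x * v"
  using v(2)[unfolded wtl_def, rule_format, of "length xs"] v(2)[unfolded wtl_def, rule_format, of "Suc (length xs)"]
  by (simp_all add: nth_append)
 from weight_neq[OF _ this] v show False by simp
qed

lemma is_weight_no_braid: "abs (y - x) = 1 ==> ~ is_weight (xs @ x # y # x # ys)"
proof
 assume xy: "abs (y - x) = 1" and "is_weight (xs @ x # y # x # ys)"
 then obtain v :: "int galg" where v: "v ~= 0" "wtl (xs @ x # y # x # ys) v" by (auto simp: is_weight_def)
 have "jm (Suc (length xs)) * v = of_int x * v" "jm (Suc (Suc (length xs))) * v = of_int y * v"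
  "jm (Suc (Suc (Suc (length xs)))) * v = of_int x * v"
  using v(2)[unfolded wtl_def, rule_format, of "length xs"] v(2)[unfolded wtl_def, rule_format, of "Suc (length xs)"]
   v(2)[unfolded wtl_def, rule_format, of "Suc (Suc (length xs))"] by (simp_all add: nth_append)
 from weight_no_braid[OF _ v(1) this xy] show False by simp
qed

definition base_set :: "int set" where
 "base_set = {x. x < 0}"

lemma last_event:
 fixes xs :: "int list"
 shows "(ALL z:set xs. abs (z - x) >= 2) |
  (EX us e zs. xs = us @ e # zs & e : {x - 1, x, x + 1} & (ALL z:set zs. abs (z - x) >= 2))"
proof -
 have far: "abs (z - x) >= 2" if "z ~: {x - 1, x, x + 1}" for z using that by (simp, arith)
 show ?thesis
proof (cases "EX z:set xs. z : {x - 1, x, x + 1}")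
 case True
 then obtain us e zs where *: "xs = us @ e # zs" "e : {x - 1, x, x + 1}" "ALL z:set zs. ~ z : {x - 1, x, x + 1}"
  using split_list_last_propE[of xs "%z. z : {x - 1, x, x + 1}"] by metis
 have "ALL z:set zs. abs (z - x) >= 2" using *(3) far by blast
 with * show ?thesis by blast
next
 case False
 thus ?thesis using far by blast
qed
qed

text \<open>Vershik and Okounkov: the last content is moved left until it meets a neighbour; the only
 obstructions to validity are the patterns \<open>x, x\<close> and \<open>x, x \<plusminus> 1, x\<close>.\<close>

theorem is_weight_valid: "is_weight as ==> valid base_set as"
proof (induction as rule: rev_induct)
 case (snoc x as)
 hence IH: "valid base_set as" unfolding is_weight_def using wtl_append by blast
 have far: "x : fin X zs <-> x : X" "x - 1 : fin X zs <-> x - 1 : X" if "ALL z:set zs. abs (z - x) >= 2" for X zs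
  using that by (intro fin_far; force)+
 \<comment> \<open>The situation in which x could not be added after its neighbour e: the bead x is
   present before e and x - 1 is not. The base set is not of this kind, so some earlier letter
   caused it, and this letter can only be x. Moving it up to e and the final x down to e produces
   the pattern x, e, x.\<close>
 have nob: False if w: "is_weight (us @ e # zs @ [x])" and e: "abs (e - x) = 1" and zs: "ALL z:set zs. abs (z - x) >= 2"
  and us: "x : fin base_set us" "x - 1 ~: fin base_set us" for us e zs
 proof -
  have "~ (ALL z:set us. abs (z - x) >= 2)"
   using far[of us base_set] us by (metis base_set_def mem_Collect_eq diff_less_0_iff_less less_trans zero_less_one diff_strict_right_mono diff_0_right zle_diff1_eq order_less_imp_le)
  then obtain us' e' zs' where *: "us = us' @ e' # zs'" "e' : {x - 1, x, x + 1}" "ALL z:set zs'. abs (z - x) >= 2"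
   using last_event[of us x] by blast
  have "e' = x" using far[OF *(3), of "mv (fin base_set us') e'"] us *(2) by (auto simp: *(1) mv_def)
  hence w: "is_weight (us' @ [x] @ zs' @ (e # zs @ [x]))" using w * by simp
  have "swps (us' @ [x] @ zs' @ (e # zs @ [x])) (us' @ zs' @ [x] @ (e # zs @ [x]))" using *(3) by (intro swps_move_right) auto
  moreover have "swps ((us' @ zs' @ [x, e]) @ zs @ [x] @ []) ((us' @ zs' @ [x, e]) @ [x] @ zs @ [])" using zs by (intro swps_move_left) auto
  ultimately have "is_weight ((us' @ zs') @ x # e # x # zs)" using is_weight_swps w by fastforce
  with is_weight_no_braid[OF e] show False by blast
 qed
 have "x - 1 : fin base_set as & x ~: fin base_set as" using last_event[of as x]
 proof (elim disjE exE conjE)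
  assume z: "ALL z:set as. abs (z - x) >= 2"
  hence "swps ([] @ as @ [x] @ []) ([] @ [x] @ as @ [])" by (intro swps_move_left) auto
  hence "is_weight (x # as)" using is_weight_swps snoc.prems by simp
  then obtain v :: "int galg" where v: "v ~= 0" "jm (Suc 0) * v = of_int x * v" by (auto simp: is_weight_def wtl_def)
  \<comment> \<open>\<open>jm 1\<close> is an empty sum, so the first content of every weight is
    0.\<close>
  hence "x = 0" using of_int_mult_eq_0[of x v] by (simp add: jm_def)
  with far[OF z, of base_set] show ?thesis by (auto simp: base_set_def)
 next
  fix us e zs assume as: "as = us @ e # zs" and e: "e : {x - 1, x, x + 1}" and zs: "ALL z:set zs. abs (z - x) >= 2"
  have w: "is_weight (us @ e # zs @ [x])" using snoc.prems as by simp
  have v: "e - 1 : fin base_set us" "e ~: fin base_set us" using IH as by auto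
  have ne: "e ~= x"
  proof
   assume "e = x"
   have "swps ((us @ [e]) @ zs @ [x] @ []) ((us @ [e]) @ [x] @ zs @ [])" using zs by (intro swps_move_left) auto
   hence "is_weight (us @ x # x # zs)" using is_weight_swps w `e = x` by fastforce
   thus False using is_weight_no_repeat by blast
  qed
  hence e1: "abs (e - x) = 1" using e by auto
  have f: "x : fin base_set as <-> x : mv (fin base_set us) e" "x - 1 : fin base_set as <-> x - 1 : mv (fin base_set us) e"
   using far[OF zs, of "mv (fin base_set us) e"] by (simp_all add: as)
  show ?thesis using nob[OF w e1 zs] e ne v f by (auto simp: mv_def)
 qed
 with IH show ?case by simp
qed simp

section \<open>Young symmetrizers\<close>

definition sgnp :: "nat perm => int" where
 "sgnp sg = sign (apply sg)"

lemma permutation_apply: "permutation (apply sg)" using finite_affected[of sg] by (simp add: permutation affected.rep_eq)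

lemma apply_mult: "apply (sg * tt) = apply sg o apply tt" by (rule ext) (simp add: apply_times)

lemma sgnp_mult: "sgnp (sg * tt) = sgnp sg * sgnp tt" unfolding sgnp_def apply_mult by (intro sign_compose permutation_apply)

lemma sgnp_one [simp]: "sgnp 1 = 1" by (simp add: sgnp_def sign_id)

lemma sgnp_swap: "a ~= b ==> sgnp {|a,b|} = -1" by (simp add: sgnp_def swap.rep_eq sign_swap_id)

lemma sgnp_inverse [simp]: "sgnp (inverse sg) = sgnp sg" by (simp add: sgnp_def apply_inverse sign_inverse permutation_apply)

lemma sgnp_sq [simp]: "sgnp sg * sgnp sg = 1" by (simp add: sgnp_def sign_idempotent)

text \<open>F c will be the set of entries of column c or of row c, so that column and row
  stabilisers share their lemmas.\<close>

definition stabf :: "nat => (nat => nat set) => nat perm set" where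
 "stabf n F = {sg : sym n. ALL c. apply sg ` F c = F c}"

lemma stabf_sym: "sg : stabf n F ==> sg : sym n" by (simp add: stabf_def)

lemma stabf_mem: "sg : stabf n F ==> x : F c ==> sg $ x : F c" by (auto simp: stabf_def)

lemma finite_stabf [simp]: "finite (stabf n F)" by (simp add: stabf_def)

lemma stabf_one [simp]: "1 : stabf n F" by (simp add: stabf_def sym_sgrp)

lemma stabf_mult: "sg : stabf n F ==> tt : stabf n F ==> sg * tt : stabf n F"
 unfolding stabf_def mem_Collect_eq sym_sgrp apply_mult image_comp[symmetric] by (simp only: sgrp_mult simp_thms)

lemma stabf_inverse: "sg : stabf n F ==> inverse sg : stabf n F"
proof -
 assume *: "sg : stabf n F"
 have "apply (inverse sg) ` F c = F c" for c
 proof -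
  have "apply (inverse sg) ` (apply sg ` F c) = F c" by (simp add: image_image)
  with * show ?thesis by (simp add: stabf_def)
 qed
 with * show ?thesis by (simp add: stabf_def sym_sgrp)
qed

lemma stabf_inverse_iff [simp]: "inverse sg : stabf n F <-> sg : stabf n F"
 using stabf_inverse[of sg n F] stabf_inverse[of "inverse sg" n F] by auto

lemma stabf_mult_left_iff: "sg : stabf n F ==> sg * tt : stabf n F <-> tt : stabf n F"
 using stabf_mult[of sg n F tt] stabf_mult[of "inverse sg" n F "sg * tt"] by (auto simp flip: mult.assoc)

lemma swap_image: "a : S <-> b : S ==> apply {|a,b|} ` S = S"
proof -
 assume ab: "a : S <-> b : S"
 have s: "{|a,b|} $ x : S" if "x : S" for x using that ab by (metis apply_swap_simp apply_swap_same)
 moreover have "x : apply {|a,b|} ` S" if "x : S" for x using s[OF that] by (metis image_eqI inverse_swap perm_apply_inverse(1))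
 ultimately show ?thesis by blast
qed

lemma stabf_swap: "a : {1..n} ==> b : {1..n} ==> (!!c. a : F c <-> b : F c) ==> {|a,b|} : stabf n F"
 unfolding stabf_def mem_Collect_eq sym_sgrp by (intro conjI allI sgrp_swap swap_image)

definition kap :: "nat => (nat => nat set) => int galg" where
 "kap n F = (SUM sg:stabf n F. of_int (sgnp sg) * gs sg)"

definition rho :: "nat => (nat => nat set) => int galg" where
 "rho n F = (SUM sg:stabf n F. gs sg)"

lemma gs_rho: "sg : stabf n F ==> gs sg * rho n F = rho n F" unfolding rho_def sum_distrib_left gs_mult
 by (rule sum.reindex_bij_witness[of _ "%tt. inverse sg * tt" "%tt. sg * tt"])
  (auto simp: stabf_mult_left_iff simp flip: mult.assoc)

lemma gs_kap: "sg : stabf n F ==> gs sg * kap n F = of_int (sgnp sg) * kap n F"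
proof -
 assume sg: "sg : stabf n F"
 have "gs sg * kap n F = (SUM tt:stabf n F. of_int (sgnp tt) * gs (sg * tt))"
  by (simp add: kap_def sum_distrib_left of_int_comm[where a = "gs sg", symmetric] gs_mult)
 also have "... = (SUM tt:stabf n F. of_int (sgnp sg) * (of_int (sgnp tt) * gs tt))"
 proof (rule sum.reindex_bij_witness[of _ "%tt. inverse sg * tt" "%tt. sg * tt"])
  fix tt
  have "sgnp sg * sgnp (sg * tt) = sgnp tt" by (simp add: sgnp_mult flip: mult.assoc)
  thus "of_int (sgnp sg) * (of_int (sgnp (sg * tt)) * gs (sg * tt)) = (of_int (sgnp tt) * gs (sg * tt) :: int galg)"
   by (metis mult.assoc of_int_mult)
 qed (use sg in \<open>auto simp: stabf_mult_left_iff simp flip: mult.assoc\<close>)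
 finally show ?thesis by (simp add: kap_def sum_distrib_left)
qed

lemma lookup_rho: "lookup (rho n F) tt = of_bool (tt : stabf n F)" by (simp add: rho_def lookup_sum lookup_single when_def)

lemma int_galg_double_zero: "x + x = 0 ==> x = (0 :: int galg)" using of_int_mult_eq_0[of 2 x] by (simp add: mult_2)

text \<open>Fixed points of the sign-reversing involution do no harm, as the integral group algebra
  has no 2-torsion.\<close>

lemma sum_involution_zero:
 fixes f :: "'a => int galg"
 assumes "!!x. x : D ==> g x : D" "!!x. x : D ==> g (g x) = x" "!!x. x : D ==> f (g x) = - f x"
 shows "sum f D = 0"
proof -
 have "sum f D = (SUM x:D. f (g x))" by (rule sum.reindex_bij_witness[of _ g g]) (use assms in auto)
 also have "... = - sum f D" using assms(3) by (simp add: sum_negf)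
 finally have "sum f D + sum f D = 0" by (simp only: eq_neg_iff_add_eq_0)
 thus ?thesis by (rule int_galg_double_zero)
qed

section \<open>Young diagrams\<close>

lemma young_closed: "partition al ==> (r, c) : young al ==> r' <= r ==> c' <= c ==> (r', c') : young al"
 using antimonoD[of al r' r] by (auto simp: young_def partition_def)

lemma young_Sigma: "young al = Sigma {r. al r ~= 0} (%r. {..<al r})" by (auto simp: young_def)

lemma finite_young [simp]: "partition al ==> finite (young al)" by (auto simp: young_Sigma partition_def)

lemma card_young: "partition al ==> card (young al) = weight al"
 by (subst young_Sigma, subst card_SigmaI) (auto simp: partition_def weight_def)

lemma partition_eqI: "young al = young be ==> al = be"
proof
 fix r assume eq: "young al = young be"
 have "c < al r <-> c < be r" for c using eq by (auto simp: young_def)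
 thus "al r = be r" by (metis less_irrefl linorder_neqE_nat)
qed

lemma tableauxD:
 assumes "t : tableaux al"
 shows "bij_betw t (young al) {1..weight al}" "inj_on t (young al)" "t ` young al = {1..weight al}"
  "x : young al ==> t x : {1..weight al}" "x ~: young al ==> t x = 0" using assms by (cases x; auto simp: tableaux_def bij_betw_def)+

definition colf :: "(nat => nat) => tableau => nat => nat set" where
 "colf al t c = t ` column al c"

definition rowf :: "(nat => nat) => tableau => nat => nat set" where
 "rowf al t r = t ` row al r"

lemma column_stabiliser_stabf: "column_stabiliser al t = stabf (weight al) (colf al t)"
 by (simp add: column_stabiliser_def stabf_def colf_def)

lemma mem_colf: "t : tableaux al ==> x : young al ==> t x : colf al t c <-> snd x = c"
 using tableauxD(2)[of t al] by (auto simp: colf_def column_def inj_on_def)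

lemma mem_rowf: "t : tableaux al ==> x : young al ==> t x : rowf al t c <-> fst x = c"
 using tableauxD(2)[of t al] by (auto simp: rowf_def row_def inj_on_def)

definition col_reading :: "(nat => nat) => tableau => bool" where
 "col_reading al t <-> (ALL x:young al. ALL y:young al. t x < t y <-> snd x < snd y | (snd x = snd y & fst x < fst y))"

definition cont :: "nat \<times> nat => int" where
 "cont x = int (snd x) - int (fst x)"

lemma ex_col_reading:
 assumes "partition al"
 shows "EX t:tableaux al. col_reading al t"
proof -
 define L where "L x y <-> snd x < snd y | (snd x = snd y & fst x < fst y)" for x y :: "nat \<times> nat"
 define B where "B x = {y : young al. L y x}" for x
 define t where "t x = (if x : young al then Suc (card (B x)) else 0)" for x
 have fin: "finite (young al)" using assms by simp
 have fB: "finite (B x)" for x using fin by (simp add: B_def)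
 have mono: "t x < t y" if "x : young al" "y : young al" "L x y" for x y
 proof -
  have "B x \<subset> B y" using that by (auto simp: B_def L_def)
  hence "card (B x) < card (B y)" using fB psubset_card_mono by blast
  thus ?thesis using that by (simp add: t_def)
 qed
 have tot: "x = y | L x y | L y x" for x y by (auto simp: L_def prod_eq_iff)
 have iff: "t x < t y <-> L x y" if "x : young al" "y : young al" for x y using mono[of x y] mono[of y x] tot[of x y] that by auto
 have inj: "inj_on t (young al)" by (rule inj_onI) (metis iff less_irrefl tot)
 have "t ` young al <= {1..weight al}"
 proof
  fix i assume "i : t ` young al"
  then obtain x where x: "x : young al" "i = Suc (card (B x))" by (auto simp: t_def)
  have "B x \<subset> young al" using x by (auto simp: B_def L_def)
  hence "card (B x) < weight al" using fin assms psubset_card_mono by (metis card_young)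
  thus "i : {1..weight al}" using x by simp
 qed
 moreover have "card (t ` young al) = weight al" using inj assms by (simp add: card_image card_young)
 ultimately have "t ` young al = {1..weight al}" by (intro card_subset_eq) auto
 hence "t : tableaux al" using inj by (auto simp: tableaux_def bij_betw_def t_def)
 moreover have "col_reading al t" using iff by (auto simp: col_reading_def L_def)
 ultimately show ?thesis by blast
qed

abbreviation kapt :: "(nat => nat) => tableau => int galg" where
 "kapt al t == kap (weight al) (colf al t)"

abbreviation rhot :: "(nat => nat) => tableau => int galg" where
 "rhot al t == rho (weight al) (rowf al t)"

lemma col_row_trivial:
 assumes t: "t : tableaux al" and sg: "sg : stabf (weight al) (colf al t)" "sg : stabf (weight al) (rowf al t)"
 shows "sg = 1"
proof (rule perm_eqI)
 fix i
 show "sg $ i = 1 $ i"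
 proof (cases "i : {1..weight al}")
  case True
  then obtain x where x: "x : young al" "i = t x" using tableauxD(3)[OF t] by blast
  have "sg $ (t x) : colf al t (snd x)" "sg $ (t x) : rowf al t (fst x)"
   using sg x mem_colf[OF t x(1)] mem_rowf[OF t x(1)] by (auto intro: stabf_mem)
  moreover obtain y where y: "y : young al" "sg $ (t x) = t y" using calculation by (auto simp: colf_def column_def)
  ultimately have "y = x" using mem_colf[OF t y(1)] mem_rowf[OF t y(1)] by (simp add: prod_eq_iff)
  thus ?thesis using x y by simp
 next
  case False
  hence "sg $ i = i" using sg(1) by (intro sgrp_fix[of _ "{1..weight al}"]) (auto dest: stabf_sym simp: sym_sgrp)
  thus ?thesis by simp
 qed
qed

text \<open>The coefficient of 1 is 1, since only the identity preserves both the rows and the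
  columns of t.\<close>

lemma kap_rho_nonzero:
 assumes t: "t : tableaux al"
 shows "kapt al t * rhot al t ~= 0"
proof -
 have "lookup (kapt al t * rhot al t) 1 =
  (SUM sg:stabf (weight al) (colf al t). sgnp sg * of_bool (sg : stabf (weight al) (rowf al t)))"
  by (simp add: kap_def sum_distrib_right lookup_sum mult.assoc lookup_of_int_times lookup_gs_mult lookup_rho)
 also have "... = (SUM sg:{1}. sgnp sg * of_bool (sg : stabf (weight al) (rowf al t)))"
  by (rule sum.mono_neutral_right) (auto dest: col_row_trivial[OF t])
 finally show ?thesis by auto
qed

text \<open>A Garnir-type relation. Expand \<open>kapt\<close> over the column stabiliser: for each
  kp exactly one b, namely \<open>b0 kp\<close>, stands in the row of \<open>t x\<close> of the
  tableau moved by kp. Its transposition is absorbed by \<open>rhot\<close> and reproduces the term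
  of kp; all remaining terms cancel in pairs.\<close>

lemma garnir:
 assumes al: "partition al" and t: "t : tableaux al" and x: "x : young al" and c: "c < snd x"
 shows "(SUM b:colf al t c. tr b (t x)) * (kapt al t * rhot al t) = kapt al t * rhot al t"
proof -
 let ?C = "stabf (weight al) (colf al t)" let ?rh = "rhot al t" let ?A = "colf al t c"
 let ?j = "t x"
 have finA: "finite ?A" using al by (simp add: colf_def column_def)
 have Asub: "?A <= {1..weight al}" using tableauxD(4)[OF t] by (auto simp: colf_def column_def)
 have jA: "?j ~: ?A" using mem_colf[OF t x] c by simp
 define pos where "pos kp = the_inv_into (young al) t (inverse kp $ ?j)" for kp
 define b0 where "b0 kp = kp $ (t (fst (pos kp), c))" for kp
 have pos: "pos kp : young al" "snd (pos kp) = snd x" "kp $ (t (pos kp)) = ?j" "(fst (pos kp), c) : young al" if "kp : ?C" for kp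
 proof -
  have m: "inverse kp $ ?j : colf al t (snd x)" using that mem_colf[OF t x] by (intro stabf_mem) (auto intro: stabf_inverse)
  hence "inverse kp $ ?j : t ` young al" by (auto simp: colf_def column_def)
  hence p: "pos kp : young al" "t (pos kp) = inverse kp $ ?j"
   unfolding pos_def using tableauxD(2)[OF t] by (auto intro: the_inv_into_into f_the_inv_into_f)
  show "pos kp : young al" by (rule p)
  show s: "snd (pos kp) = snd x" using m p mem_colf[OF t p(1)] by simp
  show "kp $ (t (pos kp)) = ?j" by (simp add: p)
  show "(fst (pos kp), c) : young al"
  proof -
   have "(fst (pos kp), snd (pos kp)) : young al" using p(1) by simp
   from young_closed[OF al this, of "fst (pos kp)" c] s c show ?thesis by simp
  qed
 qed
 have b0A: "b0 kp : ?A" if "kp : ?C" for kp unfolding b0_def using pos(4)[OF that] mem_colf[OF t] that by (intro stabf_mem) auto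
 have absorb: "a * g = g * b ==> b * r = r ==> a * (g * r) = g * r" for a b g r :: "int galg"
  by (simp only: mult.assoc[symmetric]) (simp only: mult.assoc)
 have absorb2: "a * b = b' * a ==> a * ((b * g) * r) = b' * (a * (g * r))" for a b b' g r :: "int galg"
  by (simp only: mult.assoc[symmetric])
 have fixb: "tr (b0 kp) ?j * (gs kp * ?rh) = gs kp * ?rh" if kp: "kp : ?C" for kp
 proof -
  let ?y = "(fst (pos kp), c)"
  have "{|t ?y,t (pos kp)|} : stabf (weight al) (rowf al t)" using pos[OF kp] tableauxD(4)[OF t] mem_rowf[OF t] by (intro stabf_swap) auto
  hence "tr (t ?y) (t (pos kp)) * ?rh = ?rh" unfolding tr_def by (rule gs_rho)
  moreover have "tr (b0 kp) ?j * gs kp = gs kp * (tr (t ?y) (t (pos kp)) :: int galg)"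
   using gs_tr[of kp "t ?y" "t (pos kp)", where ?'a = int] pos(3)[OF kp] by (simp add: b0_def)
  ultimately show ?thesis by (rule absorb[rotated])
 qed
 define D where "D = {(kp, b). kp : ?C & b : ?A & b ~= b0 kp}"
 define f where "f = (%(kp, b). of_int (sgnp kp) * (tr b ?j * (gs kp * ?rh)))"
 \<comment> \<open>The pairing of the cancelling terms: multiplying kp by the transposition of b and
   \<open>b0 kp\<close> exchanges the roles of these two entries and reverses the sign.\<close>
 define g where "g = (%(kp, b). ({|b,b0 kp|} * kp, b0 kp))"
 have sw: "{|b,b0 kp|} * kp : ?C" "b0 ({|b,b0 kp|} * kp) = b" if "kp : ?C" "b : ?A" for kp b
 proof -
  have A: "b : colf al t c' <-> c' = c" if "b : ?A" for b c'
  proof -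
   from that obtain y where "y : young al" "b = t y" "snd y = c" by (auto simp: colf_def column_def)
   thus ?thesis using mem_colf[OF t] by auto
  qed
  have "{|b,b0 kp|} : ?C" using that b0A[OF that(1)] Asub A by (intro stabf_swap) auto
  thus C: "{|b,b0 kp|} * kp : ?C" using that by (intro stabf_mult)
  have ne: "?j ~= b" "?j ~= b0 kp" using jA that b0A by auto
  have "inverse ({|b,b0 kp|} * kp) $ ?j = inverse kp $ ?j" using ne by (simp add: apply_times)
  hence "pos ({|b,b0 kp|} * kp) = pos kp" by (simp add: pos_def)
  hence "b0 ({|b,b0 kp|} * kp) = {|b,b0 kp|} $ (b0 kp)" by (simp add: b0_def apply_times)
  thus "b0 ({|b,b0 kp|} * kp) = b" by simp
 qed
 have D0: "sum f D = 0"
 proof (rule sum_involution_zero[where g = g])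
  fix z assume "z : D"
  then obtain kp b where z: "z = (kp, b)" "kp : ?C" "b : ?A" "b ~= b0 kp" by (auto simp: D_def)
  show "g z : D" using z sw b0A by (auto simp: g_def D_def)
  show "g (g z) = z" using z sw[OF z(2,3)] by (simp add: g_def swap_sym flip: mult.assoc)
  have "tr (b0 kp) ?j * tr b (b0 kp) = tr b ?j * (tr (b0 kp) ?j :: int galg)"
  proof -
   have ne: "?j ~= b" "?j ~= b0 kp" using jA z b0A by auto
   show ?thesis using gs_tr[of "{|b0 kp,?j|}" b "b0 kp", where ?'a = int] ne z(4) by (simp add: tr_def)
  qed
  hence "tr (b0 kp) ?j * (gs ({|b,b0 kp|} * kp) * ?rh) = tr b ?j * (tr (b0 kp) ?j * (gs kp * ?rh))"
   unfolding gs_mult[symmetric] tr_def by (rule absorb2)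
  also have "... = tr b ?j * (gs kp * ?rh)" using fixb[OF z(2)] by simp
  finally show "f (g z) = - f z" using z by (simp add: f_def g_def sgnp_mult sgnp_swap)
 qed
 have "(SUM b:?A. tr b ?j) * (kapt al t * ?rh) = (SUM kp:?C. SUM b:?A. of_int (sgnp kp) * (tr b ?j * (gs kp * ?rh)))"
  unfolding kap_def sum_distrib_left sum_distrib_right by (simp only: mult.assoc of_int_comm[where a = "tr _ _", symmetric])
 also have "... = (SUM kp:?C. of_int (sgnp kp) * (gs kp * ?rh) + (SUM b:?A - {b0 kp}. of_int (sgnp kp) * (tr b ?j * (gs kp * ?rh))))"
  by (intro sum.cong refl) (simp add: sum.remove[OF finA b0A] fixb)
 also have "... = kapt al t * ?rh + (SUM kp:?C. SUM b:?A - {b0 kp}. of_int (sgnp kp) * (tr b ?j * (gs kp * ?rh)))"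
  by (simp add: sum.distrib kap_def sum_distrib_right mult.assoc)
 also have "(SUM kp:?C. SUM b:?A - {b0 kp}. of_int (sgnp kp) * (tr b ?j * (gs kp * ?rh))) = sum f D"
  using finA by (subst sum.Sigma) (auto simp: D_def f_def intro!: sum.cong)
 finally show ?thesis by (simp add: D0)
qed

text \<open>In column order the entries smaller than \<open>t x\<close> are those of the columns to
  the left, each column acting as 1 by \<open>garnir\<close>, and those above x, each transposition
  acting as -1 because of the signs in \<open>kapt\<close>. The difference of the two counts is the
  content.\<close>

theorem jm_col_reading:
 assumes al: "partition al" and t: "t : tableaux al" and cr: "col_reading al t" and x: "x : young al"
 shows "jm (t x) * (kapt al t * rhot al t) = of_int (cont x) * (kapt al t * rhot al t)"
proof -
 let ?v = "kapt al t * rhot al t"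
 define U where "U = (UN c:{..<snd x}. colf al t c)"
 define V where "V = (%r. t (r, snd x)) ` {..<fst x}"
 have up: "(r, snd x) : young al" if "r < fst x" for r using young_closed[OF al, of "fst x" "snd x" r "snd x"] x that by simp
 have "{1..<t x} = U Un V"
 proof (intro equalityI subsetI)
  fix i assume i: "i : {1..<t x}"
  hence "i : {1..weight al}" using tableauxD(4)[OF t x] by auto
  then obtain y where y: "y : young al" "i = t y" using tableauxD(3)[OF t] by blast
  hence "snd y < snd x | (snd y = snd x & fst y < fst x)" using cr x i by (auto simp: col_reading_def)
  thus "i : U Un V"
  proof
   assume "snd y < snd x" thus ?thesis using y by (auto simp: U_def colf_def column_def)
  next
   assume "snd y = snd x & fst y < fst x" thus ?thesis using y by (auto simp: V_def intro!: image_eqI[of _ _ "fst y"]) (metis prod.collapse)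
  qed
 next
  fix i assume "i : U Un V"
  then consider y where "y : young al" "i = t y" "snd y < snd x" | r where "r < fst x" "i = t (r, snd x)"
   by (auto simp: U_def V_def colf_def column_def)
  hence "i < t x & i : {1..weight al}" by cases (use cr x up tableauxD(4)[OF t] in \<open>auto simp: col_reading_def\<close>)
  thus "i : {1..<t x}" by simp
 qed
 moreover have "U Int V = {}" using mem_colf[OF t up] by (auto simp: U_def V_def)
 moreover have "finite U" "finite V" using al by (auto simp: U_def V_def colf_def column_def)
 ultimately have jm: "jm (t x) = (SUM b:U. tr b (t x)) + (SUM b:V. tr b (t x) :: int galg)"
  unfolding jm_def by (simp add: sum.union_disjoint)
 have "(SUM b:U. tr b (t x)) * ?v = (SUM c<snd x. (SUM b:colf al t c. tr b (t x)) * ?v)"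
 proof -
  have "(SUM b:U. tr b (t x)) = (SUM c<snd x. SUM b:colf al t c. tr b (t x) :: int galg)" unfolding U_def
  proof (rule sum.UNION_disjoint)
   show "ALL c:{..<snd x}. ALL c':{..<snd x}. c ~= c' --> colf al t c Int colf al t c' = {}"
    using tableauxD(2)[OF t] by (auto simp: colf_def column_def inj_on_def)
  qed (use al in \<open>auto simp: colf_def column_def\<close>)
  thus ?thesis by (simp add: sum_distrib_right)
 qed
 also have "... = (SUM c<snd x. ?v)" using garnir[OF al t x] by (intro sum.cong) auto
 finally have 1: "(SUM b:U. tr b (t x)) * ?v = of_int (int (snd x)) * ?v" by simp
 have "tr b (t x) * ?v = - ?v" if b: "b : V" for b
 proof -
  obtain r where r: "r < fst x" "b = t (r, snd x)" using b by (auto simp: V_def)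
  have ne: "b ~= t x" using r up[OF r(1)] x tableauxD(2)[OF t] inj_onD[OF tableauxD(2)[OF t], of "(r, snd x)" x] by (metis fst_conv less_irrefl)
  have "{|b,t x|} : stabf (weight al) (colf al t)" using r up[OF r(1)] x tableauxD(4)[OF t] mem_colf[OF t] by (intro stabf_swap) auto
  from gs_kap[OF this] have "tr b (t x) * kapt al t = - kapt al t" using ne by (simp add: tr_def sgnp_swap)
  thus ?thesis by (simp flip: mult.assoc)
 qed
 hence "(SUM b:V. tr b (t x)) * ?v = (SUM b:V. - ?v)" by (simp add: sum_distrib_right)
 also have "... = of_int (- int (card V)) * ?v" by simp
 also have "card V = fst x"
 proof -
  have "inj_on (%r. t (r, snd x)) {..<fst x}" using tableauxD(2)[OF t] up by (auto simp: inj_on_def)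
  thus ?thesis by (simp add: V_def card_image)
 qed
 finally have 2: "(SUM b:V. tr b (t x)) * ?v = of_int (- int (fst x)) * ?v" .
 have "jm (t x) * ?v = (of_int (int (snd x)) + of_int (- int (fst x))) * ?v" by (simp only: jm distrib_right 1 2)
 also have "... = of_int (cont x) * ?v" by (simp only: cont_def of_int_add[symmetric]) simp
 finally show ?thesis .
qed

section \<open>Weights of partitions\<close>

definition beta_set :: "(nat => nat) => int set" where
 "beta_set al = range (%i. int (al i) - int i - 1)"

definition conts :: "(nat => nat) => int multiset" where
 "conts al = image_mset cont (mset_set (young al))"

lemma beta_strict: "partition al ==> i < j ==> int (al j) - int j < int (al i) - int i"
 using antimonoD[of al i j] by (auto simp: partition_def)

lemma beta_inj: "partition al ==> int (al i) - int i = int (al j) - int j ==> i = j"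
 using beta_strict[of al i j] beta_strict[of al j i] by (cases i j rule: linorder_cases) auto

lemma partition_zero [simp]: "partition (%_. 0)" by (simp add: partition_def antimono_def)

lemma young_zero [simp]: "young (%_. 0) = {}" by (simp add: young_def)

lemma beta_set_zero: "beta_set (%_. 0) = base_set"
proof -
 have "x : range (%i. - int i - 1)" if "x < 0" for x :: int using that by (intro image_eqI[of _ _ "nat (- x - 1)"]) auto
 thus ?thesis by (auto simp: beta_set_def base_set_def)
qed

lemma add_node:
 assumes al: "partition al" and a: "a - 1 : beta_set al" "a ~: beta_set al"
 shows "EX be. partition be & beta_set be = mv (beta_set al) a & conts be = add_mset a (conts al) & weight be = Suc (weight al)"
proof -
 obtain r where r: "a = int (al r) - int r" using a(1) by (auto simp: beta_set_def)
 define be where "be = al(r := Suc (al r))"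
 have anti: "al j <= al i" if "i <= j" for i j using al that by (auto simp: partition_def antimono_def)
 have up: "al r < al i" if "i < r" for i
 proof -
  have "al r ~= al (r - 1)"
  proof
   assume "al r = al (r - 1)"
   hence "a = int (al (r - 1)) - int (r - 1) - 1" using r that by auto
   thus False using a(2) by (auto simp: beta_set_def)
  qed
  hence "al r < al (r - 1)" using anti[of "r - 1" r] by simp
  also have "al (r - 1) <= al i" using that by (intro anti) auto
  finally show ?thesis .
 qed
 have "antimono be"
 proof (rule antimonoI)
  fix i j :: nat assume "i <= j"
  thus "be j <= be i" using anti[of i j] up[of i] by (auto simp: be_def Suc_le_eq)
 qed
 moreover have "{i. be i ~= 0} <= insert r {i. al i ~= 0}" by (auto simp: be_def)
 hence "finite {i. be i ~= 0}" using al by (auto simp: partition_def intro: finite_subset)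
 ultimately have be: "partition be" by (simp add: partition_def)
 have y: "young be = insert (r, al r) (young al)" "(r, al r) ~: young al" by (auto simp: be_def young_def split: if_splits)
 have "beta_set be = mv (beta_set al) a"
 proof -
  have "beta_set be = insert a ((%i. int (al i) - int i - 1) ` (UNIV - {r}))"
  proof -
   have "insert r (UNIV - {r}) = UNIV" by blast
   hence "beta_set be = (%i. int (be i) - int i - 1) ` insert r (UNIV - {r})" by (simp only: beta_set_def)
   also have "... = insert a ((%i. int (be i) - int i - 1) ` (UNIV - {r}))" by (simp only: image_insert) (simp add: be_def r)
   also have "(%i. int (be i) - int i - 1) ` (UNIV - {r}) = (%i. int (al i) - int i - 1) ` (UNIV - {r})"
    by (intro image_cong) (auto simp: be_def)
   finally show ?thesis .
  qed
  also have "(%i. int (al i) - int i - 1) ` (UNIV - {r}) = beta_set al - {a - 1}" using beta_inj[OF al] r by (auto simp: beta_set_def)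
  finally show ?thesis by (simp add: mv_def)
 qed
 moreover have "conts be = add_mset a (conts al)" using y al r by (simp add: conts_def cont_def)
 moreover have "weight be = Suc (weight al)" using y al be by (simp flip: card_young)
 ultimately show ?thesis using be by blast
qed

lemma valid_partition:
 "valid base_set as ==> EX al. partition al & beta_set al = fin base_set as & conts al = mset as & weight al = length as"
proof (induction as rule: rev_induct)
 case Nil
 show ?case by (intro exI[of _ "%_. 0"]) (simp add: beta_set_zero conts_def weight_def)
next
 case (snoc a as)
 then obtain al where al: "partition al" "beta_set al = fin base_set as" "conts al = mset as" "weight al = length as" by auto
 have "a - 1 : beta_set al" "a ~: beta_set al" using snoc.prems al by auto
 from add_node[OF al(1) this] al show ?case by auto
qed

definition col_conts :: "(nat => nat) => tableau => int list" where
 "col_conts al t = map (%j. cont (the_inv_into (young al) t j)) [1..<Suc (weight al)]"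

lemma mset_col_conts:
 assumes t: "t : tableaux al"
 shows "mset (col_conts al t) = conts al"
proof -
 have "mset [1..<Suc (weight al)] = mset_set {1..weight al}" by (metis atLeastLessThanSuc_atLeastAtMost mset_upt)
 also have "... = image_mset t (mset_set (young al))" using tableauxD(2,3)[OF t] by (simp add: image_mset_mset_set)
 finally have "mset (col_conts al t) = image_mset (%x. cont (the_inv_into (young al) t (t x))) (mset_set (young al))"
  by (simp add: col_conts_def image_mset.compositionality comp_def del: upt_Suc)
 also have "... = conts al" unfolding conts_def
 proof (rule image_mset_cong)
  fix x assume "x :# mset_set (young al)"
  hence "x : young al" by (metis elem_mset_set empty_iff mset_set.infinite set_mset_empty)
  thus "cont (the_inv_into (young al) t (t x)) = cont x" using tableauxD(2)[OF t] by (simp add: the_inv_into_f_f)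
 qed
 finally show ?thesis .
qed

lemma wtl_col_conts:
 assumes al: "partition al" and t: "t : tableaux al" and cr: "col_reading al t"
 shows "wtl (col_conts al t) (kapt al t * rhot al t)" unfolding wtl_def
proof (intro allI impI)
 fix j assume j: "j < length (col_conts al t)"
 hence "Suc j : t ` young al" using tableauxD(3)[OF t] by (simp add: col_conts_def del: upt_Suc)
 hence x: "the_inv_into (young al) t (Suc j) : young al" "t (the_inv_into (young al) t (Suc j)) = Suc j"
  using tableauxD(2)[OF t] by (auto intro: the_inv_into_into f_the_inv_into_f)
 have "col_conts al t ! j = cont (the_inv_into (young al) t (Suc j))" using j by (simp add: col_conts_def del: upt_Suc)
 with jm_col_reading[OF al t cr x(1)] x(2)
 show "jm (Suc j) * (kapt al t * rhot al t) = of_int (col_conts al t ! j) * (kapt al t * rhot al t)" by simp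
qed

text \<open>One weight for each partition is enough: the column reading supplies it, and every valid
  sequence with the same contents is linked to it by exchanges, which carry weights to
  weights.\<close>

theorem valid_is_weight:
 assumes "valid base_set as"
 shows "is_weight as"
proof -
 obtain al where al: "partition al" "conts al = mset as" using valid_partition[OF assms] by blast
 obtain t where t: "t : tableaux al" "col_reading al t" using ex_col_reading[OF al(1)] by blast
 have w: "is_weight (col_conts al t)" using wtl_col_conts[OF al(1) t] kap_rho_nonzero[OF t(1)] by (auto simp: is_weight_def)
 hence "valid base_set (col_conts al t)" by (rule is_weight_valid)
 hence "swps (col_conts al t) as" using assms mset_col_conts[OF t(1)] al by (intro valid_connected) auto
 thus ?thesis using w by (rule is_weight_swps)
qed

section \<open>Weights in characteristic p\<close>

lemma valid_bounds: "valid base_set as ==> (x < - int (length as) --> x : fin base_set as) &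
 (x >= int (length as) --> x ~: fin base_set as)"
proof (induction as arbitrary: x rule: rev_induct)
 case (snoc a as)
 hence v: "valid base_set as" "a - 1 : fin base_set as" "a ~: fin base_set as" by auto
 have "- int (length as) <= a" "a - 1 < int (length as)" using snoc.IH[OF v(1), of a] snoc.IH[OF v(1), of "a - 1"] v by auto
 thus ?case using snoc.IH[OF v(1), of x] by (auto simp: mv_def)
qed (simp add: base_set_def)

lemma valid_entries: "valid base_set as ==> a : set as ==> abs a <= int (length as)"
proof (induction as rule: rev_induct)
 case (snoc b as)
 hence v: "valid base_set as" "b - 1 : fin base_set as" "b ~: fin base_set as" by auto
 have "- int (length as) <= b" "b - 1 < int (length as)" using valid_bounds[OF v(1), of b] valid_bounds[OF v(1), of "b - 1"] v by auto
 with snoc v show ?case by auto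
qed simp

lemma finite_valid: "finite {as. length as = m & valid base_set as}"
proof (rule finite_subset)
 show "{as. length as = m & valid base_set as} <= {as. set as <= {- int m..int m} & length as = m}"
 proof (intro subsetI CollectI conjI)
  fix as x assume as: "as : {as. length as = m & valid base_set as}" and "x : set as"
  hence "abs x <= int m" using valid_entries[of as x] by simp
  thus "x : {- int m..int m}" by auto
 qed auto
qed (simp add: finite_lists_length_eq)

lemma wtl_wtv: "wtv m f v <-> wtl (map f [1..<Suc m]) v"
proof -
 have "(ALL j:{1..m}. P j) <-> (ALL j<m. P (Suc j))" for P
  by (metis Suc_leI Suc_le_mono atLeastAtMost_iff le_add1 less_Suc_eq_le plus_1_eq_Suc Suc_pred' One_nat_def Suc_le_lessD)
 thus ?thesis by (simp add: wtv_def wtl_def del: upt_Suc)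
qed

lemma prod_list_gz: "(!!x. x : set xs ==> x : gz m) ==> prod_list xs : gz m" by (induction xs) (auto intro: gz_mult)

lemma ip_prod_list:
 assumes "!!x y z. x : set xs ==> ip (x * y) z = ip y (x * z)"
  and "!!x y. x : set xs ==> y : set xs ==> x * y = y * (x :: int galg)"
 shows "ip (prod_list xs * y) z = ip y (prod_list xs * z)" using assms
proof (induction xs arbitrary: y z)
 case (Cons x xs)
 have c: "x * prod_list xs = prod_list xs * x"
 proof -
  have "x * y = y * x" if "y : set xs" for y using Cons.prems(2) that by auto
  thus ?thesis by (induction xs) (auto intro: comm_multI)
 qed
 have "ip (prod_list (x # xs) * y) z = ip (prod_list xs * y) (x * z)"
  using Cons.prems(1)[of x "prod_list xs * y" z] by (simp add: mult.assoc)
 also have "... = ip y (prod_list xs * (x * z))" using Cons by auto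
 also have "prod_list xs * (x * z) = prod_list (x # xs) * z" using c by (simp flip: mult.assoc)
 finally show ?case .
qed simp

lemma prod_list_eigen:
 assumes "!!i. i : set xs ==> F i * v = of_int (g i) * v"
 shows "prod_list (map F xs) * v = of_int (prod_list (map g xs)) * (v :: 'r::ring_1)" using assms
proof (induction xs)
 case (Cons i xs)
 have "prod_list (map F (i # xs)) * v = F i * (of_int (prod_list (map g xs)) * v)" using Cons by (simp add: mult.assoc)
 also have "... = of_int (prod_list (map g xs)) * (of_int (g i) * v)"
  using Cons.prems[of i] of_int_comm[of "prod_list (map g xs)" "F i" v] by simp
 also have "... = of_int (prod_list (map g (i # xs))) * v"
  by (simp only: mult.assoc[symmetric] of_int_mult[symmetric] list.map prod_list.Cons mult.commute)
 finally show ?case .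
qed simp

lemma of_int_galg_eq_0:
 assumes "(of_int c :: 'k::idom) ~= 0" "(of_int c :: 'k galg) * v = 0"
 shows "v = 0"
proof (rule poly_mapping_eqI)
 fix sg
 have "of_int c * lookup v sg = 0" using arg_cong[OF assms(2), of "%x. lookup x sg"] by (simp only: lookup_of_int_times) simp
 thus "lookup v sg = lookup 0 sg" using assms(1) by simp
qed

lemma red_prod_list: "red (prod_list xs) = prod_list (map red xs :: 'k::comm_ring_1 galg list)" by (induction xs) (auto simp: red_mult)

text \<open>Suppose that every valid sequence differs from \<open>is\<close> modulo p at some place
  J. The product P of the factors \<open>F\<close>, one for each valid sequence, then kills every
  integral weight vector, and being self-adjoint it is 0. Its reduction, however, multiplies v by a
  non-zero scalar.\<close>

theorem char_weight_valid:
 fixes v :: "'k::field galg"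
 assumes p: "prime p" and char: "CHAR('k) = p" and v: "v ~= 0" and w: "wtl is v"
 shows "EX as. valid base_set as & list_all2 (%a i. [a = i] (mod int p)) as is"
proof (rule ccontr)
 assume no: "~ ?thesis"
 define m where "m = length is"
 define K where "K = {as. length as = m & valid base_set as}"
 have "EX j<m. ~ [as ! j = is ! j] (mod int p)" if "as : K" for as using no that unfolding K_def m_def list_all2_conv_all_nth by auto
 then obtain J where J: "!!as. as : K ==> J as < m & ~ [as ! J as = is ! J as] (mod int p)" by metis
 obtain ks where ks: "set ks = K" using finite_valid[of m] finite_list unfolding K_def by blast
 define F :: "int list => int galg" where "F as = jm (Suc (J as)) - of_int (as ! J as)" for as
 define P where "P = prod_list (map F ks)"
 have Fgz: "F as : gz m" if "as : K" for as unfolding F_def using J[OF that] by (intro gz_diff gz_jm gz_of_int) auto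
 have Pgz: "P : gz m" unfolding P_def using Fgz ks by (intro prod_list_gz) auto
 have "P = 0"
 proof (rule ccontr)
  assume "P ~= 0"
  then obtain h b where h: "h : gz m" "h * P ~= 0" "wtv m b (h * P)" using ex_weight by blast
  define bs where "bs = map b [1..<Suc m]"
  have wb: "wtl bs (h * P)" using h(3) by (simp add: wtl_wtv bs_def del: upt_Suc)
  hence "is_weight bs" using h(2) by (auto simp: is_weight_def)
  hence bK: "bs : K" using is_weight_valid by (simp add: K_def bs_def)
  have "F as * (h * P) = of_int (bs ! J as - as ! J as) * (h * P)" if "as : set ks" for as
  proof -
   have "J as < length bs" using J[of as] that ks by (simp add: bs_def del: upt_Suc)
   hence "jm (Suc (J as)) * (h * P) = of_int (bs ! J as) * (h * P)" using wb by (simp add: wtl_def)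
   thus ?thesis by (simp add: F_def left_diff_distrib)
  qed
  hence "P * (h * P) = of_int (prod_list (map (%as. bs ! J as - as ! J as) ks)) * (h * P)" unfolding P_def by (rule prod_list_eigen)
  moreover have "prod_list (map (%as. bs ! J as - as ! J as) ks) = 0" using bK ks by (auto simp: prod_list_zero_iff)
  ultimately have P0: "P * (h * P) = 0" by simp
  have "ip (P * h) (P * h) = ip h (P * (P * h))" unfolding P_def
  proof (rule ip_prod_list)
   fix x y z assume "x : set (map F ks)"
   thus "ip (x * y) z = ip y (x * z)"
    by (auto simp: F_def left_diff_distrib ip_diff_left ip_diff_right ip_jm ip_of_int_left ip_of_int_right)
  qed (use Fgz ks in \<open>auto intro: gz_commute[of _ m]\<close>)
  also have "P * (P * h) = 0" using P0 gz_commute[OF Pgz h(1)] by simp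
  finally have "P * h = 0" by simp
  thus False using h(2) gz_commute[OF Pgz h(1)] by simp
 qed
 hence 0: "prod_list (map (%as. red (F as)) ks) = (0 :: 'k galg)"
  using red_prod_list[of "map F ks", where ?'k = 'k] by (simp add: P_def comp_def)
 have "(red (F as) :: 'k galg) * v = of_int (is ! J as - as ! J as) * v" if "as : set ks" for as
 proof -
  have "jm (Suc (J as)) * v = of_int (is ! J as) * v" using w J that ks unfolding m_def by (simp add: wtl_def)
  thus ?thesis by (simp add: F_def red_diff left_diff_distrib)
 qed
 hence "prod_list (map (%as. red (F as)) ks) * v = of_int (prod_list (map (%as. is ! J as - as ! J as) ks)) * v" by (rule prod_list_eigen)
 hence "(of_int (prod_list (map (%as. is ! J as - as ! J as) ks)) :: 'k galg) * v = 0" using 0 by simp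
 moreover have "(of_int (prod_list (map (%as. is ! J as - as ! J as) ks)) :: 'k) ~= 0"
 proof -
  have pl: "int p dvd prod_list ys ==> EX y:set ys. int p dvd y" for ys using p by (induction ys) (auto simp: prime_dvd_mult_iff)
  have "~ int p dvd prod_list (map (%as. is ! J as - as ! J as) ks)"
  proof
   assume "int p dvd prod_list (map (%as. is ! J as - as ! J as) ks)"
   then obtain as where "as : K" "int p dvd is ! J as - as ! J as" using pl ks by fastforce
   thus False using J[of as] by (simp add: cong_iff_dvd_diff dvd_diff_commute)
  qed
  thus ?thesis using char by (simp add: of_int_eq_0_iff_char_dvd)
 qed
 ultimately show False using v of_int_galg_eq_0 by blast
qed

lemma lookup_of_int_mult_int: "lookup (of_int c * x) sg = c * lookup (x :: int galg) sg" by (simp only: lookup_of_int_times) simp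

text \<open>An integral eigenvalue that is known modulo p only, as is the case for integral lifts of
  idempotents.\<close>

definition amod :: "nat => int galg => int galg => int => bool" where
 "amod p x v e <-> (EX h. x * v = of_int h * v & [h = e] (mod int p))"

lemma amod_one [simp]: "amod p 1 v 1" unfolding amod_def by (intro exI[of _ 1]) simp

lemma amod_zero [simp]: "amod p 0 v 0" unfolding amod_def by (intro exI[of _ 0]) simp

lemma amod_mult: "amod p x v e ==> amod p y v f ==> amod p (x * y) v (e * f)"
proof -
 assume "amod p x v e" "amod p y v f"
 then obtain h k where h: "x * v = of_int h * v" "[h = e] (mod int p)" and k: "y * v = of_int k * v" "[k = f] (mod int p)"
  by (auto simp: amod_def)
 have "x * y * v = of_int k * (x * v)" by (simp only: mult.assoc k of_int_comm)
 also have "... = of_int (h * k) * v" by (simp only: h of_int_mult mult.assoc mult.commute[of h k])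
 finally show ?thesis unfolding amod_def using h k by (blast intro: cong_mult)
qed

lemma amod_add: "amod p x v e ==> amod p y v f ==> amod p (x + y) v (e + f)"
proof -
 assume "amod p x v e" "amod p y v f"
 then obtain h k where h: "x * v = of_int h * v" "[h = e] (mod int p)" and k: "y * v = of_int k * v" "[k = f] (mod int p)"
  by (auto simp: amod_def)
 have "(x + y) * v = of_int (h + k) * v" by (simp only: distrib_right h k of_int_add)
 thus ?thesis unfolding amod_def using h k by (blast intro: cong_add)
qed

lemma amod_sum: "(!!i. i : I ==> amod p (F i) v (e i)) ==> amod p (sum F I) v (sum e I)"
 by (induction I rule: infinite_finite_induct) (auto intro: amod_add)

lemma amod_prod_list: "(!!i. i : set xs ==> amod p (F i) v (e i)) ==> amod p (prod_list (map F xs)) v (prod_list (map e xs))"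
 by (induction xs) (auto intro: amod_mult)

lemma amod_epsi: "prime p ==> x * v = of_int b * v ==> amod p (epsi p N a x) v (of_bool [b = a] (mod int p))"
 unfolding amod_def using epsi_eigen[of x v b p N a] epsi_val_cong[of p N a b]
 by (intro exI[of _ "epsi_val p N a b"]) (simp add: of_bool_def)

section \<open>Centraliser algebras\<close>

lemma keys_subset_single_sum:
 fixes x :: "'r::comm_ring_1 galg"
 assumes "finite A" "keys x <= A"
 shows "x = (SUM sg:A. single sg (lookup x sg))"
proof (rule poly_mapping_eqI)
 fix tt
 have "(SUM sg:A. lookup (single sg (lookup x sg)) tt) = (if tt : A then lookup x tt else 0)"
  using assms(1) by (simp add: lookup_single when_def)
 also have "... = lookup x tt" using assms(2) by (auto simp: in_keys_iff)
 finally show "lookup x tt = lookup (SUM sg:A. single sg (lookup x sg)) tt" by (simp add: lookup_sum)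
qed

lemma single_scalar: "single sg c = single 0 c * (gs sg :: 'r::comm_ring_1 galg)" by (simp add: mult_single)

lemma scalar_commute: "single 0 c * x = x * (single 0 c :: 'r::comm_ring_1 galg)"
 by (induction x rule: galg_induct) (auto simp: distrib_left distrib_right mult_single mult.commute)

lemma GA_mult:
 fixes x y :: "'r::comm_ring_1 galg"
 assumes "x : GA m" "y : GA m" shows "x * y : GA m" unfolding group_algebra_def mem_Collect_eq
proof
 fix sg assume "sg : keys (x * y)"
 then obtain a b where "a : keys x" "b : keys y" "sg = a * b" using keys_mult[of x y] by (auto simp: plus_perm_def)
 thus "sg : sym m" using assms unfolding group_algebra_def sym_sgrp by (auto intro!: sgrp_mult)
qed

lemma GA_add:
 "x : GA m ==> y : GA m ==> x + y : GA m" using keys_add[of x y] unfolding group_algebra_def by blast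

lemma GA_diff:
 fixes x y :: "'r::comm_ring_1 galg"
 shows "x : GA m ==> y : GA m ==> x - y : GA m" using keys_diff[of x y] unfolding group_algebra_def by blast

lemma GA_gs: "sg : sym m ==> gs sg : GA m" by (simp add: group_algebra_def)

lemma GA_one [simp]: "(1 :: 'r::comm_ring_1 galg) : GA m" using GA_gs[of 1 m, where ?'a = 'r] by (simp add: sym_sgrp)

lemma GA_zero [simp]: "0 : GA m" by (simp add: group_algebra_def)

lemma GA_single: "sg : sym m ==> single sg c : GA m" by (simp add: group_algebra_def)

lemma GA_of_int: "(of_int c :: 'r::comm_ring_1 galg) : GA m" using GA_single[of 1 m "of_int c :: 'r"]
 by (simp only: sym_sgrp of_int_eq_single zero_perm_def sgrp_one)

lemma GA_sum: "(!!i. i : I ==> f i : GA m) ==> sum f I : GA m" by (induction I rule: infinite_finite_induct) (auto intro: GA_add)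

lemma GA_mono: "l <= m ==> x : GA l ==> x : GA m" unfolding group_algebra_def sym_def by (auto dest!: subsetD)

lemma GA_power: "(x :: 'r::comm_ring_1 galg) : GA m ==> x ^ n : GA m" by (induction n) (auto intro: GA_mult)

lemma GA_jm: "j <= m ==> jm j : GA m" unfolding jm_def tr_def sym_sgrp by (intro GA_sum GA_gs) (auto simp: sym_sgrp intro!: sgrp_swap)

lemma GA_esym: "j <= m ==> esym jm j k : GA m"
proof (induction "jm :: nat => 'a galg" j k rule: esym.induct)
 case (3 j k)
 thus ?case by (auto intro!: GA_add GA_mult GA_jm)
qed auto

lemma commute_GA:
 fixes c :: "'r::comm_ring_1 galg"
 assumes "!!sg. sg : sym l ==> gs sg * c = c * gs sg" "b : GA l"
 shows "b * c = c * b"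
proof -
 have b: "b = (SUM sg:sym l. single 0 (lookup b sg) * gs sg)"
  using keys_subset_single_sum[of "sym l" b] assms(2) by (simp add: group_algebra_def flip: single_scalar)
 show ?thesis by (subst (1 2) b, unfold sum_distrib_left sum_distrib_right)
   (intro sum.cong refl comm_multI[symmetric] scalar_commute[symmetric] assms(1)[symmetric])
qed

lemma cent_iff:
 fixes c :: "'r::comm_ring_1 galg"
 shows "c : CA l m <-> c : GA m & (ALL sg:sym l. gs sg * c = c * gs sg)" unfolding centraliser_algebra_def mem_Collect_eq
 by (metis commute_GA GA_gs)

lemma cent_mult: "x : CA l m ==> y : CA l m ==> x * y : CA l m"
 for x y :: "'r::comm_ring_1 galg" unfolding cent_iff by (auto intro: GA_mult comm_multI)

lemma cent_add: "x : CA l m ==> y : CA l m ==> x + y : CA l m"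
 for x y :: "'r::comm_ring_1 galg" unfolding cent_iff by (auto intro: GA_add simp: distrib_left distrib_right)

lemma cent_diff: "x : CA l m ==> y : CA l m ==> x - y : CA l m"
 for x y :: "'r::comm_ring_1 galg" unfolding cent_iff by (auto intro: GA_diff simp: diff_distrib)

lemma cent_of_int [simp]: "(of_int c :: 'r::comm_ring_1 galg) : CA l m" by (simp add: cent_iff GA_of_int mult_of_int_commute)

lemma cent_one [simp]: "(1 :: 'r::comm_ring_1 galg) : CA l m" using cent_of_int[of 1, where ?'r = 'r] by simp

lemma cent_zero [simp]: "(0 :: 'r::comm_ring_1 galg) : CA l m" using cent_of_int[of 0, where ?'r = 'r] by simp

lemma cent_sum: "(!!i. i : I ==> f i : CA l m) ==> sum f I : CA l m"
 for f :: "_ => 'r::comm_ring_1 galg" by (induction I rule: infinite_finite_induct) (auto intro: cent_add)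

lemma cent_power: "x : CA l m ==> x ^ n : CA l m"
 for x :: "'r::comm_ring_1 galg" by (induction n) (auto intro: cent_mult)

lemma cent_prod_list: "(!!x. x : set xs ==> x : CA l m) ==> prod_list xs : CA l m"
 for xs :: "'r::comm_ring_1 galg list" by (induction xs) (auto intro: cent_mult)

lemma cent_epsi: "x : CA l m ==> epsi p N a x : CA l m"
 for x :: "'r::comm_ring_1 galg" unfolding epsi_def by (intro cent_diff cent_power cent_one cent_of_int)

lemma cent_jm: "l < j ==> j <= m ==> jm j : CA l m" unfolding cent_iff sym_sgrp by (auto intro!: GA_jm gs_jm_sgrp)

lemma sym_mono: "l <= m ==> sg : sym l ==> sg : sym m" unfolding sym_sgrp by (rule sgrp_mono[of "{1..l}"]) auto

lemma cent_esym: "l <= j ==> j <= m ==> esym jm j k : CA l m" unfolding cent_iff by (auto intro!: GA_esym gs_esym_jm sym_mono[of l j])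

lemma perm_commute_disjoint: "sg : sgrp S ==> tt : sgrp T ==> S Int T = {} ==> sg * tt = tt * sg"
 by (rule perm_mult_commute) (auto simp: sgrp_def)

lemma cent_gs: "sg : sgrp {Suc l..m} ==> gs sg : CA l m" unfolding cent_iff
proof (intro conjI ballI)
 assume sg: "sg : sgrp {Suc l..m}"
 hence "sg : sgrp {1..m}" by (rule sgrp_mono[rotated]) auto
 thus "gs sg : GA m" by (intro GA_gs) (simp add: sym_sgrp)
 fix tt assume "tt : sym l"
 hence "tt * sg = sg * tt" using sg unfolding sym_sgrp by (intro perm_commute_disjoint[of _ "{1..l}" _ "{Suc l..m}"]) auto
 thus "gs tt * gs sg = gs sg * gs tt" by (simp add: gs_mult)
qed

lemma esym_top_commute:
 fixes c :: "'r::comm_ring_1 galg"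
 shows "c : GA m ==> c * esym jm m k = esym jm m k * c" by (rule commute_GA) (rule gs_esym_jm)

lemma esym_bottom_commute:
 fixes c :: "'r::comm_ring_1 galg"
 shows "c : CA l m ==> c * esym jm l k = esym jm l k * c" by (simp add: centraliser_algebra_def GA_esym)

lemma red_cent: "x : CA l m ==> (red x :: 'k::comm_ring_1 galg) : CA l m" unfolding cent_iff
proof (intro conjI ballI)
 assume x: "x : GA m & (ALL sg:sym l. gs sg * x = x * gs sg)"
 hence "lookup x sg = 0" if "sg ~: sym m" for sg using that by (auto simp: group_algebra_def in_keys_iff)
 hence "!!sg. lookup (red x :: 'k galg) sg ~= 0 ==> sg : sym m" by (auto, metis of_int_0)
 thus "(red x :: 'k galg) : GA m" unfolding group_algebra_def in_keys_iff by (auto simp: in_keys_iff simp del: lookup_red)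
 fix sg assume "sg : sym l"
 with x have "red (gs sg * x) = (red (x * gs sg) :: 'k galg)" by auto
 thus "gs sg * red x = (red x * gs sg :: 'k galg)" by (simp add: red_mult)
qed

text \<open>By torsion-freeness; this keeps the quotients by p in \<open>central_link\<close> inside
  the centraliser algebra.\<close>

lemma cent_divide:
 fixes y :: "int galg"
 assumes "of_int c * y : CA l m" "c ~= 0"
 shows "y : CA l m" unfolding cent_iff
proof (intro conjI ballI)
 have "keys y <= keys (of_int c * y)" using assms(2) by (auto simp: in_keys_iff lookup_of_int_times simp del: single_of_int)
 thus "y : GA m" using assms(1) by (auto simp: cent_iff group_algebra_def)
 fix sg assume "sg : sym l"
 hence "gs sg * (of_int c * y) = of_int c * y * gs sg" using assms(1) by (simp add: cent_iff)
 hence "of_int c * (gs sg * y - y * gs sg) = 0" by (simp add: right_diff_distrib mult.assoc of_int_comm)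
 thus "gs sg * y = y * gs sg" using assms(2) by (simp add: of_int_mult_eq_0)
qed

text \<open>If the reduction of \<open>E\<close> is central, then \<open>ad E ^ N\<close> maps the integral centraliser algebra into its
 multiples by \<open>p ^ N\<close>.  Evaluating \<open>ad E ^ N\<close> of a simple transposition on an integral weight vector
 shows that the two weights exchanged by it have the same eigenvalue of \<open>E\<close> modulo \<open>p\<close>.\<close>

theorem central_link:
 fixes E v :: "int galg"
 assumes p: "prime p" and char: "CHAR('k::comm_ring_1) = p"
  and E: "E : CA l m"
  and cen: "!!c :: 'k galg. c : CA l m ==> red E * c = c * red E"
  and r: "l < r" "Suc r <= m"
  and v': "v' = of_int d * (sr r * v) - v" "v' ~= 0"
  and e: "E * v = of_int et * v" "E * v' = of_int et' * v'"
 shows "[et = et'] (mod int p)"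
proof -
 define x where "x N = ((%y. E * y - y * E) ^^ N) (sr r)" for N
 have x_simps: "x 0 = sr r" "x (Suc N) = E * x N - x N * E" for N by (simp_all add: x_def)
 define de where "de = et' - et"
 have p0: "int p ~= 0" using p prime_gt_0_nat by simp
 have div: "EX y:CA l m. x N = of_int (int p ^ N) * y" for N
 proof (induction N)
  case 0
  have "sr r : (CA l m :: int galg set)" unfolding tr_def using r by (intro cent_gs sgrp_swap) auto
  thus ?case by (intro bexI[of _ "sr r"]) (simp_all add: x_simps)
 next
  case (Suc N)
  then obtain y where y: "y : CA l m" "x N = of_int (int p ^ N) * y" by blast
  have "(red (E * y - y * E) :: 'k galg) = 0" using cen[OF red_cent[OF y(1)]] by (simp add: red_diff red_mult)
  then obtain y' where y': "E * y - y * E = of_int (int p) * y'" using red_eq_0_iff[OF char] by blast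
  have "of_int (int p) * y' : CA l m" unfolding y'[symmetric] using E y by (intro cent_diff cent_mult)
  hence "y' : CA l m" using p0 by (rule cent_divide)
  moreover have "x (Suc N) = of_int (int p ^ N) * (E * y - y * E)" by (simp only: x_simps y(2) right_diff_distrib of_int_comm mult.assoc)
  hence "x (Suc N) = of_int (int p ^ Suc N) * y'" by (simp only: y' power_Suc2 of_int_mult mult.assoc)
  ultimately show ?case by blast
 qed
 \<comment> \<open>Since d times \<open>sr r * v\<close> is v' + v, the first commutator with E
   removes the part in v and leaves a multiple of v'; every further commutator contributes one more
   factor et' - et.\<close>
 have ev: "of_int d * (x (Suc N) * v) = of_int (de ^ Suc N) * v'" for N
 proof -
  have step: "x (Suc N) * v = E * (x N * v) - of_int et * (x N * v)" for N
   by (simp only: x_simps left_diff_distrib mult.assoc e of_int_comm)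
  show ?thesis
  proof (induction N)
   case 0
   have "of_int d * (sr r * v) = v' + v" by (simp add: v')
   hence "of_int d * (x (Suc 0) * v) = E * (v' + v) - of_int et * (v' + v)"
    by (simp only: step x_simps(1) right_diff_distrib of_int_comm[of d E] of_int_comm[of d "of_int et"])
   also have "... = of_int de * v'" by (simp only: distrib_left e de_def of_int_diff left_diff_distrib add_diff_cancel_right)
   finally show ?case by simp
  next
   case (Suc N)
   have "of_int d * (x (Suc (Suc N)) * v) = E * (of_int d * (x (Suc N) * v)) - of_int et * (of_int d * (x (Suc N) * v))"
    by (simp only: step[of "Suc N"] right_diff_distrib of_int_comm[where c = d])
   also have "... = of_int (de ^ Suc N) * (E * v') - of_int et * (of_int (de ^ Suc N) * v')" by (simp only: Suc of_int_comm[where a = E])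
   also have "... = of_int (de ^ Suc N) * (of_int de * v')"
    by (simp only: e de_def of_int_diff diff_distrib of_int_comm[of et "of_int ((et' - et) ^ Suc N)"])
   finally show ?case by (simp only: power_Suc2 of_int_mult mult.assoc)
  qed
 qed
 show ?thesis
 proof (rule ccontr)
  assume "~ [et = et'] (mod int p)"
  hence "~ int p dvd de" by (simp add: de_def cong_iff_dvd_diff dvd_diff_commute)
  hence cop: "coprime (int p ^ N) (de ^ N)" for N using p by (simp add: prime_imp_coprime)
  obtain sg where sg: "lookup v' sg ~= 0" using v'(2) by (metis poly_mapping_eqI lookup_zero)
  let ?a = "lookup v' sg"
  \<comment> \<open>If et' - et were prime to p, all powers of p would divide a non-zero coefficient
    of v'.\<close>
  have dvd: "int p ^ Suc N dvd ?a" for N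
  proof -
   obtain y where y: "x (Suc N) = of_int (int p ^ Suc N) * y" using div by blast
   have "of_int (de ^ Suc N) * v' = of_int (int p ^ Suc N) * (of_int d * (y * v))"
    unfolding ev[symmetric] by (simp only: y mult.assoc of_int_comm[of d "of_int (int p ^ Suc N)"])
   hence "de ^ Suc N * ?a = int p ^ Suc N * lookup (of_int d * (y * v)) sg" by (metis lookup_of_int_mult_int)
   hence "int p ^ Suc N dvd de ^ Suc N * ?a" by simp
   thus ?thesis using cop[of "Suc N"] by (metis coprime_dvd_mult_right_iff)
  qed
  have "abs (?a) < int p ^ Suc (nat (abs (?a)))"
  proof -
   have "nat (abs (?a)) < p ^ Suc (nat (abs (?a)))"
    using power_gt_expt[of p "Suc (nat (abs (?a)))"] prime_gt_1_nat[OF p] by (auto simp del: power_Suc)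
   hence "int (nat (abs (?a))) < int (p ^ Suc (nat (abs (?a))))" by (simp only: of_nat_less_iff)
   thus ?thesis by simp
  qed
  moreover have "abs (int p ^ Suc (nat (abs (?a)))) <= abs (?a)" by (rule dvd_imp_le_int[OF sg dvd])
  ultimately show False by (simp del: power_Suc)
 qed
qed

section \<open>Centres of group algebras of symmetric groups\<close>

lemma ex_perm:
 assumes "f permutes S" "finite S"
 shows "EX sg:sgrp S. apply sg = f"
proof -
 have "{x. f x ~= x} <= S" using assms(1) by (auto simp: permutes_def)
 hence "finite {x. f x ~= x}" using assms(2) finite_subset by blast
 hence *: "apply (Perm f) = f" using permutes_bij[OF assms(1)] by (simp add: Perm_inverse)
 have "affected (Perm f) <= S" using * `{x. f x ~= x} <= S` by (auto simp: affected.rep_eq)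
 with * show ?thesis by (auto simp: sgrp_def)
qed

definition jmono :: "nat => (nat => nat) => 'r::comm_ring_1 galg" where
 "jmono l a = prod_list (map (%j. jm j ^ a j) [1..<Suc l])"

lemma jmono_0 [simp]: "jmono 0 a = 1" by (simp add: jmono_def)

lemma jmono_Suc: "jmono (Suc l) a = jmono l a * jm (Suc l) ^ a (Suc l)" by (simp add: jmono_def)

lemma jmono_zero [simp]: "jmono l (%_. 0) = 1" by (induction l) (auto simp: jmono_Suc)

lemma jmono_cong: "(!!j. 1 <= j ==> j <= l ==> a j = b j) ==> jmono l a = jmono l b" by (induction l) (auto simp: jmono_Suc)

lemma jm_power_commute: "jm i * jm j ^ n = jm j ^ n * jm i" by (rule power_commuting_commutes[OF jm_commute, symmetric])

lemma jm_jmono_commute: "jm i * jmono l a = jmono l a * jm i" by (induction l) (auto simp: jmono_Suc intro!: comm_multI jm_power_commute)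

lemma jmono_upd: "1 <= j ==> j <= l ==> jmono l (a(j := Suc (a j))) = jm j * (jmono l a :: 'r::comm_ring_1 galg)"
proof (induction l)
 case (Suc l)
 show ?case
 proof (cases "j = Suc l")
  case True
  have "jmono l (a(j := Suc (a j))) = (jmono l a :: 'r galg)" using True by (intro jmono_cong) auto
  hence "jmono (Suc l) (a(j := Suc (a j))) = (jmono l a :: 'r galg) * jm (Suc l) ^ (a(j := Suc (a j))) (Suc l)" by (simp only: jmono_Suc)
  also have "... = jmono l a * jm (Suc l) * jm (Suc l) ^ a (Suc l)" using True by (simp add: mult.assoc)
  also have "jmono l a * jm (Suc l) = jm (Suc l) * (jmono l a :: 'r galg)" by (rule jm_jmono_commute[symmetric])
  finally show ?thesis using True by (simp add: jmono_Suc mult.assoc)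
 next
  case False
  with Suc show ?thesis by (simp add: jmono_Suc mult.assoc)
 qed
qed simp

text \<open>\<open>lead a \<pi>\<close>: in each nontrivial cycle of \<open>\<pi>\<close> the maximum \<open>j\<close> satisfies \<open>a j + 1 =\<close> its length, and
 \<open>a\<close> vanishes elsewhere.  The permutations with \<open>lead a \<pi>\<close> are the leading terms of \<open>jmono l a\<close> with
 respect to the number of moved points.\<close>

inductive lead :: "(nat => nat) => nat perm => bool" where
 base: "lead (%_. 0) 1"
| step: "lead a tt ==> 1 <= b ==> b < j ==> tt $ b = b ==> (!!i. i > j ==> a i = 0) ==>
  lead (a(j := Suc (a j))) ({|j,b|} * tt)"

lemma affected_insert:
 assumes "tt $ b = b" "b ~= j"
 shows "affected ({|j,b|} * tt) = insert b (insert j (affected tt))"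
proof -
 have inj: "tt $ x = b <-> x = b" for x using assms(1) by (metis apply_inj)
 have "x : affected ({|j,b|} * tt) <-> x = b | x = j | x : affected tt" for x
  using assms inj[of x] inj[of j] by (simp add: in_affected apply_swap_times) metis
 thus ?thesis by blast
qed

lemma affected_swap_times: "affected ({|b,j|} * tt) <= insert b (insert j (affected tt))"
 by (auto simp: in_affected apply_swap_times split: if_splits)

lemma lead_affected: "lead a pe ==> (ALL i:affected pe. 1 <= i & (EX j>=i. a j ~= 0)) & (ALL j. a j ~= 0 --> j : affected pe)"
proof (induction rule: lead.induct)
 case (step a tt b j)
 have aff: "affected ({|j,b|} * tt) = insert b (insert j (affected tt))" using step.hyps by (intro affected_insert) simp_all
 have "EX k>=i. (a(j := Suc (a j))) k ~= 0" if "i : insert b (insert j (affected tt))" for i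
 proof -
  have "i <= j | (EX k>=i. a k ~= 0)" using that step by auto
  thus ?thesis
  proof
   assume "i <= j" thus ?thesis by (intro exI[of _ j]) auto
  next
   assume "EX k>=i. a k ~= 0"
   then obtain k where "k >= i" "a k ~= 0" by blast
   thus ?thesis by (intro exI[of _ k]) auto
  qed
 qed
 with aff step show ?case by auto
qed auto

lemma lead_max:
 assumes "lead a tt" "1 <= b" "b < j" "tt $ b = b" "!!i. i > j ==> a i = 0"
 shows "Max (affected ({|j,b|} * tt)) = j"
proof (rule Max_eqI)
 have aff: "affected ({|j,b|} * tt) = insert b (insert j (affected tt))" using assms by (intro affected_insert) auto
 show "j : affected ({|j,b|} * tt)" by (simp add: aff)
 fix y assume "y : affected ({|j,b|} * tt)"
 hence "y = b | y = j | y : affected tt" by (simp add: aff)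
 thus "y <= j" using lead_affected[OF assms(1)] assms(3,5) by (metis leI le_trans less_imp_le_nat order_refl)
qed simp

text \<open>The last step of the construction is visible in pe: j is its largest moved point and b
  is the preimage of j.\<close>

lemma lead_unique: "lead a pe ==> lead a' pe ==> a = a'"
proof (induction arbitrary: a' rule: lead.induct)
 case base
 have "a' j = 0" for j using lead_affected[OF base] by auto
 thus ?case by auto
next
 case (step a tt b j)
 let ?pe = "{|j,b|} * tt"
 have aff: "affected ?pe = insert b (insert j (affected tt))" using step.hyps by (intro affected_insert) simp_all
 have mx: "Max (affected ?pe) = j" by (rule lead_max[OF step.hyps])
 from step.prems show ?case
 proof (cases rule: lead.cases)
  case base
  thus ?thesis using aff by simp
 next
  case (step a1 tt1 b1 j1)
  have "Max (affected ?pe) = j1" unfolding step(2) by (rule lead_max[OF step(3-7)])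
  hence j: "j1 = j" using mx by simp
  have "?pe $ b = j" using `tt $ b = b` by (simp add: apply_times)
  moreover have "?pe $ b1 = j" unfolding step(2) using step j by (simp add: apply_times)
  ultimately have b: "b1 = b" by (metis apply_inj)
  have "{|j,b|} * ?pe = {|j,b|} * ({|j1,b1|} * tt1)" using step(2) by simp
  hence "tt1 = tt" using j b by (simp flip: mult.assoc)
  hence "a = a1" using step.IH[of a1] step(3) `lead a1 tt1` by blast
  thus ?thesis using step(1) j by simp
 qed
qed

lemma lead_exists: "pe : sym l ==> EX a. lead a pe"
proof (induction "card (affected pe)" arbitrary: pe rule: less_induct)
 case less
 show ?case
 proof (cases "pe = 1")
  case False
  hence ne: "affected pe ~= {}" by simp
  define j where "j = Max (affected pe)"
  have j: "j : affected pe" "!!i. i : affected pe ==> i <= j" using ne by (auto simp: j_def)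
  define b where "b = inverse pe $ j"
  have peb: "pe $ b = j" by (simp add: b_def)
  hence bne: "b ~= j" using j(1) by (auto simp: in_affected)
  hence b: "b : affected pe" using peb by (auto simp: in_affected)
  have bj: "b < j" "1 <= b" using j(2)[OF b] bne b less.prems by (auto simp: sym_def)
  define tt where "tt = {|j,b|} * pe"
  have pe: "pe = {|j,b|} * tt" by (simp add: tt_def flip: mult.assoc)
  have ttb: "tt $ b = b" using peb by (simp add: tt_def apply_times)
  have aff: "affected pe = insert b (insert j (affected tt))" unfolding pe using ttb bne by (rule affected_insert)
  have "affected tt \<subset> affected pe" using aff ttb by (auto simp: in_affected)
  hence "card (affected tt) < card (affected pe)" by (simp add: psubset_card_mono)
  moreover have "tt : sym l" using `affected tt \<subset> affected pe` less.prems by (auto simp: sym_def)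
  ultimately obtain a where a: "lead a tt" using less by blast
  have "a i = 0" if "i > j" for i using lead_affected[OF a] j(2)[of i] aff that by (metis insertCI not_le)
  thus ?thesis unfolding pe using a bj ttb by (blast intro: lead.step)
 qed (auto intro: lead.base)
qed

text \<open>The number of points moved by a permutation with \<open>lead a\<close>: each j in the
  support of a stands for a cycle of length a j + 1.\<close>

definition adeg :: "nat => (nat => nat) => nat" where
 "adeg l a = (SUM j:{1..l}. if a j = 0 then 0 else Suc (a j))"

lemma adeg_upd:
 assumes "1 <= j" "j <= l"
 shows "adeg l (a(j := Suc (a j))) = adeg l a + (if a j = 0 then 2 else 1)"
proof -
 have j: "j : {1..l}" using assms by auto
 have "(SUM i:{1..l} - {j}. if (a(j := Suc (a j))) i = 0 then 0 else Suc ((a(j := Suc (a j))) i))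
  = (SUM i:{1..l} - {j}. if a i = 0 then 0 else Suc (a i))" by (rule sum.cong) auto
 hence "adeg l (a(j := Suc (a j))) = Suc (Suc (a j)) + (SUM i:{1..l} - {j}. if a i = 0 then 0 else Suc (a i))"
  unfolding adeg_def by (subst sum.remove[OF _ j]) simp_all
 moreover have "adeg l a = (if a j = 0 then 0 else Suc (a j)) + (SUM i:{1..l} - {j}. if a i = 0 then 0 else Suc (a i))"
  unfolding adeg_def by (subst sum.remove[OF _ j]) auto
 ultimately show ?thesis by simp
qed

lemma lead_card: "lead a pe ==> (!!j. a j ~= 0 ==> j <= l) ==> card (affected pe) = adeg l a"
proof (induction rule: lead.induct)
 case (step a tt b j)
 have jl: "j <= l" using step.prems[of j] by simp
 have IH: "card (affected tt) = adeg l a"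
 proof (rule step.IH)
  fix i assume "a i ~= 0" thus "i <= l" using step.prems[of i] jl by (cases "i = j") auto
 qed
 have aff: "affected ({|j,b|} * tt) = insert b (insert j (affected tt))" using step.hyps by (intro affected_insert) simp_all
 have "b ~: affected tt" using step by (simp add: in_affected)
 moreover have "j : affected tt <-> a j ~= 0"
 proof
  assume "j : affected tt"
  then obtain k where "k >= j" "a k ~= 0" using lead_affected[OF step.hyps(1)] by blast
  thus "a j ~= 0" using step.hyps(5)[of k] by (cases "k = j") auto
 qed (use lead_affected[OF step.hyps(1)] in blast)
 ultimately show ?case using IH adeg_upd[of j l a] step.hyps(2,3) jl by (simp add: aff card_insert_if insert_absorb del: fun_upd_apply)
qed (simp add: adeg_def)

definition asupp :: "(nat => nat) => nat set" where
 "asupp a = {j. a j ~= 0}"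

text \<open>Exponents are raised only at the end of the support or beyond it, which is the order in
  which \<open>lead\<close> builds its cycles.\<close>

lemma nat_fun_induct [consumes 1, case_names zero step]:
 fixes a :: "nat => nat"
 assumes "asupp a <= {1..l}"
  and "P (%_. 0)"
  and "!!a j. P a ==> asupp a <= {1..j} ==> 1 <= j ==> j <= l ==> P (a(j := Suc (a j)))"
 shows "P a" using assms(1)
proof (induction "sum a {1..l}" arbitrary: a rule: less_induct)
 case less
 show ?case
 proof (cases "asupp a = {}")
  case True
  hence "a = (%_. 0)" by (auto simp: asupp_def)
  thus ?thesis using assms(2) by simp
 next
  case False
  have fin: "finite (asupp a)" using less.prems finite_subset by blast
  define j where "j = Max (asupp a)"
  have j: "j : asupp a" "!!i. i : asupp a ==> i <= j" using False fin by (auto simp: j_def)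
  define a' where "a' = a(j := a j - 1)"
  have a: "a = a'(j := Suc (a' j))" using j(1) by (auto simp: a'_def asupp_def)
  have jl: "1 <= j" "j <= l" using j(1) less.prems by auto
  have sub: "asupp a' <= asupp a" by (auto simp: a'_def asupp_def split: if_splits)
  have "sum a' {1..l} < sum a {1..l}"
   by (rule sum_strict_mono_ex1) (use j(1) jl in \<open>auto simp: a'_def asupp_def intro!: bexI[of _ j]\<close>)
  hence "P a'" using less sub by blast
  moreover have "asupp a' <= {1..j}"
  proof
   fix x assume "x : asupp a'"
   hence "x : asupp a" using sub by blast
   thus "x : {1..j}" using j(2)[of x] less.prems by auto
  qed
  ultimately show ?thesis using assms(3)[of a' j] jl a by simp
 qed
qed

lemma lead_upd_iff:
 assumes "asupp a <= {1..j}" "1 <= j"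
 shows "lead (a(j := Suc (a j))) pe <->
  (EX b tt. lead a tt & 1 <= b & b < j & tt $ b = b & pe = {|j,b|} * tt)"
proof
 assume "lead (a(j := Suc (a j))) pe"
 thus "EX b tt. lead a tt & 1 <= b & b < j & tt $ b = b & pe = {|j,b|} * tt"
 proof (cases rule: lead.cases)
  case base
  hence "(a(j := Suc (a j))) j = 0" by metis
  thus ?thesis by simp
 next
  case (step a1 tt1 b1 j1)
  have "j1 = j"
  proof (rule antisym)
   have "(a(j := Suc (a j))) j1 ~= 0" unfolding step(1) by simp
   thus "j1 <= j" using assms(1) by (auto simp: asupp_def split: if_splits)
   have "(a1(j1 := Suc (a1 j1))) j ~= 0" unfolding step(1)[symmetric] by simp
   thus "j <= j1" using step(7)[of j] by (metis fun_upd_other leI less_irrefl)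
  qed
  moreover from this have "a = a1"
  proof -
   have "a i = a1 i" for i using fun_cong[OF step(1), of i] `j1 = j` by (cases "i = j") auto
   thus ?thesis by blast
  qed
  ultimately show ?thesis using step by blast
 qed
next
 assume "EX b tt. lead a tt & 1 <= b & b < j & tt $ b = b & pe = {|j,b|} * tt"
 thus "lead (a(j := Suc (a j))) pe" using assms by (auto simp: asupp_def intro!: lead.step)
qed

definition lsum :: "nat => (nat => nat) => int galg" where
 "lsum l a = (SUM pe:{pe : sym l. lead a pe}. gs pe)"

lemma lookup_lsum: "lookup (lsum l a) pe = of_bool (pe : sym l & lead a pe)"
proof -
 have "finite {pe : sym l. lead a pe}" by simp
 thus ?thesis by (simp add: lsum_def lookup_sum lookup_single when_def)
qed

lemma keys_jm_mult:
 "keys (jm j * x) <= {{|b,j|} * tt | b tt. b : {1..<j} & tt : keys (x :: int galg)}"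
proof
 fix pe assume "pe : keys (jm j * x)"
 hence "(SUM b:{1..<j}. lookup x ({|b,j|} * pe)) ~= 0" by (simp add: in_keys_iff jm_def tr_def sum_distrib_right lookup_sum lookup_gs_mult)
 then obtain b where "b : {1..<j}" "lookup x ({|b,j|} * pe) ~= 0" by (meson sum.not_neutral_contains_not_neutral)
 thus "pe : {{|b,j|} * tt | b tt. b : {1..<j} & tt : keys x}"
  by (auto simp: in_keys_iff intro!: exI[of _ b] exI[of _ "{|b,j|} * pe"] simp flip: mult.assoc)
qed

text \<open>The union with the support of a makes the induction close. Multiplication by
  \<open>jm j\<close> adds at most b and j to it, and j is new only if a j = 0, when the degree
  grows by 2 instead of 1.\<close>

lemma jmono_leading:
 assumes "asupp a <= {1..l}" and "pe : keys (jmono l a - lsum l a)"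
 shows "card (affected pe Un asupp a) < adeg l a" using assms
proof (induction a arbitrary: pe rule: nat_fun_induct)
 case zero
 have "{pe : sym l. lead (%_. 0) pe} = {1}"
 proof -
  have "pe = 1" if "lead (%_. 0) pe" for pe using lead_affected[OF that] by (metis affected_empty_iff ex_in_conv)
  thus ?thesis by (auto intro: lead.base simp: sym_sgrp)
 qed
 hence "lsum l (%_. 0) = 1" by (simp add: lsum_def)
 thus ?case using zero by simp
next
 case (step a j)
 let ?a = "a(j := Suc (a j))"
 define R where "R = jmono l a - lsum l a"
 have lead_sub: "tt : sym l" "affected tt <= {1..j}" "asupp a <= affected tt" if "lead a tt" for tt
 proof -
  note la = lead_affected[OF that]
  show "affected tt <= {1..j}"
  proof
   fix i assume "i : affected tt"
   then obtain k where "1 <= i" "k >= i" "a k ~= 0" using la by blast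
   moreover from this have "k <= j" using step.hyps by (auto simp: asupp_def)
   ultimately show "i : {1..j}" by simp
  qed
  thus "tt : sym l" using step.hyps by (auto simp: sym_def)
  show "asupp a <= affected tt" using lead_affected[OF that] by (auto simp: asupp_def)
 qed
 have deg: "adeg l ?a = adeg l a + (if a j = 0 then 2 else 1)" using step.hyps by (intro adeg_upd)
 have asupp: "asupp ?a = insert j (asupp a)" by (auto simp: asupp_def)
 have "jmono l ?a = jm j * jmono l a" using step.hyps by (intro jmono_upd)
 hence m: "jmono l ?a = jm j * R + jm j * lsum l a" by (simp add: R_def right_diff_distrib)
 define Q where "Q = jm j * lsum l a - lsum l ?a"
 have "jmono l ?a - lsum l ?a = jm j * R + Q" by (simp add: m Q_def)
 hence "pe : keys (jm j * R) | pe : keys Q" using step.prems keys_add[of "jm j * R" Q] by (simp only:) blast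
 thus ?case
 proof
  assume "pe : keys (jm j * R)"
  then obtain b tt where b: "b : {1..<j}" "tt : keys R" "pe = {|b,j|} * tt" using keys_jm_mult[of j R] by blast
  have IH: "card (affected tt Un asupp a) < adeg l a" using step.IH b(2) by (simp add: R_def)
  have sub: "affected pe Un asupp ?a <= insert b (insert j (affected tt Un asupp a))"
   using affected_swap_times[of b j tt] b by (auto simp: asupp)
  have fin: "finite (affected tt Un asupp a)" using step.hyps finite_subset[of "asupp a" "{1..j}"] by auto
  have "card (affected pe Un asupp ?a) <= card (insert b (insert j (affected tt Un asupp a)))" using fin by (intro card_mono sub) auto
  also have "... <= Suc (card (insert j (affected tt Un asupp a)))" by (rule card_insert_le_m1) auto
  also have "card (insert j (affected tt Un asupp a)) <= card (affected tt Un asupp a) + (if a j = 0 then 1 else 0)"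
   using fin by (auto simp: card_insert_if asupp_def)
  finally show ?thesis using IH deg by (simp del: fun_upd_apply split: if_splits)
 next
  assume "pe : keys Q"
  hence ne: "lookup Q pe ~= 0" by (simp add: in_keys_iff)
  have lk: "lookup Q pe = (SUM b:{1..<j}. of_bool (lead a ({|b,j|} * pe))) - of_bool (lead ?a pe)"
  proof -
   have "lead ?a pe ==> pe : sym l"
   proof -
    assume le: "lead ?a pe"
    have "i : {1..l}" if "i : affected pe" for i
    proof -
     obtain k where "1 <= i" "k >= i" "?a k ~= 0" using lead_affected[OF le] `i : affected pe` by blast
     moreover from this have "k : asupp ?a" by (simp add: asupp_def)
     hence "k <= l" using step.hyps unfolding asupp by auto
     ultimately show ?thesis by simp
    qed
    thus "pe : sym l" by (auto simp: sym_def)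
   qed
   hence "pe : sym l & lead ?a pe <-> lead ?a pe" "tt : sym l & lead a tt <-> lead a tt" for tt using lead_sub(1) by blast+
   thus ?thesis unfolding Q_def
    by (simp only: lookup_minus lookup_lsum jm_def tr_def sum_distrib_right lookup_sum lookup_gs_mult inverse_swap)
  qed
  \<comment> \<open>The products in which b is a fixed point of the other factor add up to exactly
    the new leading part. A surviving term therefore has some b that was moved already, and then j
    is the only point that can be new.\<close>
  have "EX b:{1..<j}. lead a ({|b,j|} * pe) & ({|b,j|} * pe) $ b ~= b"
  proof (rule ccontr)
   assume no: "~ ?thesis"
   have eq: "lead a ({|b,j|} * pe) <-> b = inverse pe $ j & lead ?a pe" if b: "b : {1..<j}" for b
   proof
    assume le: "lead a ({|b,j|} * pe)"
    hence fx: "({|b,j|} * pe) $ b = b" using no b by blast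
    hence "pe $ b = j" by (simp add: apply_times)
    hence "b = inverse pe $ j" by (metis perm_apply_inverse(2))
    moreover have "pe = {|j,b|} * ({|b,j|} * pe)" by (simp add: swap_sym[of j b] flip: mult.assoc)
    hence "lead ?a pe" using lead_upd_iff[OF step.hyps(1,2), of pe] le fx b by (metis atLeastLessThan_iff)
    ultimately show "b = inverse pe $ j & lead ?a pe" by blast
   next
    assume *: "b = inverse pe $ j & lead ?a pe"
    then obtain b' tt where b': "lead a tt" "b' < j" "tt $ b' = b'" "pe = {|j,b'|} * tt"
     using lead_upd_iff[OF step.hyps(1,2), of pe] by blast
    have "pe $ b' = j" using b' by (simp add: apply_times)
    hence "b' = b" using * by (metis perm_apply_inverse(2))
    thus "lead a ({|b,j|} * pe)" using b' by (simp add: swap_sym[of j b] flip: mult.assoc)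
   qed
   have "(SUM b:{1..<j}. of_bool (lead a ({|b,j|} * pe)) :: int) = (SUM b:{1..<j}. if b = inverse pe $ j then of_bool (lead ?a pe) else 0)"
    by (intro sum.cong) (auto simp: eq)
   also have "... = of_bool (lead ?a pe)"
   proof -
    have "inverse pe $ j : {1..<j}" if le: "lead ?a pe"
    proof -
     obtain b' tt where b': "1 <= b'" "b' < j" "tt $ b' = b'" "pe = {|j,b'|} * tt" using lead_upd_iff[OF step.hyps(1,2), of pe] le by blast
     have "pe $ b' = j" using b' by (simp add: apply_times)
     hence "b' = inverse pe $ j" by (metis perm_apply_inverse(2))
     thus ?thesis using b' by simp
    qed
    thus ?thesis by auto
   qed
   finally show False using ne lk by simp
  qed
  then obtain b where b: "b : {1..<j}" "lead a ({|b,j|} * pe)" "b : affected ({|b,j|} * pe)" by (auto simp: in_affected)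
  define tt where "tt = {|b,j|} * pe"
  have pe: "pe = {|b,j|} * tt" by (simp add: tt_def flip: mult.assoc)
  have tt: "lead a tt" "b : affected tt" using b by (simp_all add: tt_def)
  have "affected pe Un asupp ?a <= insert j (affected tt)"
   using affected_swap_times[of b j tt] b(1) tt(2) lead_sub(3)[OF tt(1)] by (auto simp: asupp pe)
  hence "card (affected pe Un asupp ?a) <= card (insert j (affected tt))" by (intro card_mono) auto
  also have "... <= card (affected tt) + (if a j = 0 then 1 else 0)" using lead_sub(3)[OF tt(1)] by (auto simp: card_insert_if asupp_def)
  also have "card (affected tt) = adeg l a" using step.hyps by (intro lead_card[OF tt(1)]) (auto simp: asupp_def)
  finally show ?thesis using deg by (simp del: fun_upd_apply split: if_splits)
 qed
qed

text \<open>h (j, k) is the k-th successor of j in its cycle. A step of \<open>lead\<close> appends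
  b at the end of the cycle of j, that is, at the index Suc (a j).\<close>

lemma lead_cycles: "lead a pe ==> EX h. bij_betw h {(j, k). a j ~= 0 & k <= a j} (affected pe) &
  (ALL j k. a j ~= 0 --> k <= a j --> pe $ (h (j, k)) = h (j, if k = a j then 0 else Suc k)) &
  (ALL j. a j ~= 0 --> h (j, 0) = j)"
proof (induction rule: lead.induct)
 case base
 show ?case by (intro exI[of _ "%_. 0"]) (simp add: bij_betw_def)
next
 case (step a tt b j)
 let ?E = "{(j, k). a j ~= 0 & k <= a j}"
 let ?a = "a(j := Suc (a j))"
 let ?pe = "{|j,b|} * tt"
 from step.IH obtain h where h: "bij_betw h ?E (affected tt)"
  and hc: "!!i k. a i ~= 0 ==> k <= a i ==> tt $ (h (i, k)) = h (i, if k = a i then 0 else Suc k)"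
  and h0: "!!i. a i ~= 0 ==> h (i, 0) = i" by blast
 have aff: "affected ?pe = insert b (insert j (affected tt))" using step.hyps by (intro affected_insert) simp_all
 have b: "b ~: affected tt" "b ~= j" using step by (auto simp: in_affected)
 have j: "j : affected tt <-> a j ~= 0"
 proof
  assume "j : affected tt"
  then obtain k where "k >= j" "a k ~= 0" using lead_affected[OF step.hyps(1)] by blast
  thus "a j ~= 0" using step.hyps(5)[of k] by (cases "k = j") auto
 qed (use lead_affected[OF step.hyps(1)] in blast)
 define h1 where "h1 = (if a j = 0 then h((j, 0) := j) else h)"
 have h1: "bij_betw h1 (?E Un {(j, 0)}) (affected tt Un {j})"
 proof (cases "a j = 0")
  case True
  have "bij_betw (h((j, 0) := j)) ?E (affected tt)" using h True by (subst bij_betw_cong[of _ _ h]) auto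
  moreover have "(h((j, 0) := j)) (j, 0) ~: affected tt" using True j by simp
  ultimately have "bij_betw (h((j, 0) := j)) (?E Un {(j, 0)}) (affected tt Un {(h((j, 0) := j)) (j, 0)})"
   using True by (intro notIn_Un_bij_betw) auto
  thus ?thesis using True by (simp add: h1_def)
 next
  case False
  hence "?E Un {(j, 0)} = ?E" "affected tt Un {j} = affected tt" using j by auto
  thus ?thesis using h False by (simp add: h1_def)
 qed
 have h1j: "h1 (j, 0) = j" using h0[of j] by (simp add: h1_def)
 have h1E: "h1 (i, k) = h (i, k)" if "a i ~= 0" for i k using that by (auto simp: h1_def)
 define h' where "h' = h1((j, Suc (a j)) := b)"
 have E': "{(i, k). ?a i ~= 0 & k <= ?a i} = (?E Un {(j, 0)}) Un {(j, Suc (a j))}" by (auto simp: le_Suc_eq split: if_splits)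
 have "bij_betw h' (?E Un {(j, 0)}) (affected tt Un {j})" using h1 by (subst bij_betw_cong[of _ _ h1]) (auto simp: h'_def)
 hence "bij_betw h' ((?E Un {(j, 0)}) Un {(j, Suc (a j))}) ((affected tt Un {j}) Un {h' (j, Suc (a j))})"
  using b by (intro notIn_Un_bij_betw) (auto simp: h'_def)
 hence 1: "bij_betw h' {(i, k). ?a i ~= 0 & k <= ?a i} (affected ?pe)" unfolding E' aff by (simp add: h'_def insert_commute)
 have ttj: "tt $ (h1 (j, a j)) = j"
 proof (cases "a j = 0")
  case True
  thus ?thesis using j h1j by (simp add: in_affected)
 next
  case False
  thus ?thesis using hc[of j "a j"] h0[of j] h1E[of j] by simp
 qed
 have 2: "?pe $ (h' (i, k)) = h' (i, if k = ?a i then 0 else Suc k)" if ik: "?a i ~= 0" "k <= ?a i" for i k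
 proof -
  consider "(i, k) = (j, Suc (a j))" | "(i, k) = (j, a j)" | "a i ~= 0" "k <= a i" "(i, k) ~= (j, a j)"
   using ik by (auto simp: le_Suc_eq split: if_splits)
  thus ?thesis
  proof cases
   case 1
   thus ?thesis using step.hyps h1j by (simp add: h'_def apply_times)
  next
   case 2
   thus ?thesis using ttj by (simp add: h'_def apply_times)
  next
   case 3
   define k' where "k' = (if k = a i then 0 else Suc k)"
   have k': "k' <= a i" using 3 by (auto simp: k'_def)
   have t: "tt $ (h (i, k)) = h (i, k')" using hc 3 by (simp add: k'_def)
   have inE: "h (i, k') : affected tt" using bij_betwE[OF h] 3 k' by auto
   have "h (i, k') ~= j"
   proof
    assume eq: "h (i, k') = j"
    hence aj: "a j ~= 0" using inE j by simp
    hence "h (i, k') = h (j, 0)" using h0 eq by simp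
    hence "(i, k') = (j, 0)" using inj_onD[OF bij_betw_imp_inj_on[OF h], of "(i, k')" "(j, 0)"] 3 k' aj by auto
    thus False using 3 by (auto simp: k'_def split: if_splits)
   qed
   moreover have "h (i, k') ~= b" using inE b by auto
   moreover have "h' (i, k) = h (i, k)" "h' (i, k') = h (i, k')" using 3 k' h1E[of i] by (auto simp: h'_def)
   moreover have "(if k = ?a i then 0 else Suc k) = k'" using 3 by (auto simp: k'_def)
   ultimately show ?thesis using t by (simp add: apply_times)
  qed
 qed
 have 3: "h' (i, 0) = i" if "?a i ~= 0" for i using that h1j h0[of i] h1E[of i] by (auto simp: h'_def split: if_splits)
 show ?case using 1 2 3 by blast
qed

lemma extend_bij:
 assumes g: "bij_betw g A B" and S: "finite S" "A <= S" "B <= S"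
 shows "EX f. f permutes S & (ALL x:A. f x = g x)"
proof -
 have "card A = card B" using g by (rule bij_betw_same_card)
 hence "card (S - A) = card (S - B)" using S by (simp add: card_Diff_subset finite_subset)
 then obtain g' where g': "bij_betw g' (S - A) (S - B)" using S by (metis finite_Diff finite_same_card_bij)
 define f where "f x = (if x : A then g x else if x : S then g' x else x)" for x
 have "bij_betw f A B" using g by (subst bij_betw_cong[of _ _ g]) (auto simp: f_def)
 moreover have "bij_betw f (S - A) (S - B)" using g' by (subst bij_betw_cong[of _ _ g']) (auto simp: f_def)
 ultimately have "bij_betw f (A Un (S - A)) (B Un (S - B))" by (rule bij_betw_combine) auto
 hence "bij_betw f S S" using S by (simp add: Un_absorb1)
 hence "f permutes S" using S by (intro bij_imp_permutes) (auto simp: f_def)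
 thus ?thesis by (auto simp: f_def)
qed

text \<open>Equal multisets of exponents mean equal cycle types: the labellings of the cycles are
  matched along a permutation rh of the indices, and the resulting bijection of moved points is
  extended to all points.\<close>

lemma lead_conj:
 assumes l: "lead a pe" "lead a' pe'" and s: "pe : sym l" "pe' : sym l"
  and m: "image_mset a (mset_set {1..l}) = image_mset a' (mset_set {1..l})"
 shows "EX sg:sym l. pe' * sg = sg * pe"
proof -
 obtain rh where rh': "rh permutes {1..l}" "ALL x:{1..l}. a x = a' (rh x)"
  using image_mset_eq_implies_permutes[OF finite_atLeastAtMost m] by blast
 hence rh: "rh permutes {1..l}" "!!x. x : {1..l} ==> a x = a' (rh x)" by blast+
 let ?E = "{(j, k). a j ~= 0 & k <= a j}" let ?E' = "{(j, k). a' j ~= 0 & k <= a' j}"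
 obtain h where h: "bij_betw h ?E (affected pe)"
  and hc: "!!i k. a i ~= 0 ==> k <= a i ==> pe $ (h (i, k)) = h (i, if k = a i then 0 else Suc k)" using lead_cycles[OF l(1)] by blast
 obtain h' where h': "bij_betw h' ?E' (affected pe')"
  and hc': "!!i k. a' i ~= 0 ==> k <= a' i ==> pe' $ (h' (i, k)) = h' (i, if k = a' i then 0 else Suc k)"
  using lead_cycles[OF l(2)] by blast
 have sup: "a j ~= 0 ==> j : {1..l}" "a' j ~= 0 ==> j : {1..l}" for j
  using lead_affected[OF l(1)] lead_affected[OF l(2)] s unfolding sym_def by blast+
 define r where "r = (%(j, k). (rh j, k :: nat))"
 have r: "bij_betw r ?E ?E'"
 proof (rule bij_betw_imageI)
  show "inj_on r ?E" using permutes_inj[OF rh(1)] by (auto simp: r_def inj_on_def)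
  show "r ` ?E = ?E'"
  proof (intro equalityI subsetI)
   fix z assume "z : r ` ?E"
   then obtain j k where z: "z = (rh j, k)" "a j ~= 0" "k <= a j" by (auto simp: r_def)
   hence "a j = a' (rh j)" using rh(2) sup(1) by blast
   thus "z : ?E'" using z by simp
  next
   fix z assume "z : ?E'"
   then obtain i k where z: "z = (i, k)" "a' i ~= 0" "k <= a' i" by auto
   hence "i : rh ` {1..l}" using sup permutes_image[OF rh(1)] by auto
   then obtain j where "i = rh j" "j : {1..l}" by blast
   thus "z : r ` ?E" using z rh(2)[of j] by (auto simp: r_def intro!: image_eqI[of _ _ "(j, k)"])
  qed
 qed
 define g where "g = h' o r o the_inv_into ?E h"
 have g: "bij_betw g (affected pe) (affected pe')" unfolding g_def using bij_betw_the_inv_into[OF h] r h' by (intro bij_betw_trans)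
 have gh: "g (h (j, k)) = h' (rh j, k)" if "a j ~= 0" "k <= a j" for j k
  using the_inv_into_f_f[OF bij_betw_imp_inj_on[OF h], of "(j, k)"] that by (simp add: g_def r_def)
 obtain f where f: "f permutes {1..l}" "!!x. x : affected pe ==> f x = g x" using extend_bij[OF g, of "{1..l}"] s by (auto simp: sym_def)
 obtain sg where sg: "sg : sym l" "apply sg = f" using ex_perm[OF f(1)] by (auto simp: sym_sgrp)
 have "(pe' * sg) $ x = (sg * pe) $ x" for x
 proof (cases "x : affected pe")
  case True
  hence "x : h ` ?E" using bij_betw_imp_surj_on[OF h] by blast
  then obtain j k where jk: "a j ~= 0" "k <= a j" "x = h (j, k)" by auto
  have aj: "a' (rh j) = a j" using rh(2)[OF sup(1)[OF jk(1)]] by (rule sym)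
  have "pe $ x : affected pe" using True by simp
  thus ?thesis using jk gh[of j k] gh[of j "if k = a j then 0 else Suc k"] hc[of j k] hc'[of "rh j" k] aj f(2) True
   by (simp add: apply_times sg(2) split: if_splits)
 next
  case False
  have "f x ~: affected pe'"
  proof
   assume "f x : affected pe'"
   then obtain y where "y : affected pe" "g y = f x" using bij_betw_imp_surj_on[OF g] by (metis imageE)
   hence "f y = f x" using f(2) by simp
   hence "y = x" using permutes_inj[OF f(1)] by (auto dest: injD)
   thus False using `y : affected pe` False by simp
  qed
  thus ?thesis using False by (simp add: apply_times sg(2) in_affected)
 qed
 hence "pe' * sg = sg * pe" by (intro perm_eqI) auto
 with sg show ?thesis by blast
qed

section \<open>Monomial symmetric polynomials in the Jucys-Murphy elements\<close>

definition Aset :: "nat => nat multiset => (nat => nat) set" where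
 "Aset l nu = {a. asupp a <= {1..l} & image_mset a (mset_set {1..l}) = nu}"

lemma finite_Aset [simp]: "finite (Aset l nu)"
proof (rule finite_subset)
 show "Aset l nu <= {f. ALL x. (x : {1..l} --> f x : set_mset nu) & (x ~: {1..l} --> f x = 0)}" by (auto simp: Aset_def asupp_def)
 show "finite {f. ALL x. (x : {1..l} --> f x : set_mset nu) & (x ~: {1..l} --> f x = (0::nat))}" by (rule finite_set_of_finite_funs) auto
qed

lemma Aset_permute:
 assumes "rh permutes {1..l}" "a : Aset l nu"
 shows "a o rh : Aset l nu"
proof -
 have "asupp (a o rh) <= {1..l}"
 proof
  fix x assume "x : asupp (a o rh)"
  hence "rh x : {1..l}" using assms(2) by (auto simp: asupp_def Aset_def)
  thus "x : {1..l}" by (metis assms(1) permutes_in_image)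
 qed
 moreover have "image_mset (a o rh) (mset_set {1..l}) = image_mset a (mset_set {1..l})"
 proof -
  have "image_mset (a o rh) (mset_set {1..l}) = image_mset a (image_mset rh (mset_set {1..l}))" by (simp only: image_mset.compositionality)
  also have "image_mset rh (mset_set {1..l}) = mset_set {1..l}"
   using image_mset_mset_set[OF permutes_inj_on[OF assms(1)], of "{1..l}"] permutes_image[OF assms(1)] by (simp only:)
  finally show ?thesis .
 qed
 ultimately show ?thesis using assms(2) by (simp add: Aset_def)
qed

text \<open>The monomial symmetric polynomial of type nu, each monomial occurring once; nu is the
  multiset of all l exponents, zeros included.\<close>

definition msum :: "nat => nat multiset => int galg" where
 "msum l nu = (SUM a:Aset l nu. jmono l a)"

definition mtail :: "nat => nat => (nat => nat) => int galg" where
 "mtail r l a = prod_list (map (%j. jm j ^ a j) [Suc (Suc r)..<Suc l])"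

lemma jmono_split:
 "1 <= r ==> r < l ==> jmono l a = jmono (r - 1) a * (jm r ^ a r * jm (Suc r) ^ a (Suc r)) * mtail r l a"
proof -
 assume r: "1 <= r" "r < l"
 have "[1..<Suc l] = [1..<r] @ [r, Suc r] @ [Suc (Suc r)..<Suc l]"
 proof -
  have "[1..<Suc l] = [1..<r] @ [r..<Suc l]" using upt_add_eq_append[of 1 r "Suc l - r"] r by simp
  also have "[r..<Suc l] = r # Suc r # [Suc (Suc r)..<Suc l]" using r by (simp add: upt_conv_Cons del: upt_Suc)
  finally show ?thesis by simp
 qed
 moreover have "[1..<Suc (r - 1)] = [1..<r]" using r by simp
 ultimately show ?thesis by (simp add: jmono_def mtail_def mult.assoc del: upt_Suc)
qed

text \<open>Power sums x^d + y^d satisfy a recursion with the coefficients x + y and x y, which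
  commute with s; a common power of x y gives the general case.\<close>

lemma sr_sym_powers:
 assumes r: "1 <= r"
 defines "x == jm r :: int galg" and "y == jm (Suc r) :: int galg" and "s == sr r :: int galg"
 shows "s * (x ^ i * y ^ j + x ^ j * y ^ i) = (x ^ i * y ^ j + x ^ j * y ^ i) * s"
proof -
 have xy: "x * y = y * x" by (simp add: x_def y_def jm_commute)
 have ys: "y * s = s * x + 1" and sy: "s * y = x * s + 1" unfolding x_def y_def s_def by (rule jm_Suc_sr[OF r], rule sr_jm_Suc[OF r])
 have c1: "s * (x + y) = (x + y) * s" by (simp add: distrib_left distrib_right ys sy)
 have c2: "s * (x * y) = (x * y) * s"
 proof -
  have "s * (x * y) = (y * s - 1) * y" by (simp add: ys flip: mult.assoc)
  also have "... = y * (x * s + 1) - y" by (simp add: left_diff_distrib mult.assoc sy)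
  also have "... = x * y * s" by (simp add: distrib_left xy mult.assoc)
  finally show ?thesis .
 qed
 have p: "s * (x ^ d + y ^ d) = (x ^ d + y ^ d) * s" for d
 proof (induction d rule: less_induct)
  case (less d)
  consider "d = 0" | "d = 1" | e where "d = Suc (Suc e)" by (metis One_nat_def not0_implies_Suc)
  thus ?case
  proof cases
   case 3
   have "x ^ d + y ^ d = (x + y) * (x ^ Suc e + y ^ Suc e) - (x * y) * (x ^ e + y ^ e)"
    using 3 by (simp add: distrib_left distrib_right mult.assoc[symmetric] xy)
   moreover have "s * ((x + y) * (x ^ Suc e + y ^ Suc e)) = (x + y) * (x ^ Suc e + y ^ Suc e) * s"
    by (rule comm_multI[OF c1 less]) (simp add: 3)
   moreover have "s * ((x * y) * (x ^ e + y ^ e)) = (x * y) * (x ^ e + y ^ e) * s" by (rule comm_multI[OF c2 less]) (simp add: 3)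
   ultimately show ?thesis by (simp add: diff_distrib)
  qed (use c1 in \<open>auto simp: mult_2 mult_2_right distrib_left distrib_right\<close>)
 qed
 have cp: "s * (x * y) ^ n = (x * y) ^ n * s" for n using power_commuting_commutes[of "x * y" s n] c2 by simp
 have main: "s * (x ^ i * y ^ (i + d) + x ^ (i + d) * y ^ i) = (x ^ i * y ^ (i + d) + x ^ (i + d) * y ^ i) * s" for i d
 proof -
  have "x ^ i * y ^ (i + d) + x ^ (i + d) * y ^ i = (x * y) ^ i * (x ^ d + y ^ d)"
  proof -
   have yx: "y ^ i * x ^ d = x ^ d * y ^ i"
    by (rule power_commuting_commutes[OF power_commuting_commutes[OF xy, symmetric], symmetric, symmetric])
   have "(x * y) ^ i = x ^ i * y ^ i" using xy by (rule power_mult_commuting)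
   thus ?thesis by (simp only: power_add distrib_left mult.assoc yx) (rule add.commute)
  qed
  thus ?thesis using p cp by (simp only:) (intro comm_multI)
 qed
 show ?thesis
 proof (cases "i <= j")
  case True
  thus ?thesis using main[of i "j - i"] by simp
 next
  case False
  thus ?thesis using main[of j "i - j"] by (simp add: add.commute)
 qed
qed

lemma double_diff: "a + a = b + b ==> (a - b) + (a - b) = (0 :: 'a::ab_group_add)" by (simp add: algebra_simps)

lemma sr_msum:
 assumes r: "1 <= r" "r < l"
 shows "sr r * msum l nu = msum l nu * sr r"
proof -
 let ?s = "sr r :: int galg"
 let ?t = "transpose r (Suc r)"
 have tp: "?t permutes {1..l}" using r by (intro permutes_swap_id) auto
 have "(SUM a:Aset l nu. jmono l (a o ?t)) = msum l nu" unfolding msum_def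
  by (rule sum.reindex_bij_witness[of _ "%a. a o ?t" "%a. a o ?t"]) (auto intro: Aset_permute[OF tp] simp: comp_assoc)
 \<comment> \<open>Each monomial is paired with the one whose exponents at r and r + 1 are
   exchanged. Everything is counted twice; this is undone at the end, as there is no
   2-torsion.\<close>
 hence d: "msum l nu + msum l nu = (SUM a:Aset l nu. jmono l a + jmono l (a o ?t))" by (simp add: sum.distrib msum_def)
 have "?s * (jmono l a + jmono l (a o ?t)) = (jmono l a + jmono l (a o ?t)) * ?s" for a
 proof -
  have m1: "jmono (r - 1) (a o ?t) = jmono (r - 1) a" by (intro jmono_cong) (auto simp: transpose_def)
  have m2: "mtail r l (a o ?t) = mtail r l a"
   unfolding mtail_def by (intro arg_cong[of _ _ prod_list] map_cong refl) (auto simp: transpose_def)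
  have pre: "?s * jmono (r - 1) a = jmono (r - 1) a * ?s"
  proof -
   have "i <= r - 1 ==> ?s * jmono i a = jmono i a * ?s" for i
   proof (induction i)
    case (Suc i)
    have "?s * jm (Suc i) = jm (Suc i) * ?s" using Suc r by (intro sr_jm) auto
    hence "?s * jm (Suc i) ^ n = jm (Suc i) ^ n * ?s" for n using power_commuting_commutes[of "jm (Suc i)" ?s n] by simp
    with Suc show ?case by (auto simp: jmono_Suc intro!: comm_multI)
   qed simp
   thus ?thesis by simp
  qed
  have post: "?s * mtail r l a = mtail r l a * ?s"
  proof -
   have "!!j. j : set js ==> j > Suc r ==> True" for js :: "nat list" by simp
   have "(!!j. j : set js ==> j > Suc r) ==> ?s * prod_list (map (%j. jm j ^ a j) js) = prod_list (map (%j. jm j ^ a j) js) * ?s" for js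
   proof (induction js)
    case (Cons j js)
    have "?s * jm j = jm j * ?s" using Cons.prems[of j] r by (intro sr_jm) auto
    hence "?s * jm j ^ n = jm j ^ n * ?s" for n using power_commuting_commutes[of "jm j" ?s n] by simp
    with Cons show ?case by (auto intro!: comm_multI)
   qed simp
   from this[of "[Suc (Suc r)..<Suc l]"] show ?thesis by (simp add: mtail_def del: upt_Suc)
  qed
  have "jmono l a + jmono l (a o ?t) = jmono (r - 1) a * (jm r ^ a r * jm (Suc r) ^ a (Suc r) + jm r ^ a (Suc r) * jm (Suc r) ^ a r) * mtail r l a"
   unfolding jmono_split[OF r] m1 m2 by (simp add: distrib_left distrib_right)
  thus ?thesis using pre post sr_sym_powers[OF r(1)] by (simp only:) (intro comm_multI)
 qed
 hence "?s * (msum l nu + msum l nu) = (msum l nu + msum l nu) * ?s" unfolding d by (simp add: sum_distrib_left sum_distrib_right)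
 hence "(?s * msum l nu - msum l nu * ?s) + (?s * msum l nu - msum l nu * ?s) = 0"
  by (rule double_diff[OF trans[OF distrib_left[symmetric] trans[OF _ distrib_right]]])
 from int_galg_double_zero[OF this] show ?thesis by simp
qed

lemma gs_msum: "sg : sym l ==> gs sg * msum l nu = msum l nu * gs sg" unfolding sym_sgrp
proof (induction sg rule: sgrp_interval_induct)
 case (swap tt r)
 have g: "gs ({|r,Suc r|} * tt) = sr r * (gs tt :: int galg)" by (simp add: tr_def gs_mult)
 show ?case unfolding g by (rule comm_multI[symmetric]) (use swap sr_msum[of r l nu] in auto)
qed simp

lemma GA_jmono: "jmono l a : (GA l :: 'r::comm_ring_1 galg set)"
proof -
 have "i <= l ==> jmono i a : (GA l :: 'r galg set)" for i by (induction i) (auto simp: jmono_Suc intro!: GA_mult GA_power GA_jm)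
 thus ?thesis by simp
qed

lemma red_jmono: "red (jmono l a) = (jmono l a :: 'k::comm_ring_1 galg)" by (induction l) (auto simp: jmono_Suc red_mult red_power)

lemma adeg_mset: "adeg l a = (\<Sum>x\<in>#image_mset a (mset_set {1..l}). if x = 0 then 0 else Suc x)"
 by (simp add: adeg_def image_mset.compositionality comp_def sum_unfold_sum_mset)

text \<open>By \<open>jmono_leading\<close> and \<open>lead_unique\<close> a permutation moving at
  least as many points as the degree of nu can occur only as a leading term, with coefficient 1, and
  in one monomial only.\<close>

lemma lookup_msum:
 assumes pe: "pe : sym l" "lead a pe" and deg: "card (affected pe) >= (\<Sum>x\<in>#nu. if x = 0 then 0 else Suc x)"
 shows "lookup (msum l nu) pe = of_bool (image_mset a (mset_set {1..l}) = nu)"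
proof -
 have sup: "asupp a <= {1..l}" using lead_affected[OF pe(2)] pe(1) by (auto simp: asupp_def sym_def)
 have "lookup (jmono l a' :: int galg) pe = of_bool (a' = a)" if "a' : Aset l nu" for a'
 proof -
  have a': "asupp a' <= {1..l}" "adeg l a' = (\<Sum>x\<in>#nu. if x = 0 then 0 else Suc x)" using that by (auto simp: Aset_def adeg_mset)
  have "card (affected pe) <= card (affected pe Un asupp a')" using a'(1) finite_subset by (intro card_mono) auto
  hence "pe ~: keys (jmono l a' - lsum l a')" using jmono_leading[OF a'(1), of pe] a'(2) deg by auto
  hence "lookup (jmono l a' :: int galg) pe = lookup (lsum l a') pe" by (simp add: in_keys_iff lookup_minus)
  moreover have "lead a' pe <-> a' = a" using pe lead_unique by blast
  ultimately show ?thesis using pe by (simp add: lookup_lsum)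
 qed
 hence "lookup (msum l nu) pe = (SUM a':Aset l nu. of_bool (a' = a))" by (simp add: msum_def lookup_sum)
 also have "... = of_bool (a : Aset l nu)" by (simp add: of_bool_def)
 finally show ?thesis using sup by (simp add: Aset_def)
qed

section \<open>Central elements as functions of the residues of a weight\<close>

definition rmset :: "nat => nat => (nat => int) => int multiset" where
 "rmset p m f = image_mset (%j. f j mod int p) (mset_set {1..m})"

text \<open>The condition is imposed on pairs of weight vectors, so that one and the same scalar
  serves both.\<close>

definition symval :: "nat => nat => 'k::comm_ring_1 galg => bool" where
 "symval p l z <-> (ALL (v :: 'k galg) v' f f'. wtv l f v --> wtv l f' v' -->
  rmset p l f = rmset p l f' -->
  (EX s::int. z * v = of_int s * v & z * v' = of_int s * v'))"

lemma symval_add: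
 assumes x: "symval p l x" and y: "symval p l y"
 shows "symval p l (x + y)" unfolding symval_def
proof (intro allI impI)
 fix v v' :: "'a galg" and f f'
 assume h: "wtv l f v" "wtv l f' v'" "rmset p l f = rmset p l f'"
 obtain s where s: "x * v = of_int s * v" "x * v' = of_int s * v'" using x h unfolding symval_def by blast
 obtain u where u: "y * v = of_int u * v" "y * v' = of_int u * v'" using y h unfolding symval_def by blast
 show "EX s::int. (x + y) * v = of_int s * v & (x + y) * v' = of_int s * v'" by (intro exI[of _ "s + u"]) (simp add: distrib_right s u)
qed

lemma symval_of_int_mult:
 assumes x: "symval p l x"
 shows "symval p l (of_int c * x)" unfolding symval_def
proof (intro allI impI)
 fix v v' :: "'a galg" and f f'
 assume h: "wtv l f v" "wtv l f' v'" "rmset p l f = rmset p l f'"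
 obtain s where s: "x * v = of_int s * v" "x * v' = of_int s * v'" using x h unfolding symval_def by blast
 show "EX s::int. (of_int c * x) * v = of_int s * v & (of_int c * x) * v' = of_int s * v'"
  by (intro exI[of _ "c * s"]) (simp add: s mult.assoc)
qed

lemma symval_zero: "symval p l 0" unfolding symval_def by (auto intro!: exI[of _ 0])

lemma symval_sum: "(!!i. i : I ==> symval p l (f i)) ==> symval p l (sum f I)"
 by (induction I rule: infinite_finite_induct) (auto intro: symval_add symval_zero)

lemma jmono_wtv: "wtv l f v ==> jmono l a * v = of_int (PROD j:{1..l}. f j ^ a j) * v"
proof -
 assume w: "wtv l f v"
 have "jmono l a * v = of_int (prod_list (map (%j. f j ^ a j) [1..<Suc l])) * v" unfolding jmono_def
 proof (rule prod_list_eigen)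
  fix j assume "j : set [1..<Suc l]"
  thus "jm j ^ a j * v = of_int (f j ^ a j) * v" using wtvD[OF w] by (intro power_eigen) auto
 qed
 also have "prod_list (map (%j. f j ^ a j) [1..<Suc l]) = (PROD j:{1..l}. f j ^ a j)"
  by (simp add: prod.distinct_set_conv_list atLeastLessThanSuc_atLeastAtMost del: upt_Suc flip: prod.distinct_set_conv_list)
 finally show ?thesis .
qed

lemma symval_msum:
 assumes 0: "of_nat p = (0 :: 'k::comm_ring_1 galg)"
 shows "symval p l (red (msum l nu) :: 'k galg)" unfolding symval_def
proof (intro allI impI)
 fix v v' :: "'k galg" and f f'
 assume w: "wtv l f v" "wtv l f' v'"
  and m: "rmset p l f = rmset p l f'"
 obtain rh where rh': "rh permutes {1..l}" "ALL x:{1..l}. f x mod int p = f' (rh x) mod int p"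
  using image_mset_eq_implies_permutes[OF finite_atLeastAtMost m[unfolded rmset_def]] by blast
 hence rh: "rh permutes {1..l}" "!!x. x : {1..l} ==> f x mod int p = f' (rh x) mod int p" by blast+
 define S where "S f = (SUM a:Aset l nu. PROD j:{1..l}. f j ^ a j)" for f :: "nat => int"
 have act: "red (msum l nu) * v = of_int (S f) * v" if "wtv l f v" for v :: "'k galg" and f
  using that by (simp add: msum_def red_sum red_jmono sum_distrib_right jmono_wtv S_def)
 have "[S f = (SUM a:Aset l nu. PROD j:{1..l}. f' (rh j) ^ a j)] (mod int p)"
  unfolding S_def using rh(2) by (intro cong_sum cong_prod cong_pow) (auto simp: cong_def)
 also have "(SUM a:Aset l nu. PROD j:{1..l}. f' (rh j) ^ a j) = (SUM a:Aset l nu. PROD j:{1..l}. f' (rh j) ^ (a o rh) j)"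
 proof (rule sum.reindex_bij_witness[of _ "%a. a o rh" "%a. a o inv rh"])
  fix a assume a: "a : Aset l nu"
  show "a o inv rh : Aset l nu" using a permutes_inv[OF rh(1)] by (rule Aset_permute[rotated])
  show "a o inv rh o rh = a" "a o rh o inv rh = a" using permutes_inv_o[OF rh(1)] by (simp_all add: comp_assoc)
  show "a o rh : Aset l nu" using a rh(1) by (rule Aset_permute[rotated])
  show "(PROD j:{1..l}. f' (rh j) ^ (a o inv rh o rh) j) = (PROD j:{1..l}. f' (rh j) ^ a j)"
   using permutes_inv_o[OF rh(1)] by (simp add: comp_assoc)
 qed
 also have "... = S f'" unfolding S_def
 proof (rule sum.cong[OF refl])
  fix a
  show "(PROD j:{1..l}. f' (rh j) ^ (a o rh) j) = (PROD j:{1..l}. f' j ^ a j)"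
   using prod.permute[OF rh(1), of "%j. f' j ^ a j"] by (simp add: comp_def)
 qed
 finally have "[S f = S f'] (mod int p)" .
 hence "(of_int (S f) :: 'k galg) = of_int (S f')" by (rule of_int_cong[OF 0])
 thus "EX s::int. red (msum l nu) * v = of_int s * v & red (msum l nu) * v' = of_int s * v'"
  using act[OF w(1)] act[OF w(2)] by (intro exI[of _ "S f'"]) simp
qed

text \<open>An integral form of the theorem of Jucys and Murphy that symmetric polynomials in the
  Jucys-Murphy elements exhaust the centre. The coefficients of z at permutations with the most
  moved points depend on the cycle type only, so an integral combination M of the
  \<open>msum\<close> cancels them, and z - M has fewer moved points. As the leading coefficients
  are 1, the combination survives reduction modulo p.\<close>

theorem centre_symval:
 fixes z :: "int galg"
 assumes 0: "of_nat p = (0 :: 'k::comm_ring_1 galg)"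
  and z: "z : GA l" "!!sg. sg : sym l ==> gs sg * z = z * gs sg"
 shows "symval p l (red z :: 'k galg)"
proof -
 have "symval p l (red z :: 'k galg)"
  if "z : GA l" "!!sg. sg : sym l ==> gs sg * z = z * gs sg"
   "!!pe. pe : keys z ==> card (affected pe) < d" for z :: "int galg" and d using that
 proof (induction d arbitrary: z)
  case 0
  hence "keys z = {}" by blast
  hence "z = 0" by simp
  thus ?case using symval_zero by simp
 next
  case (Suc d)
  define lp where "lp pe = (SOME a. lead a pe)" for pe
  have lp: "lead (lp pe) pe" if "pe : sym l" for pe unfolding lp_def using lead_exists[OF that] by (rule someI_ex)
  define ty where "ty pe = image_mset (lp pe) (mset_set {1..l})" for pe
  have ty_deg: "(\<Sum>x\<in>#ty pe. if x = 0 then 0 else Suc x) = card (affected pe)" if "pe : sym l" for pe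
  proof -
   have "card (affected pe) = adeg l (lp pe)"
   proof (rule lead_card[OF lp[OF that]])
    fix j assume "lp pe j ~= 0"
    hence "j : affected pe" using lead_affected[OF lp[OF that]] by blast
    thus "j <= l" using that by (auto simp: sym_def)
   qed
   thus ?thesis by (simp add: adeg_mset ty_def)
  qed
  have zsym: "pe : keys z ==> pe : sym l" for pe using Suc.prems(1) by (auto simp: group_algebra_def)
  have zconj: "lookup z pe = lookup z pe'" if pepe: "pe : sym l" "pe' : sym l" "ty pe = ty pe'" for pe pe'
  proof -
   obtain sg where sg: "sg : sym l" "pe' * sg = sg * pe"
    using lead_conj[OF lp[OF pepe(1)] lp[OF pepe(2)] pepe(1,2) pepe(3)[unfolded ty_def]] by blast
   have "lookup (gs sg * z) (sg * pe) = lookup z pe" by (simp add: lookup_gs_mult flip: mult.assoc)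
   moreover have "lookup (z * gs sg) (pe' * sg) = lookup z pe'" by (simp add: lookup_mult_gs mult.assoc)
   ultimately show ?thesis using Suc.prems(2)[OF sg(1)] sg(2) by simp
  qed
  define K where "K = {pe : keys z. card (affected pe) = d}"
  define rp where "rp nu = (SOME pe. pe : K & ty pe = nu)" for nu
  have rp: "rp nu : K & ty (rp nu) = nu" if "nu : ty ` K" for nu
  proof -
   have "EX pe. pe : K & ty pe = nu" using that by blast
   thus ?thesis unfolding rp_def by (rule someI_ex)
  qed
  define c where "c nu = lookup z (rp nu)" for nu
  define M where "M = (SUM nu:ty ` K. of_int (c nu) * msum l nu)"
  have finK: "finite K" by (simp add: K_def)
  have Ksym: "pe : sym l" "card (affected pe) = d" if "pe : K" for pe using that zsym by (auto simp: K_def)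
  define z' where "z' = z - M"
  have Mga: "M : GA l" unfolding M_def msum_def by (intro GA_sum GA_mult GA_of_int GA_jmono)
  have Mc: "gs sg * M = M * gs sg" if "sg : sym l" for sg unfolding M_def sum_distrib_left sum_distrib_right
   by (intro sum.cong refl comm_multI gs_msum that) (simp add: mult_of_int_commute)
  have lkM: "lookup M pe = (SUM nu:ty ` K. c nu * of_bool (ty pe = nu))" if "pe : sym l" "card (affected pe) >= d" for pe
  proof -
   have "lookup (msum l nu) pe = of_bool (ty pe = nu)" if nu: "nu : ty ` K" for nu
   proof -
    obtain kp where "kp : K" "nu = ty kp" using nu by blast
    hence "(\<Sum>x\<in>#nu. if x = 0 then 0 else Suc x) = d" using ty_deg Ksym by simp
    thus ?thesis using lookup_msum[OF `pe : sym l` lp[OF `pe : sym l`], of nu] `card (affected pe) >= d` by (simp add: ty_def)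
   qed
   thus ?thesis by (simp add: M_def lookup_sum lookup_of_int_mult_int)
  qed
  have "symval p l (red z' :: 'k galg)"
  proof (rule Suc.IH)
   show "z' : GA l" unfolding z'_def by (intro GA_diff Mga Suc.prems)
   show "gs sg * z' = z' * gs sg" if "sg : sym l" for sg using Mc[OF that] Suc.prems(2)[OF that] by (simp add: z'_def diff_distrib)
   fix pe assume pe: "pe : keys z'"
   have pes: "pe : sym l" using `z' : GA l` pe by (auto simp: group_algebra_def)
   show "card (affected pe) < d"
   proof (rule ccontr)
    assume nd: "~ card (affected pe) < d"
    hence lk: "lookup M pe = (SUM nu:ty ` K. c nu * of_bool (ty pe = nu))" using lkM pes by simp
    have "lookup z pe = lookup M pe"
    proof (cases "ty pe : ty ` K")
     case True
     have "lookup M pe = c (ty pe)" using finK True by (simp add: lk of_bool_def if_distrib[of "%x. _ * x"] cong: if_cong)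
     moreover have "lookup z pe = c (ty pe)" unfolding c_def using zconj[OF pes] rp[OF True] Ksym by metis
     ultimately show ?thesis by simp
    next
     case False
     hence "pe ~: K" by blast
     hence "lookup z pe = 0" using nd Suc.prems(3)[of pe] by (auto simp: K_def in_keys_iff less_Suc_eq)
     moreover have "lookup M pe = 0" using False unfolding lk by (intro sum.neutral) auto
     ultimately show ?thesis by simp
    qed
    thus False using pe by (simp add: z'_def in_keys_iff lookup_minus)
   qed
  qed
  moreover have "symval p l (red M :: 'k galg)" unfolding M_def red_sum red_mult red_of_int
   by (intro symval_sum symval_of_int_mult symval_msum 0)
  ultimately have "symval p l (red z' + red M :: 'k galg)" by (rule symval_add)
  thus ?case by (simp add: z'_def flip: red_add)
 qed
 from this[OF z, of "Suc (Max (insert 0 (card ` affected ` keys z)))"]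
 show ?thesis by (auto simp: less_Suc_eq_le intro!: Max_ge)
qed

section \<open>The action of the centraliser algebra on weight vectors\<close>

definition csum :: "nat perm set => 'r::comm_ring_1 galg" where
 "csum K = (SUM pe:K. gs pe)"

lemma perm_inverse_inverse: "inverse (inverse sg) = (sg :: 'a perm)" using minus_minus[of sg] by (simp add: uminus_perm_def)

lemma perm_inverse_one [simp]: "inverse 1 = (1 :: 'a perm)"
 using minus_zero[where ?'a = "'a perm"] by (simp add: zero_perm_def uminus_perm_def)

lemma red_class_sum: "red (class_sum K) = csum K" by (simp add: class_sum_def csum_def red_sum)

lemma lookup_csum: "finite K ==> lookup (csum K) tt = of_bool (tt : K)" by (simp add: csum_def lookup_sum lookup_single when_def)

lemma lookup_scalar_mult: "lookup (single 0 a * x) tt = a * lookup (x :: 'r::comm_ring_1 galg) tt"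
proof (induction x rule: galg_induct)
 case (single sg c)
 thus ?case by (simp add: mult_single lookup_single when_def)
qed (simp_all add: distrib_left lookup_add)

lemma conj_class_self: "pe : conj_class l pe" unfolding conj_class_def sym_sgrp by (intro CollectI exI[of _ 1]) simp

lemma conj_classI: "sg : sym l ==> sg * pe * inverse sg : conj_class l pe" by (auto simp: conj_class_def)

lemma conj_class_trans: "rh : conj_class l pe ==> tt : conj_class l rh ==> tt : conj_class l pe"
proof -
 assume "rh : conj_class l pe" "tt : conj_class l rh"
 then obtain sg sg' where "sg : sym l" "sg' : sym l" "tt = sg' * (sg * pe * inverse sg) * inverse sg'" by (auto simp: conj_class_def)
 thus ?thesis using conj_classI[of "sg' * sg" l pe] by (simp add: sym_sgrp sgrp_mult mult.assoc)
qed

lemma conj_class_sym: "rh : conj_class l pe ==> pe : conj_class l rh"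
proof -
 assume "rh : conj_class l pe"
 then obtain sg where sg: "sg : sym l" "rh = sg * pe * inverse sg" by (auto simp: conj_class_def)
 have "inverse sg * rh * inverse (inverse sg) = (inverse sg * sg) * pe * (inverse sg * sg)"
  unfolding sg(2) by (simp only: mult.assoc perm_inverse_inverse)
 thus ?thesis using sg conj_classI[of "inverse sg" l rh] by (simp add: sym_sgrp)
qed

lemma conj_class_eq: "rh : conj_class l pe ==> conj_class l rh = conj_class l pe" using conj_class_trans conj_class_sym by blast

lemma finite_conj_class [simp]: "finite (conj_class l pe)" by (simp add: conj_class_def setcompr_eq_image)

lemma finite_conj_classes [simp]: "finite (conj_classes l m)" by (simp add: conj_classes_def)

lemma conj_class_sub: "pe : sym m ==> l <= m ==> conj_class l pe <= sym m"
proof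
 fix rh assume "pe : sym m" "l <= m" "rh : conj_class l pe"
 then obtain sg where sg: "sg : sym l" "rh = sg * pe * inverse sg" by (auto simp: conj_class_def)
 thus "rh : sym m" using `pe : sym m` sym_mono[OF `l <= m` sg(1)] by (simp add: sym_sgrp sgrp_mult)
qed

lemma csum_cent:
 assumes "pe : sym m" "l <= m"
 shows "(csum (conj_class l pe) :: 'r::comm_ring_1 galg) : CA l m"
proof -
 have "gs sg * csum (conj_class l pe) = csum (conj_class l pe) * (gs sg :: 'r galg)" if sg: "sg : sym l" for sg
 proof (rule poly_mapping_eqI)
  fix tt
  have "inverse sg * tt : conj_class l pe <-> tt * inverse sg : conj_class l pe"
  proof -
   have e: "sg * (inverse sg * tt) * inverse sg = tt * inverse sg" by (simp flip: mult.assoc)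
   have "tt * inverse sg : conj_class l (inverse sg * tt)" using conj_classI[OF sg, of "inverse sg * tt"] by (simp only: e)
   thus ?thesis by (metis conj_class_trans conj_class_sym)
  qed
  thus "lookup (gs sg * csum (conj_class l pe) :: 'r galg) tt = lookup (csum (conj_class l pe) * gs sg) tt"
   by (simp add: lookup_gs_mult lookup_mult_gs lookup_csum)
 qed
 moreover have "(csum (conj_class l pe) :: 'r galg) : GA m" unfolding csum_def using conj_class_sub[OF assms] by (intro GA_sum GA_gs) auto
 ultimately show ?thesis by (simp add: cent_iff)
qed

lemma cent_decomp:
 fixes c :: "'r::comm_ring_1 galg"
 assumes c: "c : CA l m" and "l <= m"
 shows "c = (SUM K:conj_classes l m. single 0 (class_coeff c K) * csum K)"
proof (rule poly_mapping_eqI)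
 fix tt
 have fin: "finite K" if "K : conj_classes l m" for K using that by (auto simp: conj_classes_def)
 have "lookup (SUM K:conj_classes l m. single 0 (class_coeff c K) * csum K) tt
  = (SUM K:conj_classes l m. class_coeff c K * of_bool (tt : K))" by (simp add: lookup_sum lookup_scalar_mult lookup_csum fin)
 also have "... = (SUM K:conj_classes l m. if K = conj_class l tt then class_coeff c K else 0)"
 proof (intro sum.cong refl)
  fix K assume "K : conj_classes l m"
  then obtain pe where K: "K = conj_class l pe" by (auto simp: conj_classes_def)
  have "tt : K <-> K = conj_class l tt" using K conj_class_eq conj_class_self by auto
  thus "class_coeff c K * of_bool (tt : K) = (if K = conj_class l tt then class_coeff c K else 0)" by simp
 qed
 also have "... = (if conj_class l tt : conj_classes l m then class_coeff c (conj_class l tt) else 0)" by simp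
 also have "... = (if conj_class l tt : conj_classes l m then lookup c tt else 0)" using c by (simp add: class_coeff_eq)
 also have "... = lookup c tt"
 proof (cases "conj_class l tt : conj_classes l m")
  case False
  hence "tt ~: sym m" by (auto simp: conj_classes_def)
  moreover have "keys c <= sym m" using c by (simp add: centraliser_algebra_def group_algebra_def)
  ultimately show ?thesis using False by (auto simp: in_keys_iff)
 qed simp
 finally show "lookup c tt = lookup (SUM K:conj_classes l m. single 0 (class_coeff c K) * csum K) tt" by simp
qed

section \<open>The outer symmetric group acting on a weight vector\<close>

definition nspan :: "nat perm set => 'r::comm_ring_1 galg => 'r galg set" where
 "nspan W v = {a * v | a. keys a <= W}"

lemma nspan_add: "x : nspan W v ==> y : nspan W v ==> x + y : nspan W v"
proof -
 assume "x : nspan W v" "y : nspan W v"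
 then obtain a b where "x = a * v" "y = b * v" "keys a <= W" "keys b <= W" by (auto simp: nspan_def)
 thus ?thesis unfolding nspan_def using Poly_Mapping.keys_add[of a b] by (intro CollectI exI[of _ "a + b"]) (auto simp: distrib_right)
qed

lemma keys_scalar_mult: "keys (single 0 c * (a :: 'r::comm_ring_1 galg)) <= keys a" by (auto simp: in_keys_iff lookup_scalar_mult)

lemma nspan_scalar: "x : nspan W v ==> single 0 c * x : nspan W v"
proof -
 assume "x : nspan W v"
 then obtain a where "x = a * v" "keys a <= W" by (auto simp: nspan_def)
 thus ?thesis unfolding nspan_def using keys_scalar_mult[of c a] by (intro CollectI exI[of _ "single 0 c * a"]) (auto simp: mult.assoc)
qed

lemma nspan_diff: "x : nspan W v ==> y : nspan W v ==> x - y : nspan W v"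
proof -
 assume x: "x : nspan W v" and "y : nspan W v"
 hence "single 0 (-1) * y : nspan W v" using nspan_scalar by blast
 thus ?thesis using nspan_add[OF x, of "- y"] by (simp add: single_uminus)
qed

lemma nspan_zero [simp]: "0 : nspan W v" by (auto simp: nspan_def intro: exI[of _ 0])

lemma nspan_sum: "(!!i. i : I ==> f i : nspan W v) ==> sum f I : nspan W v"
 by (induction I rule: infinite_finite_induct) (auto intro: nspan_add)

lemma nspan_gs: "sg : sgrp S ==> x : nspan (sgrp S) v ==> gs sg * x : nspan (sgrp S) v"
proof -
 assume sg: "sg : sgrp S" and "x : nspan (sgrp S) v"
 then obtain a where a: "x = a * v" "keys a <= sgrp S" by (auto simp: nspan_def)
 have "tt : sgrp S" if "tt : keys (gs sg * a)" for tt
 proof -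
  have "inverse sg * tt : sgrp S" using a(2) that by (auto simp: in_keys_iff lookup_gs_mult)
  hence "sg * (inverse sg * tt) : sgrp S" using sg sgrp_mult by blast
  thus ?thesis by (simp flip: mult.assoc)
 qed
 thus ?thesis unfolding nspan_def using a by (intro CollectI exI[of _ "gs sg * a"]) (auto simp: mult.assoc)
qed

lemma nspan_self: "1 : W ==> v : nspan W v" unfolding nspan_def by (intro CollectI exI[of _ 1]) (auto simp: zero_perm_def[symmetric])

lemma nspan_of_int: "x : nspan W v ==> of_int c * x : nspan W v" unfolding of_int_eq_single by (rule nspan_scalar)

lemma nspan_induct:
 assumes "u : nspan W v" "P 0" "!!x y. P x ==> P y ==> P (x + y)" "!!w c. w : W ==> P (single 0 c * (gs w * v))" "finite W"
 shows "P u"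
proof -
 obtain a where a: "u = a * v" "keys a <= W" using assms(1) by (auto simp: nspan_def)
 have u: "u = (SUM w:W. single 0 (lookup a w) * (gs w * v))"
 proof -
  have "a = (SUM w:W. single 0 (lookup a w) * gs w)" using keys_subset_single_sum[OF assms(5) a(2)] by (simp only: single_scalar[symmetric])
  hence "a * v = (SUM w:W. single 0 (lookup a w) * gs w) * v" by (rule arg_cong)
  thus ?thesis unfolding a(1) by (simp only: sum_distrib_right mult.assoc)
 qed
 have "P (SUM w:V. single 0 (lookup a w) * (gs w * v))" if "finite V" "V <= W" for V
  using that by (induction V rule: finite_induct) (auto intro: assms)
 thus ?thesis using u assms(5) by simp
qed

text \<open>The part of \<open>jm j\<close> that involves the inner points 1, ..., l. The group on
  the outer points permutes these elements among themselves, which is not true of the elements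
  \<open>jm j\<close>.\<close>

definition xop :: "nat => nat => 'r::comm_ring_1 galg" where
 "xop l j = (SUM a:{1..l}. tr a j)"

lemma jm_xop: "l < j ==> jm j = xop l j + (SUM b:{l<..<j}. tr b j)"
proof -
 assume "l < j"
 hence "{1..<j} = {1..l} Un {l<..<j}" by auto
 moreover have "{1..l} Int {l<..<j} = {}" by auto
 ultimately show ?thesis by (simp add: jm_def xop_def sum.union_disjoint)
qed

lemma gs_xop: "sg : sgrp {Suc l..m} ==> gs sg * xop l j = xop l (sg $ j) * gs sg"
proof -
 assume sg: "sg : sgrp {Suc l..m}"
 have "sg $ a = a" if "a : {1..l}" for a using that by (intro sgrp_fix[OF sg]) auto
 thus ?thesis by (simp add: xop_def sum_distrib_left sum_distrib_right gs_tr)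
qed

lemma xop_cent: "l < j ==> j <= m ==> (xop l j :: 'r::comm_ring_1 galg) : CA l m"
proof -
 assume lj: "l < j" "j <= m"
 have "(tr b j :: 'r galg) : CA l m" if "b : {l<..<j}" for b unfolding tr_def using that lj by (intro cent_gs sgrp_swap) auto
 hence "jm j - (SUM b:{l<..<j}. tr b j :: 'r galg) : CA l m" using lj by (intro cent_diff cent_jm cent_sum)
 thus ?thesis using jm_xop[OF lj(1), where ?'a = 'r] by simp
qed

text \<open>A filtration degree for the centraliser algebra: it is constant on the classes under
  \<open>sym l\<close> and drops when an inner point carried outside is split off.\<close>

definition dg :: "nat => nat perm => nat" where
 "dg l pe = card {b : {1..l}. pe $ b ~= b}"

lemma sgrp_maps: "sg : sgrp S ==> sg $ x : S <-> x : S"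
 using sgrp_image[of sg S S] by (metis imageE imageI perm_apply_inverse(2) sgrp_image sgrp_inverse subset_refl)

lemma dg_conj: "rh : conj_class l pe ==> dg l rh = dg l pe"
proof -
 assume "rh : conj_class l pe"
 then obtain sg where sg: "sg : sgrp {1..l}" "rh = sg * pe * inverse sg" by (auto simp: conj_class_def sym_sgrp)
 have "{b : {1..l}. rh $ b ~= b} = ($) sg ` {b : {1..l}. pe $ b ~= b}" (is "?A = ?B")
 proof (intro subset_antisym subsetI)
  fix x assume x: "x : ?A"
  let ?y = "inverse sg $ x"
  have "?y : {1..l}" using x sgrp_maps[of "inverse sg" "{1..l}" x] sg(1) by simp
  moreover have "pe $ ?y ~= ?y"
  proof
   assume "pe $ ?y = ?y"
   hence "rh $ x = x" by (simp add: sg(2) apply_times)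
   thus False using x by simp
  qed
  ultimately have "sg $ ?y : ?B" by blast
  thus "x : ?B" by simp
 next
  fix x assume "x : ?B"
  then obtain y where y: "x = sg $ y" "y : {1..l}" "pe $ y ~= y" by blast
  have "x : {1..l}" using y sgrp_maps[OF sg(1), of y] by simp
  moreover have "rh $ x ~= x" using y by (simp add: sg(2) apply_times apply_inj)
  ultimately show "x : ?A" by simp
 qed
 moreover have "inj_on (($) sg) X" for X by (simp add: inj_on_def apply_inj)
 ultimately show ?thesis by (simp add: dg_def card_image)
qed

lemma dg_swap_less:
 assumes "b : {1..l}" "pe $ b = j" "l < j"
 shows "dg l ({|b,j|} * pe) < dg l pe"
proof -
 have "x : {1..l} & pe $ x ~= x & x ~= b" if "x : {1..l}" "({|b,j|} * pe) $ x ~= x" for x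
  using that assms by (auto simp: apply_swap_times split: if_splits)
 hence "{x : {1..l}. ({|b,j|} * pe) $ x ~= x} \<subset> {x : {1..l}. pe $ x ~= x}"
  using assms by (intro psubsetI) (auto simp: set_eq_iff intro!: exI[of _ b])
 thus ?thesis unfolding dg_def by (intro psubset_card_mono) auto
qed

lemma dg_swap_le:
 assumes "a : {1..l}" "rh $ a ~= a" "l < j"
 shows "dg l ({|a,j|} * rh) <= dg l rh"
proof -
 have "rh $ x ~= x" if "x : {1..l}" "({|a,j|} * rh) $ x ~= x" for x using that assms by (auto simp: apply_swap_times split: if_splits)
 thus ?thesis unfolding dg_def by (intro card_mono) auto
qed

lemma conj_swap:
 assumes "sg : sym l" "l < j"
 shows "sg * ({|b,j|} * pe) * inverse sg = {|sg $ b,j|} * (sg * pe * inverse sg)"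
proof -
 have "sg $ j = j" using assms by (intro sgrp_fix[of _ "{1..l}"]) (auto simp: sym_sgrp)
 thus ?thesis using perm_swap_conj[of sg b j] by (simp flip: mult.assoc)
qed

text \<open>Splitting off b is compatible with conjugacy. A conjugating element between the split
  permutations need not carry b to a; it is corrected by the transposition of b and b0, two fixed
  points of the split permutation.\<close>

lemma swap_conj_class_iff:
 assumes b: "b : {1..l}" "pe $ b = j" "l < j" and a: "tt $ a = j"
 shows "a : {1..l} & {|a,j|} * tt : conj_class l ({|b,j|} * pe) <-> tt : conj_class l pe"
proof
 assume "tt : conj_class l pe"
 then obtain sg where sg: "sg : sym l" "tt = sg * pe * inverse sg" by (auto simp: conj_class_def)
 have j: "sg $ j = j" using sg b by (intro sgrp_fix[of _ "{1..l}"]) (auto simp: sym_sgrp)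
 have "tt $ (sg $ b) = j" using j b by (simp add: sg(2) apply_times)
 hence ab: "a = sg $ b" using a by (metis apply_inj)
 hence "a : {1..l}" using sg(1) b(1) sgrp_maps[of sg "{1..l}" b] by (simp add: sym_sgrp)
 moreover have "{|a,j|} * tt = sg * ({|b,j|} * pe) * inverse sg" using conj_swap[OF sg(1) b(3), of b pe] sg(2) ab by simp
 ultimately show "a : {1..l} & {|a,j|} * tt : conj_class l ({|b,j|} * pe)" using conj_classI[OF sg(1), of "{|b,j|} * pe"] by simp
next
 let ?rh = "{|b,j|} * pe"
 assume asm: "a : {1..l} & {|a,j|} * tt : conj_class l ?rh"
 then obtain sg where sg: "sg : sym l" "{|a,j|} * tt = sg * ?rh * inverse sg" by (auto simp: conj_class_def)
 define b0 where "b0 = inverse sg $ a"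
 have b0: "b0 : {1..l}" "sg $ b0 = a" using asm sg(1) sgrp_maps[of "inverse sg" "{1..l}" a] by (auto simp: b0_def sym_sgrp)
 have "({|a,j|} * tt) $ a = a" using a by (simp add: apply_times)
 hence "sg $ (?rh $ b0) = a" unfolding sg(2) by (simp add: apply_times b0_def)
 hence f0: "?rh $ b0 = b0" using b0(2) by (metis apply_inj)
 have fb: "?rh $ b = b" using b by (simp add: apply_times)
 define s where "s = {|b,b0|}"
 have s: "s : sym l" "inverse s = s" "s * s = 1" unfolding s_def using b b0 by (auto simp: sym_sgrp sgrp_swap inverse_swap)
 have cs: "?rh * s = s * ?rh" unfolding s_def using perm_swap_conj[of ?rh b b0] f0 fb by simp
 define sg' where "sg' = sg * s"
 have sg': "sg' : sym l" "sg' $ b = a" using sg(1) s b0 by (auto simp: sg'_def sym_sgrp sgrp_mult apply_times s_def)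
 have "sg' * ?rh * inverse sg' = sg * (s * ?rh) * s * inverse sg" by (simp add: sg'_def s mult.assoc)
 also have "... = sg * ?rh * (s * s) * inverse sg" unfolding cs[symmetric] by (simp only: mult.assoc)
 finally have e: "sg' * ?rh * inverse sg' = {|a,j|} * tt" using sg(2) s by simp
 have "sg' * ({|b,j|} * ?rh) * inverse sg' = {|a,j|} * ({|a,j|} * tt)" using conj_swap[OF sg'(1) b(3), of b ?rh] e sg'(2) by simp
 hence "sg' * pe * inverse sg' = tt" by (simp flip: mult.assoc)
 thus "tt : conj_class l pe" using conj_classI[OF sg'(1), of pe] by simp
qed

text \<open>The permutation pe carries an inner point b to an outer point j, so the transposition of
  b and j can be split off. In the product of \<open>xop l j\<close> with the class sum of what
  remains, each element of the class of pe arises once, and the other terms have smaller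
  \<open>dg\<close>.\<close>

lemma peel_step:
 assumes b: "b : {1..l}" "pe $ b = j" "l < j"
  and tt: "tt : keys (xop l j * csum (conj_class l ({|b,j|} * pe)) - csum (conj_class l pe) :: 'r::comm_ring_1 galg)"
 shows "dg l tt < dg l pe"
proof (rule ccontr)
 let ?rh = "{|b,j|} * pe"
 assume nl: "~ dg l tt < dg l pe"
 define a0 where "a0 = inverse tt $ j"
 have a0: "tt $ a0 = j" by (simp add: a0_def)
 have u: "a = a0" if a: "a : {1..l}" "{|a,j|} * tt : conj_class l ?rh" for a
 proof -
  let ?r = "{|a,j|} * tt"
  have "?r $ a = a"
  proof (rule ccontr)
   assume "?r $ a ~= a"
   hence "dg l ({|a,j|} * ?r) <= dg l ?r" by (intro dg_swap_le[OF a(1) _ b(3)])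
   also have "{|a,j|} * ?r = tt" by (simp flip: mult.assoc)
   also have "dg l ?r = dg l ?rh" by (rule dg_conj[OF a(2)])
   also have "... < dg l pe" by (rule dg_swap_less[OF b])
   finally show False using nl by simp
  qed
  hence "tt $ a = j" using a(1) b(3) by (simp add: apply_swap_times split: if_splits)
  thus ?thesis using a0 by (metis apply_inj)
 qed
 have "lookup (xop l j * csum (conj_class l ?rh) :: 'r galg) tt = (SUM a:{1..l}. of_bool ({|a,j|} * tt : conj_class l ?rh))"
  by (simp add: xop_def sum_distrib_right lookup_sum tr_def lookup_gs_mult inverse_swap lookup_csum)
 also have "... = (SUM a:{1..l}. if a = a0 then of_bool ({|a,j|} * tt : conj_class l ?rh) else 0)" using u by (intro sum.cong) auto
 also have "... = of_bool (a0 : {1..l} & {|a0,j|} * tt : conj_class l ?rh)"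
  unfolding sum.delta[OF finite_atLeastAtMost] by (cases "a0 : {1..l}") (auto simp del: atLeastAtMost_iff)
 also have "... = of_bool (tt : conj_class l pe)" using swap_conj_class_iff[OF b a0] by simp
 finally have "lookup (xop l j * csum (conj_class l ?rh) - csum (conj_class l pe) :: 'r galg) tt = 0"
  by (simp add: lookup_minus lookup_csum)
 thus False using tt by (simp add: in_keys_iff)
qed

text \<open>Moving \<open>xop l j\<close> past w turns it into some \<open>xop l q\<close>, and on v
  this differs from the scalar action of \<open>jm q\<close> only by transpositions of outer
  points.\<close>

lemma nspan_xop:
 fixes v :: "'r::comm_ring_1 galg"
 assumes j: "l < j" "j <= m" and v: "!!j. l < j ==> j <= m ==> jm j * v = of_int (is j) * v"
  and u: "u : nspan (sgrp {Suc l..m}) v"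
 shows "xop l j * u : nspan (sgrp {Suc l..m}) v" using u
proof (rule nspan_induct)
 fix w and c :: 'r assume w: "w : sgrp {Suc l..m}"
 define q where "q = inverse w $ j"
 have q: "w $ q = j" by (simp add: q_def)
 have ql: "l < q" "q <= m" using sgrp_maps[of "inverse w" "{Suc l..m}" j] w j by (auto simp: q_def)
 have sv: "v : nspan (sgrp {Suc l..m}) v" by (rule nspan_self) simp
 have "xop l q * v = of_int (is q) * v - (SUM b:{l<..<q}. tr b q * v)"
  using v[OF ql] jm_xop[OF ql(1), where ?'a = 'r] by (simp add: algebra_simps sum_distrib_right)
 also have "... : nspan (sgrp {Suc l..m}) v"
  unfolding tr_def using ql by (intro nspan_diff nspan_of_int sv nspan_sum nspan_gs sgrp_swap) auto
 finally have "gs w * (xop l q * v) : nspan (sgrp {Suc l..m}) v" by (rule nspan_gs[OF w])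
 hence "xop l j * (gs w * v) : nspan (sgrp {Suc l..m}) v" using gs_xop[OF w, of q, where ?'a = 'r] q by (simp flip: mult.assoc)
 hence "single 0 c * (xop l j * (gs w * v)) : nspan (sgrp {Suc l..m}) v" by (rule nspan_scalar)
 moreover have "xop l j * (single 0 c * (gs w * v)) = single 0 c * (xop l j * (gs w * v))"
  using scalar_commute[of c "xop l j"] by (simp flip: mult.assoc)
 ultimately show "xop l j * (single 0 c * (gs w * v)) : nspan (sgrp {Suc l..m}) v" by simp
qed (simp_all add: distrib_left nspan_add)

lemma perm_split:
 assumes pe: "pe : sym m" and st: "!!b. b : {1..l} ==> pe $ b : {1..l}" and "l <= m"
 shows "EX tt:sym l. EX w:sgrp {Suc l..m}. pe = tt * w"
proof -
 have "bij_betw (apply pe) {1..l} {1..l}"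
 proof -
  have "inj_on (apply pe) {1..l}" by (simp add: inj_on_def apply_inj)
  moreover have "apply pe ` {1..l} <= {1..l}" using st by blast
  ultimately show ?thesis by (metis bij_betw_def endo_inj_surj finite_atLeastAtMost)
 qed
 then obtain f where f: "f permutes {1..l}" "ALL x:{1..l}. f x = pe $ x" using extend_bij[of "apply pe" "{1..l}" "{1..l}" "{1..l}"] by auto
 then obtain tt where tt: "tt : sgrp {1..l}" "apply tt = f" using ex_perm by (meson finite_atLeastAtMost)
 define w where "w = inverse tt * pe"
 have "w $ x = x" if "x ~: {Suc l..m}" for x
 proof (cases "x : {1..l}")
  case True
  hence "pe $ x = tt $ x" using f tt by simp
  thus ?thesis by (simp add: w_def apply_times)
 next
  case False
  hence "x ~: {1..m}" using that by simp linarith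
  hence "pe $ x = x" using pe sgrp_fix by (simp add: sym_sgrp)
  moreover have "inverse tt $ x = x" using tt(1) False by (intro sgrp_fix[of _ "{1..l}"]) simp_all
  ultimately show ?thesis by (simp add: w_def apply_times)
 qed
 hence "affected w <= {Suc l..m}" by (meson in_affected subsetI)
 hence "w : sgrp {Suc l..m}" by (simp add: sgrp_def)
 moreover have "pe = tt * w" by (simp add: w_def flip: mult.assoc)
 ultimately show ?thesis using tt(1) by (auto simp: sym_sgrp)
qed

lemma conj_class_times:
 assumes "w : sgrp {Suc l..m}"
 shows "conj_class l (tt * w) = (%rh. rh * w) ` conj_class l tt"
proof -
 have e: "sg * (tt * w) * inverse sg = sg * tt * inverse sg * w" if "sg : sym l" for sg
 proof -
  have "inverse sg * w = w * inverse sg"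
   using that assms by (intro perm_commute_disjoint[of _ "{1..l}" _ "{Suc l..m}"]) (auto simp: sym_sgrp)
  thus ?thesis by (simp add: mult.assoc)
 qed
 have "conj_class l pe = (%sg. sg * pe * inverse sg) ` sym l" for pe by (auto simp: conj_class_def)
 thus ?thesis using e by (simp add: image_image)
qed

lemma csum_times:
 assumes "w : sgrp {Suc l..m}"
 shows "csum (conj_class l (tt * w)) = csum (conj_class l tt) * (gs w :: 'r::comm_ring_1 galg)"
proof -
 have "inj_on (%rh. rh * w) (conj_class l tt)" by (auto simp: inj_on_def plus_perm_def[symmetric])
 thus ?thesis unfolding csum_def conj_class_times[OF assms] by (simp add: sum.reindex sum_distrib_right gs_mult)
qed

lemma csum_gs_commute:
 assumes "w : sgrp {Suc l..m}" "tt : sym l"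
 shows "csum (conj_class l tt) * gs w = gs w * (csum (conj_class l tt) :: 'r::comm_ring_1 galg)"
proof -
 have "rh * w = w * rh" if "rh : conj_class l tt" for rh
 proof -
  have "rh : sym l" using that conj_class_sub[OF assms(2)] by blast
  thus ?thesis using assms(1) by (intro perm_commute_disjoint[of _ "{1..l}" _ "{Suc l..m}"]) (auto simp: sym_sgrp)
 qed
 thus ?thesis by (simp add: csum_def sum_distrib_left sum_distrib_right gs_mult)
qed

text \<open>A form of Olshanski's description of the centraliser algebra by the centre for S_l, the
  outer symmetric group and Jucys-Murphy elements. Induction on \<open>dg\<close>: a class that
  preserves the inner points is a class of S_l times an outer permutation, and any other class is
  reduced by \<open>peel_step\<close>.\<close>

theorem cent_nspan:
 fixes c v :: "'r::comm_ring_1 galg"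
 assumes lm: "l <= m" and c: "c : CA l m"
  and v: "!!j. l < j ==> j <= m ==> jm j * v = of_int (is j) * v"
  and z: "!!tt. tt : sym l ==> EX s. csum (conj_class l tt) * v = single 0 s * v"
 shows "c * v : nspan (sgrp {Suc l..m}) v"
proof -
 let ?W = "sgrp {Suc l..m}"
 have sv: "v : nspan ?W v" by (rule nspan_self) simp
 have "c * v : nspan ?W v" if "c : CA l m" "ALL tt:keys c. dg l tt < N" for N and c :: "'r galg" using that
 proof (induction N arbitrary: c)
  case 0
  hence "keys c = {}" by auto
  thus ?case by simp
 next
  case (Suc N)
  have cs: "csum (conj_class l pe) * v : nspan ?W v" if pe: "pe : sym m" "dg l pe < Suc N" for pe
  proof (cases "EX b:{1..l}. pe $ b ~: {1..l}")
   case True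
   then obtain b where b: "b : {1..l}" "pe $ b ~: {1..l}" by blast
   define j where "j = pe $ b"
   have jm: "j : {1..m}" using b lm pe(1) sgrp_maps[of pe "{1..m}" b] by (simp add: j_def sym_sgrp)
   hence j: "l < j" "j <= m" using b(2) by (auto simp: j_def)
   let ?rh = "{|b,j|} * pe"
   have rh: "?rh : sym m" using pe b lm jm by (auto simp: sym_sgrp intro!: sgrp_mult sgrp_swap)
   have drh: "dg l ?rh < dg l pe" by (rule dg_swap_less) (use b j j_def in auto)
   let ?y = "xop l j * csum (conj_class l ?rh) - csum (conj_class l pe) :: 'r galg"
   have 1: "?y * v : nspan ?W v"
   proof (rule Suc.IH)
    show "?y : CA l m" using j rh pe lm by (intro cent_diff cent_mult xop_cent csum_cent)
    show "ALL tt:keys ?y. dg l tt < N" using peel_step[OF b(1) j_def[symmetric] j(1), where ?'r = 'r] pe(2) by fastforce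
   qed
   have 2: "csum (conj_class l ?rh) * v : nspan ?W v"
   proof (rule Suc.IH)
    show "csum (conj_class l ?rh) : CA l m" using rh lm by (intro csum_cent)
    show "ALL tt:keys (csum (conj_class l ?rh) :: 'r galg). dg l tt < N"
    proof
     fix tt assume "tt : keys (csum (conj_class l ?rh) :: 'r galg)"
     hence "tt : conj_class l ?rh" by (simp add: in_keys_iff lookup_csum split: if_splits)
     hence "dg l tt = dg l ?rh" by (rule dg_conj)
     thus "dg l tt < N" using drh pe(2) by simp
    qed
   qed
   have "xop l j * (csum (conj_class l ?rh) * v) - ?y * v : nspan ?W v" by (intro nspan_diff 1 nspan_xop[OF j v 2])
   thus ?thesis by (simp add: left_diff_distrib mult.assoc)
  next
   case False
   then obtain tt w where tt: "tt : sym l" and w: "w : ?W" and pi: "pe = tt * w" using perm_split[OF pe(1) _ lm] by blast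
   obtain s where s: "csum (conj_class l tt) * v = single 0 s * v" using z[OF tt] by blast
   have "csum (conj_class l pe) * v = gs w * (csum (conj_class l tt) * v)"
    using csum_times[OF w, of tt, where ?'r = 'r] csum_gs_commute[OF w tt, where ?'r = 'r] pi by (simp add: mult.assoc)
   also have "... : nspan ?W v" unfolding s by (intro nspan_gs[OF w] nspan_scalar sv)
   finally show ?thesis .
  qed
  have "c * v = (SUM K:conj_classes l m. single 0 (class_coeff c K) * (csum K * v))"
   by (subst cent_decomp[OF Suc.prems(1) lm]) (simp add: sum_distrib_right mult.assoc)
  also have "... : nspan ?W v"
  proof (intro nspan_sum)
   fix K assume "K : conj_classes l m"
   then obtain pe where K: "K = conj_class l pe" "pe : sym m" by (auto simp: conj_classes_def)
   show "single 0 (class_coeff c K) * (csum K * v) : nspan ?W v"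
   proof (cases "pe : keys c")
    case True
    thus ?thesis unfolding K using Suc.prems(2) K(2) by (intro nspan_scalar cs) auto
   next
    case False
    hence "class_coeff c K = 0" using class_coeff_eq[OF Suc.prems(1), of pe] K by (simp add: in_keys_iff)
    thus ?thesis by simp
   qed
  qed
  finally show ?case .
 qed
 moreover have "ALL tt:keys c. dg l tt < Suc l"
 proof
  fix tt
  have "dg l tt <= card {1..l}" unfolding dg_def by (intro card_mono) auto
  thus "dg l tt < Suc l" by simp
 qed
 ultimately show ?thesis using c by blast
qed

text \<open>A numerical refinement of the reversed Bruhat order, largest at the identity: by the
  rearrangement inequality, undoing an inversion increases it.\<close>

definition psum :: "nat set => nat perm => nat" where
 "psum S w = (SUM x:S. x * w $ x)"

lemma psum_swap:
 assumes "finite S" "a : S" "q : S" "w $ a = c" "w $ q = j" "(a < q & j < c) | (q < a & c < j)"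
 shows "psum S w < psum S ({|c,j|} * w)"
proof -
 have e: "psum S w' = a * w' $ a + q * w' $ q + psum (S - {a} - {q}) w'" for w'
  using assms(1-3,6) unfolding psum_def by (subst sum.remove[of S a]) (auto simp: sum.remove[of "S - {a}" q])
 have "psum (S - {a} - {q}) ({|c,j|} * w) = psum (S - {a} - {q}) w"
  unfolding psum_def using assms(4,5) by (intro sum.cong refl) (auto simp: apply_swap_times apply_inj)
 moreover have "a * c + q * j < a * j + q * c"
 proof -
  have "0 < (int a - int q) * (int j - int c)" using assms(6) by (auto simp: zero_less_mult_iff)
  hence "int (a * c + q * j) < int (a * j + q * c)" by (simp add: algebra_simps)
  thus ?thesis by linarith
 qed
 moreover have "({|c,j|} * w) $ a = j" "({|c,j|} * w) $ q = c" using assms(4,5,6) by (auto simp: apply_swap_times)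
 ultimately show ?thesis using e[of w] e[of "{|c,j|} * w"] assms(4,5) by simp
qed

lemma sum_diff_sets:
 fixes g :: "'a => 'b::ab_group_add"
 assumes "finite A" "finite B"
 shows "sum g A - sum g B = sum g (A - B) - sum g (B - A)"
 using sum.Int_Diff[OF assms(1), of g B] sum.Int_Diff[OF assms(2), of g A] by (simp add: Int_commute)

text \<open>Transpositions occurring in both products cancel, and each of the remaining ones undoes
  an inversion of w.\<close>

lemma jm_gs_triangular:
 assumes w: "w : sgrp {Suc l..m}" and j: "l < j" "j <= m"
  and w': "w' : keys (jm j * gs w - gs w * jm (inverse w $ j) :: 'r::comm_ring_1 galg)"
 shows "w' : sgrp {Suc l..m} & psum {Suc l..m} w < psum {Suc l..m} w'"
proof -
 let ?S = "{Suc l..m}"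
 define q where "q = inverse w $ j"
 have q: "w $ q = j" by (simp add: q_def)
 have qS: "q : ?S" using sgrp_maps[of "inverse w" ?S j] w j by (auto simp: q_def)
 hence lq: "l < q" by simp
 define g :: "nat => 'r galg" where "g c = gs ({|c,j|} * w)" for c
 define A where "A = {l<..<j}"
 define B where "B = ($) w ` {l<..<q}"
 have "jm j * gs w - gs w * jm q = (SUM b:{l<..<j}. tr b j) * gs w - gs w * (SUM b:{l<..<q}. tr b q :: 'r galg)"
  using jm_xop[OF j(1), where ?'a = 'r] jm_xop[OF lq, where ?'a = 'r] gs_xop[OF w, of q, where ?'a = 'r] q by (simp add: algebra_simps)
 also have "(SUM b:{l<..<j}. tr b j) * gs w = sum g A" by (simp add: sum_distrib_right g_def tr_def gs_mult A_def)
 also have "gs w * (SUM b:{l<..<q}. tr b q :: 'r galg) = sum g B"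
 proof -
  have "gs w * tr b q = (g (w $ b) :: 'r galg)" for b by (simp only: gs_tr q) (simp only: g_def tr_def gs_mult)
  moreover have "inj_on (($) w) X" for X by (simp add: inj_on_def apply_inj)
  ultimately show ?thesis by (simp add: B_def sum.reindex sum_distrib_left)
 qed
 also have "sum g A - sum g B = sum g (A - B) - sum g (B - A)" by (rule sum_diff_sets) (auto simp: A_def B_def)
 finally have D: "jm j * gs w - gs w * jm q = sum g (A - B) - sum g (B - A)" .
 have lk: "lookup (sum g X) w' = (SUM c:X. of_bool ({|c,j|} * w = w'))" for X
  by (simp add: lookup_sum g_def lookup_single when_def) (rule sum.cong, auto)
 have "lookup (sum g (A - B)) w' ~= 0 | lookup (sum g (B - A)) w' ~= 0"
  using w' D unfolding q_def[symmetric] by (auto simp: in_keys_iff lookup_minus)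
 then obtain c where c: "(c : A - B | c : B - A)" "{|c,j|} * w = w'"
 proof
  assume "lookup (sum g (A - B)) w' ~= 0"
  then obtain c where "c : A - B" "(of_bool ({|c,j|} * w = w') :: 'r) ~= 0" unfolding lk by (rule sum.not_neutral_contains_not_neutral)
  thus ?thesis using that[of c] by (auto split: if_splits)
 next
  assume "lookup (sum g (B - A)) w' ~= 0"
  then obtain c where "c : B - A" "(of_bool ({|c,j|} * w = w') :: 'r) ~= 0" unfolding lk by (rule sum.not_neutral_contains_not_neutral)
  thus ?thesis using that[of c] by (auto split: if_splits)
 qed
 define a where "a = inverse w $ c"
 have a: "w $ a = c" by (simp add: a_def)
 have "c : ?S"
 proof (cases "c : A")
  case True thus ?thesis using j by (auto simp: A_def)
 next
  case False
  then obtain b where "b : {l<..<q}" "c = w $ b" using c by (auto simp: B_def)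
  thus ?thesis using qS sgrp_maps[OF w, of b] by auto
 qed
 hence aS: "a : ?S" using sgrp_maps[OF w, of a] a by simp
 have "(a < q & j < c) | (q < a & c < j)" using c(1)
 proof
  assume cc: "c : A - B"
  hence "~ a < q" using aS a by (auto simp: B_def)
  moreover have "a ~= q" using cc a q by (auto simp: A_def)
  ultimately show ?thesis using cc by (auto simp: A_def)
 next
  assume cc: "c : B - A"
  then obtain b where b: "b : {l<..<q}" "c = w $ b" by (auto simp: B_def)
  hence "a = b" using a by (metis apply_inj)
  hence "a < q" using b by simp
  hence "c ~= j" using a q by (metis apply_inj less_irrefl)
  thus ?thesis using cc `a < q` `c : ?S` by (auto simp: A_def)
 qed
 hence "psum ?S w < psum ?S w'" unfolding c(2)[symmetric] by (intro psum_swap[OF _ aS qS a q]) simp_all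
 moreover have "w' : sgrp ?S" unfolding c(2)[symmetric] using `c : ?S` j w by (intro sgrp_mult sgrp_swap) auto
 ultimately show ?thesis by blast
qed

text \<open>U is closed upwards for \<open>psum\<close> and contains the support of a apart from 1.
  A least element w0 of U is eliminated: if the inverse of w0 moves j, then \<open>jm j\<close>
  minus its eigenvalue kills u, which yields a relation b * v = 0 whose coefficient at w0 is that of
  a times a difference of two distinct residues. Subtracting a multiple of it clears w0.\<close>

lemma weight_line_aux:
 fixes v u :: "'k::field galg"
 assumes v: "!!j. l < j ==> j <= m ==> jm j * v = of_int (is j) * v"
  and u: "!!j. l < j ==> j <= m ==> jm j * u = of_int (is j) * u"
  and inj: "inj_on (%j. of_int (is j) :: 'k) {Suc l..m}"
  and a: "u = a * v" "keys a <= insert 1 U" and U: "U <= sgrp {Suc l..m} - {1}"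
  and up: "!!w w'. w : U ==> w' : sgrp {Suc l..m} ==> w' ~= 1 ==> psum {Suc l..m} w < psum {Suc l..m} w' ==> w' : U"
 shows "EX s. u = single 0 s * v"
proof -
 let ?W = "sgrp {Suc l..m}" and ?\<Phi> = "psum {Suc l..m}"
 have fW: "finite ?W" by simp
 show ?thesis using a U up
 proof (induction "card U" arbitrary: U a rule: less_induct)
  case less
  have fU: "finite U" using less.prems(3) fW finite_subset by blast
  show ?case
  proof (cases "U = {}")
   case True
   hence "keys a <= {1}" using less.prems(2) by blast
   hence "a = single 0 (lookup a 0)" using keys_subset_single_sum[of "{1}" a] by (simp add: zero_perm_def)
   thus ?thesis using less.prems(1) by metis
  next
   case False
   define S where "S = U - {1}"
   have S: "finite S" "S ~= {}" using fU False less.prems(3) by (auto simp: S_def)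
   hence "Min (?\<Phi> ` S) : ?\<Phi> ` S" by simp
   then obtain w0 where w0S: "w0 : S" and w0e: "?\<Phi> w0 = Min (?\<Phi> ` S)" by auto
   have w0: "w0 : U" "w0 ~= 1" "!!w. w : U ==> w ~= 1 ==> ?\<Phi> w0 <= ?\<Phi> w" using w0S S unfolding w0e by (auto simp: S_def)
   have w0W: "w0 : ?W" using w0 less.prems(3) by blast
   have "EX x. inverse w0 $ x ~= x"
   proof (rule ccontr)
    assume "\<nexists>x. inverse w0 $ x ~= x"
    hence "inverse w0 = 1" by (simp add: perm_eq_iff)
    thus False using w0(2) by (metis perm_inverse_inverse perm_inverse_one)
   qed
   then obtain j where j: "inverse w0 $ j ~= j" by blast
   hence jS: "j : {Suc l..m}" using sgrp_fix[of "inverse w0" "{Suc l..m}" j] w0W by auto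
   hence jl: "l < j" "j <= m" by auto
   \<comment> \<open>A representative of (\<open>jm j\<close> - \<open>is j\<close>) *
     \<open>gs w\<close> with the eigenvalue of v already inserted; the two agree only after
     multiplication by v.\<close>
   define B :: "nat perm => 'k galg" where
    "B w = of_int (is (inverse w $ j) - is j) * gs w + (jm j * gs w - gs w * jm (inverse w $ j))" for w
   define de :: 'k where "de = of_int (is (inverse w0 $ j)) - of_int (is j)"
   have inS: "inverse w $ j : {Suc l..m}" if "w : ?W" for w using sgrp_maps[of "inverse w" "{Suc l..m}" j] that jS by simp
   have de: "de ~= 0" using inj_onD[OF inj _ inS[OF w0W] jS] j by (auto simp: de_def)
   have kW: "w : ?W" if "w : keys a" for w using that less.prems(2,3) by auto
   have Bv: "B w * v = (jm j - of_int (is j)) * (gs w * v)" if w: "w : ?W" for w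
   proof -
    have "jm (inverse w $ j) * v = of_int (is (inverse w $ j)) * v" using inS[OF w] by (intro v) auto
    thus ?thesis using of_int_comm[of "is (inverse w $ j)" "gs w" v] by (simp add: B_def algebra_simps)
   qed
   have D0: "lookup (jm j * gs w - gs w * jm (inverse w $ j) :: 'k galg) w' = 0 |
     w' = 1 | (w' : U & w' ~= w0)" if w: "w : insert 1 U" for w w'
   proof (cases "w = 1")
    case False
    hence wU: "w : U" using w by simp
    hence "w : ?W" using less.prems(3) by blast
    have "w' = 1 | w' : U & w' ~= w0" if "w' : keys (jm j * gs w - gs w * jm (inverse w $ j) :: 'k galg)"
     using jm_gs_triangular[OF `w : ?W` jl that] less.prems(4)[OF wU] w0(3)[OF wU False] by auto
    thus ?thesis by (auto simp: in_keys_iff)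
   qed (simp add: perm_inverse_one)
   have L: "lookup ((of_int a - of_int b) * x) w' = (of_int a - of_int b) * lookup x w'"
    for a b w' and x :: "'k galg" using lookup_of_int_times[of "a - b" x w'] by simp
   have B0: "lookup (B w) w0 = (if w = w0 then de else 0)" if "w : insert 1 U" for w
    using D0[OF that, of w0] w0(2) by (auto simp: B_def lookup_add L lookup_single when_def de_def)
   have BU: "lookup (B w) w' = 0" if "w : insert 1 U" "w' ~: insert 1 U" for w w'
    using D0[OF that(1), of w'] that by (auto simp: B_def lookup_add L lookup_single when_def)
   define b where "b = (SUM w:keys a. single 0 (lookup a w) * B w)"
   have "b * v = (SUM w:keys a. single 0 (lookup a w) * ((jm j - of_int (is j)) * (gs w * v)))"
    unfolding b_def sum_distrib_right mult.assoc by (intro sum.cong refl arg_cong[where f = "(*) _"] Bv kW)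
   also have "... = (SUM w:keys a. (jm j - of_int (is j)) * (single w (lookup a w) * v))"
   proof (intro sum.cong refl)
    fix w
    show "single 0 (lookup a w) * ((jm j - of_int (is j)) * (gs w * v)) =
     (jm j - of_int (is j)) * (single w (lookup a w) * v)"
     unfolding single_scalar[of w "lookup a w"] using scalar_commute[of "lookup a w" "jm j - of_int (is j)"]
     by (simp only: mult.assoc[symmetric])
   qed
   also have "... = (jm j - of_int (is j)) * ((SUM w:keys a. single w (lookup a w)) * v)" by (simp only: sum_distrib_left sum_distrib_right)
   also have "(SUM w:keys a. single w (lookup a w)) = a" by (rule keys_subset_single_sum[symmetric]) auto
   also have "(jm j - of_int (is j)) * (a * v) = 0" using u[OF jl] less.prems(1) by (simp add: left_diff_distrib)
   finally have bv: "b * v = 0" .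
   have b0: "lookup b w0 = de * lookup a w0"
   proof -
    have "lookup b w0 = (SUM w:keys a. lookup a w * (if w = w0 then de else 0))" unfolding b_def lookup_sum lookup_scalar_mult
     by (intro sum.cong refl arg_cong[where f = "(*) _"] B0 subsetD[OF less.prems(2)])
    also have "... = (SUM w:keys a. if w = w0 then de * lookup a w0 else 0)" by (intro sum.cong refl) auto
    also have "... = de * lookup a w0" by (simp add: in_keys_iff)
    finally show ?thesis .
   qed
   have bU: "lookup b w' = 0" if "w' ~: insert 1 U" for w'
    unfolding b_def lookup_sum lookup_scalar_mult using less.prems(2) BU[OF _ that] by (intro sum.neutral) auto
   define a' where "a' = a - single 0 (1 / de) * b"
   have "u = a' * v" unfolding a'_def using bv less.prems(1) by (simp add: left_diff_distrib mult.assoc)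
   moreover have "keys a' <= insert 1 (U - {w0})"
   proof
    fix w assume "w : keys a'"
    hence nz: "lookup a w - 1 / de * lookup b w ~= 0" by (simp add: a'_def in_keys_iff lookup_minus lookup_scalar_mult)
    have "w ~= w0" using nz b0 de by auto
    moreover have "w : insert 1 U"
    proof (rule ccontr)
     assume n: "w ~: insert 1 U"
     hence "w ~: keys a" using less.prems(2) by blast
     thus False using nz bU[OF n] by (simp add: in_keys_iff)
    qed
    ultimately show "w : insert 1 (U - {w0})" by blast
   qed
   moreover have "card (U - {w0}) < card U" using fU w0(1) by (intro psubset_card_mono) auto
   moreover have "U - {w0} <= ?W - {1}" using less.prems(3) by blast
   moreover have "w' : U - {w0}" if "w : U - {w0}" "w' : ?W" "w' ~= 1" "?\<Phi> w < ?\<Phi> w'" for w w'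
   proof -
    have "w' : U" using less.prems(4) that by blast
    moreover have "w' ~= w0"
    proof -
     have "w ~= 1" using that less.prems(3) by blast
     thus ?thesis using that w0(3)[of w] by auto
    qed
    ultimately show ?thesis by blast
   qed
   ultimately show ?thesis using less.hyps[of "U - {w0}" a'] by blast
  qed
 qed
qed

theorem weight_line:
 fixes v u :: "'k::field galg"
 assumes v: "!!j. l < j ==> j <= m ==> jm j * v = of_int (is j) * v"
  and u: "!!j. l < j ==> j <= m ==> jm j * u = of_int (is j) * u"
  and inj: "inj_on (%j. of_int (is j) :: 'k) {Suc l..m}"
  and "u : nspan (sgrp {Suc l..m}) v"
 shows "EX s. u = single 0 s * v"
proof -
 obtain a where "u = a * v" "keys a <= sgrp {Suc l..m}" using assms(4) by (auto simp: nspan_def)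
 thus ?thesis using v u inj by (intro weight_line_aux[where U = "sgrp {Suc l..m} - {1}" and a = a]) auto
qed

section \<open>Block idempotents\<close>

lemma esym_zero: "m < k ==> esym f m k = 0"
proof (induction m arbitrary: k)
 case 0 thus ?case by (cases k) auto
next
 case (Suc m) thus ?case by (cases k) auto
qed

lemma of_int_esym: "of_int (esym f m k) = esym (%j. of_int (f j) :: 'r::ring_1) m k" by (induction f m k rule: esym.induct) auto

lemma coeff_esym:
 "coeff (PROD j:{1..m}. [:F j, 1:]) i = (if i <= m then esym F m (m - i) else (0 :: 'k::field))"
proof (induction m arbitrary: i)
 case 0
 thus ?case by (cases i) (simp_all add: coeff_1)
next
 case (Suc m)
 have "(PROD j:{1..Suc m}. [:F j, 1:]) = [:F (Suc m), 1:] * (PROD j:{1..m}. [:F j, 1:])" by (simp add: prod.nat_ivl_Suc')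
 hence e: "coeff (PROD j:{1..Suc m}. [:F j, 1:]) i =
  F (Suc m) * coeff (PROD j:{1..m}. [:F j, 1:]) i + (case i of 0 => 0 | Suc i' => coeff (PROD j:{1..m}. [:F j, 1:]) i')"
  by (simp add: coeff_pCons split: nat.splits)
 show ?case
 proof (cases i)
  case 0
  thus ?thesis unfolding e Suc.IH by (simp add: esym_zero mult.commute)
 next
  case (Suc i')
  have "Suc m - i = m - i'" using Suc by simp
  moreover have "m - i' = Suc (m - i)" if "i' < m" using that Suc by simp
  ultimately show ?thesis unfolding e Suc.IH using Suc by (cases "i' < m") (auto simp: esym_zero mult.commute)
 qed
qed

lemma rmset_of_int:
 assumes p: "prime p" and char: "CHAR('k::field) = p"
 shows "rmset p m f = rmset p m g <->
  image_mset (%j. of_int (f j) :: 'k) (mset_set {1..m}) = image_mset (%j. of_int (g j)) (mset_set {1..m})"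
proof
 have p0: "int p > 0" using p prime_gt_0_nat by simp
 have e: "(of_int (a mod int p) :: 'k) = of_int a" for a by (simp add: of_int_eq_iff_cong_CHAR char)
 have "image_mset (%j. of_int (f j) :: 'k) (mset_set {1..m}) = image_mset of_int (rmset p m f)" for f
  by (simp add: rmset_def image_mset.compositionality o_def e)
 thus "rmset p m f = rmset p m g ==>
  image_mset (%j. of_int (f j) :: 'k) (mset_set {1..m}) = image_mset (%j. of_int (g j)) (mset_set {1..m})" by simp
 define h :: "'k => int" where "h x = (SOME b. EX a. x = of_int a & b = a mod int p)" for x
 have "h (of_int a) = a mod int p" for a
 proof -
  have "EX a'. (of_int a :: 'k) = of_int a' & h (of_int a) = a' mod int p" unfolding h_def by (rule someI_ex) blast
  thus ?thesis by (auto simp: of_int_eq_iff_cong_CHAR char cong_def)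
 qed
 hence "rmset p m f = image_mset h (image_mset (%j. of_int (f j) :: 'k) (mset_set {1..m}))" for f
  by (simp add: rmset_def image_mset.compositionality o_def)
 thus "image_mset (%j. of_int (f j) :: 'k) (mset_set {1..m}) = image_mset (%j. of_int (g j)) (mset_set {1..m}) ==>
  rmset p m f = rmset p m g" by metis
qed

text \<open>By Vieta, both sides say that the monic polynomials over the field with roots -g j and
  -f j coincide.\<close>

lemma esym_rmset:
 assumes p: "prime p" and char: "CHAR('k::field) = p"
 shows "(ALL k<=m. [esym g m k = esym f m k] (mod int p)) <-> rmset p m g = rmset p m f"
proof -
 define F G where "F j = (of_int (f j) :: 'k)" and "G j = (of_int (g j) :: 'k)" for j
 let ?P = "%H :: nat => 'k. PROD j:{1..m}. [:H j, 1:]"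
 have "(ALL k<=m. [esym g m k = esym f m k] (mod int p)) <-> (ALL k<=m. esym G m k = esym F m k)"
  unfolding F_def G_def of_int_esym[symmetric] by (simp add: of_int_eq_iff_cong_CHAR char)
 also have "... <-> ?P G = ?P F"
 proof
  assume "ALL k<=m. esym G m k = esym F m k"
  thus "?P G = ?P F" using coeff_esym[of G m] coeff_esym[of F m] by (intro poly_eqI) simp
 next
  assume e: "?P G = ?P F"
  show "ALL k<=m. esym G m k = esym F m k"
  proof (intro allI impI)
   fix k assume "k <= m"
   thus "esym G m k = esym F m k" using coeff_esym[of G m "m - k"] coeff_esym[of F m "m - k"] e by simp
  qed
 qed
 also have "... <-> image_mset G (mset_set {1..m}) = image_mset F (mset_set {1..m})"
 proof
  have pr: "proots (?P H) = image_mset (%j. - H j) (mset_set {1..m})" for H by (subst proots_prod) (simp_all add: sum_unfold_sum_mset)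
  assume "?P G = ?P F"
  hence "image_mset uminus (image_mset (%j. - G j) (mset_set {1..m})) = image_mset uminus (image_mset (%j. - F j) (mset_set {1..m}))"
   using pr[of G] pr[of F] by simp
  thus "image_mset G (mset_set {1..m}) = image_mset F (mset_set {1..m})" by (simp add: image_mset.compositionality o_def)
 next
  have "?P H = prod_mset (image_mset (%a. [:a, 1:]) (image_mset H (mset_set {1..m})))" for H
   by (simp add: prod_unfold_prod_mset image_mset.compositionality o_def)
  thus "image_mset G (mset_set {1..m}) = image_mset F (mset_set {1..m}) ==> ?P G = ?P F" by simp
 qed
 also have "... <-> rmset p m g = rmset p m f" unfolding G_def F_def rmset_of_int[OF p char] ..
 finally show ?thesis .
qed

text \<open>The projection onto weights whose first m residues are those of f, up to order: all
  elementary symmetric values are prescribed. In \<open>eB\<close> this is done for S_m and for S_l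
  at once.\<close>

definition eBp :: "nat => nat => nat => (nat => int) => 'r::comm_ring_1 galg" where
 "eBp p N m f = prod_list (map (%k. epsi p N (esym f m k) (esym jm m k)) [0..<Suc m])"

definition eB :: "nat => nat => nat => nat => (nat => int) => 'r::comm_ring_1 galg" where
 "eB p N l m f = eBp p N m f * eBp p N l f"

definition eW :: "nat => nat => nat => int list => 'r::comm_ring_1 galg" where
 "eW p N l w = prod_list (map (%r. epsi p N (w ! r) (jm (Suc (l + r)))) [0..<length w])"

lemma red_eB: "red (eB p N l m f) = (eB p N l m f :: 'k::comm_ring_1 galg)"
 by (simp add: eB_def eBp_def red_mult red_prod_list red_epsi o_def del: upt_Suc)

lemma red_eW: "red (eW p N l w) = (eW p N l w :: 'k::comm_ring_1 galg)" by (simp add: eW_def red_prod_list red_epsi o_def)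

lemma eBp_gz: "n <= m ==> eBp p N n f : gz m" unfolding eBp_def by (intro prod_list_gz) (auto intro!: epsi_gz esym_gz simp del: upt_Suc)

lemma eB_gz: "l <= m ==> eB p N l m f : gz m" unfolding eB_def by (intro gz_mult eBp_gz) auto

lemma eW_gz: "l + length w <= m ==> eW p N l w : gz m" unfolding eW_def by (intro prod_list_gz) (auto intro!: epsi_gz gz_jm)

lemma epsi_commute: "z * x = x * z ==> z * epsi p N a x = epsi p N a x * (z :: 'r::ring_1)"
proof -
 assume zx: "z * x = x * z"
 have "z * (x ^ p ^ N - of_int a) = (x ^ p ^ N - of_int a) * z"
  using power_commuting_commutes[OF zx[symmetric], of "p ^ N"] by (simp add: algebra_simps mult_of_int_commute)
 from power_commuting_commutes[OF this[symmetric], of "p - 1"] show ?thesis by (simp add: epsi_def algebra_simps)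
qed

lemma prod_list_commute: "(!!x. x : set xs ==> z * x = x * z) ==> z * prod_list xs = prod_list xs * (z :: 'r::monoid_mult)"
proof (induction xs)
 case (Cons x xs)
 hence "z * x = x * z" "z * prod_list xs = prod_list xs * z" by auto
 thus ?case by (metis mult.assoc prod_list.Cons)
qed simp

lemma eB_commute:
 fixes c :: "'r::comm_ring_1 galg"
 assumes "c : CA l m"
 shows "c * eB p N l m f = eB p N l m f * c"
proof -
 have "c : GA m" using assms by (simp add: centraliser_algebra_def)
 hence "c * eBp p N m f = eBp p N m f * c" unfolding eBp_def
  by (intro prod_list_commute) (auto intro!: epsi_commute esym_top_commute simp del: upt_Suc)
 moreover have "c * eBp p N l f = eBp p N l f * c" unfolding eBp_def
  using assms by (intro prod_list_commute) (auto intro!: epsi_commute esym_bottom_commute simp del: upt_Suc)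
 ultimately show ?thesis unfolding eB_def by (metis mult.assoc)
qed

lemma eB_cent: "l <= m ==> eB p N l m f : CA l m"
proof -
 assume lm: "l <= m"
 have "eBp p N n f : CA l m" if "n = l | n = m" for n
  unfolding eBp_def using lm that by (intro cent_prod_list) (auto intro!: cent_epsi cent_esym simp del: upt_Suc)
 thus ?thesis unfolding eB_def using cent_mult by blast
qed

lemma eW_cent: "l + length w <= m ==> eW p N l w : CA l m" unfolding eW_def by (intro cent_prod_list) (auto intro!: cent_epsi cent_jm)

lemma prod_list_idem:
 assumes "!!x. x : set xs ==> x * x = x" "!!x y. x : set xs ==> y : set xs ==> x * y = y * x"
 shows "prod_list xs * prod_list xs = prod_list (xs :: 'r::monoid_mult list)" using assms
proof (induction xs)
 case (Cons x xs)
 have "prod_list xs * x = x * prod_list xs" using Cons.prems(2) by (intro prod_list_commute[symmetric]) auto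
 moreover have "prod_list xs * prod_list xs = prod_list xs" "x * x = x" using Cons by auto
 ultimately show ?case by (metis mult.assoc prod_list.Cons)
qed simp

lemma mult_idem_commute: "a * a = a ==> b * b = b ==> a * b = b * a ==> (a * b) * (a * b) = a * (b :: 'r::semigroup_mult)"
 by (metis mult.assoc)

lemma galg_char: "CHAR('k::comm_ring_1) = p ==> of_nat p = (0 :: 'k galg)"
proof -
 assume "CHAR('k) = p"
 hence "(of_nat p :: 'k) = 0" using of_nat_CHAR by blast
 thus ?thesis using of_int_eq_single[of "int p", where ?'r = 'k] by simp
qed

lemma semis_jm:
 assumes p: "prime p" and 0: "of_nat p = (0 :: 'k::comm_ring_1 galg)"
 shows "EX N. ALL j:{1..m}. semis p N (jm j :: 'k galg)"
proof (induction m)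
 case (Suc m)
 then obtain N where N: "ALL j:{1..m}. semis p N (jm j :: 'k galg)" by blast
 obtain cs where "rprod cs (jm (Suc m) :: 'k galg) = 0" using jm_annihilator[of "Suc m"] by auto
 then obtain N' where N': "semis p N' (jm (Suc m) :: 'k galg)" using semis_root_prod[OF p 0] by blast
 have "semis p (max N N') (jm j :: 'k galg)" if "j : {1..Suc m}" for j
 proof (cases "j = Suc m")
  case True
  thus ?thesis using semis_mono[OF _ N', of "max N N'"] by simp
 next
  case False
  hence "semis p N (jm j :: 'k galg)" using N that by simp
  thus ?thesis using semis_mono[of N "max N N'"] by simp
 qed
 thus ?case by blast
qed auto

context
 fixes p N m :: nat
 assumes p: "prime p" and zero: "of_nat p = (0 :: 'k::comm_ring_1 galg)" and semis: "ALL j:{1..m}. semis p N (jm j :: 'k galg)"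
begin

lemma eBp_idem: "n <= m ==> eBp p N n f * eBp p N n f = (eBp p N n f :: 'k galg)" unfolding eBp_def
proof (rule prod_list_idem)
 fix x :: "'k galg" assume n: "n <= m" and "x : set (map (%k. epsi p N (esym f n k) (esym jm n k)) [0..<Suc n])"
 then obtain k where x: "x = epsi p N (esym f n k) (esym jm n k)" by auto
 have "semis p N (esym jm n k :: 'k galg)" using n semis by (intro semis_esym[OF p zero] jm_commute) auto
 thus "x * x = x" unfolding x by (rule epsi_idem[OF p zero])
next
 fix x y :: "'k galg" assume n: "n <= m" and x: "x : set (map (%k. epsi p N (esym f n k) (esym jm n k)) [0..<Suc n])"
  and y: "y : set (map (%k. epsi p N (esym f n k) (esym jm n k)) [0..<Suc n])"
 hence "x : gz n" "y : gz n" by (auto intro!: epsi_gz esym_gz simp del: upt_Suc)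
 thus "x * y = y * x" by (rule gz_commute)
qed

lemma eB_idem: "l <= m ==> eB p N l m f * eB p N l m f = (eB p N l m f :: 'k galg)"
 unfolding eB_def by (intro mult_idem_commute eBp_idem gz_commute[of _ m] eBp_gz) auto

lemma eW_idem: "l + length w <= m ==> eW p N l w * eW p N l w = (eW p N l w :: 'k galg)" unfolding eW_def
proof (rule prod_list_idem)
 fix x :: "'k galg" assume n: "l + length w <= m" and "x : set (map (%r. epsi p N (w ! r) (jm (Suc (l + r)))) [0..<length w])"
 then obtain r where r: "r < length w" and x: "x = epsi p N (w ! r) (jm (Suc (l + r)))" by auto
 have "semis p N (jm (Suc (l + r)) :: 'k galg)" using n r semis by auto
 thus "x * x = x" unfolding x by (rule epsi_idem[OF p zero])
next
 fix x y :: "'k galg" assume n: "l + length w <= m" and "x : set (map (%r. epsi p N (w ! r) (jm (Suc (l + r)))) [0..<length w])"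
  "y : set (map (%r. epsi p N (w ! r) (jm (Suc (l + r)))) [0..<length w])"
 hence "x : gz m" "y : gz m" by (auto intro!: epsi_gz gz_jm)
 thus "x * y = y * x" by (rule gz_commute)
qed

end

lemma prod_list_indicator:
 assumes "!!i. i : set xs ==> F i * v = (if P i then v else 0)"
 shows "prod_list (map F xs) * v = (if ALL i:set xs. P i then v else (0 :: 'r::ring_1))"
 using assms by (induction xs) (auto simp: mult.assoc)

lemma eBp_wtv:
 fixes v :: "'k::field galg"
 assumes p: "prime p" and char: "CHAR('k) = p" and v: "wtv m g v" and n: "n <= m"
 shows "eBp p N n f * v = (if rmset p n g = rmset p n f then v else 0)"
proof -
 have 0: "of_nat p = (0 :: 'k galg)" by (rule galg_char[OF char])
 have "eBp p N n f * v = (if ALL k:set [0..<Suc n]. [esym g n k = esym f n k] (mod int p) then v else 0)"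
  unfolding eBp_def by (intro prod_list_indicator epsi_eigen_char[OF p 0] esym_wtv[OF v n])
 also have "(ALL k:set [0..<Suc n]. [esym g n k = esym f n k] (mod int p)) <-> (ALL k<=n. [esym g n k = esym f n k] (mod int p))"
  by (auto simp del: upt_Suc)
 finally show ?thesis by (simp only: esym_rmset[OF p char])
qed

lemma eB_wtv:
 fixes v :: "'k::field galg"
 assumes "prime p" "CHAR('k) = p" "wtv m g v" "l <= m"
 shows "eB p N l m f * v = (if rmset p m g = rmset p m f & rmset p l g = rmset p l f then v else 0)"
 unfolding eB_def mult.assoc eBp_wtv[OF assms] using eBp_wtv[OF assms(1-3) order_refl] by simp

lemma eW_wtv:
 fixes v :: "'k::field galg"
 assumes p: "prime p" and char: "CHAR('k) = p" and v: "wtv m g v" and n: "l + length w <= m"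
 shows "eW p N l w * v = (if ALL r<length w. [g (Suc (l + r)) = w ! r] (mod int p) then v else 0)"
proof -
 have 0: "of_nat p = (0 :: 'k galg)" by (rule galg_char[OF char])
 have "eW p N l w * v = (if ALL r:set [0..<length w]. [g (Suc (l + r)) = w ! r] (mod int p) then v else 0)"
  unfolding eW_def using n by (intro prod_list_indicator epsi_eigen_char[OF p 0] wtvD[OF v]) auto
 thus ?thesis by (simp add: Ball_def)
qed

lemma eBp_amod:
 assumes p: "prime p" and char: "CHAR('k::field) = p" and v: "wtv m g v" and n: "n <= m" and r: "rmset p n g = rmset p n f"
 shows "amod p (eBp p N n f) v 1"
proof -
 have c: "[esym g n k = esym f n k] (mod int p)" if "k <= n" for k using esym_rmset[OF p char] r that by blast
 have "amod p (eBp p N n f) v (prod_list (map (%k. of_bool ([esym g n k = esym f n k] (mod int p))) [0..<Suc n]))"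
  unfolding eBp_def by (intro amod_prod_list amod_epsi[OF p] esym_wtv[OF v n])
 also have "map (%k. of_bool ([esym g n k = esym f n k] (mod int p))) [0..<Suc n] = map (%k. 1 :: int) [0..<Suc n]"
  using c by (intro map_cong) auto
 also have "prod_list (map (%k. 1 :: int) xs) = 1" for xs :: "nat list" by (induction xs) auto
 finally show ?thesis .
qed

lemma eB_amod:
 assumes "prime p" "CHAR('k::field) = p" "wtv m g v" "l <= m" "rmset p m g = rmset p m f" "rmset p l g = rmset p l f"
 shows "amod p (eB p N l m f) v 1"
 unfolding eB_def using amod_mult[OF eBp_amod[OF assms(1-3) order_refl assms(5)] eBp_amod[OF assms(1-4) assms(6)]] by simp

lemma eW_amod:
 assumes p: "prime p" and v: "wtv m g v" and n: "l + length w <= m"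
 shows "amod p (eW p N l w) v (of_bool (ALL r<length w. [g (Suc (l + r)) = w ! r] (mod int p)))"
proof -
 have "amod p (eW p N l w) v (prod_list (map (%r. of_bool ([g (Suc (l + r)) = w ! r] (mod int p))) [0..<length w]))"
  unfolding eW_def using n by (intro amod_prod_list amod_epsi[OF p] wtvD[OF v]) auto
 also have "prod_list (map (%r. of_bool (P r)) xs) = (of_bool (ALL r:set xs. P r) :: int)" for P and xs :: "nat list" by (induction xs) auto
 finally show ?thesis by (simp add: Ball_def)
qed

section \<open>Residue words and the splitting of central idempotents\<close>

definition rwords :: "nat => nat => int list set" where
 "rwords p n = {w. set w <= {0..<int p} & length w = n}"

lemma finite_rwords [simp]: "finite (rwords p n)" unfolding rwords_def by (intro finite_lists_length_eq) simp

definition rword :: "nat => int list => int list" where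
 "rword p = map (%a. a mod int p)"

lemma rword_eq_iff:
 assumes "w : rwords p n" "length as = n"
 shows "(ALL r<n. [as ! r = w ! r] (mod int p)) <-> w = rword p as"
proof -
 have "w ! r mod int p = w ! r" if "r < n" for r
 proof -
  have "w ! r : set w" using assms that by (simp add: rwords_def)
  hence "w ! r : {0..<int p}" using assms(1) unfolding rwords_def by blast
  thus ?thesis by simp
 qed
 thus ?thesis using assms by (auto simp: list_eq_iff_nth_eq rword_def rwords_def cong_def)
qed

lemma rword_in_rwords: "p > 0 ==> rword p as : rwords p (length as)" by (auto simp: rword_def rwords_def)

text \<open>Projections for different words are orthogonal, so 1 minus their sum is an idempotent.
  It kills every weight vector, since each belongs to exactly one word.\<close>

lemma sum_eW:
 assumes p: "prime p" and char: "CHAR('k::field) = p" and semis: "ALL j:{1..m}. semis p N (jm j :: 'k galg)" and lm: "l + n = m"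
 shows "(SUM w:rwords p n. eW p N l w) = (1 :: 'k galg)"
proof -
 have 0: "of_nat p = (0 :: 'k galg)" by (rule galg_char[OF char])
 have p0: "p > 0" using p prime_gt_0_nat by blast
 have len: "l + length w <= m" if "w : rwords p n" for w using that lm by (simp add: rwords_def)
 have act: "eW p N l w * v = (if w = rword p (map (%r. g (Suc (l + r))) [0..<n]) then v else 0)"
  if "w : rwords p n" and v: "wtv m g v" for w g and v :: "'k galg"
 proof -
  have "length w = n" using that(1) by (simp add: rwords_def)
  hence "(ALL r<length w. [g (Suc (l + r)) = w ! r] (mod int p)) <-> w = rword p (map (%r. g (Suc (l + r))) [0..<n])"
   using rword_eq_iff[OF that(1), of "map (%r. g (Suc (l + r))) [0..<n]"] by simp
  thus ?thesis using eW_wtv[OF p char v len[OF that(1)]] by simp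
 qed
 have orth: "eW p N l w * eW p N l w' = (if w = w' then eW p N l w else (0 :: 'k galg))"
  if w: "w : rwords p n" "w' : rwords p n" for w w'
 proof (cases "w = w'")
  case True
  thus ?thesis using eW_idem[OF p 0 semis len[OF w(1)]] by simp
 next
  case False
  have g: "(eW p N l w :: 'k galg) : gz m" "(eW p N l w' :: 'k galg) : gz m" by (intro eW_gz len w)+
  have "eW p N l w * eW p N l w' = (0 :: 'k galg)"
  proof (rule gz_idempotent_zero)
   show "eW p N l w * (eW p N l w' :: 'k galg) : gz m" using g by (rule gz_mult)
   show "eW p N l w * eW p N l w' * (eW p N l w * eW p N l w') = eW p N l w * (eW p N l w' :: 'k galg)"
    by (intro mult_idem_commute eW_idem[OF p 0 semis len] w gz_commute[OF g])
   fix g and v :: "'k galg" assume v: "wtv m g v"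
   show "eW p N l w * eW p N l w' * v = 0" unfolding mult.assoc using act[OF w(1) v] act[OF w(2) v] False by auto
  qed
  thus ?thesis using False by simp
 qed
 define S where "S = (SUM w:rwords p n. eW p N l w :: 'k galg)"
 have "S * S = (SUM w:rwords p n. SUM w':rwords p n. if w = w' then eW p N l w else 0)"
  unfolding S_def sum_product by (intro sum.cong refl orth)
 hence SS: "S * S = S" by (simp add: S_def)
 have "1 - S = 0"
 proof (rule gz_idempotent_zero)
  show "1 - S : gz m" unfolding S_def by (intro gz_diff gz_one gz_sum eW_gz len)
  show "(1 - S) * (1 - S) = 1 - S" using SS by (simp add: algebra_simps)
  fix g and v :: "'k galg" assume v: "wtv m g v"
  let ?w = "rword p (map (%r. g (Suc (l + r))) [0..<n])"
  have "S * v = (SUM w:rwords p n. if w = ?w then v else 0)" unfolding S_def sum_distrib_right by (intro sum.cong refl act v)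
  also have "... = v" using rword_in_rwords[OF p0, of "map (%r. g (Suc (l + r))) [0..<n]"] by simp
  finally show "(1 - S) * v = 0" by (simp add: left_diff_distrib)
 qed
 thus ?thesis by (simp add: S_def)
qed

lemma rmset_tail:
 assumes "l <= m" "rmset p m g = rmset p m f" "rmset p l g = rmset p l f"
 shows "image_mset (%j. g j mod int p) (mset_set {Suc l..m}) = image_mset (%j. f j mod int p) (mset_set {Suc l..m})"
proof -
 have "{1..m} = {1..l} Un {Suc l..m}" "{1..l} Int {Suc l..m} = {}" using assms(1) by auto
 hence "rmset p m f = rmset p l f + image_mset (%j. f j mod int p) (mset_set {Suc l..m})" for f
  unfolding rmset_def by (simp add: mset_set_Union)
 thus ?thesis using assms by simp
qed

lemma inj_on_image_mset_eq:
 assumes "finite A" "image_mset f (mset_set A) = image_mset g (mset_set A)" "inj_on f A"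
 shows "inj_on g A"
proof -
 have "f ` A = g ` A" using assms(1,2) by (metis finite_set_mset_mset_set set_image_mset)
 hence "card (g ` A) = card A" using assms(3) by (metis card_image)
 thus ?thesis using assms(1) by (rule inj_on_iff_eq_card[THEN iffD2, rotated])
qed

lemma red_class_sum_symval:
 assumes char: "CHAR('k::comm_ring_1) = p" and tt: "tt : sym l"
 shows "symval p l (csum (conj_class l tt) :: 'k galg)"
proof -
 have "csum (conj_class l tt) : CA l l" by (rule csum_cent[OF tt]) simp
 hence "csum (conj_class l tt) : GA l" "!!sg. sg : sym l ==> gs sg * csum (conj_class l tt) = csum (conj_class l tt) * (gs sg :: int galg)"
  unfolding cent_iff by blast+
 from centre_symval[OF galg_char[OF char] this] have "symval p l (red (csum (conj_class l tt) :: int galg) :: 'k galg)" .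
 moreover have "red (csum (conj_class l tt) :: int galg) = (csum (conj_class l tt) :: 'k galg)" by (simp add: csum_def red_sum)
 ultimately show ?thesis by simp
qed

lemma ex_weight_idem:
 fixes x :: "'k::field galg"
 assumes p: "prime p" and char: "CHAR('k) = p" and semis: "ALL j:{1..m}. semis p N (jm j :: 'k galg)"
  and w: "w : rwords p n" and lm: "l + n = m" and x: "x ~= 0" "eW p N l w * x = x" "eB p N l m f * x = x"
 shows "EX h g. h : gz m & h * x ~= 0 & wtv m g (h * x) & rmset p m g = rmset p m f & rmset p l g = rmset p l f &
  (ALL r<n. [g (Suc (l + r)) = w ! r] (mod int p))"
proof -
 have len: "length w = n" using w by (simp add: rwords_def)
 obtain h g where h: "h : gz m" "h * x ~= 0" "wtv m g (h * x)" using ex_weight[OF x(1)] by blast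
 have "eW p N l w * (h * x) = h * (eW p N l w * x)" using gz_commute[OF h(1) eW_gz[of l w m p N]] len lm by (simp flip: mult.assoc)
 hence 1: "eW p N l w * (h * x) = h * x" using x by simp
 have lm': "l <= m" using lm by simp
 have "eB p N l m f * (h * x) = h * (eB p N l m f * x)" using gz_commute[OF h(1) eB_gz[OF lm', of p N f]] by (simp flip: mult.assoc)
 hence 2: "eB p N l m f * (h * x) = h * x" using x by simp
 have "ALL r<n. [g (Suc (l + r)) = w ! r] (mod int p)" using 1 eW_wtv[OF p char h(3), of l w N] h(2) len lm by (auto split: if_splits)
 moreover have "rmset p m g = rmset p m f & rmset p l g = rmset p l f"
  using 2 eB_wtv[OF p char h(3) lm', of N f] h(2) by (auto split: if_splits)
 ultimately show ?thesis using h by blast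
qed

text \<open>Otherwise e * y and (1 - e) * y have non-zero multiples v1 and v2 that are weight
  vectors with the same word, where y is the projection. Class sums of S_l act on both by the same
  scalars, so \<open>cent_nspan\<close> applies to v = v1 + v2 and places e * v = v1 in its span. By
  \<open>weight_line\<close> v1 is a scalar multiple of v; applying e shows that the scalar fixes
  v1, and comparing the parts in v2 that it is 0.\<close>

theorem idempotent_dichotomy:
 fixes e :: "'k::field galg"
 assumes p: "prime p" and char: "CHAR('k) = p" and semis: "ALL j:{1..m}. semis p N (jm j :: 'k galg)"
  and lm: "l + n = m" and inj: "inj_on (%j. f j mod int p) {Suc l..m}"
  and e: "e : CA l m" "e * e = e" and cen: "!!c. c : CA l m ==> e * c = c * e"
  and w: "w : rwords p n"
 shows "e * (eW p N l w * eB p N l m f) : {0, eW p N l w * eB p N l m f}"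
proof (rule ccontr)
 let ?y = "eW p N l w * eB p N l m f :: 'k galg"
 have 0: "of_nat p = (0 :: 'k galg)" by (rule galg_char[OF char])
 have lm': "l <= m" using lm by simp
 have len: "l + length w <= m" using w lm by (simp add: rwords_def)
 have WW: "eW p N l w * eW p N l w = (eW p N l w :: 'k galg)" by (rule eW_idem[OF p 0 semis len])
 have BB: "eB p N l m f * eB p N l m f = (eB p N l m f :: 'k galg)" by (rule eB_idem[OF p 0 semis lm'])
 have WB: "eB p N l m f * eW p N l w = (eW p N l w * eB p N l m f :: 'k galg)" by (rule gz_commute[OF eB_gz[OF lm'] eW_gz[OF len]])
 have Wy: "eW p N l w * ?y = ?y" using WW by (simp flip: mult.assoc)
 have By: "eB p N l m f * ?y = ?y" using WB BB by (metis mult.assoc)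
 have eW: "e * eW p N l w = eW p N l w * e" using cen[OF eW_cent[OF len]] .
 have eBc: "e * eB p N l m f = eB p N l m f * e" using cen[OF eB_cent[OF lm']] .
 assume "~ ?thesis"
 hence nz: "e * ?y ~= 0" "(1 - e) * ?y ~= 0" by (auto simp: left_diff_distrib)
 have P: "eW p N l w * (z * ?y) = z * ?y & eB p N l m f * (z * ?y) = z * ?y" if "z = e | z = 1 - e" for z
 proof -
  have "eW p N l w * z = z * eW p N l w & eB p N l m f * z = z * eB p N l m f"
   using that by (rule disjE) (simp_all add: eW eBc diff_distrib)
  hence "eW p N l w * (z * ?y) = z * (eW p N l w * ?y)" "eB p N l m f * (z * ?y) = z * (eB p N l m f * ?y)" using mult.assoc by metis+
  thus ?thesis unfolding Wy By by simp
 qed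
 obtain h1 g1 where 1: "h1 : gz m" "h1 * (e * ?y) ~= 0" "wtv m g1 (h1 * (e * ?y))" "rmset p m g1 = rmset p m f"
  "rmset p l g1 = rmset p l f" "!!r. r < n ==> [g1 (Suc (l + r)) = w ! r] (mod int p)"
  using ex_weight_idem[OF p char semis w lm nz(1), of f] P[of e] by blast
 obtain h2 g2 where 2: "h2 : gz m" "h2 * ((1 - e) * ?y) ~= 0" "wtv m g2 (h2 * ((1 - e) * ?y))" "rmset p m g2 = rmset p m f"
  "rmset p l g2 = rmset p l f" "!!r. r < n ==> [g2 (Suc (l + r)) = w ! r] (mod int p)"
  using ex_weight_idem[OF p char semis w lm nz(2), of f] P[of "1 - e"] by blast
 define v1 v2 where "v1 = h1 * (e * ?y)" and "v2 = h2 * ((1 - e) * ?y)"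
 have ejm: "e * jm j = jm j * e" if "j : {1..m}" for j
 proof (cases "l < j")
  case True
  thus ?thesis using that by (intro cen cent_jm) auto
 next
  case False
  hence "(jm j :: 'k galg) : GA l" by (intro GA_jm) simp
  thus ?thesis using e(1) by (simp add: centraliser_algebra_def)
 qed
 have eh: "e * h1 = h1 * e" "e * h2 = h2 * e" using gzD[OF 1(1) ejm] gzD[OF 2(1) ejm] by blast+
 have "e * v1 = h1 * (e * e * ?y)" unfolding v1_def using eh by (metis mult.assoc)
 hence ev1: "e * v1 = v1" using e(2) by (simp add: v1_def)
 have "e * v2 = h2 * (e * (1 - e) * ?y)" unfolding v2_def using eh by (metis mult.assoc)
 hence ev2: "e * v2 = 0" using e(2) by (simp add: right_diff_distrib)
 define v where "v = v1 + v2"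
 define "is" where "is j = w ! (j - Suc l)" for j
 have wt: "jm j * u = of_int (is j) * u" if "l < j" "j <= m" "wtv m g u" "!!r. r < n ==> [g (Suc (l + r)) = w ! r] (mod int p)" for j g and u :: "'k galg"
 proof -
  have "[g (Suc (l + (j - Suc l))) = w ! (j - Suc l)] (mod int p)" using that lm by (intro that(4)) simp
  hence "[g j = is j] (mod int p)" using that(1) by (simp add: is_def)
  hence "(of_int (g j) :: 'k galg) = of_int (is j)" by (rule of_int_cong[OF 0])
  thus ?thesis using wtvD[OF that(3), of j] that by simp
 qed
 have j1: "jm j * v1 = of_int (is j) * v1" if "l < j" "j <= m" for j using wt[OF that 1(3) 1(6)] by (simp add: v1_def)
 have j2: "jm j * v2 = of_int (is j) * v2" if "l < j" "j <= m" for j using wt[OF that 2(3) 2(6)] by (simp add: v2_def)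
 have jv: "jm j * v = of_int (is j) * v" if "l < j" "j <= m" for j using j1[OF that] j2[OF that] by (simp add: v_def distrib_left)
 have cs: "EX s. csum (conj_class l tt) * v = single 0 s * v" if tt: "tt : sym l" for tt
 proof -
  have "wtv l g1 v1" "wtv l g2 v2" using 1(3) 2(3) lm' by (auto simp: wtv_def v1_def v2_def)
  moreover have "rmset p l g1 = rmset p l g2" using 1 2 by simp
  ultimately have "EX s::int. csum (conj_class l tt) * v1 = of_int s * v1 & csum (conj_class l tt) * v2 = of_int s * v2"
   using red_class_sum_symval[OF char tt] unfolding symval_def by blast
  then obtain s :: int where "csum (conj_class l tt) * v = of_int s * v" by (auto simp: v_def distrib_left)
  thus ?thesis unfolding of_int_eq_single by blast
 qed
 have "e * v : nspan (sgrp {Suc l..m}) v" by (rule cent_nspan[OF lm' e(1) jv cs])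
 hence mem: "v1 : nspan (sgrp {Suc l..m}) v" using ev1 ev2 by (simp add: v_def distrib_left)
 have "inj_on (%j. g1 j mod int p) {Suc l..m}" using inj_on_image_mset_eq[OF _ rmset_tail[OF lm' 1(4) 1(5), symmetric] inj] by simp
 moreover have "is j mod int p = g1 j mod int p" if "j : {Suc l..m}" for j
 proof -
  have "[g1 (Suc (l + (j - Suc l))) = w ! (j - Suc l)] (mod int p)" using that lm by (intro 1(6)) auto
  thus ?thesis using that by (simp add: is_def cong_def)
 qed
 ultimately have "inj_on (%j. of_int (is j) :: 'k) {Suc l..m}" by (auto simp: inj_on_def of_int_eq_iff_cong_CHAR char cong_def)
 from weight_line[OF jv j1 this mem] obtain s where s: "v1 = single 0 s * v" by blast
 have "e * v1 = single 0 s * (e * v)" by (metis s scalar_commute mult.assoc)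
 hence "v1 = single 0 s * v1" using ev1 ev2 by (simp add: v_def distrib_left)
 hence s1: "single 0 s * v1 = v1" by (rule sym)
 have "single 0 s * v2 = single 0 s * v - single 0 s * v1" by (simp add: v_def distrib_left)
 hence "single 0 s * v2 = 0" unfolding s1 s[symmetric] by simp
 hence "s * lookup v2 sg = 0" for sg by (metis lookup_scalar_mult lookup_zero)
 moreover have "v2 ~= 0" using 2 by (simp add: v2_def)
 then obtain sg where "lookup v2 sg ~= 0" by (metis lookup_zero poly_mapping_eqI)
 ultimately have "s = 0" by (metis mult_eq_0_iff)
 hence "v1 = 0" using s1 by simp
 thus False using 1 by (simp add: v1_def)
qed

abbreviation entry :: "int list => nat => int" where
 "entry ts j == ts ! (j - 1)"

lemma rmset_entry: "n <= length ts ==> rmset p n (entry ts) = mset (rword p (take n ts))"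
proof -
 assume n: "n <= length ts"
 have "mset (map (%j. entry ts j mod int p) [1..<Suc n]) = mset (rword p (take n ts))"
  using n by (intro arg_cong[where f = mset]) (auto simp: list_eq_iff_nth_eq rword_def simp del: upt_Suc)
 moreover have "mset (map (%j. entry ts j mod int p) [1..<Suc n]) = image_mset (%j. entry ts j mod int p) (mset_set (set [1..<Suc n]))"
  by (subst mset_set_set) (auto simp del: upt_Suc)
 moreover have "set [1..<Suc n] = {1..n}" by auto
 ultimately show ?thesis by (simp add: rmset_def del: upt_Suc)
qed

lemma wtl_wtv_entry: "wtl ts v ==> wtv (length ts) (entry ts) v" unfolding wtl_def wtv_def
proof
 fix j assume w: "ALL j<length ts. jm (Suc j) * v = of_int (ts ! j) * v" and j: "j : {1..length ts}"
 hence "j - 1 < length ts" by auto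
 with w have "jm (Suc (j - 1)) * v = of_int (ts ! (j - 1)) * v" by blast
 thus "jm j * v = of_int (entry ts j) * v" using j by simp
qed

context
 fixes p N l m n :: nat and f :: "nat => int" and e :: "'k::field galg"
 assumes p: "prime p" and char: "CHAR('k) = p" and semis: "ALL j:{1..m}. semis p N (jm j :: 'k galg)"
  and lm: "l + n = m" and inj: "inj_on (%j. f j mod int p) {Suc l..m}"
  and e: "e : CA l m" "e * e = e" and cen: "!!c. c : CA l m ==> e * c = c * e"
begin

definition jwords :: "int list set" where
 "jwords = {w : rwords p n. e * (eW p N l w * eB p N l m f) ~= 0}"

lemma idempotent_words: "e * eB p N l m f = (SUM w:jwords. eW p N l w * eB p N l m f)"
proof -
 have "e * eB p N l m f = e * ((SUM w:rwords p n. eW p N l w) * eB p N l m f)" using sum_eW[OF p char semis lm] by simp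
 also have "... = (SUM w:rwords p n. e * (eW p N l w * eB p N l m f))" by (simp add: sum_distrib_left sum_distrib_right)
 also have "... = (SUM w:jwords. e * (eW p N l w * eB p N l m f))" by (rule sum.mono_neutral_right) (auto simp: jwords_def)
 also have "... = (SUM w:jwords. eW p N l w * eB p N l m f)"
  using idempotent_dichotomy[OF p char semis lm inj e cen] by (intro sum.cong refl) (fastforce simp: jwords_def)
 finally show ?thesis .
qed

text \<open>A non-zero projection contains a weight vector in characteristic p, and
  \<open>char_weight_valid\<close> lifts its residues to the contents of an actual chain of
  partitions.\<close>

lemma jwords_nonzero_path:
 assumes w: "w : rwords p n" and nz: "eW p N l w * eB p N l m f ~= (0 :: 'k galg)"
 shows "EX ts. valid base_set ts & length ts = m & mset (rword p ts) = rmset p m f &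
  mset (rword p (take l ts)) = rmset p l f & rword p (drop l ts) = w"
proof -
 let ?y = "eW p N l w * eB p N l m f :: 'k galg"
 have 0: "of_nat p = (0 :: 'k galg)" by (rule galg_char[OF char])
 have lm': "l <= m" using lm by simp
 have len: "l + length w <= m" and lw: "length w = n" using w lm by (simp_all add: rwords_def)
 have WB: "eB p N l m f * eW p N l w = ?y" by (rule gz_commute[OF eB_gz[OF lm'] eW_gz[OF len]])
 have Wy: "eW p N l w * ?y = ?y" using eW_idem[OF p 0 semis len] by (simp flip: mult.assoc)
 have By: "eB p N l m f * ?y = ?y" using WB eB_idem[OF p 0 semis lm'] by (metis mult.assoc)
 obtain h g where g: "h * ?y ~= 0" "wtv m g (h * ?y)" "rmset p m g = rmset p m f"
  "rmset p l g = rmset p l f" "ALL r<n. [g (Suc (l + r)) = w ! r] (mod int p)" using ex_weight_idem[OF p char semis w lm nz Wy By] by blast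
 define gs where "gs = map g [1..<Suc m]"
 have len_gs: "length gs = m" by (simp add: gs_def del: upt_Suc)
 have gs_nth: "gs ! j = g (Suc j)" if "j < m" for j using that by (simp add: gs_def del: upt_Suc)
 have "wtl gs (h * ?y)" using g(2) by (simp only: wtl_wtv gs_def)
 then obtain ts where ts: "valid base_set ts" "list_all2 (%a i. [a = i] (mod int p)) ts gs" using char_weight_valid[OF p char g(1)] by blast
 hence lt: "length ts = m" using len_gs by (auto dest: list_all2_lengthD)
 have cg: "[ts ! j = g (Suc j)] (mod int p)" if "j < m" for j using list_all2_nthD2[OF ts(2), of j] that len_gs gs_nth by simp
 have "rmset p k (entry ts) = rmset p k g" if "k <= m" for k
 proof -
  have "entry ts j mod int p = g j mod int p" if "j : {1..k}" for j using cg[of "j - 1"] that `k <= m` by (auto simp: cong_def)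
  thus ?thesis unfolding rmset_def by (intro image_mset_cong) auto
 qed
 hence "mset (rword p ts) = rmset p m f" "mset (rword p (take l ts)) = rmset p l f"
  using rmset_entry[of m ts p] rmset_entry[of l ts p] lt g lm' by auto
 moreover have "w = rword p (drop l ts)"
 proof -
  have "[drop l ts ! r = w ! r] (mod int p)" if "r < n" for r
  proof -
   have "[ts ! (l + r) = g (Suc (l + r))] (mod int p)" using that lm by (intro cg) simp
   thus ?thesis using g(5) that lt lm by (auto intro: cong_trans)
  qed
  thus ?thesis using rword_eq_iff[OF w, of "drop l ts"] lt lm by auto
 qed
 ultimately show ?thesis using ts(1) lt by blast
qed

text \<open>The integral lift \<open>?E\<close> of e * eB acts on the integral weight vectors of ts
  and of the exchanged sequence by 1 or 0 modulo p, according to whether their words lie in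
  \<open>jwords\<close>; \<open>central_link\<close> makes these values equal.\<close>

lemma jwords_swap:
 assumes ts: "valid base_set ts" "length ts = m" "mset (rword p ts) = rmset p m f" "mset (rword p (take l ts)) = rmset p l f"
  and tsd: "ts = xs @ c # d # ys" and xs: "l <= length xs" and cd: "abs (d - c) >= 2"
 shows "rword p (drop l ts) : jwords <-> rword p (drop l (xs @ d # c # ys)) : jwords"
proof -
 let ?ts' = "xs @ d # c # ys"
 let ?E = "SUM w:jwords. eW p N l w * eB p N l m f :: int galg"
 have lm': "l <= m" using lm by simp
 have p0: "p > 0" using p prime_gt_0_nat by blast
 have len: "l + length w <= m" if "w : jwords" for w using that lm by (simp add: jwords_def rwords_def)
 have ts': "length ?ts' = m" "mset (rword p ?ts') = rmset p m f" "mset (rword p (take l ?ts')) = rmset p l f"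
  using ts xs unfolding tsd by (auto simp: rword_def add_mset_commute)
 obtain v :: "int galg" where v: "v ~= 0" "wtl ts v" using valid_is_weight[OF ts(1)] by (auto simp: is_weight_def)
 define v' where "v' = of_int (d - c) * (sr (Suc (length xs)) * v) - v"
 have v': "v' ~= 0" "wtl ?ts' v'" using wtl_swap[OF v(1) _ cd, of xs ys] v(2) unfolding tsd v'_def by blast+
 have am: "amod p ?E u (of_bool (rword p (drop l us) : jwords))"
  if us: "wtl us u" "length us = m" "mset (rword p us) = rmset p m f" "mset (rword p (take l us)) = rmset p l f" for us u
 proof -
  have w: "wtv m (entry us) u" using wtl_wtv_entry[OF us(1)] us(2) by simp
  have "rmset p m (entry us) = rmset p m f" "rmset p l (entry us) = rmset p l f"
   using rmset_entry[of m us p] rmset_entry[of l us p] us lm' by auto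
  hence B: "amod p (eB p N l m f) u 1" by (rule eB_amod[OF p char w lm'])
  have W: "amod p (eW p N l w * eB p N l m f) u (if w = rword p (drop l us) then 1 else 0)" if "w : jwords" for w
  proof -
   have wr: "w : rwords p n" "length w = n" using that by (auto simp: jwords_def rwords_def)
   have "(ALL r<length w. [entry us (Suc (l + r)) = w ! r] (mod int p)) <-> w = rword p (drop l us)"
    using rword_eq_iff[OF wr(1), of "drop l us"] us(2) lm wr by simp
   thus ?thesis using amod_mult[OF eW_amod[OF p w len[OF that]] B] by (simp add: of_bool_def)
  qed
  have "amod p ?E u (SUM w:jwords. if w = rword p (drop l us) then 1 else 0)" by (intro amod_sum W)
  moreover have "finite jwords" by (simp add: jwords_def)
  ultimately show ?thesis by (simp add: of_bool_def)
 qed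
 obtain et where et: "?E * v = of_int et * v" "[et = of_bool (rword p (drop l ts) : jwords)] (mod int p)"
  using am[OF v(2) ts(2-4)] by (auto simp: amod_def)
 obtain et' where et': "?E * v' = of_int et' * v'" "[et' = of_bool (rword p (drop l ?ts') : jwords)] (mod int p)"
  using am[OF v'(2) ts'] by (auto simp: amod_def)
 have rE: "(red ?E :: 'k galg) = e * eB p N l m f" unfolding idempotent_words by (simp add: red_sum red_mult red_eW red_eB)
 have "[et = et'] (mod int p)"
 proof (rule central_link[OF p char])
  show "?E : CA l m" by (intro cent_sum cent_mult eW_cent eB_cent lm' len)
  show "red ?E * c = c * (red ?E :: 'k galg)" if "c : CA l m" for c
   unfolding rE using cen[OF that] eB_commute[OF that] by (metis mult.assoc)
  show "l < Suc (length xs)" "Suc (Suc (length xs)) <= m" using xs ts(2) by (auto simp: tsd)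
  show "v' = of_int (d - c) * (sr (Suc (length xs)) * v) - v" by (simp add: v'_def)
 qed (use v' et et' in auto)
 hence c: "[of_bool (rword p (drop l ts) : jwords) = (of_bool (rword p (drop l ?ts') : jwords) :: int)] (mod int p)"
  using et(2) et'(2) by (meson cong_sym cong_trans)
 have "~ [0 = (1::int)] (mod int p)" "~ [1 = (0::int)] (mod int p)" using prime_gt_1_nat[OF p] by (auto simp: cong_def)
 thus ?thesis using c by (auto simp: of_bool_def split: if_splits)
qed

lemma jwords_swps:
 assumes "swps bs bs'" "valid base_set (as @ bs)" "length as = l" "length bs = n"
  "mset (rword p (as @ bs)) = rmset p m f" "mset (rword p as) = rmset p l f"
 shows "rword p bs : jwords <-> rword p bs' : jwords" using assms
proof (induction rule: rtranclp_induct)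
 case (step y z)
 hence IH: "rword p bs : jwords <-> rword p y : jwords" by blast
 from step.hyps(2) obtain c d xs ys where cd: "abs (c - d) >= 2" "y = xs @ c # d # ys" "z = xs @ d # c # ys" by (auto elim: swp.cases)
 have "swps (as @ bs) (as @ y)" using swps_append[OF step.hyps(1), of as "[]"] by simp
 hence v: "valid base_set (as @ y)" using step.prems(1) swps_valid by blast
 have ms: "mset y = mset bs" using step.hyps(1) by (induction rule: rtranclp_induct) (auto dest: swp_mset)
 hence "length y = n" using step.prems(3) by (metis mset_eq_length)
 have "rword p (drop l (as @ y)) : jwords <-> rword p (drop l ((as @ xs) @ d # c # ys)) : jwords"
 proof (rule jwords_swap[OF v])
  show "mset (rword p (as @ y)) = rmset p m f" using ms step.prems(4) by (simp add: rword_def)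
 qed (use step.prems `length y = n` lm cd in auto)
 thus ?case using IH step.prems cd by simp
qed simp

end

section \<open>Chains of bead configurations\<close>

text \<open>Beads of runner \<open>t\<close> of an abacus are at the heights \<open>B\<close>.  Letter \<open>t\<close> of a word adds a bead at height \<open>z\<close>
 and letter \<open>t + 1\<close> removes one at height \<open>w\<close>.  In \<open>TH\<close> the former comes first, in \<open>TV\<close> the latter; \<open>TF\<close> permits
 both orders.  Only letter \<open>t + 1\<close> occurs in \<open>TS\<close>, only letter \<open>t\<close> in \<open>TN\<close>, and neither in \<open>TO\<close>.\<close>

datatype ety = TH | TV | TF | TS | TN | TO

fun conn :: "ety => nat => nat => nat set => bool" where
 "conn TH z w B <-> z ~: B & (w : B | w = z)"
| "conn TV z w B <-> w : B & (z ~: B | z = w)"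
| "conn TF z w B <-> z ~= w & z ~: B & w : B"
| "conn TS z w B <-> w : B"
| "conn TN z w B <-> z ~: B"
| "conn TO z w B <-> True"

text \<open>The sum \<open>E\<close> of all heights determines the size of the partition, as the bead counts are fixed.\<close>

fun reach :: "(nat \<times> ety) list => nat => nat => bool" where
 "reach [] z E <-> E = 0"
| "reach ((c, t) # L) z E <->
  (EX B w E'. finite B & card B = c & conn t z w B & reach L w E' & E = \<Sum>B + E')"

fun seg :: "(nat \<times> ety) list => nat => nat => nat => bool" where
 "seg [] z y E <-> z = y & E = 0"
| "seg ((c, t) # L) z y E <->
  (EX B w E'. finite B & card B = c & conn t z w B & seg L w y E' & E = \<Sum>B + E')"

lemma reachI': "finite B ==> card B = c ==> conn t z w B ==> reach L w E' ==> E = \<Sum>B + E' ==> reach ((c, t) # L) z E" by auto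

lemma segI: "finite B ==> card B = c ==> conn t z w B ==> seg L w y E' ==> E = \<Sum>B + E' ==> seg ((c, t) # L) z y E" by auto

lemma reach_append: "reach (L @ L') z E <-> (EX w E1 E2. seg L z w E1 & reach L' w E2 & E = E1 + E2)"
proof (induction L z E rule: reach.induct)
 case (2 c t L z E)
 show ?case
 proof
  assume "reach (((c, t) # L) @ L') z E"
  then obtain B w E' where B: "finite B" "card B = c" "conn t z w B" "reach (L @ L') w E'" "E = \<Sum>B + E'" by auto
  then obtain y E1 E2 where "seg L w y E1" "reach L' y E2" "E' = E1 + E2" using 2 by blast
  hence "seg ((c, t) # L) z y (\<Sum>B + E1)" "E = \<Sum>B + E1 + E2" using segI[OF B(1-3)] B(5) by simp_all
  thus "EX y E1 E2. seg ((c, t) # L) z y E1 & reach L' y E2 & E = E1 + E2" using `reach L' y E2` by blast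
 next
  assume "EX y E1 E2. seg ((c, t) # L) z y E1 & reach L' y E2 & E = E1 + E2"
  then obtain y E1 E2 B w E' where *: "finite B" "card B = c" "conn t z w B" "seg L w y E'" "E1 = \<Sum>B + E'" "reach L' y E2" "E = E1 + E2" by auto
  hence "reach (L @ L') w (E' + E2)" using 2 by blast
  thus "reach (((c, t) # L) @ L') z E" unfolding append_Cons reach.simps using * by (intro exI[of _ B] exI[of _ w] exI[of _ "E' + E2"]) auto
 qed
qed auto

definition swp_bead :: "nat => nat => nat set => nat set" where
 "swp_bead a b B = insert b (B - {a})"

lemma swp_bead:
 assumes "finite B" "a : B" "b ~: B"
 shows "finite (swp_bead a b B)" "card (swp_bead a b B) = card B" "\<Sum>(swp_bead a b B) + a = \<Sum>B + b"
proof -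
 have b: "b ~: B - {a}" using assms by blast
 have "card (swp_bead a b B) = Suc (card (B - {a}))" unfolding swp_bead_def using assms(1) b by simp
 thus "card (swp_bead a b B) = card B" using assms by (metis card_Suc_Diff1)
 have "\<Sum>(swp_bead a b B) = b + \<Sum>(B - {a})" unfolding swp_bead_def using assms(1) b by simp
 moreover have "\<Sum>B = a + \<Sum>(B - {a})" using assms by (simp add: sum.remove)
 ultimately show "\<Sum>(swp_bead a b B) + a = \<Sum>B + b" by simp
qed (use assms in \<open>simp add: swp_bead_def\<close>)

lemma mem_swp_bead [simp]: "x : swp_bead a b B <-> x = b | (x : B & x ~= a)" by (auto simp: swp_bead_def)

lemma reachI: "finite B ==> conn t z w B ==> reach L w E' ==> reach ((card B, t) # L) z (\<Sum>B + E')" by auto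

text \<open>A change of the start by one costs at most one unit of height: upwards the total stays
  or drops by one, downwards it stays or grows by one. An obstructing bead is moved between z and z
  + 1. If the next target has to follow, the induction hypothesis is used, sometimes in the opposite
  direction, so both directions are proved together.\<close>

lemma shift_reach:
 "(reach L z E --> reach L (Suc z) E | (EX E'. E = Suc E' & reach L (Suc z) E')) &
  (reach L (Suc z) E --> reach L z E | reach L z (Suc E))"
proof (induction L arbitrary: z E)
 case (Cons ct L)
 obtain c t where ct: "ct = (c, t)" by fastforce
 have up: "reach L (Suc w) E' | (EX E''. E' = Suc E'' & reach L (Suc w) E'')" if "reach L w E'" for w E' using Cons that by blast
 have down: "reach L w E' | reach L w (Suc E')" if "reach L (Suc w) E'" for w E' using Cons that by blast
 show ?case
 proof (intro conjI impI)
  assume "reach (ct # L) z E"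
  then obtain B w E' where B: "finite B" "card B = c" "conn t z w B" "reach L w E'" "E = \<Sum>B + E'" unfolding ct by auto
  let ?G = "reach (ct # L) (Suc z) E | (EX E'. E = Suc E' & reach (ct # L) (Suc z) E')"
  have same: ?G if "conn t (Suc z) w' B" "reach L w' E'" for w' using reachI[OF B(1) that] B unfolding ct by auto
  have sameup: ?G if "w' = Suc w" "conn t (Suc z) w' B" for w'
   using up[OF B(4)] reachI[OF B(1) that(2), of L E'] reachI[OF B(1) that(2), of L] B(2,5) that(1) unfolding ct by auto
  have sw: ?G if "Suc z : B" "z ~: B" "conn t (Suc z) w' (swp_bead (Suc z) z B)" "reach L w' E'" for w'
  proof -
   note s = swp_bead[OF B(1) that(1,2)]
   show ?thesis using reachI'[OF s(1) _ that(3,4), of c "\<Sum>(swp_bead (Suc z) z B) + E'"] s(2,3) B(2,5) unfolding ct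
    by (intro disjI2 exI[of _ "\<Sum>(swp_bead (Suc z) z B) + E'"] conjI) linarith+
  qed
  have swdown: ?G if "Suc z : B" "z ~: B" "conn t (Suc z) z (swp_bead (Suc z) z B)" "w = Suc z"
  proof -
   note s = swp_bead[OF B(1) that(1,2)]
   have "reach L z E' | reach L z (Suc E')" using down B(4) that(4) by blast
   thus ?thesis
   proof
    assume "reach L z E'"
    from reachI'[OF s(1) _ that(3) this, of c "\<Sum>(swp_bead (Suc z) z B) + E'"] s(2,3) B(2,5) show ?thesis unfolding ct
     by (intro disjI2 exI[of _ "\<Sum>(swp_bead (Suc z) z B) + E'"] conjI) linarith+
   next
    assume "reach L z (Suc E')"
    from reachI'[OF s(1) _ that(3) this, of c E] s(2,3) B(2,5) show ?thesis unfolding ct by (intro disjI1) linarith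
   qed
  qed
  show ?G
  proof (cases t)
   case TH
   thus ?thesis using B same[of w] sameup[of "Suc z"] sw[of w] by (cases "Suc z : B"; cases "w = z"; cases "w = Suc z") auto
  next
   case TV
   thus ?thesis using B same[of w] sameup[of "Suc z"] sw[of w] by (cases "Suc z : B"; cases "w = z"; cases "w = Suc z") auto
  next
   case TF
   thus ?thesis using B same[of w] sw[of w] swdown by (cases "Suc z : B"; cases "w = Suc z") auto
  next
   case TS
   thus ?thesis using B same[of w] by auto
  next
   case TN
   thus ?thesis using B same[of w] sw[of w] by (cases "Suc z : B") auto
  next
   case TO
   thus ?thesis using B same[of w] by auto
  qed
 next
  assume "reach (ct # L) (Suc z) E"
  then obtain B w E' where B: "finite B" "card B = c" "conn t (Suc z) w B" "reach L w E'" "E = \<Sum>B + E'" unfolding ct by auto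
  let ?G = "reach (ct # L) z E | reach (ct # L) z (Suc E)"
  have same: ?G if "conn t z w' B" "reach L w' E'" for w' using reachI[OF B(1) that] B unfolding ct by auto
  have samedown: ?G if "w = Suc z" "conn t z z B"
   using down[of z E'] reachI[OF B(1) that(2), of L E'] reachI[OF B(1) that(2), of L "Suc E'"] B(2,4,5) that(1) unfolding ct by auto
  have sw: ?G if "z : B" "Suc z ~: B" "conn t z w' (swp_bead z (Suc z) B)" "reach L w' E'" for w'
  proof -
   note s = swp_bead[OF B(1) that(1,2)]
   show ?thesis using reachI'[OF s(1) _ that(3,4), of c "Suc E"] s(2,3) B(2,5) unfolding ct by (intro disjI2) linarith
  qed
  have swup: ?G if "z : B" "Suc z ~: B" "conn t z (Suc z) (swp_bead z (Suc z) B)" "w = z"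
  proof -
   note s = swp_bead[OF B(1) that(1,2)]
   have "reach L (Suc z) E' | (EX E''. E' = Suc E'' & reach L (Suc z) E'')" using up B(4) that(4) by blast
   thus ?thesis
   proof
    assume "reach L (Suc z) E'"
    from reachI'[OF s(1) _ that(3) this, of c "Suc E"] s(2,3) B(2,5) show ?thesis unfolding ct by (intro disjI2) linarith
   next
    assume "EX E''. E' = Suc E'' & reach L (Suc z) E''"
    then obtain E'' where E'': "E' = Suc E''" "reach L (Suc z) E''" by blast
    from reachI'[OF s(1) _ that(3) E''(2), of c E] s(2,3) B(2,5) E''(1) show ?thesis unfolding ct by (intro disjI1) linarith
   qed
  qed
  show ?G
  proof (cases t)
   case TH
   thus ?thesis using B same[of w] samedown sw[of w] sw[of "Suc z"] by (cases "z : B"; cases "w = z"; cases "w = Suc z") auto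
  next
   case TV
   thus ?thesis using B same[of w] samedown sw[of w] by (cases "z : B"; cases "w = z"; cases "w = Suc z") auto
  next
   case TF
   thus ?thesis using B same[of w] sw[of w] swup by (cases "z : B"; cases "w = z") auto
  next
   case TS
   thus ?thesis using B same[of w] by auto
  next
   case TN
   thus ?thesis using B same[of w] sw[of w] by (cases "z : B") auto
  next
   case TO
   thus ?thesis using B same[of w] by auto
  qed
 qed
qed auto

text \<open>One unit of height is to be inserted. If x + 1 is occupied, a higher bead with free
  space above it is raised. Otherwise the bead x is raised; should the rest of the chain give the
  unit back by \<open>shift_reach\<close>, the argument is repeated with a smaller rest.\<close>

lemma pad_reach_aux:
 assumes "finite B" "x : B" "reach L x E'" "conn TS z x B"
 shows "reach ((card B, TS) # L) z (Suc (\<Sum>B + E'))" using assms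
proof (induction E' arbitrary: B x rule: less_induct)
 case (less E')
 show ?case
 proof (cases "Suc x : B")
  case True
  obtain y where y: "y : B" "y > x" "Suc y ~: B"
  proof -
   define y where "y = Max B"
   have "y : B" "Suc x <= y" using less.prems(1) True by (auto simp: y_def intro: Max_in)
   moreover have "Suc y ~: B" using Max_ge[OF less.prems(1), of "Suc (Max B)"] by (auto simp: y_def)
   ultimately show ?thesis using that by auto
  qed
  note s = swp_bead[OF less.prems(1) y(1,3)]
  have "conn TS z x (swp_bead y (Suc y) B)" using less.prems y by auto
  from reachI[OF s(1) this less.prems(3)] s(2,3) show ?thesis by auto
 next
  case False
  note s = swp_bead[OF less.prems(1,2) False]
  have c: "conn TS z (Suc x) (swp_bead x (Suc x) B)" by simp
  have "reach L (Suc x) E' | (EX E''. E' = Suc E'' & reach L (Suc x) E'')" using shift_reach less.prems(3) by blast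
  thus ?thesis
  proof
   assume "reach L (Suc x) E'"
   from reachI[OF s(1) c this] s(2,3) show ?thesis by auto
  next
   assume "EX E''. E' = Suc E'' & reach L (Suc x) E''"
   then obtain E'' where E'': "E' = Suc E''" "reach L (Suc x) E''" by blast
   have "reach ((card (swp_bead x (Suc x) B), TS) # L) z (Suc (\<Sum>(swp_bead x (Suc x) B) + E''))"
    using less.IH[OF _ s(1) _ E''(2) c] E''(1) by simp
   moreover have "\<Sum>(swp_bead x (Suc x) B) + E'' = \<Sum>B + E'" using s(3) E''(1) by simp
   ultimately show ?thesis using s(2) by simp
  qed
 qed
qed

lemma pad_reach: "E' <= E ==> reach ((c, TS) # L) z E' ==> reach ((c, TS) # L) z E"
proof (induction E rule: dec_induct)
 case (step E)
 then obtain B w E1 where "finite B" "card B = c" "conn TS z w B" "reach L w E1" "E = \<Sum>B + E1" by auto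
 thus ?case using pad_reach_aux[of B w L E1 z] by auto
qed

text \<open>The least sum of c distinct heights.\<close>

definition tri :: "nat => nat" where "tri c = \<Sum>{..<c}"

lemma tri_Suc [simp]: "tri (Suc c) = tri c + c" "tri 0 = 0" by (simp_all add: tri_def)

lemma tri_le: "finite B ==> card B = c ==> tri c <= \<Sum>B"
proof (induction c arbitrary: B)
 case (Suc c)
 define M where "M = Max B"
 have M: "M : B" using Suc.prems by (auto simp: M_def intro: Max_in)
 have "B - {M} <= {..<M}" using Suc.prems(1) by (force simp: M_def intro: le_neq_trans)
 hence "card (B - {M}) <= M" using card_mono[of "{..<M}"] by fastforce
 hence "c <= M" using Suc.prems M by simp
 moreover have "tri c <= \<Sum>(B - {M})" using Suc.prems M by (intro Suc.IH) auto
 moreover have "\<Sum>B = M + \<Sum>(B - {M})" using Suc.prems M by (simp add: sum.remove)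
 ultimately show ?case by simp
qed simp

lemma tri_le_member: "finite B ==> x : B ==> tri (card B) + x <= \<Sum>B + (card B - 1)"
proof -
 assume B: "finite B" "x : B"
 hence "tri (card (B - {x})) <= \<Sum>(B - {x})" by (intro tri_le) auto
 moreover have "\<Sum>B = x + \<Sum>(B - {x})" using B by (simp add: sum.remove)
 moreover have "card B = Suc (card (B - {x}))" using B by (metis card_Suc_Diff1)
 ultimately show ?thesis by simp
qed

lemma tri_le_gap: "finite B ==> x ~: B ==> tri (card B) + card B <= \<Sum>B + x" using tri_le[of "insert x B" "Suc (card B)"] by simp

lemma tri_le_jump: "finite B ==> w : B ==> z ~: B ==> tri (card B) + w <= \<Sum>B + z"
 using swp_bead[of B w z] tri_le[of "swp_bead w z B" "card B"] by simp

text \<open>The type for which a chain can rest at height c0 - 1 while c beads lie as low as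
  possible: \<open>TH\<close> if that height is above the beads, \<open>TV\<close> if it is
  occupied.\<close>

definition lazy :: "nat => nat => ety" where
 "lazy c0 c = (if c < c0 then TH else TV)"

text \<open>In types \<open>TH\<close> and \<open>TV\<close> a moving chain passes from a gap z to a
  bead w. Exchanging the two leaves at least the minimal sum, so the height exceeds it by at least w
  - z.\<close>

lemma seg_lower:
 "seg L z y E ==> (!!c t. (c, t) : set L ==> t = TH | t = TV) ==> (\<Sum>(c, t)\<leftarrow>L. tri c) + y <= E + z & (\<Sum>(c, t)\<leftarrow>L. tri c) <= E"
proof (induction L arbitrary: z E)
 case (Cons ct L)
 obtain c t where ct: "ct = (c, t)" by fastforce
 obtain B w E' where B: "finite B" "card B = c" "conn t z w B" "seg L w y E'" "E = \<Sum>B + E'" using Cons.prems(1) unfolding ct by auto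
 have IH: "(\<Sum>(c, t)\<leftarrow>L. tri c) + y <= E' + w" "(\<Sum>(c, t)\<leftarrow>L. tri c) <= E'" using Cons.IH[OF B(4)] Cons.prems(2) by auto
 have "t = TH | t = TV" using Cons.prems(2) ct by auto
 hence "tri c + w <= \<Sum>B + z" using B tri_le[OF B(1,2)] tri_le_jump[OF B(1), of w z] by (cases "w = z") auto
 thus ?case using IH tri_le[OF B(1,2)] by (simp add: ct B(5))
qed auto

lemma seg_flush:
 assumes "!!c t. (c, t) : set L ==> t = lazy (Suc t0) c"
 shows "seg L t0 t0 (\<Sum>(c, t)\<leftarrow>L. tri c)" using assms
proof (induction L)
 case (Cons ct L)
 obtain c t where ct: "ct = (c, t)" by fastforce
 have "t = lazy (Suc t0) c" using Cons.prems ct by auto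
 hence "conn t t0 t0 {..<c}" by (auto simp: lazy_def)
 moreover have "seg L t0 t0 (\<Sum>(c, t)\<leftarrow>L. tri c)" using Cons by auto
 ultimately have "seg ((c, t) # L) t0 t0 (\<Sum>{..<c} + (\<Sum>(c, t)\<leftarrow>L. tri c))" by (intro segI[OF _ _ _ _ refl]) simp_all
 thus ?case by (simp add: ct tri_def)
qed simp

text \<open>The order can be freed at the first type that is not lazy. All runners of the run before
  it are lowered to their minimal configurations with the chain at rest at t0. The height saved
  suffices to give the runner in question beads that avoid t0 and meet the continuation of the
  chain, and a surplus is used up by \<open>pad_reach\<close>.\<close>

lemma reach_flip:
 assumes L1: "!!c t. (c, t) : set L1 ==> t = lazy c0 c" and t: "t : {TH, TV}" "t ~= lazy c0 c"
  and r: "reach ((c0, TS) # L1 @ (c, t) # L2) z E"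
 shows "reach ((c0, TS) # L1 @ (c, TF) # L2) z E"
proof -
 obtain B0 w0 E0 where B0: "finite B0" "card B0 = c0" "w0 : B0" "reach (L1 @ (c, t) # L2) w0 E0" "E = \<Sum>B0 + E0" using r by auto
 obtain x E1 E2 where x: "seg L1 w0 x E1" "reach ((c, t) # L2) x E2" "E0 = E1 + E2" using B0(4) reach_append by blast
 obtain B x' E3 where B: "finite B" "card B = c" "conn t x x' B" "reach L2 x' E3" "E2 = \<Sum>B + E3" using x(2) by auto
 define S where "S = (\<Sum>(c, t)\<leftarrow>L1. tri c)"
 have "c0 > 0" using B0 by (auto simp: card_gt_0_iff)
 then obtain t0 where t0: "c0 = Suc t0" by (cases c0) auto
 have "S + x <= E1 + w0 & S <= E1" unfolding S_def using L1 unfolding lazy_def by (intro seg_lower[OF x(1)]) metis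
 moreover have "tri c0 + w0 <= \<Sum>B0 + t0" "tri c0 <= \<Sum>B0" using tri_le_member[OF B0(1,3)] tri_le[OF B0(1,2)] B0(2) t0 by simp_all
 ultimately have low: "tri c0 + S + x <= \<Sum>B0 + E1 + t0" "tri c0 + S <= \<Sum>B0 + E1" by linarith+
 have new: "reach ((c0, TS) # L1 @ (c, TF) # L2) z (tri c0 + S + \<Sum>B' + E')"
  if "finite B'" "card B' = c" "t0 ~: B'" "y : B'" "reach L2 y E'" for B' y E'
 proof -
  have "seg L1 t0 t0 S" unfolding S_def using L1 t0 by (intro seg_flush) simp
  moreover have "conn TF t0 y B'" using that by auto
  hence "reach ((c, TF) # L2) t0 (\<Sum>B' + E')" using reachI[OF that(1) _ that(5), of TF t0] that(2) by simp
  ultimately have "reach (L1 @ (c, TF) # L2) t0 (S + (\<Sum>B' + E'))" unfolding reach_append by blast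
  moreover have "conn TS z t0 {..<c0}" using t0 by simp
  ultimately have "reach ((card {..<c0}, TS) # L1 @ (c, TF) # L2) z (\<Sum>{..<c0} + (S + (\<Sum>B' + E')))" by (intro reachI) simp_all
  thus ?thesis by (simp add: tri_def add.assoc)
 qed
 show ?thesis
 \<comment> \<open>If the chain moves at this runner, both orders are already permitted by B; only a
   chain at rest calls for new beads.\<close>
 proof (cases "x = x'")
  case False
  hence "conn TF x x' B" using B(3) t(1) by auto
  hence "reach ((c, TF) # L2) x E2" using reachI[OF B(1) _ B(4), of TF x] B(2,5) by simp
  hence "reach (L1 @ (c, TF) # L2) w0 E0" unfolding reach_append using x(1,3) by blast
  thus ?thesis using B0 by auto
 next
  case eq: True
  show ?thesis
  proof (cases "t = TH")
   case True
   hence c: "t0 < c" using t(2) t0 by (auto simp: lazy_def split: if_splits)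
   have xB: "x ~: B" using B(3) True by simp
   have gap: "tri c + c <= \<Sum>B + x" "tri c <= \<Sum>B" using tri_le_gap[OF B(1) xB] tri_le[OF B(1,2)] B(2) by simp_all
   \<comment> \<open>The lowest c beads that avoid t0, as t0 < c.\<close>
   define B1 where "B1 = {..c} - {t0}"
   have "\<Sum>{..c} = t0 + \<Sum>B1" unfolding B1_def using c by (intro sum.remove) auto
   hence B1: "finite B1" "card B1 = c" "t0 ~: B1" "\<Sum>B1 + t0 = tri c + c"
    using c tri_Suc(1)[of c] by (auto simp: B1_def tri_def lessThan_Suc_atMost)
   consider "x = t0" | "x ~= t0" "x < c" | "x >= c" "x ~= t0" using c by linarith
   thus ?thesis
   proof cases
    \<comment> \<open>The continuation starts at t0, which must stay free, so it is restarted one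
      height above; by \<open>shift_reach\<close> this does not increase the total.\<close>
    case 1
    then obtain E' where E': "reach L2 (Suc t0) E'" "E' <= E3" using shift_reach[of L2 t0 E3] B(4) eq by auto
    have "reach ((c0, TS) # L1 @ (c, TF) # L2) z (tri c0 + S + \<Sum>B1 + E')"
     using c by (intro new[OF B1(1-3) _ E'(1)]) (auto simp: B1_def)
    moreover have "tri c0 + S + \<Sum>B1 + E' <= E" using low gap B1(4) E'(2) 1 unfolding B0(5) x(3) B(5) by linarith
    ultimately show ?thesis using pad_reach by blast
   next
    case 2
    hence "reach ((c0, TS) # L1 @ (c, TF) # L2) z (tri c0 + S + \<Sum>B1 + E3)" using B(4) eq by (intro new[OF B1(1-3)]) (auto simp: B1_def)
    moreover have "tri c0 + S + \<Sum>B1 + E3 <= E" using low gap B1(4) unfolding B0(5) x(3) B(5) by linarith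
    ultimately show ?thesis using pad_reach by blast
   next
    case 3
    have nx: "t0 : {..<c}" "x ~: {..<c}" using c 3 by auto
    define B2 where "B2 = swp_bead t0 x {..<c}"
    have B2: "finite B2" "card B2 = c" "\<Sum>B2 + t0 = tri c + x" using swp_bead[OF _ nx] by (simp_all add: B2_def tri_def)
    have "reach ((c0, TS) # L1 @ (c, TF) # L2) z (tri c0 + S + \<Sum>B2 + E3)"
     using B(4) eq 3 by (intro new[OF B2(1,2)]) (auto simp: B2_def)
    moreover have "tri c0 + S + \<Sum>B2 + E3 <= E" using low gap B2(3) unfolding B0(5) x(3) B(5) by linarith
    ultimately show ?thesis using pad_reach by blast
   qed
  next
   case False
   hence tV: "t = TV" using t by auto
   hence c: "c <= t0" using t(2) t0 by (auto simp: lazy_def split: if_splits)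
   have xB: "x : B" using B(3) eq tV by simp
   hence "c > 0" using B by (auto simp: card_gt_0_iff)
   then obtain c1 where c1: "c = Suc c1" by (cases c) auto
   have mem: "tri c + x <= \<Sum>B + c1" "tri c <= \<Sum>B" using tri_le_member[OF B(1) xB] tri_le[OF B(1,2)] B(2) c1 by simp_all
   have ins: "finite (insert y {..<c1})" "card (insert y {..<c1}) = c" "\<Sum>(insert y {..<c1}) = tri c1 + y" if "y >= c1" for y
    using that c1 by (auto simp: tri_def)
   consider "x = t0" | "x ~= t0" "x < c" | "x ~= t0" "x >= c" by linarith
   thus ?thesis
   proof cases
    \<comment> \<open>Again t0 must stay free. The continuation is restarted one height below, and
      the unit that this may cost is covered by the lower bead.\<close>
    case 1
    hence "reach L2 (Suc (t0 - 1)) E3" using B(4) eq c c1 by simp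
    then obtain E' where E': "reach L2 (t0 - 1) E'" "E' <= Suc E3" using shift_reach[of L2 "t0 - 1" E3] by (meson le_Suc_eq order_refl)
    have y: "t0 - 1 >= c1" using c c1 by simp
    have "reach ((c0, TS) # L1 @ (c, TF) # L2) z (tri c0 + S + \<Sum>(insert (t0 - 1) {..<c1}) + E')"
     using c c1 by (intro new[OF ins(1,2)[OF y] _ _ E'(1)]) auto
    moreover have "tri c0 + S + \<Sum>(insert (t0 - 1) {..<c1}) + E' <= E"
     using low mem E'(2) 1 c c1 unfolding B0(5) x(3) B(5) ins(3)[OF y] by simp
    ultimately show ?thesis using pad_reach by blast
   next
    case 2
    hence "reach ((c0, TS) # L1 @ (c, TF) # L2) z (tri c0 + S + \<Sum>{..<c} + E3)" using B(4) eq c by (intro new) auto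
    moreover have "tri c0 + S + \<Sum>{..<c} + E3 <= E" using low mem unfolding B0(5) x(3) B(5) tri_def[symmetric] by simp
    ultimately show ?thesis using pad_reach by blast
   next
    case 3
    hence y: "x >= c1" using c1 by simp
    have "reach ((c0, TS) # L1 @ (c, TF) # L2) z (tri c0 + S + \<Sum>(insert x {..<c1}) + E3)"
     using B(4) eq 3 c c1 by (intro new[OF ins(1,2)[OF y]]) auto
    moreover have "tri c0 + S + \<Sum>(insert x {..<c1}) + E3 <= E" using low mem c1 unfolding B0(5) x(3) B(5) ins(3)[OF y] by simp
    ultimately show ?thesis using pad_reach by blast
   qed
  qed
 qed
qed

section \<open>Paths as chains\<close>

definition chain :: "nat => (nat => nat) => (nat => ety) => (nat => nat set) => (nat => nat) => bool" where
 "chain k c ty B x <-> (ALL t<k. finite (B t) & card (B t) = c t & conn (ty t) (x t) (x (Suc t)) (B t))"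

lemma reach_chain:
 "reach (map (%t. (c t, ty t)) [i..<i + k]) z E <->
  (EX B x. x i = z & (ALL t:{i..<i + k}. finite (B t) & card (B t) = c t & conn (ty t) (x t) (x (Suc t)) (B t)) &
   E = (SUM t:{i..<i + k}. \<Sum>(B t)))"
proof (induction k arbitrary: i z E)
 case (Suc k)
 have l: "[i..<i + Suc k] = i # [Suc i..<Suc i + k]" by (simp add: upt_conv_Cons del: upt_Suc)
 have s: "{i..<i + Suc k} = insert i {Suc i..<Suc i + k}" by auto
 show ?case (is "?L <-> ?R")
 proof
  assume ?L
  then obtain B0 w E' where B0: "finite B0" "card B0 = c i" "conn (ty i) z w B0" "E = \<Sum>B0 + E'"
   "reach (map (%t. (c t, ty t)) [Suc i..<Suc i + k]) w E'" unfolding l by auto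
  then obtain B x where Bx: "x (Suc i) = w" "ALL t:{Suc i..<Suc i + k}. finite (B t) & card (B t) = c t & conn (ty t) (x t) (x (Suc t)) (B t)"
   "E' = (SUM t:{Suc i..<Suc i + k}. \<Sum>(B t))" using Suc.IH by blast
  have "(SUM t:{Suc i..<Suc i + k}. \<Sum>((B(i := B0)) t)) = E'" unfolding Bx(3) by (intro sum.cong) auto
  hence "E = (SUM t:{i..<i + Suc k}. \<Sum>((B(i := B0)) t))" unfolding s using B0(4) by simp
  moreover have "ALL t:{i..<i + Suc k}. finite ((B(i := B0)) t) & card ((B(i := B0)) t) = c t &
   conn (ty t) ((x(i := z)) t) ((x(i := z)) (Suc t)) ((B(i := B0)) t)" unfolding s using B0 Bx by auto
  ultimately show ?R by (intro exI[of _ "B(i := B0)"] exI[of _ "x(i := z)"]) simp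
 next
  assume ?R
  then obtain B x where Bx: "x i = z" "ALL t:{i..<i + Suc k}. finite (B t) & card (B t) = c t & conn (ty t) (x t) (x (Suc t)) (B t)"
   "E = (SUM t:{i..<i + Suc k}. \<Sum>(B t))" by blast
  have "reach (map (%t. (c t, ty t)) [Suc i..<Suc i + k]) (x (Suc i)) (SUM t:{Suc i..<Suc i + k}. \<Sum>(B t))"
   unfolding Suc.IH using Bx(2) by (intro exI[of _ B] exI[of _ x]) (auto simp: s)
  moreover have "E = \<Sum>(B i) + (SUM t:{Suc i..<Suc i + k}. \<Sum>(B t))" unfolding Bx(3) s by simp
  moreover have "finite (B i)" "card (B i) = c i" "conn (ty i) z (x (Suc i)) (B i)" using Bx(1,2) by auto
  ultimately have "reach ((c i, ty i) # map (%t. (c t, ty t)) [Suc i..<Suc i + k]) z E" by (intro reachI')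
  thus ?L unfolding l by (simp only: list.map)
 qed
qed (auto intro: exI[of _ "%_. _"])

lemma reach_iff_chain:
 "(EX z. reach (map (%t. (c t, ty t)) [0..<k]) z E) <-> (EX B x. chain k c ty B x & E = (SUM t<k. \<Sum>(B t)))"
proof -
 have s: "{0..<0 + k} = {..<k}" "[0..<0 + k] = [0..<k]" by auto
 have "reach (map (%t. (c t, ty t)) [0..<k]) z E <-> (EX B x. x 0 = z & chain k c ty B x & E = (SUM t<k. \<Sum>(B t)))" for z
  using reach_chain[of c ty 0 k z E] unfolding s chain_def Ball_def lessThan_iff by blast
 thus ?thesis by blast
qed

definition before :: "'a list => 'a => 'a => bool" where
 "before v s t <-> (EX xs ys. v = xs @ t # ys & s : set xs)"

lemma distinct_split: "distinct (xs @ t # ys) ==> xs @ t # ys = xs' @ t # ys' ==> xs = xs' & ys = ys'"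
 by (metis append_Cons_eq_iff distinct.simps(2) distinct_append disjoint_iff list.set_intros(1))

lemma before_split: "distinct v ==> v = xs @ t # ys ==> before v s t <-> s : set xs" unfolding before_def using distinct_split by metis

lemma before_total:
 assumes "distinct v" "s : set v" "t : set v" "s ~= t"
 shows "before v s t <-> ~ before v t s"
proof -
 obtain xs ys where v: "v = xs @ t # ys" using assms(3) by (meson split_list)
 show ?thesis
 proof (cases "s : set xs")
  case True
  then obtain us vs where xs: "xs = us @ s # vs" by (meson split_list)
  have "v = us @ s # (vs @ t # ys)" using v xs by simp
  thus ?thesis using before_split[OF assms(1) v, of s] before_split[OF assms(1), of us s "vs @ t # ys" t] assms(1) v xs by auto
 next
  case False
  hence "s : set ys" using assms v by auto
  then obtain us vs where ys: "ys = us @ s # vs" by (meson split_list)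
  have "v = (xs @ t # us) @ s # vs" using v ys by simp
  thus ?thesis using before_split[OF assms(1) v, of s] before_split[OF assms(1), of "xs @ t # us" s vs t] False by auto
 qed
qed

definition wty :: "nat list => nat => ety" where
 "wty v t = (if t : set v then if Suc t : set v then if before v t (Suc t) then TH else TV else TN
  else if Suc t : set v then TS else TO)"

lemma fin_mem_prev: "c ~: set xs ==> c - 1 : fin X xs <-> c - 1 : X | c - 1 : set xs" by (induction xs arbitrary: X) (auto simp: mv_def)

lemma fin_mem_self: "c ~: set xs ==> c : fin X xs <-> c : X & c + 1 ~: set xs"
proof (induction xs arbitrary: X)
 case (Cons a xs)
 have "c : mv X a <-> c : X & c + 1 ~= a" using Cons.prems by (simp add: mv_def) linarith
 thus ?case using Cons by simp
qed simp

lemma valid_splits: "valid X bs <-> (ALL xs c ys. bs = xs @ c # ys --> c - 1 : fin X xs & c ~: fin X xs)"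
proof (induction bs arbitrary: X)
 case (Cons a bs)
 have "(ALL xs c ys. a # bs = xs @ c # ys --> c - 1 : fin X xs & c ~: fin X xs) <->
  (a - 1 : X & a ~: X) & (ALL xs c ys. bs = xs @ c # ys --> c - 1 : fin (mv X a) xs & c ~: fin (mv X a) xs)"
  (is "?A <-> ?B & ?C")
 proof (intro iffI conjI)
  assume A: ?A
  show "a - 1 : X" "a ~: X" using A[rule_format, of "[]" a bs] by auto
  show ?C
  proof (intro allI impI)
   fix xs c ys assume "bs = xs @ c # ys"
   thus "c - 1 : fin (mv X a) xs & c ~: fin (mv X a) xs" using A[rule_format, of "a # xs" c ys] by simp
  qed
 next
  assume "?B & ?C"
  thus ?A by (auto simp: Cons_eq_append_conv)
 qed
 thus ?case using Cons.IH[of "mv X a"] by simp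
qed simp

text \<open>When no letter repeats, the possibility of adding c depends only on which of its
  neighbours came earlier, so validity is a local condition.\<close>

lemma valid_distinct:
 assumes "distinct bs"
 shows "valid X bs <-> (ALL c:set bs. (c - 1 : X | before bs (c - 1) c) & (c ~: X | before bs (c + 1) c))"
proof -
 have "(c - 1 : fin X xs & c ~: fin X xs) <-> (c - 1 : X | before bs (c - 1) c) & (c ~: X | before bs (c + 1) c)"
  if "bs = xs @ c # ys" for xs c ys
 proof -
  have "c ~: set xs" using that assms by simp
  thus ?thesis using fin_mem_prev[of c xs X] fin_mem_self[of c xs X] before_split[OF assms that] by blast
 qed
 thus ?thesis unfolding valid_splits by (metis in_set_conv_decomp)
qed

section \<open>Abacus coordinates of bead configurations\<close>

definition pos :: "int => nat => nat => nat => int" where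
 "pos b p t r = b + int t + int p * int r"

text \<open>Every position below b is occupied, and b will lie below all beads that move, so only
  the beads from b upwards are recorded.\<close>

definition cfg :: "int => nat => (nat => nat set) => int set" where
 "cfg b p B = {y. y < b} Un {pos b p t r | t r. t < p & r : B t}"

lemma pos_eq_iff: "t < p ==> t' < p ==> pos b p t r = pos b p t' r' <-> t = t' & r = r'"
proof
 assume t: "t < p" "t' < p" and "pos b p t r = pos b p t' r'"
 hence "int (t + p * r) = int (t' + p * r')" unfolding pos_def of_nat_add of_nat_mult by linarith
 hence e: "t + p * r = t' + p * r'" by (simp only: of_nat_eq_iff)
 hence "(t + p * r) mod p = (t' + p * r') mod p" by simp
 hence "t = t'" using t by simp
 thus "t = t' & r = r'" using e t by simp
qed simp

lemma pos_ge: "b <= pos b p t r" by (simp add: pos_def)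

lemma pos_mem_cfg: "t < p ==> pos b p t r : cfg b p B <-> r : B t" using pos_ge[of b p t r] pos_eq_iff[of t p] by (auto simp: cfg_def)

lemma pos_exists: "p > 0 ==> b <= y ==> y = pos b p (nat ((y - b) mod int p)) (nat ((y - b) div int p))"
 using mult_div_mod_eq[of "int p" "y - b"] by (simp add: pos_def pos_imp_zdiv_nonneg_iff algebra_simps)

lemma cfg_of: "p > 0 ==> {y. y < b} <= X ==> cfg b p (%t. {r. pos b p t r : X}) = X"
proof (intro subset_antisym subsetI)
 fix y assume p: "p > 0" "y : X"
 show "y : cfg b p (%t. {r. pos b p t r : X})"
 proof (cases "y < b")
  case False
  let ?t = "nat ((y - b) mod int p)" and ?r = "nat ((y - b) div int p)"
  have y: "y = pos b p ?t ?r" using pos_exists[OF p(1)] False by simp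
  have t: "?t < p" using p(1) by (simp add: nat_less_iff)
  hence "pos b p ?t ?r : cfg b p (%t. {r. pos b p t r : X}) <-> pos b p ?t ?r : X" by (simp only: pos_mem_cfg mem_Collect_eq)
  thus ?thesis using y p by metis
 qed (simp add: cfg_def)
qed (auto simp: cfg_def)

lemma map_before:
 assumes "inj_on f (set v)" "distinct v" "s : set v" "t : set v"
 shows "before (map f v) (f s) (f t) <-> before v s t"
proof -
 obtain xs ys where v: "v = xs @ t # ys" using assms(4) by (meson split_list)
 have "distinct (map f v)" using assms by (simp add: distinct_map)
 moreover have "map f v = map f xs @ f t # map f ys" by (simp add: v)
 ultimately have "before (map f v) (f s) (f t) <-> f s : f ` set xs"
  using before_split[of "map f v" "map f xs" "f t" "map f ys" "f s"] by simp
 also have "... <-> s : set xs" using assms(1,3) v by (auto simp: inj_on_def)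
 finally show ?thesis using before_split[OF assms(2) v] by simp
qed

lemma before_in: "before v s t ==> s : set v & t : set v" by (auto simp: before_def)

text \<open>Letter t moves a bead from runner t - 1 to runner t at height x t. As letter 0 does not
  occur, no bead passes from the last runner to the first, and the runners form a line on which the
  condition splits into one for each runner.\<close>

lemma valid_cfg:
 assumes v: "distinct v" "set v <= {1..<p}"
 shows "valid (cfg b p B) (map (%t. pos b p t (x t)) v) <-> (ALL t<p. conn (wty v t) (x t) (x (Suc t)) (B t))"
proof -
 let ?f = "%t. pos b p t (x t)"
 have inj: "inj_on ?f (set v)" using v(2) by (auto simp: inj_on_def pos_eq_iff subset_eq)
 have d: "distinct (map ?f v)" using inj v by (simp add: distinct_map)
 have bf: "before (map ?f v) (pos b p s r) (?f t) <-> before v s t & x s = r" if "s < p" "t : set v" for s t r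
 proof
  assume B: "before (map ?f v) (pos b p s r) (?f t)"
  hence "pos b p s r : set (map ?f v)" using before_in by metis
  then obtain u where u: "u : set v" "pos b p s r = ?f u" by auto
  hence "u = s" "x s = r" using that v(2) pos_eq_iff[of s p u b r "x u"] by auto
  moreover have "before (map ?f v) (?f u) (?f t)" using B unfolding u(2) .
  ultimately show "before v s t & x s = r" using map_before[OF inj v(1) u(1) that(2)] by blast
 next
  assume "before v s t & x s = r"
  thus "before (map ?f v) (pos b p s r) (?f t)" using map_before[OF inj v(1) _ that(2), of s] before_in[of v s t] by auto
 qed
 have prev: "?f t - 1 = pos b p (t - 1) (x t)" if "t : set v" for t using v(2) that by (force simp: pos_def)
 have nxt: "before (map ?f v) (?f t + 1) (?f t) <-> before v (Suc t) t & x (Suc t) = x t" if t: "t : set v" for t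
 proof (cases "Suc t < p")
  case True
  have "?f t + 1 = pos b p (Suc t) (x t)" by (simp add: pos_def)
  thus ?thesis using bf[OF True t] by simp
 next
  case False
  hence "Suc t = p" using v(2) t by force
  hence e: "?f t + 1 = pos b p 0 (Suc (x t))" by (simp add: pos_def algebra_simps)
  have "~ before v 0 t" "~ before v (Suc t) t" using before_in v(2) `Suc t = p` by fastforce+
  moreover have "0 < p" using `Suc t = p` by simp
  ultimately show ?thesis unfolding e using bf[of 0 t "Suc (x t)"] t by blast
 qed
 have "valid (cfg b p B) (map ?f v) <-> (ALL t:set v. (x t : B (t - 1) | (before v (t - 1) t & x (t - 1) = x t)) &
   (x t ~: B t | (before v (Suc t) t & x (Suc t) = x t)))" unfolding valid_distinct[OF d]
 proof -
  have "((?f t - 1 : cfg b p B | before (map ?f v) (?f t - 1) (?f t)) & (?f t ~: cfg b p B | before (map ?f v) (?f t + 1) (?f t))) <->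
   ((x t : B (t - 1) | (before v (t - 1) t & x (t - 1) = x t)) & (x t ~: B t | (before v (Suc t) t & x (Suc t) = x t)))"
   if t: "t : set v" for t
  proof -
   have tp: "t < p" "t - 1 < p" using v(2) t by force+
   show ?thesis unfolding nxt[OF t] prev[OF t] bf[OF tp(2) t] pos_mem_cfg[OF tp(1)] pos_mem_cfg[OF tp(2)] ..
  qed
  thus "(ALL c:set (map ?f v). (c - 1 : cfg b p B | before (map ?f v) (c - 1) c) & (c ~: cfg b p B | before (map ?f v) (c + 1) c)) <->
   (ALL t:set v. (x t : B (t - 1) | before v (t - 1) t & x (t - 1) = x t) & (x t ~: B t | before v (Suc t) t & x (Suc t) = x t))" by simp
 qed
 also have "... <-> (ALL t<p. (Suc t : set v --> x (Suc t) : B t | (before v t (Suc t) & x t = x (Suc t))) &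
   (t : set v --> x t ~: B t | (before v (Suc t) t & x (Suc t) = x t)))" (is "?A <-> ?B")
 proof
  assume A: ?A
  show ?B
  proof (intro allI impI conjI)
   fix t assume "Suc t : set v"
   thus "x (Suc t) : B t | before v t (Suc t) & x t = x (Suc t)" using A[rule_format, of "Suc t"] by simp
  next
   fix t assume "t : set v"
   thus "x t ~: B t | before v (Suc t) t & x (Suc t) = x t" using A by blast
  qed
 next
  assume B: ?B
  show ?A
  proof
   fix t assume t: "t : set v"
   hence "t < p" "Suc (t - 1) = t" "t - 1 < p" using v(2) by force+
   thus "(x t : B (t - 1) | before v (t - 1) t & x (t - 1) = x t) & (x t ~: B t | before v (Suc t) t & x (Suc t) = x t)"
    using B[rule_format, of t] B[rule_format, of "t - 1"] t by auto
  qed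
 qed
 also have "... <-> (ALL t<p. conn (wty v t) (x t) (x (Suc t)) (B t))"
 proof -
  have "((Suc t : set v --> x (Suc t) : B t | (before v t (Suc t) & x t = x (Suc t))) &
   (t : set v --> x t ~: B t | (before v (Suc t) t & x (Suc t) = x t))) <-> conn (wty v t) (x t) (x (Suc t)) (B t)" for t
  proof (cases "t : set v & Suc t : set v")
   case True
   hence "before v (Suc t) t <-> ~ before v t (Suc t)" using before_total[OF v(1), of "Suc t" t] by auto
   thus ?thesis using True by (cases "before v t (Suc t)") (auto simp: wty_def)
  next
   case False
   hence "~ before v t (Suc t)" "~ before v (Suc t) t" using before_in[of v t "Suc t"] before_in[of v "Suc t" t] by blast+
   thus ?thesis using False by (auto simp: wty_def)
  qed
  thus ?thesis by simp
 qed
 finally show ?thesis .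
qed

section \<open>Connectedness of the residue words of a combinatorial block\<close>

definition hi :: "int => int set => int set" where
 "hi b X = {x : X. b <= x}"

text \<open>A letter replaces the bead a - 1 by a, so a statistic of the beads changes by f a - f (a
  - 1). Constants, positions and indicators of residues are the statistics of interest.\<close>

lemma hi_sum:
 fixes f :: "int => int"
 assumes "valid X as" "!!a. a : set as ==> b < a" "finite (hi b X)"
 shows "finite (hi b (fin X as)) & (SUM x:hi b (fin X as). f x) = (SUM x:hi b X. f x) + (\<Sum>a\<leftarrow>as. f a - f (a - 1))"
 using assms
proof (induction as arbitrary: X)
 case (Cons a as)
 have a: "a - 1 : X" "a ~: X" "b < a" "valid (mv X a) as" using Cons.prems by auto
 have h: "hi b (mv X a) = insert a (hi b X - {a - 1})" using a by (auto simp: hi_def mv_def)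
 have m: "a - 1 : hi b X" "a ~: hi b X" using a by (auto simp: hi_def)
 have "(SUM x:hi b (mv X a). f x) = f a + (SUM x:hi b X - {a - 1}. f x)" unfolding h using Cons.prems(3) m by simp
 also have "(SUM x:hi b X - {a - 1}. f x) = (SUM x:hi b X. f x) - f (a - 1)" using Cons.prems(3) m by (simp add: sum_diff1)
 finally have "(SUM x:hi b (mv X a). f x) = (SUM x:hi b X. f x) + (f a - f (a - 1))" by simp
 moreover have "finite (hi b (mv X a))" unfolding h using Cons.prems(3) by simp
 ultimately show ?case using Cons.IH[OF a(4)] Cons.prems(2) by simp
qed simp

lemma fin_below: "(!!a. a : set as ==> b < a) ==> {y. y < b} <= X ==> {y. y < b} <= fin X as"
proof (induction as arbitrary: X)
 case (Cons a as)
 have "{y. y < b} <= mv X a" using Cons.prems(1)[of a] Cons.prems(2) by (auto simp: mv_def)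
 thus ?case using Cons.IH[of "mv X a"] Cons.prems(1) by simp
qed simp

lemma mod_pred_eq_iff:
 assumes "0 <= r" "r < int p"
 shows "(a - 1) mod int p = r <-> a mod int p = (r + 1) mod int p"
proof
 assume "(a - 1) mod int p = r"
 hence "(a - 1 + 1) mod int p = (r + 1) mod int p" by (metis mod_add_left_eq)
 thus "a mod int p = (r + 1) mod int p" by simp
next
 assume "a mod int p = (r + 1) mod int p"
 hence "(a - 1) mod int p = (r + 1 - 1) mod int p" by (metis mod_diff_left_eq)
 thus "(a - 1) mod int p = r" using assms by simp
qed

lemma residue_count:
 assumes "0 <= r" "r < int p"
 shows "(\<Sum>a\<leftarrow>as. of_bool (a mod int p = r) - of_bool ((a - 1) mod int p = r)) =
  int (count (mset (rword p as)) r) - int (count (mset (rword p as)) ((r + 1) mod int p))"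
 by (induction as) (auto simp: rword_def mod_pred_eq_iff[OF assms] of_bool_def)

lemma finite_hi_base [simp]: "finite (hi b base_set)" by (rule finite_subset[of _ "{b..<0}"]) (auto simp: hi_def base_set_def)

text \<open>Descent on the total height: a bead above b with a gap beneath it is lowered by one.
  When there is none left, the number of beads forces the base set.\<close>

lemma reach_config:
 assumes "b <= 0" "{y. y < b} <= X" "finite (hi b X)" "int (card (hi b X)) = - b"
 shows "EX as. valid base_set as & fin base_set as = X & (ALL a:set as. b < a)" using assms(2-)
proof (induction "nat (SUM x:hi b X. x - b)" arbitrary: X rule: less_induct)
 case less
 show ?case
 proof (cases "EX x:X. b < x & x - 1 ~: X")
  case True
  then obtain x where x: "x : X" "b < x" "x - 1 ~: X" by blast
  define X' where "X' = insert (x - 1) (X - {x})"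
  have h: "hi b X' = insert (x - 1) (hi b X - {x})" using x by (auto simp: X'_def hi_def)
  have xm: "x : hi b X" "x - 1 ~: hi b X" using x by (auto simp: hi_def)
  have s: "(SUM y:hi b X'. y - b) = (SUM y:hi b X. y - b) - 1" unfolding h using less.prems(2) xm by (simp add: sum_diff1)
  have "(SUM y:hi b X'. y - b) >= 0" by (rule sum_nonneg) (simp add: hi_def)
  hence "nat (SUM y:hi b X'. y - b) < nat (SUM y:hi b X. y - b)" using s by linarith
  moreover have "card (hi b X') = card (hi b X)" unfolding h using less.prems(2) xm
   by (metis Diff_iff card_Suc_Diff1 card_insert_disjoint finite_Diff)
  moreover have "finite (hi b X')" unfolding h using less.prems(2) by simp
  moreover have "{y. y < b} <= X'" using less.prems(1) x by (auto simp: X'_def)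
  ultimately obtain as where as: "valid base_set as" "fin base_set as = X'" "ALL a:set as. b < a"
   using less.hyps[of X'] less.prems(3) by auto
  have "valid base_set (as @ [x])" using as x by (auto simp: valid_append X'_def)
  moreover have "fin base_set (as @ [x]) = X" using as(2) x by (auto simp: X'_def mv_def)
  ultimately show ?thesis using as(3) x by (intro exI[of _ "as @ [x]"]) auto
 next
  case False
  have "X = base_set"
  proof (cases "hi b X = {}")
   case True
   hence "b = 0" using less.prems(3) by simp
   thus ?thesis using True less.prems(1) by (force simp: hi_def base_set_def)
  next
   case ne: False
   define M where "M = Max (hi b X)"
   have M: "M : hi b X" "!!x. x : hi b X ==> x <= M" using less.prems(2) ne by (auto simp: M_def)
   have down: "M - int k : X" if "b <= M - int k" for k using that
   proof (induction k)
    case 0 thus ?case using M by (simp add: hi_def)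
   next
    case (Suc k)
    hence "M - int k : X" "b < M - int k" by auto
    thus ?case using False by (force simp: algebra_simps)
   qed
   have "hi b X = {b..M}"
   proof (intro subset_antisym subsetI)
    fix x assume "x : {b..M}"
    thus "x : hi b X" using down[of "nat (M - x)"] by (simp add: hi_def)
   qed (use M in \<open>auto simp: hi_def\<close>)
   moreover have "b <= M" using M by (simp add: hi_def)
   ultimately have "M = - 1" using less.prems(3) by simp
   hence h: "hi b X = {b..-1}" using `hi b X = {b..M}` by simp
   show ?thesis
   proof (intro set_eqI)
    fix x show "x : X <-> x : base_set"
    proof (cases "x < b")
     case True thus ?thesis using less.prems(1) assms(1) by (auto simp: base_set_def)
    next
     case False
     hence "x : X <-> x : hi b X" by (simp add: hi_def)
     thus ?thesis using h False by (auto simp: base_set_def)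
    qed
   qed
  qed
  thus ?thesis by (intro exI[of _ "[]"]) simp
 qed
qed

lemma hi_cfg_sum:
 fixes f :: "int => int"
 assumes "ALL t<p. finite (B t)"
 shows "finite (hi b (cfg b p B)) & (SUM x:hi b (cfg b p B). f x) = (SUM t<p. SUM r:B t. f (pos b p t r))"
proof -
 have h: "hi b (cfg b p B) = (%(t, r). pos b p t r) ` (SIGMA t:{..<p}. B t)" by (force simp: hi_def cfg_def pos_ge)
 have inj: "inj_on (%(t, r). pos b p t r) (SIGMA t:{..<p}. B t)" by (auto simp: inj_on_def pos_eq_iff)
 have "(SUM x:hi b (cfg b p B). f x) = (SUM (t, r):(SIGMA t:{..<p}. B t). f (pos b p t r))"
  unfolding h sum.reindex[OF inj] by (intro sum.cong) auto
 also have "... = (SUM t<p. SUM r:B t. f (pos b p t r))" using assms by (intro sum.Sigma[symmetric]) auto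
 finally show ?thesis unfolding h using assms by auto
qed

lemma upt_split: "i <= j ==> j <= k ==> [i..<k] = [i..<j] @ [j..<k]" using upt_add_eq_append[of i j "k - j"] by simp

lemma const_of_cyclic:
 fixes d :: "nat => int"
 assumes "!!t. t < k ==> d t = d (Suc t)" "t <= k"
 shows "d t = d 0" using assms(2) by (induction t) (use assms(1) in auto)

section \<open>Paths with prescribed inner and outer residues\<close>

context
 fixes p l n :: nat and b :: int and M1 M2 :: "int multiset" and P :: "int list => bool"
 assumes p: "p > 0" and b: "b < - int (l + n)" and bM: "b mod int p ~:# M2" and cM: "!!i. count M2 i <= 1"
  and SW: "!!as bs bs'. valid base_set (as @ bs) ==> length as = l ==> length bs = n ==> mset (rword p as) = M1 ==>
   mset (rword p bs) = M2 ==> swps bs bs' ==> P (rword p bs) <-> P (rword p bs')"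
begin

definition pclass :: "int list => int list => bool" where
 "pclass as bs <-> valid base_set (as @ bs) & length as = l & length bs = n & mset (rword p as) = M1 & mset (rword p bs) = M2"

definition res :: "nat => int" where "res t = (b + int t) mod int p"

definition idx :: "nat set" where "idx = {t : {1..<p}. res t :# M2}"

text \<open>The number of beads from b upwards on runner t after letters with residues M1 have been
  added to the base set.\<close>

definition chg :: "nat => int" where
 "chg t = (SUM x:hi b base_set. of_bool (x mod int p = res t)) + int (count M1 (res t)) - int (count M1 (res (Suc t)))"

text \<open>Bead counts and the sum of positions are invariants of the residues M1 and the length l;
  \<open>okc_path\<close> shows that they are complete.\<close>

definition okc :: "(nat => nat set) => bool" where
 "okc B <-> (ALL t<p. finite (B t) & int (card (B t)) = chg t) &
  (SUM t<p. SUM r:B t. pos b p t r) = (SUM x:hi b base_set. x) + int l"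

lemma res_bounds: "0 <= res t" "res t < int p" "(res t + 1) mod int p = res (Suc t)" using p by (auto simp: res_def mod_simps algebra_simps)

lemma res_inj: "t < p ==> t' < p ==> res t = res t' <-> t = t'"
proof
 assume t: "t < p" "t' < p" "res t = res t'"
 hence "(b + int t - b) mod int p = (b + int t' - b) mod int p" unfolding res_def by (metis mod_diff_left_eq)
 thus "t = t'" using t by simp
qed simp

lemma res_pos: "pos b p t r mod int p = res t" by (simp add: pos_def res_def)

lemma res_surj: "0 <= r ==> r < int p ==> EX t<p. r = res t"
proof -
 assume r: "0 <= r" "r < int p"
 let ?t = "nat ((r - b) mod int p)"
 have "res ?t = r" using p r by (simp add: res_def mod_simps)
 moreover have "?t < p" using p by (simp add: nat_less_iff)
 ultimately show ?thesis by metis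
qed

lemma pclass_bounds:
 assumes "pclass as bs" "a : set (as @ bs)"
 shows "b < a" using valid_entries[of "as @ bs" a] assms b by (auto simp: pclass_def)

lemma pclass_cfg:
 assumes c: "pclass as bs"
 shows "EX B. okc B & fin base_set as = cfg b p B"
proof -
 have v: "valid base_set as" using c by (auto simp: pclass_def valid_append)
 have ab: "b < a" if "a : set as" for a using pclass_bounds[OF c] that by simp
 let ?X = "fin base_set as"
 note hs = hi_sum[OF v ab finite_hi_base]
 define B where "B t = {r. pos b p t r : ?X}" for t
 have X: "cfg b p B = ?X" unfolding B_def using b by (intro cfg_of p fin_below ab) (auto simp: base_set_def)
 have fB: "finite (B t)" if "t < p" for t
 proof (rule finite_imageD[of "pos b p t"])
  have "pos b p t ` B t <= hi b ?X" by (auto simp: B_def hi_def pos_ge)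
  thus "finite (pos b p t ` B t)" using hs[of id] finite_subset by blast
  show "inj_on (pos b p t) (B t)" using that by (auto simp: inj_on_def pos_eq_iff)
 qed
 have fBA: "ALL t<p. finite (B t)" using fB by blast
 have "int (card (B t)) = chg t" if t: "t < p" for t
 proof -
  have "(SUM x:hi b ?X. of_bool (x mod int p = res t)) = (SUM s<p. SUM r:B s. of_bool (s = t) :: int)"
   unfolding X[symmetric] using hi_cfg_sum[OF fBA, where b = b and f = "%x. of_bool (x mod int p = res t)"] t res_inj
   by (simp add: res_pos del: sum_of_bool_eq)
  also have "... = (SUM s<p. if s = t then int (card (B t)) else 0)" by (intro sum.cong) auto
  also have "... = int (card (B t))" using t by simp
  finally show ?thesis using hs[of "%x. of_bool (x mod int p = res t)"] c residue_count[where r = "res t" and p = p and as = as, OF res_bounds(1) res_bounds(2)]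
   by (simp add: chg_def pclass_def res_bounds(3) del: sum_of_bool_eq)
 qed
 moreover have "(SUM t<p. SUM r:B t. pos b p t r) = (SUM x:hi b base_set. x) + int l"
  using hs[of "%x. x"] hi_cfg_sum[OF fBA, where b = b and f = "%x. x"] c unfolding X by (simp add: pclass_def sum_list_triv)
 ultimately show ?thesis using fB X unfolding okc_def by metis
qed

text \<open>The counts determine differences of multiplicities of consecutive residues around the
  circle, hence all multiplicities up to a common constant. The length, read off from the sum of
  positions, makes this constant 0.\<close>

lemma okc_path:
 assumes c: "pclass as0 bs0" and B: "okc B"
 shows "EX as. valid base_set as & fin base_set as = cfg b p B & length as = l & mset (rword p as) = M1"
proof -
 have fBA: "ALL t<p. finite (B t)" using B by (simp add: okc_def)
 obtain B0 where B0: "okc B0" "fin base_set as0 = cfg b p B0" using pclass_cfg[OF c] by blast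
 have fB0: "ALL t<p. finite (B0 t)" using B0 by (simp add: okc_def)
 have v0: "valid base_set as0" using c by (auto simp: pclass_def valid_append)
 have ab0: "b < a" if "a : set as0" for a using pclass_bounds[OF c] that by simp
 have "hi b base_set = {b..<0}" using b by (auto simp: hi_def base_set_def)
 hence "(SUM x:hi b base_set. 1::int) = - b" using b by simp
 hence "(SUM x:hi b (cfg b p B0). 1::int) = - b" using hi_sum[OF v0 ab0 finite_hi_base, of "%_. 1"] B0(2) by (simp add: sum_list_triv)
 moreover have "(SUM t<p. SUM r:B t. 1::int) = (SUM t<p. SUM r:B0 t. 1)" using B B0(1) by (simp add: okc_def)
 ultimately have "(SUM x:hi b (cfg b p B). 1::int) = - b"
  using hi_cfg_sum[OF fBA, where b = b and f = "%_. 1"] hi_cfg_sum[OF fB0, where b = b and f = "%_. 1"] by simp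
 hence "int (card (hi b (cfg b p B))) = - b" by simp
 moreover have "{y. y < b} <= cfg b p B" "b <= 0" using b by (auto simp: cfg_def)
 ultimately obtain as where as: "valid base_set as" "fin base_set as = cfg b p B" "ALL a:set as. b < a"
  using reach_config[of b "cfg b p B"] hi_cfg_sum[OF fBA, where b = b and f = id] by blast
 have ab: "b < a" if "a : set as" for a using as(3) that by blast
 note hs = hi_sum[OF as(1) ab finite_hi_base, unfolded as(2)]
 have l: "length as = l" using hs[of "%x. x"] hi_cfg_sum[OF fBA, where b = b and f = "%x. x"] B by (simp add: okc_def sum_list_triv)
 define d where "d t = int (count (mset (rword p as)) (res t)) - int (count M1 (res t))" for t
 have step: "d t = d (Suc t)" if t: "t < p" for t
 proof -
  have "(SUM x:hi b (cfg b p B). of_bool (x mod int p = res t)) = (SUM s<p. SUM r:B s. of_bool (s = t) :: int)"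
   using hi_cfg_sum[OF fBA, where b = b and f = "%x. of_bool (x mod int p = res t)"] t res_inj by (simp add: res_pos del: sum_of_bool_eq)
  also have "... = (SUM s<p. if s = t then int (card (B t)) else 0)" by (intro sum.cong) auto
  also have "... = chg t" using t B by (simp add: okc_def)
  finally show ?thesis using hs[of "%x. of_bool (x mod int p = res t)"] residue_count[where r = "res t" and p = p and as = as, OF res_bounds(1) res_bounds(2)]
   by (simp add: chg_def d_def res_bounds(3) del: sum_of_bool_eq)
 qed
 have tot: "(SUM t<p. int (count (mset (rword p as)) (res t))) = int (length as)" for as
 proof (induction as)
  case (Cons a as)
  obtain t0 where t0: "t0 < p" "a mod int p = res t0" using res_surj[of "a mod int p"] p by auto
  have "(SUM t<p. int (count (mset (rword p (a # as))) (res t))) = (SUM t<p. int (count (mset (rword p as)) (res t)) + (if t = t0 then 1 else 0))"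
   using t0 res_inj by (intro sum.cong) (auto simp: rword_def)
  thus ?case using Cons t0 by (simp add: sum.distrib)
 qed (simp add: rword_def)
 have s0: "(SUM t<p. d t) = 0"
 proof -
  have "mset (rword p as0) = M1" "length as0 = l" using c by (simp_all add: pclass_def)
  hence "(SUM t<p. int (count M1 (res t))) = int l" using tot[of as0] by metis
  thus ?thesis using tot[of as] l unfolding d_def sum_subtractf by linarith
 qed
 have dc: "d t = d 0" if "t < p" for t using const_of_cyclic[of p d t] step that by simp
 have "(SUM t<p. d t) = (SUM t<p. d 0)" by (intro sum.cong refl dc) simp
 hence "int p * d 0 = 0" using s0 by simp
 hence "d 0 = 0" using p by auto
 hence d0: "d t = 0" if "t < p" for t using dc[OF that] by (rule trans[rotated])
 have "mset (rword p as) = M1"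
 proof (rule multiset_eqI)
  fix r
  show "count (mset (rword p as)) r = count M1 r"
  proof (cases "0 <= r & r < int p")
   case True
   then obtain t where "t < p" "r = res t" using res_surj by blast
   thus ?thesis using d0[of t] by (simp add: d_def)
  next
   case False
   have "r ~:# mset (rword p xs)" for xs using False p by (auto simp: rword_def)
   thus ?thesis using c by (metis count_eq_zero_iff pclass_def)
  qed
 qed
 thus ?thesis using as l by blast
qed

definition letters :: "(nat => nat) => nat list => int list" where
 "letters x v = map (%t. pos b p t (x t)) v"

lemma rword_letters: "rword p (letters x v) = map res v" by (simp add: rword_def letters_def res_pos)

lemma pclass_word:
 assumes c: "pclass as bs"
 shows "EX B x v. okc B & distinct v & set v = idx & rword p bs = map res v & (ALL t<p. conn (wty v t) (x t) (x (Suc t)) (B t))"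
proof -
 obtain B where B: "okc B" "fin base_set as = cfg b p B" using pclass_cfg[OF c] by blast
 have vb: "valid (cfg b p B) bs" using c B by (simp add: pclass_def valid_append)
 define ix rw where "ix a = nat ((a - b) mod int p)" and "rw a = nat ((a - b) div int p)" for a
 have ab: "b < a" if "a : set bs" for a using pclass_bounds[OF c] that by simp
 have a: "a = pos b p (ix a) (rw a)" if "a : set bs" for a unfolding ix_def rw_def using ab[OF that] by (intro pos_exists p) simp
 have ixp: "ix a < p" for a using p by (simp add: ix_def nat_less_iff)
 have rx: "res (ix a) = a mod int p" if "a : set bs" for a using res_pos[of "ix a" "rw a"] a[OF that] by simp
 define v where "v = map ix bs"
 have rv: "rword p bs = map res v" using rx by (simp add: v_def rword_def)
 have dr: "distinct (rword p bs)" unfolding distinct_count_atmost_1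
 proof
  fix a
  have "mset (rword p bs) = M2" using c by (simp add: pclass_def)
  hence "count (mset (rword p bs)) a <= 1" using cM by simp
  thus "count (mset (rword p bs)) a = (if a : set (rword p bs) then 1 else 0)"
   by (metis count_eq_zero_iff le_antisym less_one not_le set_mset_mset)
 qed
 hence dv: "distinct v" unfolding rv by (simp add: distinct_map)
 have sv: "set v = idx"
 proof (intro subset_antisym subsetI)
  fix t assume t: "t : set v"
  hence tp: "t < p" using ixp by (auto simp: v_def)
  have m: "res t :# M2" using t rv c unfolding pclass_def by (metis image_eqI list.set_map set_mset_mset)
  hence "t ~= 0" using bM by (intro notI) (simp add: res_def)
  thus "t : idx" using tp m by (simp add: idx_def)
 next
  fix t assume t: "t : idx"
  hence "res t : set (map res v)" using c rv unfolding pclass_def idx_def by (metis (no_types, lifting) mem_Collect_eq set_mset_mset)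
  then obtain u where u: "u : set v" "res t = res u" by auto
  hence "u < p" using ixp by (auto simp: v_def)
  thus "t : set v" using u t res_inj[of t u] by (simp add: idx_def)
 qed
 define x where "x t = (case map_of (map (%a. (ix a, rw a)) bs) t of Some r => r | None => 0)" for t
 have "x (ix a) = rw a" if "a : set bs" for a
 proof -
  have "distinct (map fst (map (%a. (ix a, rw a)) bs))" using dv by (simp add: v_def o_def)
  moreover have "(ix a, rw a) : set (map (%a. (ix a, rw a)) bs)" using that by auto
  ultimately have "map_of (map (%a. (ix a, rw a)) bs) (ix a) = Some (rw a)" by (rule map_of_is_SomeI)
  thus ?thesis by (simp add: x_def)
 qed
 hence "map (%t. pos b p t (x t)) v = bs" using a by (auto simp: v_def intro!: map_idI)
 moreover have "set v <= {1..<p}" unfolding sv by (auto simp: idx_def)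
 ultimately have "ALL t<p. conn (wty v t) (x t) (x (Suc t)) (B t)" using valid_cfg[OF dv, of p b B x] vb by simp
 thus ?thesis using B(1) dv sv rv by blast
qed

lemma mset_M2:
 assumes "pclass as0 bs0" "distinct v" "set v = idx"
 shows "mset (map res v) = M2"
proof -
 obtain v0 where v0: "distinct v0" "set v0 = idx" "rword p bs0 = map res v0" using pclass_word[OF assms(1)] by blast
 have "mset v = mset v0" using assms v0 by (metis set_eq_iff_mset_eq_distinct)
 thus ?thesis using v0(3) assms(1) by (simp add: pclass_def)
qed

text \<open>With the same configuration and the same heights x, two valid orders are two valid
  sequences with equal multisets, so \<open>valid_connected\<close> joins them by exchanges, along
  which P is constant.\<close>

lemma word_exchange:
 assumes c: "pclass as0 bs0" and B: "okc B" and v: "distinct v" "set v = idx" and v': "distinct v'" "set v' = idx"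
  and cv: "ALL t<p. conn (wty v t) (x t) (x (Suc t)) (B t)" and cv': "ALL t<p. conn (wty v' t) (x t) (x (Suc t)) (B t)"
 shows "P (map res v) <-> P (map res v')"
proof -
 obtain as where as: "valid base_set as" "fin base_set as = cfg b p B" "length as = l" "mset (rword p as) = M1"
  using okc_path[OF c B] by blast
 have sub: "set v <= {1..<p}" "set v' <= {1..<p}" unfolding v(2) v'(2) by (auto simp: idx_def)
 have val: "valid (cfg b p B) (letters x v)" "valid (cfg b p B) (letters x v')"
  unfolding letters_def using valid_cfg[OF v(1) sub(1)] valid_cfg[OF v'(1) sub(2)] cv cv' by blast+
 have "mset v = mset v'" using v v' by (metis set_eq_iff_mset_eq_distinct)
 hence "mset (letters x v) = mset (letters x v')" by (simp add: letters_def)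
 hence sw: "swps (letters x v) (letters x v')" using valid_connected val by blast
 have m: "mset (rword p (letters x v)) = M2" unfolding rword_letters by (rule mset_M2[OF c v])
 have "size (mset (rword p (letters x v))) = size (mset (rword p bs0))" using m c by (simp add: pclass_def)
 hence ln: "length (letters x v) = n" using c by (simp add: rword_def pclass_def)
 have "P (rword p (letters x v)) <-> P (rword p (letters x v'))"
 proof (rule SW[OF _ as(3) ln as(4) m sw])
  show "valid base_set (as @ letters x v)" using as(1,2) val(1) by (simp add: valid_append)
 qed
 thus ?thesis by (simp add: rword_letters)
qed

text \<open>Patterns of relative orders realised within the class; an entry \<open>TF\<close> asks
  for a configuration that permits both orders.\<close>

definition att :: "(nat => ety) => bool" where
 "att ty <-> (EX B x. okc B & (ALL t<p. conn (ty t) (x t) (x (Suc t)) (B t)))"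

text \<open>With the bead counts fixed, the sum of positions is a constant plus p times the sum of
  heights. The size condition in \<open>okc\<close> thus prescribes the total height of a
  chain.\<close>

lemma att_reach:
 assumes B0: "okc B0"
 shows "att ty <-> (EX z. reach (map (%t. (nat (chg t), ty t)) [0..<p]) z (SUM t<p. \<Sum>(B0 t)))"
proof -
 have E: "(SUM t<p. SUM r:B t. pos b p t r) = (SUM t<p. (b + int t) * int (card (B t))) + int p * int (SUM t<p. \<Sum>(B t))" for B
 proof -
  have "(SUM r:B t. pos b p t r) = (b + int t) * int (card (B t)) + int p * int (\<Sum>(B t))" for t
   unfolding pos_def by (simp add: sum.distrib sum_distrib_left algebra_simps)
  thus ?thesis by (simp add: sum.distrib sum_distrib_left)
 qed
 have c0: "chg t = int (card (B0 t))" if "t < p" for t using B0 that by (simp add: okc_def)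
 hence chg0: "nat (chg t) = card (B0 t)" "chg t = int (card (B0 t))" if "t < p" for t using that by simp_all
 have ok: "okc B <-> (ALL t<p. finite (B t) & card (B t) = nat (chg t)) & (SUM t<p. \<Sum>(B0 t)) = (SUM t<p. \<Sum>(B t))" for B
 proof -
  have "okc B <-> (ALL t<p. finite (B t) & card (B t) = nat (chg t)) & (SUM t<p. SUM r:B0 t. pos b p t r) = (SUM t<p. SUM r:B t. pos b p t r)"
   using B0 chg0 unfolding okc_def by auto
  also have "... <-> (ALL t<p. finite (B t) & card (B t) = nat (chg t)) & (SUM t<p. \<Sum>(B0 t)) = (SUM t<p. \<Sum>(B t))"
  proof (rule conj_cong[OF refl])
   assume "ALL t<p. finite (B t) & card (B t) = nat (chg t)"
   hence "(SUM t<p. (b + int t) * int (card (B t))) = (SUM t<p. (b + int t) * int (card (B0 t)))" using chg0 by (intro sum.cong) auto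
   thus "(SUM t<p. SUM r:B0 t. pos b p t r) = (SUM t<p. SUM r:B t. pos b p t r) <-> (SUM t<p. \<Sum>(B0 t)) = (SUM t<p. \<Sum>(B t))"
    unfolding E using p by (simp del: of_nat_sum)
  qed
  finally show ?thesis .
 qed
 show ?thesis unfolding att_def reach_iff_chain ok chain_def by blast
qed

text \<open>The runner just before the maximal run of letters containing t. It has type
  \<open>TS\<close>: the chain only has to find a bead there, whatever came before.\<close>

definition start :: "nat => nat" where "start t = Max {s. s < t & s ~: idx}"

definition lty :: "nat => ety" where "lty t = lazy (nat (chg (start t))) (nat (chg t))"

lemma start_props:
 assumes "t : idx"
 shows "start t < t" "start t ~: idx" "!!u. start t < u ==> u <= t ==> u : idx"
proof -
 have "0 : {s. s < t & s ~: idx}" using assms by (auto simp: idx_def)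
 hence "start t : {s. s < t & s ~: idx}" unfolding start_def by (intro Max_in) auto
 thus "start t < t" "start t ~: idx" by auto
 fix u assume u: "start t < u" "u <= t"
 show "u : idx"
 proof (rule ccontr)
  assume "u ~: idx"
  hence "u : {s. s < t & s ~: idx}" using assms u by (cases "u = t") auto
  hence "u <= start t" unfolding start_def by (intro Max_ge) auto
  thus False using u by simp
 qed
qed

lemma start_eq:
 assumes "r : idx" "start r < u" "u <= r"
 shows "start u = start r"
proof -
 have u: "u : idx" using start_props(3)[OF assms] .
 have "start r : {s. s < u & s ~: idx}" using assms start_props(2)[OF assms(1)] by simp
 hence "start r <= start u" unfolding start_def[of u] by (intro Max_ge) auto
 moreover have "~ start r < start u"
 proof
  assume "start r < start u"
  hence "start u : idx" using start_props(3)[OF assms(1), of "start u"] start_props(1)[OF u] assms(3) by simp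
  thus False using start_props(2)[OF u] by simp
 qed
 ultimately show ?thesis by simp
qed

text \<open>The chain is cut at \<open>start r\<close>: what precedes it keeps its beads and its
  share of the height, and \<open>reach_flip\<close> applies to the rest.\<close>

lemma att_flip:
 assumes v: "set v = idx" and a: "att (wty v)" and r: "r : idx" "Suc r : idx" "wty v r ~= lty r"
  and min: "!!u. u < r ==> u : idx ==> Suc u : idx ==> wty v u = lty u"
 shows "att ((wty v)(r := TF))"
proof -
 obtain B0 where B0: "okc B0" using a by (auto simp: att_def)
 let ?E = "SUM t<p. \<Sum>(B0 t)"
 let ?s = "start r"
 note sp = start_props[OF r(1)]
 have rp: "r < p" using r(1) by (simp add: idx_def)
 define L where "L ty = map (%t. (nat (chg t), ty t))" for ty :: "nat => ety"
 have split: "[0..<p] = [0..<?s] @ ?s # [Suc ?s..<r] @ r # [Suc r..<p]"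
 proof -
  have "[0..<p] = [0..<?s] @ [?s..<p]" using sp(1) rp by (intro upt_split) auto
  also have "[?s..<p] = ?s # [Suc ?s..<p]" using sp(1) rp by (simp add: upt_conv_Cons)
  also have "[Suc ?s..<p] = [Suc ?s..<r] @ [r..<p]" using sp(1) rp by (intro upt_split) auto
  also have "[r..<p] = r # [Suc r..<p]" using rp by (simp add: upt_conv_Cons)
  finally show ?thesis .
 qed
 have "Suc ?s : idx" using sp by auto
 hence ws: "wty v ?s = TS" using sp(2) v by (simp add: wty_def)
 have Lv: "L (wty v) [0..<p] = L (wty v) [0..<?s] @ (nat (chg ?s), TS) # L (wty v) [Suc ?s..<r] @ (nat (chg r), wty v r) # L (wty v) [Suc r..<p]"
  unfolding split L_def using ws by simp
 obtain z where "reach (L (wty v) [0..<p]) z ?E" using a att_reach[OF B0] unfolding L_def by blast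
 then obtain w E1 E2 where w: "seg (L (wty v) [0..<?s]) z w E1" "?E = E1 + E2"
  "reach ((nat (chg ?s), TS) # L (wty v) [Suc ?s..<r] @ (nat (chg r), wty v r) # L (wty v) [Suc r..<p]) w E2"
  unfolding Lv reach_append[of "L (wty v) [0..<?s]"] by blast
 have "reach ((nat (chg ?s), TS) # L (wty v) [Suc ?s..<r] @ (nat (chg r), TF) # L (wty v) [Suc r..<p]) w E2"
 proof (rule reach_flip[OF _ _ _ w(3)])
  fix c t assume "(c, t) : set (L (wty v) [Suc ?s..<r])"
  then obtain u where u: "?s < u" "u < r" "c = nat (chg u)" "t = wty v u" by (auto simp: L_def Suc_le_eq)
  have "u : idx" "Suc u : idx" using sp(3)[of u] sp(3)[of "Suc u"] u by auto
  hence "t = lty u" using min u by simp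
  thus "t = lazy (nat (chg ?s)) c" using start_eq[OF r(1), of u] u by (simp add: lty_def)
 next
  show "wty v r : {TH, TV}" using r v by (simp add: wty_def)
  show "wty v r ~= lazy (nat (chg ?s)) (nat (chg r))" using r(3) by (simp add: lty_def)
 qed
 hence "reach (L (wty v) [0..<?s] @ (nat (chg ?s), TS) # L (wty v) [Suc ?s..<r] @ (nat (chg r), TF) # L (wty v) [Suc r..<p]) z ?E"
  unfolding reach_append[of "L (wty v) [0..<?s]"] using w by blast
 also have "L (wty v) [0..<?s] @ (nat (chg ?s), TS) # L (wty v) [Suc ?s..<r] @ (nat (chg r), TF) # L (wty v) [Suc r..<p] = L ((wty v)(r := TF)) [0..<p]"
  unfolding split L_def using ws sp(1) by auto
 finally show ?thesis using att_reach[OF B0] unfolding L_def by blast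
qed

text \<open>Sorting the letters by \<open>height o'\<close> gives a word in which \<open>t\<close> precedes \<open>t + 1\<close> iff \<open>o' t\<close>.\<close>

fun height :: "(nat => bool) => nat => int" where
 "height o' 0 = 0"
| "height o' (Suc t) = height o' t + (if o' t then 1 else - 1)"

lemma before_sort_key:
 fixes h :: "nat => int"
 assumes "distinct v" "sorted (map h v)" "s : set v" "t : set v" "h s < h t"
 shows "before v s t"
proof -
 obtain xs ys where v: "v = xs @ t # ys" using assms(4) by (meson split_list)
 have "s ~: set (t # ys)" using assms(2,5) by (auto simp: v sorted_append)
 thus ?thesis using assms(3) v by (auto simp: before_def)
qed

lemma ex_word:
 "EX v. distinct v & set v = idx & (ALL t. t : idx --> Suc t : idx --> wty v t = (if o' t then TH else TV))"
proof -
 have fI: "finite idx" by (simp add: idx_def)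
 define v where "v = sort_key (height o') (sorted_list_of_set idx)"
 have v: "distinct v" "set v = idx" "sorted (map (height o') v)" using fI by (simp_all add: v_def)
 have "wty v t = (if o' t then TH else TV)" if t: "t : idx" "Suc t : idx" for t
 proof (cases "o' t")
  case True
  hence "before v t (Suc t)" using before_sort_key[OF v(1,3), of t "Suc t"] t v by simp
  thus ?thesis using t v True by (simp add: wty_def)
 next
  case False
  hence "before v (Suc t) t" using before_sort_key[OF v(1,3), of "Suc t" t] t v by simp
  hence "~ before v t (Suc t)" using before_total[OF v(1), of "Suc t" t] t v by simp
  thus ?thesis using t v False by (simp add: wty_def)
 qed
 thus ?thesis using v by blast
qed

lemma wty_other: "set v = idx ==> set v' = idx ==> ~ (t : idx & Suc t : idx) ==> wty v t = wty v' t" by (auto simp: wty_def)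

text \<open>The lazy word serves as normal form. At the first pair that deviates from it,
  \<open>att_flip\<close> yields a configuration valid for both orders, so reversing this pair
  preserves P and leaves one deviation less.\<close>

lemma word_lazy:
 assumes c: "pclass as0 bs0" and vl: "distinct vl" "set vl = idx" "ALL t. t : idx --> Suc t : idx --> wty vl t = lty t"
  and v: "distinct v" "set v = idx" "att (wty v)"
 shows "P (map res v) <-> P (map res vl)" using v
proof (induction "card {t : idx. Suc t : idx & wty v t ~= lty t}" arbitrary: v rule: less_induct)
 case less
 let ?N = "{t : idx. Suc t : idx & wty v t ~= lty t}"
 have fN: "finite ?N" by (simp add: idx_def)
 show ?case
 proof (cases "?N = {}")
  case True
  have "wty v t = wty vl t" for t
  proof (cases "t : idx & Suc t : idx")
   case True
   thus ?thesis using `?N = {}` vl(3) by auto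
  next
   case False
   thus ?thesis by (rule wty_other[OF less.prems(2) vl(2)])
  qed
  moreover obtain B x where "okc B" "ALL t<p. conn (wty v t) (x t) (x (Suc t)) (B t)" using less.prems(3) by (auto simp: att_def)
  ultimately show ?thesis using word_exchange[OF c _ less.prems(1,2) vl(1,2)] by auto
 next
  case False
  define r where "r = Min ?N"
  have "r : ?N" unfolding r_def using fN False by (rule Min_in)
  hence r: "r : idx" "Suc r : idx" "wty v r ~= lty r" by auto
  have min: "wty v u = lty u" if "u < r" "u : idx" "Suc u : idx" for u
  proof (rule ccontr)
   assume "wty v u ~= lty u"
   hence "r <= u" unfolding r_def using that fN by (intro Min_le) auto
   thus False using that by simp
  qed
  obtain B x where B: "okc B" and x: "ALL t<p. conn (((wty v)(r := TF)) t) (x t) (x (Suc t)) (B t)"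
   using att_flip[OF less.prems(2,3) r min] by (auto simp: att_def)
  \<comment> \<open>A word with the relative orders of v, except that r and r + 1 are
    reversed.\<close>
  obtain v' where v': "distinct v'" "set v' = idx"
   "ALL t. t : idx --> Suc t : idx --> wty v' t = (if (if t = r then wty v r ~= TH else wty v t = TH) then TH else TV)"
   using ex_word[of "%t. if t = r then wty v r ~= TH else wty v t = TH"] by blast
  have HV: "wty v t = TH | wty v t = TV" if "t : idx" "Suc t : idx" for t using that less.prems(2) by (simp add: wty_def)
  have same: "wty v' t = wty v t" if "t ~= r" for t
  proof (cases "t : idx & Suc t : idx")
   case True
   hence "wty v' t = (if wty v t = TH then TH else TV)" using v'(3) that by simp
   thus ?thesis using HV[of t] True by (cases "wty v t = TH") simp_all
  next
   case False
   thus ?thesis by (rule wty_other[OF v'(2) less.prems(2)])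
  qed
  have wr: "wty v' r = (if wty v r ~= TH then TH else TV)" using v'(3) r by simp
  hence wr': "wty v' r = lty r" using HV[OF r(1,2)] r(3) by (auto simp: lty_def lazy_def split: if_splits)
  have F: "conn t z w A" if "conn TF z w A" "t = TH | t = TV" for t z w A using that by auto
  have cv: "ALL t<p. conn (wty v t) (x t) (x (Suc t)) (B t)"
  proof (intro allI impI)
   fix t assume "t < p"
   thus "conn (wty v t) (x t) (x (Suc t)) (B t)" using x HV[OF r(1,2)] F[of "x r" "x (Suc r)" "B r"] by (cases "t = r") auto
  qed
  have cv': "ALL t<p. conn (wty v' t) (x t) (x (Suc t)) (B t)"
  proof (intro allI impI)
   fix t assume "t < p"
   thus "conn (wty v' t) (x t) (x (Suc t)) (B t)" using x wr same[of t] F[of "x r" "x (Suc r)" "B r"] by (cases "t = r") auto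
  qed
  have "P (map res v) <-> P (map res v')" by (rule word_exchange[OF c B less.prems(1,2) v'(1,2) cv cv'])
  also have "... <-> P (map res vl)"
  proof (rule less.hyps)
   have "{t : idx. Suc t : idx & wty v' t ~= lty t} \<subset> ?N" using same wr' r by force
   thus "card {t : idx. Suc t : idx & wty v' t ~= lty t} < card ?N" using fN by (rule psubset_card_mono[rotated])
   show "att (wty v')" using B cv' by (auto simp: att_def)
  qed (rule v')+
  finally show ?thesis .
 qed
qed

lemma pclass_words:
 assumes "pclass as bs" "pclass as' bs'"
 shows "P (rword p bs) <-> P (rword p bs')"
proof -
 have "lty t = (if lty t = TH then TH else TV)" for t by (simp add: lty_def lazy_def)
 then obtain vl where vl: "distinct vl" "set vl = idx" "ALL t. t : idx --> Suc t : idx --> wty vl t = lty t"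
  using ex_word[of "%t. lty t = TH"] by metis
 have "P (rword p bs) <-> P (map res vl)" if "pclass as bs" for as bs using pclass_word[OF that] word_lazy[OF that vl] by (metis att_def)
 thus ?thesis using assms by blast
qed

end

section \<open>Primitivity of the block idempotent\<close>

lemma ex_base:
 assumes "p > 0" "size M < p"
 shows "EX b. b < - int k & b mod int p ~:# M"
proof -
 have "card (set_mset M) <= size M" by (metis size_mset_mono size_mset_set finite_set_mset mset_set_set_mset_msubset)
 hence "card (set_mset M) < card {0..<int p}" using assms by simp
 hence "~ {0..<int p} <= set_mset M" using card_mono[of "set_mset M" "{0..<int p}"] by fastforce
 then obtain r where "r : {0..<int p}" and rM: "r ~:# M" by blast
 hence r: "0 <= r" "r < int p" "r ~:# M" by simp_all
 have 1: "int (k + 1) <= int p * int (k + 1)" using mult_right_mono[of 1 "int p" "int (k + 1)"] assms(1) by simp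
 have 2: "int p * int (k + 2) = int p * int (k + 1) + int p" by (simp add: algebra_simps)
 have "r - int p * int (k + 2) < - int k" unfolding 2 using 1 r by linarith
 moreover have "(r - int p * int (k + 2)) mod int p = r" using r by (simp add: mod_diff_right_eq[symmetric])
 ultimately show ?thesis using r by metis
qed

text \<open>By \<open>idempotent_words\<close> the product e * eB is the sum of the projections for
  the words in \<open>jwords\<close>. All words with non-zero projection come from one class of
  paths, on which membership in \<open>jwords\<close> is constant, so the sum is empty or
  complete.\<close>

theorem eB_primitive:
 fixes e :: "'k::field galg"
 assumes p: "prime p" and char: "CHAR('k) = p" and semis: "ALL j:{1..m}. semis p N (jm j :: 'k galg)"
  and ts0: "length ts0 = m" "distinct (rword p (drop l ts0))" and lm: "l + n = m" and n: "n < p"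
  and e: "e : CA l m" "e * e = e" and cen: "!!c. c : CA l m ==> e * c = c * e"
 shows "e * eB p N l m (entry ts0) : {0, eB p N l m (entry ts0)}"
proof -
 let ?f = "entry ts0"
 have p0: "p > 0" using p prime_gt_0_nat by blast
 have inj: "inj_on (%j. ?f j mod int p) {Suc l..m}"
 proof -
  have "map (%j. ?f j mod int p) [Suc l..<Suc m] = rword p (drop l ts0)"
   using ts0(1) lm by (auto simp: list_eq_iff_nth_eq rword_def simp del: upt_Suc)
  hence "inj_on (%j. ?f j mod int p) (set [Suc l..<Suc m])" using ts0(2) by (metis distinct_map)
  moreover have "set [Suc l..<Suc m] = {Suc l..m}" by auto
  ultimately show ?thesis by simp
 qed
 note ctx = p char semis lm inj e cen
 define M1 M2 where "M1 = mset (rword p (take l ts0))" and "M2 = mset (rword p (drop l ts0))"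
 have rl: "rmset p l ?f = M1" using rmset_entry[of l ts0 p] ts0 lm by (simp add: M1_def)
 have rm: "rmset p m ?f = M1 + M2"
 proof -
  have "rmset p m ?f = mset (rword p (take l ts0 @ drop l ts0))" using rmset_entry[of m ts0 p] ts0 lm by simp
  thus ?thesis unfolding rword_def map_append mset_append M1_def M2_def .
 qed
 have "size M2 = n" using ts0 lm by (simp add: M2_def rword_def)
 then obtain b where b: "b < - int (l + n)" "b mod int p ~:# M2" using ex_base[OF p0, of M2 "l + n"] n by auto
 have cM: "count M2 i <= 1" for i using ts0(2) unfolding distinct_count_atmost_1 M2_def by (metis le_refl zero_le)
 let ?J = "jwords p N l m n ?f e"
 have SW: "rword p bs : ?J <-> rword p bs' : ?J"
  if "valid base_set (as @ bs)" "length as = l" "length bs = n" "mset (rword p as) = M1"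
   "mset (rword p bs) = M2" "swps bs bs'" for as bs bs' using jwords_swps[OF ctx that(6,1,2,3)] that(4,5) rl rm by (simp add: rword_def)
 have const: "rword p bs : ?J <-> rword p bs' : ?J" if "pclass p l n M1 M2 as bs" "pclass p l n M1 M2 as' bs'" for as bs as' bs'
  by (rule pclass_words[where P = "%w. w : ?J", OF p0 b cM SW that])
 have pd: "pclass p l n M1 M2 as bs <-> valid base_set (as @ bs) & length as = l & length bs = n &
   mset (rword p as) = M1 & mset (rword p bs) = M2" for as bs by (rule pclass_def[where P = "%w. w : ?J", OF p0 b cM SW])
 have path: "EX as bs. pclass p l n M1 M2 as bs & rword p bs = w"
  if w: "w : rwords p n" "eW p N l w * eB p N l m ?f ~= (0 :: 'k galg)" for w
 proof -
  obtain ts where ts: "valid base_set ts" "length ts = m" "mset (rword p ts) = rmset p m ?f"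
   "mset (rword p (take l ts)) = rmset p l ?f" "rword p (drop l ts) = w" using jwords_nonzero_path[OF ctx w] by blast
  have "mset (rword p (take l ts @ drop l ts)) = M1 + M2" using ts(3) rm by simp
  hence "mset (rword p (take l ts)) + mset (rword p (drop l ts)) = M1 + M2" unfolding rword_def map_append mset_append .
  hence "mset (rword p (drop l ts)) = M2" using ts(4) rl by simp
  hence "pclass p l n M1 M2 (take l ts) (drop l ts)" using ts rl lm by (simp add: pd)
  thus ?thesis using ts(5) by blast
 qed
 note iw = idempotent_words[OF ctx]
 show ?thesis
 proof (cases "?J = {}")
  case True
  thus ?thesis using iw by simp
 next
  case False
  have "?J = {w : rwords p n. e * (eW p N l w * eB p N l m ?f) ~= 0}" by (rule jwords_def[OF ctx])
  hence Jd: "w : ?J <-> w : rwords p n & e * (eW p N l w * eB p N l m ?f) ~= 0" for w by blast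
  obtain w0 where w0: "w0 : ?J" using False by blast
  hence "w0 : rwords p n" "eW p N l w0 * eB p N l m ?f ~= (0 :: 'k galg)" using Jd by auto
  then obtain as0 bs0 where c0: "pclass p l n M1 M2 as0 bs0" "rword p bs0 = w0" using path by blast
  have "eW p N l w * eB p N l m ?f = (0 :: 'k galg)" if w: "w : rwords p n - ?J" for w
  proof (rule ccontr)
   assume "eW p N l w * eB p N l m ?f ~= (0 :: 'k galg)"
   then obtain as bs where "pclass p l n M1 M2 as bs" "rword p bs = w" using path w by blast
   thus False using const[OF c0(1)] c0(2) w0 w by blast
  qed
  hence "(SUM w:?J. eW p N l w * eB p N l m ?f) = (SUM w:rwords p n. eW p N l w * eB p N l m ?f :: 'k galg)"
   using Jd by (intro sum.mono_neutral_left) auto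
  also have "... = eB p N l m ?f" using sum_eW[OF p char semis lm] by (simp flip: sum_distrib_right)
  finally show ?thesis using iw by simp
 qed
qed

section \<open>Cores and residue contents\<close>

definition rc :: "nat => (nat => nat) => int multiset" where
 "rc p al = image_mset (residue p) (mset_set (young al))"

lemma residue_cont: "residue p x = cont x mod int p" by (simp add: residue_def cont_def case_prod_unfold)

lemma rc_conts: "rc p al = image_mset (%a. a mod int p) (conts al)"
 unfolding rc_def conts_def by (simp add: image_mset.compositionality o_def) (intro image_mset_cong residue_cont)

lemma diagonal_young:
 assumes al: "partition al" and "x : young al" "cont y = cont x" "fst y <= fst x"
 shows "y : young al"
proof -
 have "snd y <= snd x" using assms(3,4) by (simp add: cont_def)
 thus ?thesis using young_closed[OF al, of "fst x" "snd x" "fst y" "snd y"] assms by simp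
qed

lemma diagonal_eq: "cont x = cont y ==> fst x = fst y ==> x = y" by (simp add: cont_def prod_eq_iff)

lemma rim_cont_inj:
 assumes al: "partition al" and x: "x : rim al" "y : rim al" "cont x = cont y"
 shows "x = y"
proof -
 have False if "x : rim al" "y : rim al" "cont x = cont y" "fst x < fst y" for x y
 proof -
  have "(Suc (fst x), Suc (snd x)) : young al"
   using diagonal_young[OF al, of y "(Suc (fst x), Suc (snd x))"] that by (auto simp: cont_def rim_def)
  thus False using that by (auto simp: rim_def)
 qed
 thus ?thesis using x diagonal_eq by (metis linorder_neqE_nat)
qed

lemma connected_interval:
 assumes "(x, y) : {(u, v). u : R & v : R & adjacent u v}\<^sup>*" "x : R" "cont x <= z" "z <= cont y"
 shows "z : cont ` R" using assms(1,4)
proof (induction rule: rtrancl_induct)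
 case base thus ?case using assms by auto
next
 case (step y y')
 hence "cont y' <= cont y + 1" "y' : R" by (auto simp: adjacent_def cont_def)
 then consider "z <= cont y" | "z = cont y'" using step.prems by linarith
 thus ?case using step.IH `y' : R` by cases auto
qed

text \<open>The contents of a connected part of the rim form an interval without repetition, so p
  nodes have p consecutive contents and each residue once.\<close>

lemma rc_remove:
 assumes "remove_rim_hook p al be" "p > 0"
 shows "rc p al = rc p be + mset_set {0..<int p}"
proof -
 obtain R where al: "partition al" and R: "R <= rim al" "connected_nodes R" "card R = p" "young be = young al - R"
  using assms(1) by (auto simp: remove_rim_hook_def)
 have RY: "R <= young al" using R(1) by (auto simp: rim_def)
 have fR: "finite R" using al RY finite_subset finite_young by blast
 have far: False if "x : R" "y : R" "residue p x = residue p y" "cont x < cont y" for x y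
 proof -
  have "int p dvd cont y - cont x" using that(3) by (simp add: residue_cont mod_eq_dvd_iff dvd_diff_commute)
  hence "int p <= cont y - cont x" using that(4) by (intro zdvd_imp_le) auto
  moreover have "{cont x..cont y} <= cont ` R" using connected_interval[of x y R] R(2) that by (auto simp: connected_nodes_def)
  hence "card {cont x..cont y} <= card (cont ` R)" by (intro card_mono) (use fR in auto)
  moreover have "card (cont ` R) <= p" using card_image_le[OF fR, of cont] R(3) by simp
  ultimately show False by simp
 qed
 have inj: "inj_on (residue p) R"
 proof (rule inj_onI)
  fix x y assume xy: "x : R" "y : R" "residue p x = residue p y"
  hence "cont x = cont y" using far[of x y] far[of y x] by (metis linorder_less_linear)
  thus "x = y" using rim_cont_inj[OF al] xy R(1) by blast
 qed
 have "residue p ` R = {0..<int p}"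
 proof (rule card_subset_eq)
  show "card (residue p ` R) = card {0..<int p}" using card_image[OF inj] R(3) by simp
 qed (use assms(2) in \<open>auto simp: residue_cont\<close>)
 hence "image_mset (residue p) (mset_set R) = mset_set {0..<int p}" using image_mset_mset_set[OF inj] by simp
 moreover have "mset_set (young al) = mset_set (young be) + mset_set R"
 proof -
  have "(young al - R) Int R = {}" "young al - R Un R = young al" using RY by auto
  thus ?thesis using R(4) fR finite_young[OF al] mset_set_Union[of "young al - R" R] by simp
 qed
 ultimately show ?thesis by (simp add: rc_def)
qed

lemma mem_beta_set: "x : beta_set al <-> (EX i. x = int (al i) - int i - 1)" by (auto simp: beta_set_def)

lemma ex_rim_node:
 assumes al: "partition al" and x: "x : young al"
 shows "EX y:rim al. cont y = cont x"
proof -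
 let ?D = "{y : young al. cont y = cont x}"
 have D: "finite ?D" using finite_young[OF al] by simp
 have "x : ?D" using x by simp
 hence "Max (fst ` ?D) : fst ` ?D" using D by (intro Max_in) blast+
 then obtain y where y: "y : ?D" "fst y = Max (fst ` ?D)" by force
 have "(Suc (fst y), Suc (snd y)) ~: young al"
 proof
  assume "(Suc (fst y), Suc (snd y)) : young al"
  hence "(Suc (fst y), Suc (snd y)) : ?D" using y(1) by (simp add: cont_def)
  hence "Suc (fst y) : fst ` ?D" by force
  hence "Suc (fst y) <= Max (fst ` ?D)" using D by (intro Max_ge) auto
  thus False using y by simp
 qed
 thus ?thesis using y by (intro bexI[of _ y]) (auto simp: rim_def)
qed

lemma rim_next:
 assumes al: "partition al" and x: "x : rim al" "y : rim al" "cont y = cont x + 1"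
 shows "adjacent x y"
proof (cases "(fst x, Suc (snd x)) : young al")
 case True
 have "(Suc (fst x), Suc (Suc (snd x))) ~: young al"
  using x(1) young_closed[OF al, of "Suc (fst x)" "Suc (Suc (snd x))" "Suc (fst x)" "Suc (snd x)"] by (auto simp: rim_def)
 hence "(fst x, Suc (snd x)) : rim al" using True by (simp add: rim_def)
 hence "y = (fst x, Suc (snd x))" using x by (intro rim_cont_inj[OF al]) (auto simp: cont_def)
 thus ?thesis by (simp add: adjacent_def case_prod_unfold)
next
 case False
 have yx: "fst y < fst x"
 proof (rule ccontr)
  assume "~ fst y < fst x"
  hence "(fst x, Suc (snd x)) : young al"
   using x `~ fst y < fst x` diagonal_young[OF al, of y "(fst x, Suc (snd x))"] by (auto simp: cont_def rim_def)
  thus False using False by simp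
 qed
 then obtain r where r: "fst x = Suc r" by (cases "fst x") auto
 have "(r, snd x) : young al" using x(1) r young_closed[OF al, of "fst x" "snd x" r "snd x"] by (auto simp: rim_def)
 hence "(r, snd x) : rim al" using False r by (simp add: rim_def)
 hence "y = (r, snd x)" using x r by (intro rim_cont_inj[OF al]) (auto simp: cont_def)
 thus ?thesis using r by (simp add: adjacent_def case_prod_unfold)
qed

text \<open>If b is a bead and b - p is not, the rim nodes with contents above b - p and at most b
  form a removable hook, and its removal moves that bead.\<close>

lemma core_flush:
 assumes core: "is_core p al" and p: "p > 0" and b: "b : beta_set al"
 shows "b - int p : beta_set al"
proof (rule ccontr)
 assume nb: "b - int p ~: beta_set al"
 have al: "partition al" using core by (simp add: is_core_def)
 hence anti: "al j <= al i" if "i <= j" for i j using that by (simp add: partition_def antimono_def)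
 obtain i where i: "b = int (al i) - int i - 1" using b by (auto simp: mem_beta_set)
 define R where "R = {x : rim al. b - int p < cont x & cont x <= b}"
 have node: "EX x:R. cont x = z" if z: "b - int p < z" "z <= b" for z
 proof -
  \<comment> \<open>The first node of the diagonal z, in the top row or in the first column. For
    negative z an empty row would make b - p a bead.\<close>
  have "(nat (max 0 (- z)), nat (max 0 z)) : young al"
  proof (cases "z >= 0")
   case True
   thus ?thesis using z(2) i anti[of 0 i] by (simp add: young_def)
  next
   case False
   have "al (nat (- z)) ~= 0"
   proof
    assume "al (nat (- z)) = 0"
    hence "al (nat (- (b - int p) - 1)) = 0" using anti[of "nat (- z)" "nat (- (b - int p) - 1)"] z by simp
    hence "b - int p : beta_set al" using z False unfolding mem_beta_set by (intro exI[of _ "nat (- (b - int p) - 1)"]) auto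
    thus False using nb by simp
   qed
   thus ?thesis using False by (simp add: young_def)
  qed
  from ex_rim_node[OF al this] obtain x where "x : rim al" "cont x = z" by (auto simp: cont_def split: if_splits)
  thus ?thesis using z unfolding R_def by blast
 qed
 have inj: "inj_on cont R" using rim_cont_inj[OF al] by (auto simp: inj_on_def R_def)
 have "cont ` R = {b - int p<..b}" using node by (force simp: R_def)
 hence cR: "card R = p" using card_image[OF inj] by simp
 let ?E = "{(u, v). u : R & v : R & adjacent u v}"
 have up: "(x, y) : ?E\<^sup>* & (y, x) : ?E\<^sup>*" if "x : R" "y : R" "cont y = cont x + int k" for x y k using that(2,3)
 proof (induction k arbitrary: y)
  case 0
  thus ?case using inj that(1) by (auto dest: inj_onD)
 next
  case (Suc k)
  have "b - int p < cont x + int k" "cont x + int k <= b" using that(1) Suc.prems by (auto simp: R_def)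
  then obtain w where w: "w : R" "cont w = cont x + int k" using node by blast
  hence "adjacent w y" using Suc.prems by (intro rim_next[OF al]) (auto simp: R_def)
  hence "(w, y) : ?E" "(y, w) : ?E" using w Suc.prems by (auto simp: adjacent_def)
  thus ?case using Suc.IH[OF w] by (meson converse_rtrancl_into_rtrancl rtrancl.rtrancl_into_rtrancl)
 qed
 have con: "connected_nodes R" unfolding connected_nodes_def
 proof (intro ballI)
  fix x y assume "x : R" "y : R"
  thus "(x, y) : ?E\<^sup>*" using up[of x y "nat (cont y - cont x)"] up[of y x "nat (cont x - cont y)"] by (cases "cont x <= cont y") auto
 qed
 \<comment> \<open>Inside the hook a row takes the length of the next row minus 1. The value b - p +
   k + 1 places a bead at b - p and takes over in the last row of the hook; the minimum keeps the
   rows below unchanged.\<close>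
 define be where "be k = (if k < i then al k else min (al k) (max (al (Suc k) - 1) (nat (b - int p + int k + 1))))" for k
 have below: "be k <= al k" for k by (simp add: be_def)
 have "be (Suc k) <= be k" for k
 proof (cases "k < i")
  case True
  thus ?thesis using below[of "Suc k"] anti[of k "Suc k"] by (simp add: be_def)
 next
  case False
  have ne: "int (al (Suc k)) ~= b - int p + int k + 2"
   using nb unfolding mem_beta_set by (metis add.commute add_diff_cancel_left' diff_diff_eq of_nat_Suc one_add_one add.assoc)
  have "al (Suc (Suc k)) <= al (Suc k)" "al (Suc k) <= al k" using anti by simp_all
  thus ?thesis using False ne by (simp add: be_def min_def max_def) linarith
 qed
 hence "antimono be" by (simp add: antimono_iff_le_Suc)
 moreover have "finite {r. be r ~= 0}"
 proof (rule finite_subset)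
  show "{r. be r ~= 0} <= {r. al r ~= 0}" using below by (metis (mono_tags) Collect_mono le_zero_eq)
 qed (use al in \<open>simp add: partition_def\<close>)
 ultimately have be: "partition be" by (simp add: partition_def)
 have "x : young be <-> x : young al - R" for x
 proof -
  obtain k c where x: "x = (k, c)" by fastforce
  have R: "x : R <-> c < al k & al (Suc k) <= Suc c & b - int p < int c - int k & int c - int k <= b"
   by (auto simp: R_def x rim_def young_def cont_def)
  show ?thesis
  proof (cases "k < i")
   case True
   hence "al i <= al (Suc k)" using anti by simp
   thus ?thesis unfolding Diff_iff R using True i by (auto simp: x young_def be_def)
  next
   case False
   hence "int (al k) - int k - 1 <= b" using anti[of i k] i by simp
   thus ?thesis unfolding Diff_iff R using False by (auto simp: x young_def be_def)
  qed
 qed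
 hence "young be = young al - R" by blast
 moreover have "R <= rim al" by (auto simp: R_def)
 ultimately have "remove_rim_hook p al be" unfolding remove_rim_hook_def using al be con cR by blast
 thus False using core by (auto simp: is_core_def)
qed

lemma beta_set_inj:
 assumes "partition al" "partition be" "beta_set al = beta_set be"
 shows "al = be"
proof
 fix i show "al i = be i"
 proof (induction i rule: less_induct)
  case (less i)
  have "int (al i) - int i <= int (be i) - int i"
   if "partition al" "partition be" "beta_set al = beta_set be" "!!j. j < i ==> al j = be j" for al be
  proof -
   have "int (al i) - int i - 1 : beta_set be" unfolding that(3)[symmetric] mem_beta_set by blast
   then obtain j where j: "int (al i) - int i = int (be j) - int j" by (auto simp: mem_beta_set)
   have "~ j < i"
   proof
    assume "j < i"
    thus False using that(4)[of j] beta_strict[OF that(1), of j i] j by simp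
   qed
   thus ?thesis using beta_strict[OF that(2), of i j] j by (cases "i = j") auto
  qed
  from this[OF assms less] this[OF assms(2,1) assms(3)[symmetric] less[symmetric]] show ?case by simp
 qed
qed

text \<open>The multiplicity of a content is the number of nodes on its diagonal, and these nodes
  are an initial segment of the diagonal.\<close>

lemma conts_inj:
 assumes "partition al" "partition be" "conts al = conts be"
 shows "al = be"
proof -
 have "young al <= young be" if *: "partition al" "partition be" "conts al = conts be" for al be
 proof (rule ccontr)
  assume "~ young al <= young be"
  then obtain x where x: "x : young al" "x ~: young be" by blast
  let ?D = "%al. {y : young al. cont y = cont x}"
  have cnt: "count (conts al) (cont x) = card (?D al)" if "partition al" for al
   unfolding conts_def using finite_young[OF that] by (subst count_image_mset') (simp add: Int_def conj_commute eq_commute[of _ "cont x"])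
  have "y : young al" if "y : ?D be" for y
  proof (rule diagonal_young[OF *(1) x(1)])
   show "fst y <= fst x" using diagonal_young[OF *(2), of y x] that x(2) by fastforce
  qed (use that in simp)
  hence "?D be \<subset> ?D al" using x by blast
  hence "card (?D be) < card (?D al)" using finite_young[OF *(1)] by (intro psubset_card_mono) auto
  thus False using cnt[OF *(1)] cnt[OF *(2)] *(3) by simp
 qed
 from this[OF assms] this[OF assms(2,1) assms(3)[symmetric]] show ?thesis by (intro partition_eqI subset_antisym)
qed

lemma partition_path:
 assumes "partition al"
 shows "EX as. valid base_set as & fin base_set as = beta_set al & mset as = conts al"
proof -
 obtain t where t: "t : tableaux al" "col_reading al t" using ex_col_reading[OF assms] by blast
 have "is_weight (col_conts al t)" unfolding is_weight_def using kap_rho_nonzero[OF t(1)] wtl_col_conts[OF assms t] by blast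
 hence v: "valid base_set (col_conts al t)" by (rule is_weight_valid)
 then obtain be where "partition be" "beta_set be = fin base_set (col_conts al t)" "conts be = mset (col_conts al t)"
  using valid_partition by blast
 thus ?thesis using v conts_inj[OF `partition be` assms] mset_col_conts[OF t(1)] by metis
qed

lemma flush_mult: "(!!x. x : X ==> x - int p : X) ==> x : X ==> x - int p * int k : X"
proof (induction k)
 case (Suc k)
 hence "x - int p * int k - int p : X" by blast
 thus ?case by (simp add: algebra_simps)
qed simp

text \<open>Beads that are pushed down as far as possible are determined on each runner by their
  number.\<close>

lemma flush_eq:
 assumes p: "p > 0" and X: "!!x. x : X ==> x - int p : X" and Y: "!!x. x : Y ==> x - int p : Y"
  and fX: "finite (hi b X)" and bY: "{y. y < b} <= Y"
  and c: "!!r. card {x : hi b X. x mod int p = r} = card {x : hi b Y. x mod int p = r}"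
 shows "X <= Y"
proof (rule ccontr)
 have mult: "EX k. y = x - int p * int k" if "y <= x" "y mod int p = x mod int p" for x y
 proof -
  note yx = that
  obtain k where k: "x - y = int p * k" using yx(2) by (metis mod_eq_dvd_iff dvdE)
  hence "0 <= k" using yx(1) p by (metis diff_ge_0_iff_ge of_nat_0_less_iff zero_le_mult_iff not_le)
  thus ?thesis using k by (intro exI[of _ "nat k"]) simp
 qed
 assume "~ X <= Y"
 then obtain x where x: "x : X" "x ~: Y" by blast
 hence "b <= x" using bY by force
 let ?S = "%X. {y : hi b X. y mod int p = x mod int p}"
 have "y : ?S X" if y: "y : ?S Y" for y
 proof -
  have "y <= x" using mult[of x y] flush_mult[OF Y, of y] y x(2) by (force simp: hi_def)
  then obtain k where "y = x - int p * int k" using mult y by auto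
  hence "y : X" using flush_mult[OF X x(1)] by simp
  thus ?thesis using y by (simp add: hi_def)
 qed
 hence "?S Y \<subset> ?S X" using x `b <= x` by (auto simp: hi_def)
 hence "card (?S Y) < card (?S X)" using fX by (intro psubset_card_mono) auto
 thus False using c by simp
qed

text \<open>Full sets of residues do not affect the bead counts, which depend on differences of
  multiplicities of consecutive residues; by \<open>core_flush\<close> and \<open>flush_eq\<close>
  these counts determine a core. This also makes \<open>core\<close> well defined.\<close>

lemma core_rc_unique:
 assumes p: "p > 0" and g: "is_core p ga" "is_core p ga'"
  and e: "rc p ga + repeat_mset k (mset_set {0..<int p}) = rc p ga' + repeat_mset k' (mset_set {0..<int p})"
 shows "ga = ga'"
proof -
 have P: "partition ga" "partition ga'" using g by (auto simp: is_core_def)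
 obtain as where as: "valid base_set as" "fin base_set as = beta_set ga" "mset as = conts ga" using partition_path P by blast
 obtain as' where as': "valid base_set as'" "fin base_set as' = beta_set ga'" "mset as' = conts ga'" using partition_path P by blast
 define b where "b = - int (length as) - int (length as') - 1"
 have ab: "b < a" if "a : set as" for a using valid_entries[OF as(1) that] by (simp add: b_def)
 have ab': "b < a" if "a : set as'" for a using valid_entries[OF as'(1) that] by (simp add: b_def)
 have bb: "{y. y < b} <= base_set" by (auto simp: b_def base_set_def)
 note h = hi_sum[OF as(1) ab finite_hi_base, unfolded as(2)] and h' = hi_sum[OF as'(1) ab' finite_hi_base, unfolded as'(2)]
 have rc: "mset (rword p as) = rc p ga" "mset (rword p as') = rc p ga'" using as as' by (simp_all add: rc_conts rword_def)
 have ce: "count (rc p ga) r + k = count (rc p ga') r + k'" if "0 <= r" "r < int p" for r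
  using arg_cong[OF e, of "%M. count M r"] that by simp
 have c: "card {x : hi b (beta_set ga). x mod int p = r} = card {x : hi b (beta_set ga'). x mod int p = r}" for r
 proof (cases "0 <= r & r < int p")
  case True
  hence r: "0 <= r" "r < int p" "0 <= (r + 1) mod int p" "(r + 1) mod int p < int p" using p by auto
  have "int (card {x : hi b X. x mod int p = r}) = (SUM x:hi b X. of_bool (x mod int p = r))" if "finite (hi b X)" for X
   using that by (simp add: Int_def)
  hence "int (card {x : hi b (beta_set ga). x mod int p = r}) = int (card {x : hi b (beta_set ga'). x mod int p = r})"
   using h[of "%x. of_bool (x mod int p = r)"] h'[of "%x. of_bool (x mod int p = r)"]
    residue_count[OF r(1,2), where as = as] residue_count[OF r(1,2), where as = as'] ce[OF r(1,2)] ce[OF r(3,4)] rc by (simp del: sum_of_bool_eq)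
  thus ?thesis by simp
 next
  case False
  hence "{x : X. x mod int p = r} = {}" for X :: "int set" using p by auto
  thus ?thesis by (simp only:)
 qed
 have "beta_set ga = beta_set ga'"
 proof
  show "beta_set ga <= beta_set ga'"
   using flush_eq[OF p core_flush[OF g(1) p] core_flush[OF g(2) p] _ _ c] h fin_below[OF ab' bb] as'(2) by auto
  show "beta_set ga' <= beta_set ga"
   using flush_eq[OF p core_flush[OF g(2) p] core_flush[OF g(1) p] _ _ c[symmetric]] h' fin_below[OF ab bb] as(2) by auto
 qed
 thus ?thesis using beta_set_inj P by blast
qed

lemma rc_removes:
 assumes "(remove_rim_hook p)\<^sup>*\<^sup>* al ga" "p > 0"
 shows "EX k. rc p al = rc p ga + repeat_mset k (mset_set {0..<int p})" using assms(1)
proof (induction rule: rtranclp_induct)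
 case base
 show ?case by (intro exI[of _ 0]) simp
next
 case (step be ga)
 then obtain k where "rc p al = rc p be + repeat_mset k (mset_set {0..<int p})" by blast
 thus ?case using rc_remove[OF step.hyps(2) assms(2)] by (intro exI[of _ "Suc k"]) simp
qed

lemma ex_core:
 assumes "partition al" "p > 0"
 shows "EX ga. (remove_rim_hook p)\<^sup>*\<^sup>* al ga & is_core p ga" using assms(1)
proof (induction "card (young al)" arbitrary: al rule: less_induct)
 case less
 show ?case
 proof (cases "is_core p al")
  case False
  then obtain be where be: "remove_rim_hook p al be" using less.prems by (auto simp: is_core_def)
  hence "size (rc p al) = size (rc p be) + p" using rc_remove[OF be assms(2)] by simp
  hence "card (young be) < card (young al)" using assms(2) by (simp add: rc_def)
  moreover have "partition be" using be by (simp add: remove_rim_hook_def)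
  ultimately obtain ga where "(remove_rim_hook p)\<^sup>*\<^sup>* be ga" "is_core p ga" using less.hyps by blast
  thus ?thesis using be converse_rtranclp_into_rtranclp by metis
 qed auto
qed

lemma core_props:
 assumes "partition al" "p > 0"
 shows "is_core p (core p al) & (EX k. rc p al = rc p (core p al) + repeat_mset k (mset_set {0..<int p}))"
proof -
 obtain ga where ga: "(remove_rim_hook p)\<^sup>*\<^sup>* al ga" "is_core p ga" using ex_core[OF assms] by blast
 have "core p al = ga" unfolding core_def
 proof (rule the_equality)
  fix ga' assume "(remove_rim_hook p)\<^sup>*\<^sup>* al ga' & is_core p ga'"
  thus "ga' = ga" using rc_removes[OF _ assms(2)] ga core_rc_unique[OF assms(2)] by metis
 qed (use ga in blast)
 thus ?thesis using ga rc_removes[OF ga(1) assms(2)] by blast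
qed

theorem core_eq_iff:
 assumes "partition al" "partition be" "weight al = weight be" "p > 0"
 shows "core p al = core p be <-> rc p al = rc p be"
proof -
 obtain k where k: "is_core p (core p al)" "rc p al = rc p (core p al) + repeat_mset k (mset_set {0..<int p})"
  using core_props[OF assms(1,4)] by blast
 obtain k' where k': "is_core p (core p be)" "rc p be = rc p (core p be) + repeat_mset k' (mset_set {0..<int p})"
  using core_props[OF assms(2,4)] by blast
 show ?thesis
 proof
  assume "rc p al = rc p be"
  thus "core p al = core p be" using core_rc_unique[OF assms(4) k(1) k'(1)] k(2) k'(2) by metis
 next
  assume c: "core p al = core p be"
  have "size (rc p al) = size (rc p be)" using assms by (simp add: rc_def card_young)
  hence "k * p = k' * p" using k(2) k'(2) c by simp
  thus "rc p al = rc p be" using k(2) k'(2) c assms(4) by simp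
 qed
qed

section \<open>Integral Specht modules\<close>

abbreviation ta :: "nat perm => (tableau set \<Rightarrow>\<^sub>0 int) => (tableau set \<Rightarrow>\<^sub>0 int)" where
 "ta sg == frag_extend (%A. frag_of (act_tabloid sg A))"

lemma act_tabloid_mult: "act_tabloid (sg * tt) A = act_tabloid sg (act_tabloid tt A)"
 by (simp add: act_tabloid_def image_image apply_mult o_assoc)

lemma act_tabloid_one [simp]: "act_tabloid 1 A = A" by (simp add: act_tabloid_def o_def)

lemma ta_mult: "ta (sg * tt) x = ta sg (ta tt x)" using frag_extend_compose[of "%A. frag_of (act_tabloid sg A)" "act_tabloid tt" x]
 by (simp add: act_tabloid_mult[abs_def] o_def)

lemma act_int_superset:
 assumes "finite S" "keys a <= S"
 shows "act_int a x = (SUM sg:S. frag_cmul (lookup a sg) (ta sg x))"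
 unfolding act_int_def using assms by (intro sum.mono_neutral_left) (auto simp: in_keys_iff)

lemma act_int_add_left: "act_int (a + b) x = act_int a x + act_int b x"
proof -
 let ?S = "keys a Un keys b"
 have "act_int (a + b) x = (SUM sg:?S. frag_cmul (lookup (a + b) sg) (ta sg x))"
  by (rule act_int_superset) (use Poly_Mapping.keys_add[of a b] in auto)
 also have "... = act_int a x + act_int b x" unfolding act_int_superset[of ?S a, simplified] act_int_superset[of ?S b, simplified]
  by (simp add: lookup_add frag_cmul_distrib sum.distrib)
 finally show ?thesis .
qed

lemma act_int_add [simp]: "act_int a (x + y) = act_int a x + act_int a y"
 by (simp add: act_int_def frag_extend_add frag_cmul_distrib2 sum.distrib)

lemma act_int_zero [simp]: "act_int a 0 = 0" "act_int 0 x = 0" by (simp_all add: act_int_def)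

lemma act_int_single: "act_int (single sg c) x = frag_cmul c (ta sg x)" by (cases "c = 0") (simp_all add: act_int_def)

lemma act_int_mult: "act_int (a * b) x = act_int a (act_int b x)"
proof (induction a rule: galg_induct)
 case (single sg c)
 show ?case
 proof (induction b rule: galg_induct)
  case (single tt d)
  show ?case by (simp add: mult_single act_int_single plus_perm_def ta_mult frag_extend_cmul)
 qed (simp_all add: distrib_left act_int_add_left)
qed (simp_all add: distrib_right act_int_add_left)

lemma act_int_diff_left: "act_int (a - b) x = act_int a x - act_int b x" using act_int_add_left[of "a - b" b x] by (simp add: algebra_simps)

lemma act_int_diff [simp]: "act_int a (x - y) = act_int a x - act_int a y" using act_int_add[of a "x - y" y] by (simp add: algebra_simps)

lemma act_int_sum_left: "act_int (sum f I) x = (SUM i:I. act_int (f i) x)"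
 by (induction I rule: infinite_finite_induct) (simp_all add: act_int_add_left)

lemma act_int_of_int: "act_int (of_int c) x = frag_cmul c x"
proof -
 have "ta 1 x = x" by (simp add: frag_expansion[symmetric])
 thus ?thesis unfolding of_int_eq_single by (simp add: act_int_single zero_perm_def)
qed

lemma act_int_cmul: "act_int a (frag_cmul c x) = frag_cmul c (act_int a x)"
 by (simp add: act_int_def frag_extend_cmul frag_cmul_sum mult.commute o_def)

lemma act_int_one [simp]: "act_int 1 x = x" using act_int_of_int[of 1 x] by simp

lemma act_int_gs_of [simp]: "act_int (gs sg) (frag_of A) = frag_of (act_tabloid sg A)" by (simp add: act_int_single)

lemma tableaux_comp: "t : tableaux al ==> sg : sym (weight al) ==> apply sg o t : tableaux al"
proof -
 assume t: "t : tableaux al" and sg: "sg : sym (weight al)"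
 have "bij_betw (apply sg) {1..weight al} {1..weight al}"
  using sgrp_image[of sg "{1..weight al}"] sg by (auto simp: bij_betw_def inj_on_def apply_inj sym_sgrp)
 thus ?thesis using bij_betw_trans[OF tableauxD(1)[OF t]] tableauxD(5)[OF t] sgrp_fix[of sg "{1..weight al}" 0] sg
  by (auto simp: tableaux_def sym_sgrp)
qed

lemma tableaux_transitive:
 assumes t: "t : tableaux al" and s: "s : tableaux al"
 shows "EX sg:sym (weight al). s = apply sg o t"
proof -
 let ?n = "{1..weight al}"
 have b: "bij_betw (s o the_inv_into (young al) t) ?n ?n"
  using tableauxD(1)[OF t] tableauxD(1)[OF s] by (metis bij_betw_the_inv_into bij_betw_trans)
 from extend_bij[OF b] obtain f where f: "f permutes ?n" "ALL x:?n. f x = (s o the_inv_into (young al) t) x" by auto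
 obtain sg where sg: "sg : sgrp ?n" "apply sg = f" using ex_perm[OF f(1)] by auto
 have "s x = sg $ (t x)" for x
 proof (cases "x : young al")
  case True
  thus ?thesis using f(2) tableauxD(4)[OF t True] the_inv_into_f_f[OF tableauxD(2)[OF t]] sg(2) by simp
 next
  case False
  thus ?thesis using tableauxD(5)[OF t] tableauxD(5)[OF s] sgrp_fix[OF sg(1), of 0] by simp
 qed
 hence "s = apply sg o t" by (intro ext) simp
 thus ?thesis using sg(1) unfolding sym_sgrp by blast
qed

lemma tabloid_comp:
 assumes t: "t : tableaux al" and sg: "sg : sym (weight al)"
 shows "tabloid al (apply sg o t) = act_tabloid sg (tabloid al t)"
proof (intro subset_antisym subsetI)
 have i: "inverse sg : sym (weight al)" using sg by (simp add: sym_sgrp)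
 fix s assume "s : tabloid al (apply sg o t)"
 hence s: "s : tableaux al" "!!r. s ` row al r = (apply sg o t) ` row al r" by (auto simp: tabloid_def)
 have "(apply (inverse sg) o s) ` row al r = t ` row al r" for r unfolding image_comp[symmetric] s(2) by (simp add: image_image)
 hence "apply (inverse sg) o s : tabloid al t" using tableaux_comp[OF s(1) i] by (simp add: tabloid_def)
 moreover have "s = apply sg o (apply (inverse sg) o s)" by (auto simp: o_def)
 ultimately show "s : act_tabloid sg (tabloid al t)" unfolding act_tabloid_def by blast
next
 fix s assume "s : act_tabloid sg (tabloid al t)"
 then obtain u where u: "s = apply sg o u" "u : tableaux al" "!!r. u ` row al r = t ` row al r" by (auto simp: tabloid_def act_tabloid_def)
 have "(apply sg o u) ` row al r = (apply sg o t) ` row al r" for r unfolding image_comp[symmetric] u(3) ..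
 thus "s : tabloid al (apply sg o t)" using tableaux_comp[OF u(2) sg] unfolding u(1) by (simp add: tabloid_def)
qed

lemma act_tabloid_row:
 assumes t: "t : tableaux al" and sg: "sg : sym (weight al)"
 shows "act_tabloid sg (tabloid al t) = tabloid al t <-> sg : stabf (weight al) (rowf al t)"
proof -
 have "tabloid al s = tabloid al t <-> (ALL r. s ` row al r = t ` row al r)" if "s : tableaux al" for s
 proof
  assume "tabloid al s = tabloid al t"
  moreover have "s : tabloid al s" using that by (simp add: tabloid_def)
  ultimately show "ALL r. s ` row al r = t ` row al r" by (simp add: tabloid_def)
 qed (simp add: tabloid_def)
 from this[OF tableaux_comp[OF t sg]] show ?thesis
  unfolding tabloid_comp[OF t sg] using sg by (simp add: stabf_def rowf_def image_image o_def)
qed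

abbreviation tbl :: "(nat => nat) => tableau => (tableau set \<Rightarrow>\<^sub>0 int)" where
 "tbl al t == frag_of (tabloid al t)"

text \<open>Tabloids correspond to cosets of the row stabiliser, so sending the tabloid of t to
  \<open>rhot\<close> is a well-defined map into the group algebra.\<close>

lemma act_tbl_zero:
 assumes t: "t : tableaux al" and a: "a : GA (weight al)" and z: "act_int a (tbl al t) = 0"
 shows "a * rhot al t = 0"
proof (rule poly_mapping_eqI)
 fix tt
 let ?R = "stabf (weight al) (rowf al t)" and ?S = "sym (weight al)"
 have ka: "keys a <= ?S" using a by (simp add: group_algebra_def)
 have l: "lookup (a * rhot al t) tt = (SUM sg:?S. lookup a sg * of_bool (inverse sg * tt : ?R))"
 proof -
  have "a * rhot al t = (SUM sg:?S. single 0 (lookup a sg) * (gs sg * rhot al t))"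
  proof -
   have "a = (SUM sg:?S. single 0 (lookup a sg) * gs sg)"
    using keys_subset_single_sum[OF finite_sym ka] by (simp only: single_scalar[symmetric])
   hence "a * rhot al t = (SUM sg:?S. single 0 (lookup a sg) * gs sg) * rhot al t" by (rule arg_cong)
   thus ?thesis by (simp only: sum_distrib_right mult.assoc)
  qed
  thus ?thesis by (simp add: lookup_sum lookup_scalar_mult lookup_gs_mult lookup_rho)
 qed
 show "lookup (a * rhot al t) tt = lookup 0 tt"
 proof (cases "tt : ?S")
  case True
  have "0 = lookup (act_int a (tbl al t)) (act_tabloid tt (tabloid al t))" using z by simp
  also have "... = (SUM sg:?S. lookup a sg * of_bool (act_tabloid tt (tabloid al t) = act_tabloid sg (tabloid al t)))"
   by (simp add: act_int_superset[OF _ ka] lookup_sum when_def of_bool_def)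
  also have "... = (SUM sg:?S. lookup a sg * of_bool (inverse sg * tt : ?R))"
  proof (intro sum.cong refl arg_cong2[where f = "(*)"] arg_cong[where f = of_bool])
   fix sg assume sg: "sg : ?S"
   hence s: "inverse sg * tt : ?S" using True by (simp add: sym_sgrp sgrp_mult)
   have "act_tabloid tt (tabloid al t) = act_tabloid sg (tabloid al t) <-> act_tabloid (inverse sg * tt) (tabloid al t) = tabloid al t"

   proof
    assume "act_tabloid (inverse sg * tt) (tabloid al t) = tabloid al t"
    hence "act_tabloid (sg * (inverse sg * tt)) (tabloid al t) = act_tabloid sg (tabloid al t)" by (simp only: act_tabloid_mult)
    thus "act_tabloid tt (tabloid al t) = act_tabloid sg (tabloid al t)" by (simp flip: mult.assoc)
   qed (simp add: act_tabloid_mult flip: act_tabloid_mult[of "inverse sg" sg])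
   thus "act_tabloid tt (tabloid al t) = act_tabloid sg (tabloid al t) <-> inverse sg * tt : ?R" using act_tabloid_row[OF t s] by simp
  qed
  finally show ?thesis using l by simp
 next
  case False
  have "inverse sg * tt ~: ?R" if "sg : ?S" for sg
  proof
   assume "inverse sg * tt : ?R"
   hence "sg * (inverse sg * tt) : ?S" using that stabf_sym sgrp_mult by (metis sym_sgrp)
   thus False using False by (simp flip: mult.assoc)
  qed
  thus ?thesis unfolding l by simp
 qed
qed

lemma polytabloid_kap: "polytabloid al t = act_int (kapt al t) (tbl al t)"
 by (simp add: polytabloid_def column_stabiliser_stabf kap_def act_int_sum_left act_int_mult act_int_of_int sgnp_def)

lemma kap_GA: "kap n F : GA n" unfolding kap_def by (intro GA_sum GA_mult GA_of_int GA_gs stabf_sym)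

lemma rho_GA: "rho n F : GA n" unfolding rho_def by (intro GA_sum GA_gs stabf_sym)

lemma gs_kapt:
 assumes "sg : sym (weight al)"
 shows "gs sg * kapt al t = kapt al (apply sg o t) * gs sg"
proof -
 let ?C = "%t. stabf (weight al) (colf al t)"
 have sub: "sg * kp * inverse sg : ?C (apply sg o t)" if "sg : sym (weight al)" "kp : ?C t" for sg kp t
 proof -
  have "apply (sg * kp * inverse sg) ` (apply sg o t) ` column al c = (apply sg o t) ` column al c" for c
  proof -
   have "apply kp ` t ` column al c = t ` column al c" using that(2) by (simp add: stabf_def colf_def)
   hence "apply sg ` apply kp ` t ` column al c = apply sg ` t ` column al c" by simp
   thus ?thesis by (simp add: image_image apply_mult)
  qed
  moreover have "sg * kp * inverse sg : sym (weight al)" using that stabf_sym[OF that(2)] by (simp add: sym_sgrp sgrp_mult)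
  ultimately show ?thesis unfolding stabf_def colf_def by blast
 qed
 have i: "inverse sg : sym (weight al)" using assms by (simp add: sym_sgrp)
 have "bij_betw (%kp. sg * kp * inverse sg) (?C t) (?C (apply sg o t))"
 proof (rule bij_betw_byWitness[where f' = "%kp. inverse sg * kp * sg"])
  have c: "inverse sg * (sg * x) = x" "sg * (inverse sg * x) = x" for x by (simp_all flip: mult.assoc)
  show "ALL kp:?C t. inverse sg * (sg * kp * inverse sg) * sg = kp" by (simp add: mult.assoc c)
  show "ALL kp:?C (apply sg o t). sg * (inverse sg * kp * sg) * inverse sg = kp" by (simp add: mult.assoc c)
  show "(%kp. sg * kp * inverse sg) ` ?C t <= ?C (apply sg o t)" using sub[OF assms] by blast
  show "(%kp. inverse sg * kp * sg) ` ?C (apply sg o t) <= ?C t"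
   using sub[OF i, of _ "apply sg o t"] by (auto simp: perm_inverse_inverse o_def)
 qed
 moreover have sg: "sgnp (sg * kp * inverse sg) = sgnp kp" for kp
  using sgnp_sq[of sg] by (simp add: sgnp_mult mult.commute mult.left_commute)
 ultimately have bij: "bij_betw (%kp. sg * kp * inverse sg) (?C t) (?C (apply sg o t))" by blast
 from sum.reindex_bij_betw[OF bij, of "%kp. of_int (sgnp kp) * gs kp :: int galg"]
 have "kapt al (apply sg o t) = (SUM kp:?C t. of_int (sgnp kp) * gs (sg * kp * inverse sg))" by (simp add: kap_def sg)
 hence "kapt al (apply sg o t) * gs sg = (SUM kp:?C t. of_int (sgnp kp) * (gs sg * gs kp))"
  by (simp add: sum_distrib_right mult.assoc gs_mult)
 thus ?thesis by (simp add: kap_def sum_distrib_left of_int_comm[symmetric])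
qed

lemma act_polytabloid:
 assumes "t : tableaux al" "sg : sym (weight al)"
 shows "act_int (gs sg) (polytabloid al t) = polytabloid al (apply sg o t)" using assms gs_kapt[OF assms(2), of t]
 by (simp add: polytabloid_kap tabloid_comp flip: act_int_mult) (simp add: act_int_mult)

lemma specht_zero [simp]: "0 : specht_int al" by (simp add: specht_int_def)

lemma specht_add: "x : specht_int al ==> y : specht_int al ==> x + y : specht_int al" by (simp add: specht_int_def group_closure_add)

lemma specht_cmul: "x : specht_int al ==> frag_cmul c x : specht_int al"
proof (induction c rule: int_induct[of _ 0])
 case (step1 c) thus ?case by (simp add: frag_cmul_distrib specht_add)
next
 case (step2 c) thus ?case by (simp add: frag_cmul_diff_distrib specht_int_def group_closure.diff)
qed (simp add: specht_int_def)

lemma specht_act: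
 assumes "x : specht_int al" "a : GA (weight al)"
 shows "act_int a x : specht_int al"
proof -
 have g: "act_int (gs sg) x : specht_int al" if "sg : sym (weight al)" for sg using assms(1) unfolding specht_int_def
 proof (induction rule: group_closure.induct)
  case (base s)
  thus ?case using act_polytabloid[OF _ that] tableaux_comp[OF _ that] by (auto intro!: group_closure.base)
 qed (simp add: group_closure.diff)
 have "act_int a x = (SUM sg:sym (weight al). frag_cmul (lookup a sg) (act_int (gs sg) x))"
  using assms(2) by (subst act_int_superset[of "sym (weight al)"]) (auto simp: group_algebra_def act_int_single)
 moreover have "(SUM sg:V. frag_cmul (lookup a sg) (act_int (gs sg) x)) : specht_int al"
  if "V <= sym (weight al)" for V using that by (induction V rule: infinite_finite_induct) (auto intro!: specht_add specht_cmul g)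
 ultimately show ?thesis by auto
qed

lemma specht_cyclic:
 assumes t: "t : tableaux al" and v: "v : specht_int al"
 shows "EX a:GA (weight al). v = act_int (a * kapt al t) (tbl al t)" using v unfolding specht_int_def
proof (induction rule: group_closure.induct)
 case (base s)
 then consider "s = 0" | s' where "s' : tableaux al" "s = polytabloid al s'" by auto
 thus ?case
 proof cases
  case 2
  then obtain sg where sg: "sg : sym (weight al)" "s' = apply sg o t" using tableaux_transitive[OF t] by blast
  have "s = act_int (gs sg * kapt al t) (tbl al t)"
   unfolding 2(2) sg(2) act_polytabloid[OF t sg(1), symmetric] by (simp add: polytabloid_kap act_int_mult)
  thus ?thesis using GA_gs[OF sg(1)] by blast
 qed (auto intro!: bexI[of _ 0])
next
 case (diff s s')
 thus ?case by (metis act_int_diff_left GA_diff left_diff_distrib)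
qed

section \<open>Scalar actions on integral Specht modules\<close>

definition scal :: "(tableau set \<Rightarrow>\<^sub>0 int) set => int galg => int => bool" where
 "scal W x c <-> (ALL w:W. act_int x w = frag_cmul c w)"

lemma scal_of_int: "scal W (of_int c) c" by (simp add: scal_def act_int_of_int)

lemma scal_mult: "scal W x c ==> scal W y d ==> scal W (x * y) (c * d)" by (simp add: scal_def act_int_mult act_int_cmul mult.commute)

lemma scal_diff: "scal W x c ==> scal W y d ==> scal W (x - y) (c - d)" by (simp add: scal_def act_int_diff_left frag_cmul_diff_distrib)

lemma scal_one: "scal W 1 1" by (simp add: scal_def)

lemma scal_power: "scal W x c ==> scal W (x ^ n) (c ^ n)" by (induction n) (auto intro: scal_one scal_mult)

lemma scal_epsi: "scal W x b ==> scal W (epsi p N a x) (epsi_val p N a b)"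
 unfolding epsi_def epsi_val_def by (intro scal_diff scal_one scal_power scal_of_int)

lemma scal_prod_list:
 assumes "!!i. i : set xs ==> EX om. scal W (F i) om & [om = of_bool (P i)] (mod int p)"
 shows "EX om. scal W (prod_list (map F xs)) om & [om = of_bool (ALL i:set xs. P i)] (mod int p)" using assms
proof (induction xs)
 case Nil
 show ?case using scal_one by (intro exI[of _ 1]) simp
next
 case (Cons x xs)
 obtain om where "scal W (F x) om" "[om = of_bool (P x)] (mod int p)" using Cons.prems[of x] by auto
 moreover obtain om' where "scal W (prod_list (map F xs)) om'" "[om' = of_bool (ALL i:set xs. P i)] (mod int p)"
  using Cons.IH Cons.prems by auto
 ultimately show ?case using scal_mult cong_mult[of om "of_bool (P x)" "int p" om' "of_bool (ALL i:set xs. P i)"]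
  by (intro exI[of _ "om * om'"]) (auto simp flip: of_bool_conj)
qed

lemma act_rho_tbl:
 assumes "t : tableaux al"
 shows "act_int (rhot al t) (tbl al t) = frag_cmul (int (card (stabf (weight al) (rowf al t)))) (tbl al t)"
proof -
 have "act_int (gs sg) (tbl al t) = tbl al t" if "sg : stabf (weight al) (rowf al t)" for sg
  using act_tabloid_row[OF assms stabf_sym[OF that]] that by simp
 hence "act_int (rhot al t) (tbl al t) = (SUM sg:stabf (weight al) (rowf al t). tbl al t)" by (simp add: rho_def act_int_sum_left)
 also have "(SUM sg:A. tbl al t) = frag_cmul (int (card A)) (tbl al t)" if "finite A" for A :: "nat perm set"
  using that by (induction A rule: finite_induct) (auto simp: frag_cmul_distrib)
 finally show ?thesis by simp
qed

text \<open>The eigenvalue is known on \<open>kapt mu t * rhot mu t\<close>, which sends the tabloid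
  of t to a positive multiple of the polytabloid, and this multiple cancels in a free abelian group.
  The polytabloid generates the module and the element is central, so the scalar is the same
  everywhere.\<close>

lemma esym_scal:
 assumes mu: "partition mu" and t: "t : tableaux mu" "col_reading mu t"
 shows "scal (specht_int mu) (esym jm (weight mu) k) (esym (entry (col_conts mu t)) (weight mu) k)" (is "scal _ ?z ?c")
proof -
 let ?y = "kapt mu t * rhot mu t" and ?R = "stabf (weight mu) (rowf mu t)"
 have "length (col_conts mu t) = weight mu" by (simp add: col_conts_def del: upt_Suc)
 hence "wtv (weight mu) (entry (col_conts mu t)) ?y" using wtl_wtv_entry[OF wtl_col_conts[OF mu t]] by simp
 hence zy: "?z * ?y = of_int ?c * ?y" by (rule esym_wtv) simp
 have y: "act_int ?y (tbl mu t) = frag_cmul (int (card ?R)) (polytabloid mu t)"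
  by (simp add: act_int_mult act_rho_tbl[OF t(1)] act_int_cmul polytabloid_kap)
 have "frag_cmul (int (card ?R)) (act_int ?z (polytabloid mu t)) = act_int (?z * ?y) (tbl mu t)"
  by (simp add: act_int_mult[of ?z] y act_int_cmul)
 also have "... = frag_cmul (int (card ?R)) (frag_cmul ?c (polytabloid mu t))"
  unfolding zy act_int_mult[of "of_int ?c"] act_int_of_int y by (simp add: mult.commute)
 finally have "frag_cmul (int (card ?R)) (act_int ?z (polytabloid mu t) - frag_cmul ?c (polytabloid mu t)) = 0"
  by (metis (no_types, lifting) frag_cmul_distrib2 add_diff_cancel diff_add_cancel diff_self)
 moreover have "card ?R > 0" using card_gt_0_iff by (metis empty_iff finite_stabf stabf_one)
 hence "int (card ?R) ~= 0" by linarith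
 ultimately have "act_int ?z (polytabloid mu t) - frag_cmul ?c (polytabloid mu t) = 0" unfolding frag_cmul_eq_0_iff by blast
 hence zt: "act_int ?z (polytabloid mu t) = frag_cmul ?c (polytabloid mu t)" by (simp only: right_minus_eq)
 show ?thesis unfolding scal_def
 proof
  fix v assume "v : specht_int mu"
  then obtain a where a: "a : GA (weight mu)" "v = act_int (a * kapt mu t) (tbl mu t)" using specht_cyclic[OF t(1)] by blast
  hence v: "v = act_int a (polytabloid mu t)" by (simp add: act_int_mult polytabloid_kap)
  have "act_int ?z v = act_int (a * ?z) (polytabloid mu t)" unfolding v esym_top_commute[OF a(1)] act_int_mult ..
  thus "act_int ?z v = frag_cmul ?c v" by (simp add: act_int_mult zt act_int_cmul v)
 qed
qed

lemma eBp_scal: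
 assumes p: "prime p" and char: "CHAR('k::field) = p" and mu: "partition mu"
 shows "EX om. scal (specht_int mu) (eBp p N (weight mu) f) om & [om = of_bool (rc p mu = rmset p (weight mu) f)] (mod int p)"
proof -
 obtain t where t: "t : tableaux mu" "col_reading mu t" using ex_col_reading[OF mu] by blast
 let ?g = "entry (col_conts mu t)" and ?m = "weight mu"
 have len: "length (col_conts mu t) = ?m" by (simp add: col_conts_def del: upt_Suc)
 have "EX om. scal (specht_int mu) (epsi p N (esym f ?m k) (esym jm ?m k)) om & [om = of_bool ([esym ?g ?m k = esym f ?m k] (mod int p))] (mod int p)" for k
  using scal_epsi[OF esym_scal[OF mu t]] epsi_val_cong[OF p] unfolding of_bool_def by blast
 from scal_prod_list[OF this] have "EX om. scal (specht_int mu) (eBp p N ?m f) om &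
   [om = of_bool (ALL k:set [0..<Suc ?m]. [esym ?g ?m k = esym f ?m k] (mod int p))] (mod int p)" unfolding eBp_def .
 also have "(ALL k:set [0..<Suc ?m]. [esym ?g ?m k = esym f ?m k] (mod int p)) <-> (ALL k<=?m. [esym ?g ?m k = esym f ?m k] (mod int p))"
  by (auto simp del: upt_Suc)
 also have "... <-> rmset p ?m ?g = rmset p ?m f" by (rule esym_rmset[OF p char])
 also have "rmset p ?m ?g = rc p mu"
  using rmset_entry[of ?m "col_conts mu t" p] len mset_col_conts[OF t(1)] by (simp add: rword_def rc_conts)
 finally show ?thesis .
qed

context
 fixes mu nu :: "nat => nat" and l m :: nat
 assumes sk: "(mu, nu) : skew_partitions l m"
begin

lemma skD: "partition mu" "partition nu" "young nu <= young mu" "weight nu = l" "weight mu = m" "l <= m"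
proof -
 show *: "partition mu" "partition nu" "young nu <= young mu" "weight nu = l" "weight mu = m" using sk by (auto simp: skew_partitions_def)
 thus "l <= m" using card_mono[OF finite_young[OF *(1)] *(3)] by (simp add: card_young)
qed

abbreviation Hm :: "specht_map set" where "Hm == specht_hom (mu, nu)"

lemma homD:
 assumes "ph : Hm"
 shows "ph v : specht_int mu" "v ~: specht_int nu ==> ph v = 0"
  "v : specht_int nu ==> w : specht_int nu ==> ph (v + w) = ph v + ph w"
  "b : GA l ==> v : specht_int nu ==> ph (act_int b v) = act_int b (ph v)"
proof -
 show "ph v : specht_int mu" using assms by (cases "v : specht_int nu") (auto simp: specht_hom_def)
qed (use assms skD(4) in \<open>auto simp: specht_hom_def\<close>)

lemma hom_act:
 assumes ph: "ph : Hm" and y: "y : CA l m"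
 shows "(%v. act_int y (ph v)) : Hm"
proof -
 have ym: "y : GA (weight mu)" using y skD(5) by (simp add: centraliser_algebra_def)
 have "act_int y (act_int b x) = act_int b (act_int y x)" if "b : GA l" for b x
  using y that unfolding centraliser_algebra_def by (simp flip: act_int_mult)
 thus ?thesis using homD[OF ph] specht_act[OF _ ym] skD(4) by (simp add: specht_hom_def)
qed

lemma hom_add: "ph : Hm ==> ps : Hm ==> ph + ps : Hm" by (simp add: specht_hom_def specht_add)

lemma hom_zero: "0 : Hm" by (simp add: specht_hom_def)

lemma hom_cmul: "ph : Hm ==> (%v. frag_cmul c (ph v)) : Hm" using hom_act[of ph "of_int c"] by (simp add: act_int_of_int)

text \<open>The factor for S_m acts on the values of ph, while the factor for S_l passes through ph
  and acts on its source.\<close>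

lemma eB_hom:
 assumes p: "prime p" and char: "CHAR('k::field) = p"
 shows "EX om. (ALL ph:Hm. ALL v. act_int (eB p N l m f) (ph v) = frag_cmul om (ph v)) &
  [om = of_bool (rc p mu = rmset p m f & rc p nu = rmset p l f)] (mod int p)"
proof -
 obtain om1 where 1: "scal (specht_int mu) (eBp p N m f) om1" "[om1 = of_bool (rc p mu = rmset p m f)] (mod int p)"
  using eBp_scal[OF p char skD(1)] skD(5) by blast
 obtain om2 where 2: "scal (specht_int nu) (eBp p N l f) om2" "[om2 = of_bool (rc p nu = rmset p l f)] (mod int p)"
  using eBp_scal[OF p char skD(2)] skD(4) by blast
 have g: "(eBp p N l f :: int galg) : GA l"
 proof -
  have "(eBp p N l f :: int galg) : CA l l" unfolding eBp_def by (intro cent_prod_list) (auto intro!: cent_epsi cent_esym simp del: upt_Suc)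
  thus ?thesis by (simp add: centraliser_algebra_def)
 qed
 have "act_int (eB p N l m f) (ph v) = frag_cmul (om1 * om2) (ph v)" if ph: "ph : Hm" for ph v
 proof (cases "v : specht_int nu")
  case True
  have "act_int (eBp p N l f) (ph v) = ph (act_int (eBp p N l f) v)" using homD(4)[OF ph g True] by simp
  also have "act_int (eBp p N l f) v = act_int (of_int om2) v" using 2(1) True by (simp add: scal_def act_int_of_int)
  also have "ph (act_int (of_int om2) v) = frag_cmul om2 (ph v)" using homD(4)[OF ph GA_of_int True] by (simp add: act_int_of_int)
  finally show ?thesis using 1(1) homD(1)[OF ph, of v] by (simp add: eB_def act_int_mult act_int_cmul scal_def mult.commute)
 next
  case False
  thus ?thesis using homD(2)[OF ph] by simp
 qed
 moreover have "[om1 * om2 = of_bool (rc p mu = rmset p m f & rc p nu = rmset p l f)] (mod int p)"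
  using cong_mult[OF 1(2) 2(2)] by (simp add: of_bool_conj)
 ultimately show ?thesis by blast
qed

section \<open>Existence of non-zero homomorphisms\<close>

lemma extend_tableau:
 assumes t: "t : tableaux nu"
 shows "EX s:tableaux mu. ALL x:young nu. s x = t x"
proof -
 have "finite (young mu - young nu)" "card (young mu - young nu) = card {Suc l..m}" using skD by (simp_all add: card_Diff_subset card_young)
 then obtain g where g: "bij_betw g (young mu - young nu) {Suc l..m}" using finite_same_card_bij by blast
 define s where "s x = (if x : young nu then t x else if x : young mu then g x else 0)" for x
 have "bij_betw s (young nu) {1..l}" using tableauxD(1)[OF t] unfolding skD(4) by (simp add: s_def cong: bij_betw_cong)
 moreover have "bij_betw s (young mu - young nu) {Suc l..m}" using g by (subst bij_betw_cong[where g = g]) (auto simp: s_def)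
 ultimately have "bij_betw s (young nu Un (young mu - young nu)) ({1..l} Un {Suc l..m})" by (rule bij_betw_combine) auto
 moreover have "young nu Un (young mu - young nu) = young mu" "{1..l} Un {Suc l..m} = {1..m}" using skD by auto
 ultimately have "s : tableaux mu" using skD by (auto simp: tableaux_def s_def)
 moreover have "ALL x:young nu. s x = t x" by (simp add: s_def)
 ultimately show ?thesis by blast
qed

lemma ip_gs_adjoint: "ip (gs sg * x) y = ip x (gs (inverse sg) * y)" using ip_gs[of "inverse sg" "gs sg * x" y] by (simp flip: mult.assoc)

lemma lookup_kap_rho:
 assumes t: "t : tableaux al" and tt: "tt : stabf (weight al) (rowf al t)"
 shows "lookup (kapt al t * rhot al t) tt = 1"
proof -
 let ?R = "stabf (weight al) (rowf al t)"
 have R: "inverse sg * tt : ?R <-> sg : ?R" for sg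
 proof
  assume "inverse sg * tt : ?R"
  from stabf_mult[OF this stabf_inverse[OF tt]] have "inverse sg * tt * inverse tt : ?R" .
  thus "sg : ?R" by (simp add: mult.assoc)
 qed (use tt in \<open>auto intro: stabf_mult\<close>)
 have "lookup (kapt al t * rhot al t) tt = (SUM sg:stabf (weight al) (colf al t). sgnp sg * of_bool (sg : ?R))"
  by (simp add: kap_def sum_distrib_right lookup_sum mult.assoc lookup_of_int_times lookup_gs_mult lookup_rho R)
 also have "... = (SUM sg:{1}. sgnp sg * of_bool (sg : ?R))" by (rule sum.mono_neutral_right) (auto dest: col_row_trivial[OF t])
 finally show ?thesis by simp
qed

lemma stabf_mono_fix:
 assumes "sg : stabf l F" "!!c. F c <= G c" "!!c. G c <= F c Un {Suc l..m}"
 shows "sg : stabf m G"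
proof -
 have sg: "sg : sgrp {1..l}" using assms(1) by (simp add: stabf_def sym_sgrp)
 have fx: "sg $ x = x" if "x : G c - F c" for x c using that assms(3)[of c] by (intro sgrp_fix[OF sg]) auto
 have "apply sg ` G c = G c" for c
 proof -
  have "G c = F c Un (G c - F c)" using assms(2) by blast
  moreover have "apply sg ` (G c - F c) = G c - F c" using fx by force
  moreover have "apply sg ` F c = F c" using assms(1) by (simp add: stabf_def)
  ultimately show ?thesis by (metis image_Un)
 qed
 thus ?thesis using sgrp_mono[OF _ sg, of "{1..m}"] skD(6) by (simp add: stabf_def sym_sgrp)
qed

text \<open>Let y be the product for mu. The column stabiliser for nu acts on y by signs, so a zero
  product makes rho y orthogonal to y, hence to itself, and rho y = 0, where rho is the row sum for
  nu. But y has coefficient 1 throughout the row stabiliser for mu, so the coefficient of 1 in rho y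
  is the order of the row stabiliser for nu.\<close>

lemma hom_element_nonzero:
 assumes t: "t : tableaux nu" and s: "s : tableaux mu" and st: "!!x. x : young nu ==> s x = t x"
 shows "kapt nu t * rhot nu t * (kapt mu s * rhot mu s) ~= 0"
proof
 let ?y = "kapt mu s * rhot mu s" and ?C = "stabf (weight nu) (colf nu t)" and ?R = "stabf (weight nu) (rowf nu t)"
 have tail: "s x : {Suc l..m}" if x: "x : young mu" "x ~: young nu" for x
 proof -
  have "s x ~: {1..l}"
  proof
   assume "s x : {1..l}"
   then obtain y where y: "y : young nu" "t y = s x" using tableauxD(3)[OF t] skD(4) by (metis imageE)
   thus False using x st[of y] inj_onD[OF tableauxD(2)[OF s], of x y] skD(3) by auto
  qed
  thus ?thesis using tableauxD(4)[OF s x(1)] skD(5) by auto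
 qed
 have C: "sg : stabf (weight mu) (colf mu s)" if "sg : ?C" for sg unfolding skD(5) using that[unfolded skD(4)]
 proof (rule stabf_mono_fix)
  show "colf nu t c <= colf mu s c" for c using skD(3) st by (force simp: colf_def column_def)
  show "colf mu s c <= colf nu t c Un {Suc l..m}" for c using st tail by (force simp: colf_def column_def)
 qed
 have R: "sg : stabf (weight mu) (rowf mu s)" if "sg : ?R" for sg unfolding skD(5) using that[unfolded skD(4)]
 proof (rule stabf_mono_fix)
  show "rowf nu t c <= rowf mu s c" for c using skD(3) st by (force simp: rowf_def row_def)
  show "rowf mu s c <= rowf nu t c Un {Suc l..m}" for c using st tail by (force simp: rowf_def row_def)
 qed
 have pos: "?C ~= {}" "?R ~= {}" using stabf_one by blast+
 assume "kapt nu t * rhot nu t * ?y = 0"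
 hence "0 = ip (kapt nu t * (rhot nu t * ?y)) ?y" by (simp only: mult.assoc ip_zero)
 also have "... = (SUM sg:?C. sgnp sg * ip (rhot nu t * ?y) (gs (inverse sg) * ?y))"
  by (simp add: kap_def sum_distrib_right ip_sum_left mult.assoc ip_of_int_left ip_gs_adjoint)
 also have "... = (SUM sg:?C. ip (rhot nu t * ?y) ?y)"
 proof (intro sum.cong refl)
  fix sg assume "sg : ?C"
  hence "gs (inverse sg) * kapt mu s = of_int (sgnp sg) * kapt mu s" using gs_kap[of "inverse sg"] C by simp
  hence "gs (inverse sg) * ?y = of_int (sgnp sg) * ?y" by (simp only: mult.assoc[symmetric])
  hence "sgnp sg * ip (rhot nu t * ?y) (gs (inverse sg) * ?y) = (sgnp sg * sgnp sg) * ip (rhot nu t * ?y) ?y"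
   by (simp only: ip_of_int_right mult.assoc)
  thus "sgnp sg * ip (rhot nu t * ?y) (gs (inverse sg) * ?y) = ip (rhot nu t * ?y) ?y" by (simp only: sgnp_sq mult_1)
 qed
 finally have "ip (rhot nu t * ?y) ?y = 0" using pos by simp
 hence z: "ip ?y (rhot nu t * ?y) = 0" by (simp only: ip_commute)
 have "ip (rhot nu t * ?y) (rhot nu t * ?y) = (SUM sg:?R. ip ?y (gs (inverse sg) * (rhot nu t * ?y)))"
  by (simp add: rho_def[of _ "rowf nu t"] sum_distrib_right ip_sum_left mult.assoc ip_gs_adjoint)
 also have "... = (SUM sg:?R. 0)"
 proof (intro sum.cong refl)
  fix sg assume "sg : ?R"
  hence "gs (inverse sg) * rhot nu t = rhot nu t" by (intro gs_rho) simp
  thus "ip ?y (gs (inverse sg) * (rhot nu t * ?y)) = 0" using z by (simp flip: mult.assoc)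
 qed
 finally have "rhot nu t * ?y = 0" by simp
 hence "0 = lookup (rhot nu t * ?y) 1" by simp
 also have "... = (SUM sg:?R. lookup ?y (inverse sg))" by (simp add: rho_def[of _ "rowf nu t"] sum_distrib_right lookup_sum lookup_gs_mult)
 also have "... = (SUM sg:?R. 1)" using R by (intro sum.cong refl lookup_kap_rho[OF s]) simp
 finally show False using pos by simp
qed

text \<open>The tabloid of t is sent to \<open>rhot nu t\<close> applied to the polytabloid of an
  extension s of t. This guards against a zero module, on which every idempotent would act as the
  identity.\<close>

lemma hom_nonzero: "EX ph:Hm. EX v. ph v ~= 0"
proof -
 obtain t where t: "t : tableaux nu" using ex_col_reading[OF skD(2)] by blast
 obtain s where s: "s : tableaux mu" "ALL x:young nu. s x = t x" using extend_tableau[OF t] by blast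
 \<comment> \<open>A chosen element of the group algebra producing v from the tabloid; after
   multiplication by \<open>rhot nu t\<close> the choice makes no difference, by
   \<open>act_tbl_zero\<close>.\<close>
 define A where "A v = (SOME a. a : GA l & v = act_int a (tbl nu t))" for v
 define ph where "ph v = (if v : specht_int nu then act_int (A v * rhot nu t) (polytabloid mu s) else 0)" for v
 have A: "A v : GA l" "v = act_int (A v) (tbl nu t)" if v: "v : specht_int nu" for v
 proof -
  obtain a where "a : GA l" "v = act_int (a * kapt nu t) (tbl nu t)" using specht_cyclic[OF t v] skD(4) by auto
  moreover have "kapt nu t : GA l" using kap_GA[of l] skD(4) by simp
  ultimately have "EX a. a : GA l & v = act_int a (tbl nu t)" using GA_mult by blast
  hence "A v : GA l & v = act_int (A v) (tbl nu t)" unfolding A_def by (rule someI_ex)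
  thus "A v : GA l" "v = act_int (A v) (tbl nu t)" by auto
 qed
 have ph: "ph (act_int a (tbl nu t)) = act_int (a * rhot nu t) (polytabloid mu s)"
  if a: "a : GA l" "act_int a (tbl nu t) : specht_int nu" for a
 proof -
  let ?v = "act_int a (tbl nu t)"
  have "act_int (A ?v - a) (tbl nu t) = 0" using A(2)[OF a(2)] by (simp add: act_int_diff_left)
  moreover have "A ?v - a : GA (weight nu)" using A(1)[OF a(2)] a(1) GA_diff skD(4) by blast
  ultimately have "(A ?v - a) * rhot nu t = 0" by (intro act_tbl_zero[OF t])
  hence "A ?v * rhot nu t = a * rhot nu t" by (simp add: left_diff_distrib)
  thus ?thesis using a(2) by (simp add: ph_def)
 qed
 have rl: "rhot nu t : GA m" using rho_GA[of l "rowf nu t"] GA_mono[OF skD(6)] skD(4) by auto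
 have "polytabloid mu s : specht_int mu" unfolding specht_int_def using s(1) by (auto intro: group_closure.base)
 hence im: "ph v : specht_int mu" for v using specht_act[of _ mu] GA_mult[OF GA_mono[OF skD(6) A(1)] rl] skD(5) by (simp add: ph_def)
 have add: "ph (v + w) = ph v + ph w" if v: "v : specht_int nu" and w: "w : specht_int nu" for v w
 proof -
  have e: "v + w = act_int (A v + A w) (tbl nu t)" unfolding act_int_add_left A(2)[OF v, symmetric] A(2)[OF w, symmetric] ..
  have "ph (act_int (A v + A w) (tbl nu t)) = act_int ((A v + A w) * rhot nu t) (polytabloid mu s)"
   using specht_add[OF v w] unfolding e by (intro ph GA_add A v w)
  thus ?thesis using v w unfolding e[symmetric] by (simp add: ph_def distrib_right act_int_add_left)
 qed
 have eq: "ph (act_int b v) = act_int b (ph v)" if b: "b : GA l" and v: "v : specht_int nu" for b v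
 proof -
  have e: "act_int b v = act_int (b * A v) (tbl nu t)" unfolding act_int_mult A(2)[OF v, symmetric] ..
  have "act_int b v : specht_int nu" using specht_act[OF v] b skD(4) by simp
  hence "ph (act_int (b * A v) (tbl nu t)) = act_int (b * A v * rhot nu t) (polytabloid mu s)" unfolding e by (intro ph GA_mult b A v)
  thus ?thesis using v unfolding e[symmetric] by (simp add: ph_def act_int_mult mult.assoc)
 qed
 have "ph v = 0" if "v ~: specht_int nu" for v using that by (simp add: ph_def)
 hence "ph : Hm" using im add eq skD(4) by (simp add: specht_hom_def)
 moreover have "ph (polytabloid nu t) ~= 0"
 proof
  have "polytabloid nu t : specht_int nu" unfolding specht_int_def using t by (auto intro: group_closure.base)
  moreover have "kapt nu t : GA l" using kap_GA[of l] skD(4) by simp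
  moreover assume "ph (polytabloid nu t) = 0"
  ultimately have "act_int (kapt nu t * rhot nu t * kapt mu s) (tbl mu s) = 0"
   using ph[of "kapt nu t"] by (simp add: polytabloid_kap act_int_mult)
  moreover have "kapt nu t * rhot nu t * kapt mu s : GA (weight mu)"
   using rl kap_GA[of m "colf mu s"] GA_mono[OF skD(6) kap_GA[of l "colf nu t"]] skD(4,5) by (auto intro!: GA_mult)
  ultimately have "kapt nu t * rhot nu t * kapt mu s * rhot mu s = 0" by (intro act_tbl_zero[OF s(1)])
  thus False using hom_element_nonzero[OF t s(1)] s(2) by (simp add: mult.assoc)
 qed
 ultimately show ?thesis by blast
qed

end

section \<open>Specht modules of the centraliser algebra\<close>

definition fsum :: "('a => 'k::comm_ring_1) => ('a \<Rightarrow>\<^sub>0 int) => 'k" where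
 "fsum g z = (SUM x:keys z. of_int (lookup z x) * g x)"

lemma fsum_diff: "fsum g (u - v) = fsum g u - fsum g v"
proof -
 let ?A = "keys u Un keys v Un keys (u - v)"
 have "fsum g z = (SUM x:?A. of_int (lookup z x) * g x)" if "keys z <= ?A" for z
  unfolding fsum_def using that by (intro sum.mono_neutral_left) (auto simp: in_keys_iff)
 hence "fsum g u = (SUM x:?A. of_int (lookup u x) * g x)" "fsum g v = (SUM x:?A. of_int (lookup v x) * g x)"
  "fsum g (u - v) = (SUM x:?A. of_int (lookup (u - v) x) * g x)" by auto
 thus ?thesis by (simp add: lookup_minus left_diff_distrib sum_subtractf)
qed

lemma fsum_of [simp]: "fsum g (frag_of x) = g x" by (simp add: fsum_def)

lemma fsum_zero [simp]: "fsum g 0 = 0" by (simp add: fsum_def)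

lemma fsum_sum: "fsum g (sum f I) = (SUM i:I. fsum g (f i))"
proof (induction I rule: infinite_finite_induct)
 case (insert i I)
 have "fsum g (f i + sum f I) = fsum g (f i) + fsum g (sum f I)"
  using fsum_diff[of g "f i + sum f I" "sum f I"] by (simp add: algebra_simps)
 thus ?case using insert by simp
qed simp_all

lemma sum_fun_app: "(SUM i:I. f i) v = (SUM i:I. f i (v :: 'a) :: 'b::comm_monoid_add)" by (induction I rule: infinite_finite_induct) auto

lemma class_coeff_combine:
 fixes x y :: "'r::comm_ring_1 galg"
 assumes "x : CA l m" "y : CA l m" "K : conj_classes l m"
 shows "class_coeff (x + y) K = class_coeff x K + class_coeff y K"
 using assms(3) class_coeff_eq[OF assms(1)] class_coeff_eq[OF assms(2)] class_coeff_eq[OF cent_add[OF assms(1,2)]]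
 by (auto simp: conj_classes_def lookup_add)

lemma class_coeff_red:
 assumes "y : CA l m" "K : conj_classes l m"
 shows "class_coeff (single 0 a * red y :: 'k::comm_ring_1 galg) K = a * of_int (class_coeff y K)"
proof -
 have r: "(red y :: 'k galg) : CA l m" by (rule red_cent[OF assms(1)])
 have "single 0 a * (red y :: 'k galg) : CA l m"
 proof (rule cent_mult[OF _ r])
  have "single 0 a : GA m" by (intro GA_single) (simp add: sym_def zero_perm_def)
  thus "single 0 a : CA l m" unfolding cent_iff using scalar_commute by metis
 qed
 thus ?thesis using assms class_coeff_eq[OF assms(1)] by (auto simp: conj_classes_def class_coeff_eq lookup_scalar_mult)
qed

context
 fixes mu nu :: "nat => nat" and l m :: nat
 assumes sk: "(mu, nu) : skew_partitions l m"
begin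

lemmas skw = skD[OF sk]
lemmas hadd = hom_add[OF sk]
lemmas hact = hom_act[OF sk]
lemmas hcmul = hom_cmul[OF sk]

abbreviation H :: "specht_map set" where "H == specht_hom (mu, nu)"

lemma class_sum_cent: "K : conj_classes l m ==> class_sum K : CA l m"
 using csum_cent[of _ m l, where ?'r = int] skw(6) by (auto simp: conj_classes_def class_sum_def csum_def)

lemma hsum: "(!!i. i : I ==> f i : H) ==> (SUM i:I. f i) : H"
 by (induction I rule: infinite_finite_induct) (auto intro: hadd hom_zero[OF sk])

lemma act_class_sum:
 assumes z: "z : CA l m"
 shows "(SUM K:conj_classes l m. (%v. frag_cmul (class_coeff z K) (act_int (class_sum K) (ph v)))) = (%v. act_int z (ph v))"
proof
 fix v
 have "act_int z (ph v) = act_int (SUM K:conj_classes l m. of_int (class_coeff z K) * class_sum K) (ph v)"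
  using cent_decomp[OF z skw(6)] by (simp add: of_int_eq_single class_sum_def csum_def)
 thus "(SUM K:conj_classes l m. (%v. frag_cmul (class_coeff z K) (act_int (class_sum K) (ph v)))) v = act_int z (ph v)"
  by (simp add: sum_fun_app act_int_sum_left act_int_mult act_int_of_int)
qed

definition teq :: "('k::field \<times> specht_map \<Rightarrow>\<^sub>0 int) => ('k \<times> specht_map \<Rightarrow>\<^sub>0 int) => bool" where
 "teq u v <-> u - v : tensor_relations H"

lemma teq_refl: "teq u u" by (simp add: teq_def tensor_relations_def)

lemma teq_diff: "teq u v ==> teq u' v' ==> teq (u - u') (v - v')"
proof -
 have "u - u' - (v - v') = (u - v) - (u' - v')" by simp
 thus "teq u v ==> teq u' v' ==> ?thesis" unfolding teq_def tensor_relations_def by (simp only: group_closure.diff)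
qed

lemma teq_sym: "teq u v ==> teq v u" using teq_diff[OF teq_refl, of u v "u"] by (simp add: teq_def tensor_relations_def)

lemma teq_add: "teq u v ==> teq u' v' ==> teq (u + u') (v + v')"
 unfolding teq_def tensor_relations_def add_diff_add by (rule group_closure_add)

lemma teq_trans: "teq u v ==> teq v w ==> teq u w" using teq_add[of u v v w] by (simp add: teq_def)

lemma teq_sum: "(!!i. i : I ==> teq (f i) (g i)) ==> teq (sum f I) (sum g I)"
 by (induction I rule: infinite_finite_induct) (auto intro: teq_refl teq_add)

lemma teq_left: "x : H ==> teq (frag_of (a + b, x)) (frag_of (a, x) + frag_of (b, x))"
 unfolding teq_def tensor_relations_def diff_diff_eq[symmetric] by (intro group_closure.base) blast

lemma teq_right: "x : H ==> y : H ==> teq (frag_of (a, x + y)) (frag_of (a, x) + frag_of (a, y))"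
 unfolding teq_def tensor_relations_def diff_diff_eq[symmetric] by (intro group_closure.base) blast

text \<open>Additivity in n forces g 0 to be trivial modulo the relations, and then gives all
  positive and negative multiples.\<close>

lemma teq_cmul:
 assumes g: "!!n::int. teq (g (n + 1)) (g n + g 1)"
 shows "teq (g n) (frag_cmul n (g 1))"
proof (induction n rule: int_induct[of _ 0])
 case base
 show ?case using teq_diff[OF teq_sym[OF g[of 0]] teq_refl[of "g 1"]] by simp
next
 case (step1 n)
 thus ?case using teq_trans[OF g teq_add[OF _ teq_refl]] by (simp add: frag_cmul_distrib)
next
 case (step2 n)
 have "teq (g (n - 1)) (g n - g 1)" using teq_diff[OF teq_sym[OF g[of "n - 1"]] teq_refl[of "g 1"]] by simp
 thus ?case using teq_trans[OF _ teq_diff[OF step2(2) teq_refl]] by (simp add: frag_cmul_diff_distrib)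
qed

lemma teq_balanced:
 assumes x: "x : H"
 shows "teq (frag_of (of_int n * a, x)) (frag_of (a, %v. frag_cmul n (x v)))"
proof -
 have "teq (frag_of (of_int (n + 1) * a, x)) (frag_of (of_int n * a, x) + frag_of (of_int 1 * a, x))" for n
  using teq_left[OF x, of "of_int n * a" a] by (simp add: distrib_right)
 from teq_cmul[where g = "%n. frag_of (of_int n * a, x)", OF this]
 have 1: "teq (frag_of (of_int n * a, x)) (frag_cmul n (frag_of (a, x)))" by simp
 have "teq (frag_of (a, %v. frag_cmul (n + 1) (x v))) (frag_of (a, %v. frag_cmul n (x v)) + frag_of (a, %v. frag_cmul 1 (x v)))" for n
 proof -
  have "(%v. frag_cmul (n + 1) (x v)) = (%v. frag_cmul n (x v)) + (%v. frag_cmul 1 (x v))" by (rule ext) (simp add: frag_cmul_distrib)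
  thus ?thesis using teq_right[OF hcmul[OF x] hcmul[OF x]] by metis
 qed
 from teq_cmul[where g = "%n. frag_of (a, %v. frag_cmul n (x v))", OF this]
 have "teq (frag_of (a, %v. frag_cmul n (x v))) (frag_cmul n (frag_of (a, x)))" by simp
 from teq_trans[OF 1 teq_sym[OF this]] show ?thesis .
qed

lemma teq_sum_right: "finite I ==> (!!i. i : I ==> f i : H) ==> teq (SUM i:I. frag_of (a, f i)) (frag_of (a, SUM i:I. f i))"
proof (induction I rule: finite_induct)
 case empty
 have "teq (frag_of (a, 0)) (frag_of (a, 0) + frag_of (a, 0))" using teq_right[OF hom_zero[OF sk] hom_zero[OF sk]] by simp
 from teq_diff[OF teq_sym[OF this] teq_refl[of "frag_of (a, 0)"]] have "teq (frag_of (a, 0)) 0"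
  by (simp only: add_diff_cancel_right' diff_self)
 thus ?case unfolding sum.empty by (rule teq_sym)
next
 case (insert i I)
 have "teq (frag_of (a, f i) + (SUM i:I. frag_of (a, f i))) (frag_of (a, f i) + frag_of (a, SUM i:I. f i))"
  using insert by (intro teq_add teq_refl) auto
 hence "teq (frag_of (a, f i) + (SUM i:I. frag_of (a, f i))) (frag_of (a, f i + (SUM i:I. f i)))"
  using insert.prems by (intro teq_trans[OF _ teq_sym[OF teq_right]] hsum) auto
 thus ?case unfolding sum.insert[OF insert.hyps(1,2)] .
qed

text \<open>The coefficients of \<open>red z\<close> come from integers, so they move across the
  tensor sign. The class sums then recombine to z, which acts by om, and om moved back is 1.\<close>

lemma act_pure_teq:
 assumes z: "z : CA l m" and om: "!!ph v. ph : H ==> act_int z (ph v) = frag_cmul om (ph v)"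
  and 1: "of_int om = (1 :: 'k::field)" and ph: "ph : H"
 shows "teq (act_pure (mu, nu) (red z) (a :: 'k, ph)) (frag_of (a, ph))"
proof -
 let ?s = "%K v. act_int (class_sum K) (ph v)"
 have sH: "?s K : H" if "K : conj_classes l m" for K using hact[OF ph class_sum_cent[OF that]] .
 have e: "act_pure (mu, nu) (red z) (a, ph) = (SUM K:conj_classes l m. frag_of (of_int (class_coeff z K) * a, ?s K))"
 proof -
  have "class_coeff (red z :: 'k galg) K = of_int (class_coeff z K)" if "K : conj_classes l m" for K
   using class_coeff_red[OF z that, of "1 :: 'k"] gs_one by (simp add: zero_perm_def)
  thus ?thesis unfolding act_pure_def using skw(4,5) by simp
 qed
 have 2: "teq ... (SUM K:conj_classes l m. frag_of (a, %v. frag_cmul (class_coeff z K) (?s K v)))" by (intro teq_sum teq_balanced sH)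
 have 3: "teq ... (frag_of (a, SUM K:conj_classes l m. (%v. frag_cmul (class_coeff z K) (?s K v))))"
  by (intro teq_sum_right finite_conj_classes hcmul sH)
 have f: "(SUM K:conj_classes l m. (%v. frag_cmul (class_coeff z K) (?s K v))) = (%v. frag_cmul om (ph v))"
  unfolding act_class_sum[OF z] using om[OF ph] by simp
 have "teq (frag_of (a, %v. frag_cmul om (ph v))) (frag_of (a, ph))" using teq_sym[OF teq_balanced[OF ph, of om a]] 1 by simp
 from teq_trans[OF 2 teq_trans[OF 3[unfolded f] this]] show ?thesis unfolding e .
qed

lemma tensor_class_teq: "u : tensor_class H v <-> teq u v" unfolding tensor_class_def teq_def by (auto intro: exI[of _ "u - v"])

lemma act_specht_identity:
 assumes z: "z : CA l m" and om: "!!ph v. ph : H ==> act_int z (ph v) = frag_cmul om (ph v)"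
  and 1: "of_int om = (1 :: 'k::field)" and X: "X : specht (mu, nu)"
 shows "act_specht (mu, nu) (red z :: 'k galg) X = X"
proof -
 let ?f = "frag_extend (act_pure (mu, nu) (red z :: 'k galg))"
 obtain z0 where z0: "X = tensor_class H z0" "keys z0 <= UNIV \<times> H" using X by (auto simp: specht_def tensor_product_def)
 \<comment> \<open>A coset contains all its representatives, while the action is known only on those
   supported on \<open>H\<close>; the relations preserve this support.\<close>
 have rel: "keys u <= UNIV \<times> H" if "u : tensor_relations H" for u :: "'k \<times> specht_map \<Rightarrow>\<^sub>0 int"
  using that unfolding tensor_relations_def
 proof (induction rule: group_closure.induct)
  case (base s)
  have K: "keys (frag_of p - frag_of q - frag_of r) <= UNIV \<times> H" if "snd p : H" "snd q : H" "snd r : H"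
   for p q r :: "'k \<times> specht_map"
   using keys_diff[of "frag_of p - frag_of q" "frag_of r"] keys_diff[of "frag_of p" "frag_of q"] that by force
  from base consider "s = 0" | a b x where "x : H" "s = frag_of (a + b, x) - frag_of (a, x) - frag_of (b, x)"
   | a x y where "x : H" "y : H" "s = frag_of (a, x + y) - frag_of (a, x) - frag_of (a, y)" by blast
  thus ?case
  proof cases
   case 2 thus ?thesis by (metis K snd_conv)
  next
   case 3 thus ?thesis by (metis K snd_conv hadd)
  qed simp
 next
  case (diff s t)
  thus ?case using keys_diff[of s t] by blast
 qed
 have ext: "teq (?f w) w" if "keys w <= UNIV \<times> H" for w using that
 proof (induction w rule: frag_induction)
  case zero
  show ?case by (simp add: teq_refl)
 next
  case (one x)
  hence "teq (act_pure (mu, nu) (red z) (fst x, snd x)) (frag_of (fst x, snd x))" by (intro act_pure_teq[where om = om] z om 1) auto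
  thus ?case by simp
 next
  case (diff a b)
  thus ?case by (simp add: frag_extend_diff teq_diff)
 qed
 have w: "tensor_class H (?f w) = X" if "w : X" for w
 proof -
  have t: "teq w z0" using that z0 tensor_class_teq by blast
  hence "keys (w - z0) <= UNIV \<times> H" using rel by (simp add: teq_def)
  hence "keys w <= UNIV \<times> H" using z0(2) Poly_Mapping.keys_add[of "w - z0" z0] by auto
  hence "teq (?f w) z0" using ext t teq_trans by blast
  hence "teq u (?f w) <-> teq u z0" for u using teq_trans[of u "?f w" z0] teq_trans[of u z0 "?f w"] teq_sym by blast
  thus ?thesis unfolding z0(1) by (auto simp: tensor_class_teq)
 qed
 moreover have "z0 : X" using z0(1) tensor_class_teq teq_refl by blast
 ultimately show ?thesis unfolding act_specht_def by auto
qed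

text \<open>A coordinate of the value at one point, divided by its least positive value d on
  \<open>H\<close>, which divides all the others. The value 1 at \<open>ph0\<close> survives in
  every characteristic, so the functional shows that the pure tensor of 1 and \<open>ph0\<close> is
  not 0.\<close>

lemma ex_functional:
 "EX ps ph0. ph0 : H & ps ph0 = (1::int) & (ALL x:H. ALL y:H. ps (x + y) = ps x + ps y) &
  (ALL x:H. ALL n. ps (%v. frag_cmul n (x v)) = n * ps x)"
proof -
 obtain ph1 v0 where ph1: "ph1 : H" "ph1 v0 ~= 0" using hom_nonzero[OF sk] by blast
 then obtain t0 where t0: "lookup (ph1 v0) t0 ~= 0" by (metis lookup_zero poly_mapping_eqI)
 define c where "c x = lookup (x v0) t0" for x :: specht_map
 have cadd: "c (x + y) = c x + c y" and ccm: "c (%v. frag_cmul n (x v)) = n * c x" for x y n by (simp_all add: c_def lookup_add)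
 let ?Q = "%k. k > 0 & (EX ph:H. c ph = int k)"
 have "c (%v. frag_cmul (sgn (c ph1)) (ph1 v)) = int (nat \<bar>c ph1\<bar>)" unfolding ccm by (simp add: mult_sgn_abs sgn_mult_abs mult.commute abs_sgn[symmetric])
 moreover have "nat \<bar>c ph1\<bar> > 0" using t0 by (simp add: c_def)
 ultimately have "?Q (nat \<bar>c ph1\<bar>)" using hcmul[OF ph1(1)] by blast
 hence Q: "?Q (LEAST k. ?Q k)" by (rule LeastI)
 define d where "d = (LEAST k. ?Q k)"
 obtain ph0 where ph0: "ph0 : H" "c ph0 = int d" "d > 0" using Q unfolding d_def by blast
 have dv: "int d dvd c x" if x: "x : H" for x
 proof -
  let ?y = "x + (%v. frag_cmul (- (c x div int d)) (ph0 v))"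
  have "c ?y = c x mod int d" unfolding cadd ccm ph0(2) by (simp add: minus_div_mult_eq_mod[symmetric])
  moreover have "?y : H" using hadd x hcmul ph0(1) by blast
  ultimately have "~ nat (c x mod int d) > 0"
   using not_less_Least[of "nat (c x mod int d)" ?Q] ph0(3) unfolding d_def[symmetric] by (force simp: nat_less_iff)
  moreover have "0 <= c x mod int d" using ph0(3) by simp
  ultimately have "c x mod int d = 0" by linarith
  thus ?thesis by (simp add: dvd_eq_mod_eq_0)
 qed
 define ps where "ps x = c x div int d" for x
 have "ps (x + y) = ps x + ps y" if "x : H" "y : H" for x y using dv[OF that(1)] by (simp add: ps_def cadd div_plus_div_distrib_dvd_left)
 moreover have "ps (%v. frag_cmul n (x v)) = n * ps x" if "x : H" for x n using dv[OF that] by (simp add: ps_def ccm div_mult_swap)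
 ultimately show ?thesis using ph0 by (intro exI[of _ ps] exI[of _ ph0]) (simp add: ps_def)
qed

text \<open>The additive map \<open>a \<otimes> \<phi> \<mapsto> a \<psi>(\<phi>)\<close> applied to \<open>c (1 \<otimes> \<phi>0)\<close>.\<close>

definition ang :: "(specht_map => int) => specht_map => 'k::field galg => 'k" where
 "ang ps ph0 c = (SUM K:conj_classes l m. class_coeff c K * of_int (ps (%v. act_int (class_sum K) (ph0 v))))"

text \<open>The additive map to the field kills the tensor relations, so it may be applied to the
  equation saying that c fixes the pure tensor of 1 and \<open>ph0\<close>.\<close>

lemma ang_identity:
 assumes ph0: "ph0 : H" "ps ph0 = 1" and add: "ALL x:H. ALL y:H. ps (x + y) = ps x + ps y"
  and c: "!!X. X : specht (mu, nu) ==> act_specht (mu, nu) c X = X"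
 shows "ang ps ph0 (c :: 'k::field galg) = 1"
proof -
 let ?g = "%(a :: 'k, x). a * of_int (ps x)"
 have rel: "fsum ?g u = 0" if "u : tensor_relations H" for u using that unfolding tensor_relations_def
 proof (induction rule: group_closure.induct)
  case (base s)
  then consider "s = 0" | a b x where "x : H" "s = frag_of (a + b, x) - frag_of (a, x) - frag_of (b, x)"
   | a x y where "x : H" "y : H" "s = frag_of (a, x + y) - frag_of (a, x) - frag_of (a, y)" by blast
  thus ?case
  proof cases
   case (2 a b x)
   thus ?thesis unfolding 2(2) by (simp only: fsum_diff fsum_of case_prod_conv) (simp add: algebra_simps)
  next
   case (3 a x y)
   hence "ps (x + y) = ps x + ps y" using add by blast
   thus ?thesis unfolding 3(3) by (simp only: fsum_diff fsum_of case_prod_conv of_int_add) (simp add: algebra_simps)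
  qed simp
 qed (simp add: fsum_diff)
 let ?x = "frag_of (1 :: 'k, ph0)" let ?X = "tensor_class H ?x"
 have "?X : specht (mu, nu)" using ph0(1) by (auto simp: specht_def tensor_product_def keys_frag_of intro!: exI[of _ ?x])
 hence "act_specht (mu, nu) c ?X = ?X" by (rule c)
 moreover have "?x : ?X" by (simp add: tensor_class_teq teq_refl)
 hence "act_pure (mu, nu) c (1, ph0) : act_specht (mu, nu) c ?X"
  unfolding act_specht_def by (intro UN_I[of ?x]) (simp_all add: tensor_class_teq teq_refl)
 ultimately have "teq (act_pure (mu, nu) c (1, ph0)) ?x" by (simp add: tensor_class_teq)
 hence "fsum ?g (act_pure (mu, nu) c (1, ph0) - ?x) = 0" unfolding teq_def by (rule rel)
 hence "fsum ?g (act_pure (mu, nu) c (1, ph0)) = fsum ?g ?x" by (simp only: fsum_diff right_minus_eq)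
 thus ?thesis using ph0(2) skw(4,5) by (simp add: act_pure_def fsum_sum ang_def)
qed

text \<open>After c is expanded in class sums, z acts on \<open>ph0\<close> by om, and this factor
  comes out of every term.\<close>

lemma ang_scale:
 assumes ph0: "ph0 : H" and add: "ALL x:H. ALL y:H. ps (x + y) = ps x + ps y"
  and cm: "ALL x:H. ALL n. ps (%v. frag_cmul n (x v)) = n * ps x"
  and z: "z : CA l m" and om: "!!ph v. ph : H ==> act_int z (ph v) = frag_cmul om (ph v)"
  and c: "(c :: 'k::field galg) : CA l m"
 shows "ang ps ph0 (c * red z) = of_int om * ang ps ph0 c"
proof -
 have z0: "ps 0 = 0" using add hom_zero[OF sk] by (metis add_cancel_right_right)
 have psum: "ps (SUM i:I. f i) = (SUM i:I. ps (f i))" if "finite I" "!!i. i : I ==> f i : H" for I :: "nat perm set set" and f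
  using that by (induction I rule: finite_induct) (auto simp: z0 add hsum)
 have pure: "ang ps ph0 (single 0 a * red y :: 'k galg) = a * of_int (ps (%v. act_int y (ph0 v)))"
  if y: "y : CA l m" for a y
 proof -
  have sH: "(%v. act_int (class_sum K) (ph0 v)) : H" if "K : conj_classes l m" for K using hact[OF ph0 class_sum_cent[OF that]] .
  have "ps (%v. act_int y (ph0 v)) = (SUM K:conj_classes l m. ps (%v. frag_cmul (class_coeff y K) (act_int (class_sum K) (ph0 v))))"
   unfolding act_class_sum[OF y, of ph0, symmetric] by (intro psum hcmul sH) simp
  also have "... = (SUM K:conj_classes l m. class_coeff y K * ps (%v. act_int (class_sum K) (ph0 v)))" using cm sH by (intro sum.cong) auto
  finally show ?thesis unfolding ang_def by (simp add: class_coeff_red[OF y] sum_distrib_left mult.assoc)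
 qed
 have asum: "ang ps ph0 (SUM i:I. f i) = (SUM i:I. ang ps ph0 (f i))"
  if "finite I" "!!i. i : I ==> f i : CA l m" for I :: "nat perm set set" and f :: "_ => 'k galg" using that
 proof (induction I rule: finite_induct)
  case empty
  thus ?case using pure[OF cent_zero, of 0] by simp
 next
  case (insert i I)
  have "sum f I : CA l m" "f i : CA l m" using insert by (auto intro: cent_sum)
  hence "ang ps ph0 (f i + sum f I) = ang ps ph0 (f i) + ang ps ph0 (sum f I)"
   unfolding ang_def sum.distrib[symmetric] by (intro sum.cong refl) (simp add: class_coeff_combine distrib_right)
  thus ?case using insert by simp
 qed
 have "c * red z = (SUM K:conj_classes l m. single 0 (class_coeff c K) * csum K) * red z" using cent_decomp[OF c skw(6)] by simp
 also have "... = (SUM K:conj_classes l m. single 0 (class_coeff c K) * red (class_sum K * z))"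
  by (simp add: sum_distrib_right red_mult red_class_sum mult.assoc)
 finally have e: "c * red z = (SUM K:conj_classes l m. single 0 (class_coeff c K) * red (class_sum K * z))" .
 have "ang ps ph0 (c * red z) = (SUM K:conj_classes l m. class_coeff c K * of_int (ps (%v. act_int (class_sum K * z) (ph0 v))))" unfolding e
 proof (subst asum)
  fix K assume "K : conj_classes l m"
  hence "(red (class_sum K * z) :: 'k galg) : CA l m" by (intro red_cent cent_mult class_sum_cent z)
  moreover have "single 0 (class_coeff c K) : GA m" by (intro GA_single) (simp add: sym_def zero_perm_def)
  hence "single 0 (class_coeff c K) : CA l m" unfolding cent_iff using scalar_commute by metis
  ultimately show "single 0 (class_coeff c K) * red (class_sum K * z) : CA l m" by (intro cent_mult)
 qed (auto intro!: sum.cong pure cent_mult class_sum_cent z)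
 also have "... = (SUM K:conj_classes l m. of_int om * (class_coeff c K * of_int (ps (%v. act_int (class_sum K) (ph0 v)))))"
 proof (intro sum.cong refl)
  fix K assume "K : conj_classes l m"
  hence "(%v. act_int (class_sum K) (ph0 v)) : H" using hact[OF ph0 class_sum_cent] by simp
  hence "ps (%v. act_int (class_sum K * z) (ph0 v)) = om * ps (%v. act_int (class_sum K) (ph0 v))"
   using cm by (simp add: act_int_mult om[OF ph0] act_int_cmul)
  thus "class_coeff c K * of_int (ps (%v. act_int (class_sum K * z) (ph0 v))) =
   of_int om * (class_coeff c K * of_int (ps (%v. act_int (class_sum K) (ph0 v))))" by simp
 qed
 finally show ?thesis by (simp add: ang_def sum_distrib_left)
qed

end

lemma block_idempotent_unique:
 fixes C :: "'r::ring_1 set"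
 assumes "central_idempotent C e" "central_idempotent C f" "1 : C" "(%c. e * c) ` C = (%c. f * c) ` C"
 shows "e = f"
proof -
 have "g * h = h" if "central_idempotent C g" "(%c. g * c) ` C = (%c. h * c) ` C" for g h
 proof -
  have "h * 1 : (%c. g * c) ` C" using that(2) assms(3) by blast
  then obtain c where "h = g * c" by auto
  thus ?thesis using that(1) unfolding central_idempotent_def by (metis mult.assoc)
 qed
 from this[OF assms(1,4)] this[OF assms(2) assms(4)[symmetric]] show ?thesis using assms(1,2) unfolding central_idempotent_def by metis
qed

text \<open>Contents of nu followed by those of the skew diagram in any order. The list need not be
  a valid sequence of contents; it only carries the residues.\<close>

lemma content_list:
 assumes sk: "(mu, nu) : skew_partitions l m" and c: "!!i. count (content p (mu, nu)) i <= 1"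
 shows "EX ts. length ts = m & distinct (rword p (drop l ts)) & rmset p m (entry ts) = rc p mu & rmset p l (entry ts) = rc p nu"
proof -
 note d = skD[OF sk]
 obtain as where as: "mset as = conts nu" using ex_mset by blast
 obtain bs where bs: "mset bs = image_mset cont (mset_set (young mu - young nu))" using ex_mset by blast
 have la: "length as = l" using as d by (metis card_young conts_def size_image_mset size_mset size_mset_set)
 have "young nu Un (young mu - young nu) = young mu" using d(3) by blast
 hence u: "mset_set (young mu) = mset_set (young nu) + mset_set (young mu - young nu)"
  using mset_set_Union[of "young nu" "young mu - young nu"] finite_young[OF d(1)] finite_young[OF d(2)] by simp
 hence ab: "mset (as @ bs) = conts mu" using as bs by (simp add: conts_def)
 have lab: "length (as @ bs) = m" using ab d by (metis card_young conts_def size_image_mset size_mset size_mset_set)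
 have rb: "mset (rword p bs) = content p (mu, nu)"
  using bs by (simp add: rword_def content_def image_mset.compositionality o_def residue_cont[abs_def])
 have "distinct (rword p bs)" unfolding distinct_count_atmost_1
 proof
  fix a show "count (mset (rword p bs)) a = (if a : set (rword p bs) then 1 else 0)"
   using c[of a] unfolding rb[symmetric] by (metis count_eq_zero_iff le_antisym less_one not_le set_mset_mset)
 qed
 moreover have "rmset p m (entry (as @ bs)) = rc p mu"
  using rmset_entry[of m "as @ bs" p] lab unfolding rc_conts ab[symmetric] by (simp add: rword_def)
 moreover have "rmset p l (entry (as @ bs)) = rc p nu" using rmset_entry[of l "as @ bs" p] la as by (simp add: rc_conts rword_def)
 ultimately show ?thesis using lab la by (intro exI[of _ "as @ bs"]) simp
qed

theorem corollary3p10: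
  fixes p l m :: nat and B :: "skew set"
    and \<mu>\<^sub>1 \<nu>\<^sub>1 \<mu>\<^sub>2 \<nu>\<^sub>2 :: "nat \<Rightarrow> nat"
  assumes "prime p" and "CHAR('k::alg_closed_field) = p"
    and "l \<le> m" and "m - l < p"
    and "generalised_ribbon_block p l m B"
    and "(\<mu>\<^sub>1, \<nu>\<^sub>1) \<in> B" and "(\<mu>\<^sub>2, \<nu>\<^sub>2) \<in> skew_partitions l m"
  shows "(\<exists>b \<in> blocks (centraliser_algebra l m :: (nat perm \<Rightarrow>\<^sub>0 'k) set).
            specht_in_block l m (\<mu>\<^sub>1, \<nu>\<^sub>1) b \<and> specht_in_block l m (\<mu>\<^sub>2, \<nu>\<^sub>2) b)
         \<longleftrightarrow> core p \<mu>\<^sub>1 = core p \<mu>\<^sub>2 \<and> core p \<nu>\<^sub>1 = core p \<nu>\<^sub>2"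
proof -
 let ?C = "CA l m :: 'k galg set"
 note p = `prime p` and char = `CHAR('k) = p`
 have p0: "p > 0" using p prime_gt_0_nat by blast
 have 0: "of_nat p = (0 :: 'k galg)" by (rule galg_char[OF char])
 have sk1: "(\<mu>\<^sub>1, \<nu>\<^sub>1) : skew_partitions l m" and sk2: "(\<mu>\<^sub>2, \<nu>\<^sub>2) : skew_partitions l m"
  using assms by (auto simp: generalised_ribbon_block_def combinatorial_block_def)
 have cnt: "count (content p (\<mu>\<^sub>1, \<nu>\<^sub>1)) i <= 1" for i using assms(5,6) by (auto simp: generalised_ribbon_block_def)
 obtain ts where ts: "length ts = m" "distinct (rword p (drop l ts))" "rmset p m (entry ts) = rc p \<mu>\<^sub>1" "rmset p l (entry ts) = rc p \<nu>\<^sub>1"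
  using content_list[OF sk1 cnt] by blast
 obtain N where N: "ALL j:{1..m}. semis p N (jm j :: 'k galg)" using semis_jm[OF p 0] by blast
 define Z :: "int galg" where "Z = eB p N l m (entry ts)"
 define E :: "'k galg" where "E = eB p N l m (entry ts)"
 have Z: "Z : CA l m" unfolding Z_def by (rule eB_cent[OF `l <= m`])
 have ZE: "red Z = E" unfolding Z_def E_def by (rule red_eB)
 have E: "central_idempotent ?C E"
  unfolding central_idempotent_def E_def using eB_cent[OF `l <= m`] eB_idem[OF p 0 N `l <= m`] eB_commute[where ?'r = 'k] by metis
 have dich: "e * E : {0, E}" if "central_idempotent ?C e" for e
  unfolding E_def using that assms(3,4) by (intro eB_primitive[OF p char N ts(1,2), of "m - l"]) (auto simp: central_idempotent_def)
 have act: "EX om. (ALL ph v. ph : specht_hom (\<mu>, \<nu>) --> act_int Z (ph v) = frag_cmul om (ph v)) &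
   ((of_int om :: 'k) = (if rc p \<mu> = rc p \<mu>\<^sub>1 & rc p \<nu> = rc p \<nu>\<^sub>1 then 1 else 0))"
  if sk: "(\<mu>, \<nu>) : skew_partitions l m" for \<mu> \<nu>
 proof -
  obtain om where om: "ALL ph:specht_hom (\<mu>, \<nu>). ALL v. act_int (eB p N l m (entry ts)) (ph v) = frag_cmul om (ph v)"
   "[om = of_bool (rc p \<mu> = rmset p m (entry ts) & rc p \<nu> = rmset p l (entry ts))] (mod int p)"
   using eB_hom[OF sk p char] by blast
  have "(of_int om :: 'k) = of_int (of_bool (rc p \<mu> = rc p \<mu>\<^sub>1 & rc p \<nu> = rc p \<nu>\<^sub>1))"
   using om(2) unfolding ts(3,4) of_int_eq_iff_cong_CHAR char .
  thus ?thesis using om(1) by (intro exI[of _ om]) (auto simp: Z_def)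
 qed
 have cores: "core p \<mu>\<^sub>1 = core p \<mu>\<^sub>2 <-> rc p \<mu>\<^sub>2 = rc p \<mu>\<^sub>1" "core p \<nu>\<^sub>1 = core p \<nu>\<^sub>2 <-> rc p \<nu>\<^sub>2 = rc p \<nu>\<^sub>1"
  using core_eq_iff[OF _ _ _ p0, of \<mu>\<^sub>1 \<mu>\<^sub>2] core_eq_iff[OF _ _ _ p0, of \<nu>\<^sub>1 \<nu>\<^sub>2] skD[OF sk1] skD[OF sk2] by auto
 have id: "act_specht (\<mu>, \<nu>) E X = X"
  if "(\<mu>, \<nu>) : skew_partitions l m" "rc p \<mu> = rc p \<mu>\<^sub>1" "rc p \<nu> = rc p \<nu>\<^sub>1" "X : specht (\<mu>, \<nu>)" for \<mu> \<nu> X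
  using act[OF that(1)] act_specht_identity[OF that(1) Z _ _ that(4)] that(2,3) unfolding ZE by auto
 \<comment> \<open>A functional attached to the Specht module. It equals 1 on elements acting as the
   identity, and it detects through the factor E whether the residues of the module are those of the
   given block.\<close>
 have ang: "EX g. (ALL c:?C. (ALL X:specht (\<mu>, \<nu>). act_specht (\<mu>, \<nu>) c X = X) --> g c = (1 :: 'k)) &
   (ALL c:?C. g (c * E) = (if rc p \<mu> = rc p \<mu>\<^sub>1 & rc p \<nu> = rc p \<nu>\<^sub>1 then g c else 0)) & g 0 = 0"
  if sk: "(\<mu>, \<nu>) : skew_partitions l m" for \<mu> \<nu>
 proof -
  obtain ps ph0 where ps: "ph0 : specht_hom (\<mu>, \<nu>)" "ps ph0 = (1::int)"
   "ALL x:specht_hom (\<mu>, \<nu>). ALL y:specht_hom (\<mu>, \<nu>). ps (x + y) = ps x + ps y"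
   "ALL x:specht_hom (\<mu>, \<nu>). ALL n. ps (%v. frag_cmul n (x v)) = n * ps x"
   using ex_functional[OF sk] by blast
  obtain om where om: "!!ph v. ph : specht_hom (\<mu>, \<nu>) ==> act_int Z (ph v) = frag_cmul om (ph v)"
   "(of_int om :: 'k) = (if rc p \<mu> = rc p \<mu>\<^sub>1 & rc p \<nu> = rc p \<nu>\<^sub>1 then 1 else 0)"
   using act[OF sk] by blast
  let ?g = "ang l m ps ph0 :: 'k galg => 'k"
  have "?g c = 1" if "ALL X:specht (\<mu>, \<nu>). act_specht (\<mu>, \<nu>) c X = X" for c
   using ang_identity[OF sk ps(1-3)] that by blast
  moreover have s: "?g (c * E) = of_int om * ?g c" if "c : ?C" for c
   unfolding ZE[symmetric] by (rule ang_scale[OF sk ps(1,3,4) Z _ that]) (rule om(1))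
  moreover have "?g 0 = 0"
   unfolding ang_def[OF sk] by (rule sum.neutral) (auto simp: conj_classes_def class_coeff_eq[OF cent_zero])
  ultimately show ?thesis using om(2) by (intro exI[of _ ?g]) auto
 qed
 obtain g1 where g1: "!!c. c : ?C ==> ALL X:specht (\<mu>\<^sub>1, \<nu>\<^sub>1). act_specht (\<mu>\<^sub>1, \<nu>\<^sub>1) c X = X ==> g1 c = (1 :: 'k)"
  "!!c. c : ?C ==> g1 (c * E) = g1 c" "g1 0 = 0" using ang[OF sk1] by auto
 obtain g2 where g2: "!!c. c : ?C ==> ALL X:specht (\<mu>\<^sub>2, \<nu>\<^sub>2). act_specht (\<mu>\<^sub>2, \<nu>\<^sub>2) c X = X ==> g2 c = (1 :: 'k)"
  "!!c. c : ?C ==> g2 (c * E) = (if rc p \<mu>\<^sub>2 = rc p \<mu>\<^sub>1 & rc p \<nu>\<^sub>2 = rc p \<nu>\<^sub>1 then g2 c else 0)" using ang[OF sk2] by blast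
 have EC: "E : ?C" "E * E = E" using E by (auto simp: central_idempotent_def)
 have En: "E ~= 0" using g1(1)[OF EC(1)] id[OF sk1] g1(3) by auto
 show ?thesis
 proof
  assume "EX b:blocks ?C. specht_in_block l m (\<mu>\<^sub>1, \<nu>\<^sub>1) b & specht_in_block l m (\<mu>\<^sub>2, \<nu>\<^sub>2) b"
  then obtain b where b: "specht_in_block l m (\<mu>\<^sub>1, \<nu>\<^sub>1) (b :: 'k galg set)" "specht_in_block l m (\<mu>\<^sub>2, \<nu>\<^sub>2) b" by blast
  obtain e where e: "primitive_central_idempotent ?C e" "b = (%c. e * c) ` ?C" "ALL X:specht (\<mu>\<^sub>1, \<nu>\<^sub>1). act_specht (\<mu>\<^sub>1, \<nu>\<^sub>1) e X = X"
   using b(1) by (auto simp: specht_in_block_def)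
  obtain e' where e': "primitive_central_idempotent ?C e'" "b = (%c. e' * c) ` ?C" "ALL X:specht (\<mu>\<^sub>2, \<nu>\<^sub>2). act_specht (\<mu>\<^sub>2, \<nu>\<^sub>2) e' X = X"
   using b(2) by (auto simp: specht_in_block_def)
  have ci: "central_idempotent ?C e" "central_idempotent ?C e'" using e e' by (auto simp: primitive_central_idempotent_def)
  have "e = e'" using block_idempotent_unique[OF ci] e(2) e'(2) by simp
  have eC: "e : ?C" "e * e = e" "!!c. c : ?C ==> e * c = c * e" using ci(1) by (auto simp: central_idempotent_def)
  \<comment> \<open>As e acts as the identity on the first module, e * E is not 0, and the dichotomy
    leaves e * E = E. Primitivity of e, applied to e = E + (e - E), then gives e = E.\<close>
  have "g1 (e * E) = 1" using g1(2)[OF eC(1)] g1(1)[OF eC(1) e(3)] by simp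
  hence eE: "e * E = E" using dich[OF ci(1)] g1(3) by auto
  have Ee: "E * e = E" using eC(3)[OF EC(1)] eE by simp
  have "central_idempotent ?C (e - E)"
   unfolding central_idempotent_def
  proof (intro conjI ballI)
   show "e - E : ?C" by (rule cent_diff[OF eC(1) EC(1)])
   show "(e - E) * (e - E) = e - E" using eE Ee EC(2) eC(2) by (simp add: diff_distrib)
   fix c assume "c : ?C"
   hence "e * c = c * e" "E * c = c * E" using eC(3) E by (auto simp: central_idempotent_def)
   thus "(e - E) * c = c * (e - E)" by (simp add: diff_distrib)
  qed
  moreover have "E * (e - E) = 0" "e = E + (e - E)" using Ee EC by (simp_all add: right_diff_distrib)
  ultimately have "E = 0 | e - E = 0" using e(1) E unfolding primitive_central_idempotent_def by blast
  hence "e = E" using En by simp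
  hence "g2 (E * E) = 1" using g2(1)[OF EC(1)] e'(3) `e = e'` EC(2) by simp
  hence "rc p \<mu>\<^sub>2 = rc p \<mu>\<^sub>1 & rc p \<nu>\<^sub>2 = rc p \<nu>\<^sub>1" using g2(2)[OF EC(1)] by (auto split: if_splits)
  thus "core p \<mu>\<^sub>1 = core p \<mu>\<^sub>2 & core p \<nu>\<^sub>1 = core p \<nu>\<^sub>2" using cores by simp
 next
  assume "core p \<mu>\<^sub>1 = core p \<mu>\<^sub>2 & core p \<nu>\<^sub>1 = core p \<nu>\<^sub>2"
  hence r: "rc p \<mu>\<^sub>2 = rc p \<mu>\<^sub>1" "rc p \<nu>\<^sub>2 = rc p \<nu>\<^sub>1" using cores by auto
  have prim: "primitive_central_idempotent ?C E"
   unfolding primitive_central_idempotent_def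
  proof (intro conjI allI impI)
   fix f g assume fg: "central_idempotent ?C f & central_idempotent ?C g & f * g = 0 & E = f + g"
   hence "f * E = f" by (simp add: distrib_left central_idempotent_def)
   thus "f = 0 | g = 0" using dich[of f] fg by auto
  qed (use E En in auto)
  have "specht_in_block l m (\<mu>\<^sub>1, \<nu>\<^sub>1) ((%c. E * c) ` ?C)" "specht_in_block l m (\<mu>\<^sub>2, \<nu>\<^sub>2) ((%c. E * c) ` ?C)"
   unfolding specht_in_block_def using prim id[OF sk1] id[OF sk2 r] by blast+
  thus "EX b:blocks ?C. specht_in_block l m (\<mu>\<^sub>1, \<nu>\<^sub>1) b & specht_in_block l m (\<mu>\<^sub>2, \<nu>\<^sub>2) b"
   unfolding blocks_def using prim by blast
 qed
qed

end
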